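(* For $n\geq 1$, the Zhu algebra of $\mathcal{A}(n)^{Sp(2n)}$ satisfies $A(\mathcal{A}(n)^{Sp(2n)})\cong\mathbb{C}[a^0,a^2,\dots,a^{2n-2}]$ (a polynomial algebra in $n$ variables), where $a^{2m}=\pi_{\mathrm{Zhu}}(j^{2m})$ and $j^{2m}=\frac12\sum_{i=1}^n\big(:e^i\,\partial^{2m}f^i:+:\partial^{2m}e^i\,f^i:\big)$. Hence the irreducible, admissible $\mathcal{A}(n)^{Sp(2n)}$-modules are all highest-weight modules, and are parametrized by the points in $\mathbb{C}^n$.
   Context: The rank $n$ symplectic fermion algebra $\mathcal{A}(n)$ is the vertex (super)algebra over $\mathbb{C}$ freely generated by odd elements $e^i,f^i$, $i=1,\dots,n$, with operator product expansions $e^i(z)f^j(w)\sim\delta_{i,j}(z-w)^{-2}$, $f^j(z)e^i(w)\sim-\delta_{i,j}(z-w)^{-2}$, $e^i(z)e^j(w)\sim 0$, $f^i(z)f^j(w)\sim 0$, with conformal vector $L=-\sum_i :e^if^i:$, for which $e^i,f^i$ have weight one. Its full automorphism group is $Sp(2n)$, acting linearly on the span of the generators, which is the standard module $\mathbb{C}^{2n}$. $\mathcal{A}(n)^{Sp(2n)}$ is the subalgebra of invariants. For a weight-graded vertex algebra $\mathcal{V}=\bigoplus_k\mathcal{V}_k$, the Zhu algebra $A(\mathcal{V})$ is the associative algebra given by Zhu's construction, with surjective linear map $\pi_{\mathrm{Zhu}}:\mathcal{V}\to A(\mathcal{V})$, $a\mapsto[a]$. A $\mathbb{Z}_{\geq0}$-graded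 $\mathcal{V}$-module $M=\bigoplus_{k\geq0}M_k$ is admissible if $a(l)M_k\subset M_{m+k-l-1}$ for all $a\in\mathcal{V}_m$ and $l\in\mathbb{Z}$. Then $M_0$ is an $A(\mathcal{V})$-module with $[a]$ ($a\in\mathcal{V}_m$) acting by $a(m-1)$, and $M\mapsto M_0$ is a one-to-one correspondence between irreducible admissible $\mathcal{V}$-modules and irreducible $A(\mathcal{V})$-modules. When $A(\mathcal{V})$ is commutative, its irreducible modules are one-dimensional, and the corresponding (cyclic) $\mathcal{V}$-modules are called highest-weight modules. *)

theory Defs
  imports
    Complex_Main
    "HOL-Library.Poly_Mapping"
    "HOL-Algebra.RingHom"
    "HOL-Algebra.QuotRing"
    "Jordan_Normal_Form.Matrix"
begin

section \<open>Graded vector spaces\<close>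

text \<open>\<open>Sum_any\<close> is the sum of a finitely supported family. Vector spaces are subspaces of an ambient
  space, which is a type with a scalar multiplication \<open>s\<close>.\<close>

definition decomposition :: "(int \<Rightarrow> 'a::ab_group_add set) \<Rightarrow> 'a \<Rightarrow> (int \<Rightarrow> 'a) \<Rightarrow> bool" where
  "decomposition D a c \<longleftrightarrow> (\<forall>k. c k \<in> D k) \<and> finite {k. c k \<noteq> 0} \<and> a = Sum_any c"

definition is_direct_sum ::
    "(complex \<Rightarrow> 'a \<Rightarrow> 'a) \<Rightarrow> 'a::ab_group_add set \<Rightarrow> (int \<Rightarrow> 'a set) \<Rightarrow> bool" where
  "is_direct_sum s A D \<longleftrightarrow>
     (\<forall>k. module.subspace s (D k) \<and> D k \<subseteq> A) \<and> (\<forall>a\<in>A. \<exists>!c. decomposition D a c)"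

section \<open>Vertex superalgebras\<close>

text \<open>\<open>sector V 0\<close> and \<open>sector V 1\<close> are the even and the odd part; \<open>mode V a k b\<close> is \<open>a(k)b\<close>, where
  \<open>Y(a,z) = \<Sum>\<^sub>k a(k) z\<^sup>-\<^sup>k\<^sup>-\<^sup>1\<close>.\<close>

record 'v vertex_structure = "'v partial_object" +
  scl :: "complex \<Rightarrow> 'v \<Rightarrow> 'v"
  sector :: "nat \<Rightarrow> 'v set"
  vac :: 'v
  mode :: "'v \<Rightarrow> int \<Rightarrow> 'v \<Rightarrow> 'v"

text \<open>The Borcherds (Jacobi) identity for \<open>a\<close>, \<open>b\<close> acting on a vector \<open>c\<close> of \<open>V\<close> or of a
  \<open>V\<close>-module with scalar multiplication \<open>s\<close> and action \<open>act\<close>; \<open>\<epsilon>\<close> is the sign \<open>(-1)\<^sup>|\<^sup>a\<^sup>|\<^sup>|\<^sup>b\<^sup>|\<close>.\<close>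

definition borcherds_identity ::
    "'v vertex_structure \<Rightarrow> (complex \<Rightarrow> 'm \<Rightarrow> 'm) \<Rightarrow> ('v \<Rightarrow> int \<Rightarrow> 'm \<Rightarrow> 'm)
      \<Rightarrow> complex \<Rightarrow> 'v \<Rightarrow> 'v \<Rightarrow> 'm::ab_group_add \<Rightarrow> bool" where
  "borcherds_identity V s act \<epsilon> a b c \<longleftrightarrow>
    (\<forall>m n k :: int.
      Sum_any (\<lambda>j::nat. s (of_int m gchoose j) (act (mode V a (n + int j) b) (m + k - int j) c)) =
      Sum_any (\<lambda>j::nat. s ((-1) ^ j * (of_int n gchoose j))
                          (act a (m + n - int j) (act b (k + int j) c)))
      - Sum_any (\<lambda>j::nat. s ((-1) ^ j * (of_int n gchoose j) * ((-1) powi n) * \<epsilon>)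
                            (act b (n + k - int j) (act a (m + int j) c))))"

locale vertex_superalgebra =
  fixes V :: "'v::ab_group_add vertex_structure"
  assumes vector_space: "vector_space (scl V)"
    and subspace_carrier: "module.subspace (scl V) (carrier V)"
    and subspace_sector: "p < 2 \<Longrightarrow> module.subspace (scl V) (sector V p)"
    and sector_disjoint: "sector V 0 \<inter> sector V 1 = {0}"
    and carrier_sum: "carrier V = {a + b | a b. a \<in> sector V 0 \<and> b \<in> sector V 1}"
    and mode_sector: "\<lbrakk>p < 2; q < 2; a \<in> sector V p; b \<in> sector V q\<rbrakk>
          \<Longrightarrow> mode V a k b \<in> sector V ((p + q) mod 2)"
    and mode_add_left: "\<lbrakk>a \<in> carrier V; a' \<in> carrier V; b \<in> carrier V\<rbrakk>
          \<Longrightarrow> mode V (a + a') k b = mode V a k b + mode V a' k b"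
    and mode_add_right: "\<lbrakk>a \<in> carrier V; b \<in> carrier V; b' \<in> carrier V\<rbrakk>
          \<Longrightarrow> mode V a k (b + b') = mode V a k b + mode V a k b'"
    and mode_scl_left: "\<lbrakk>a \<in> carrier V; b \<in> carrier V\<rbrakk>
          \<Longrightarrow> mode V (scl V x a) k b = scl V x (mode V a k b)"
    and mode_scl_right: "\<lbrakk>a \<in> carrier V; b \<in> carrier V\<rbrakk>
          \<Longrightarrow> mode V a k (scl V x b) = scl V x (mode V a k b)"
    and truncation: "\<lbrakk>a \<in> carrier V; b \<in> carrier V\<rbrakk> \<Longrightarrow> \<exists>N. \<forall>k\<ge>N. mode V a k b = 0"
    and vac_even: "vac V \<in> sector V 0"
    and vac_left: "a \<in> carrier V \<Longrightarrow> mode V (vac V) k a = (if k = -1 then a else 0)"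
    and creation: "a \<in> carrier V \<Longrightarrow> mode V a (-1) (vac V) = a"
    and creation_regular: "\<lbrakk>a \<in> carrier V; k \<ge> 0\<rbrakk> \<Longrightarrow> mode V a k (vac V) = 0"
    and borcherds: "\<lbrakk>p < 2; q < 2; a \<in> sector V p; b \<in> sector V q; c \<in> carrier V\<rbrakk>
          \<Longrightarrow> borcherds_identity V (scl V) (mode V) ((-1) ^ (p * q)) a b c"

definition deriv_V :: "'v vertex_structure \<Rightarrow> 'v \<Rightarrow> 'v" where
  "deriv_V V a = mode V a (-2) (vac V)"

definition wick :: "'v vertex_structure \<Rightarrow> 'v \<Rightarrow> 'v \<Rightarrow> 'v" where
  "wick V a b = mode V a (-1) b"

text \<open>\<open>has_ope V a b c\<close>: \<open>a(z)b(w) \<sim> \<Sum>\<^sub>k c\<^sub>k(w) (z-w)\<^sup>-\<^sup>k\<^sup>-\<^sup>1\<close>, the sum being over \<open>k \<ge> 0\<close>.\<close>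

definition has_ope :: "'v vertex_structure \<Rightarrow> 'v \<Rightarrow> 'v \<Rightarrow> (nat \<Rightarrow> 'v) \<Rightarrow> bool" where
  "has_ope V a b c \<longleftrightarrow> (\<forall>k. mode V a (int k) b = c k)"

text \<open>The entry \<open>(i, k)\<close> of the list stands for the factor \<open>\<partial>\<^sup>k g\<^sub>i\<close>; iterated Wick products are
  nested to the right.\<close>

definition wick_monomial :: "'v vertex_structure \<Rightarrow> (nat \<Rightarrow> 'v) \<Rightarrow> (nat \<times> nat) list \<Rightarrow> 'v" where
  "wick_monomial V g xs = foldr (\<lambda>(i, k). wick V ((deriv_V V ^^ k) (g i))) xs (vac V)"

text \<open>All generators are odd, so no factor is repeated in an ordered monomial.\<close>

definition ordered_words :: "nat \<Rightarrow> (nat \<times> nat) list set" where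
  "ordered_words N = {xs. sorted_wrt (\<lambda>(i, k) (i', k'). i < i' \<or> i = i' \<and> k > k') xs
                          \<and> (\<forall>(i, k) \<in> set xs. i < N)}"

definition freely_generated_by_odd :: "'v::ab_group_add vertex_structure \<Rightarrow> (nat \<Rightarrow> 'v) \<Rightarrow> nat \<Rightarrow> bool" where
  "freely_generated_by_odd V g N \<longleftrightarrow>
     (\<forall>i<N. g i \<in> sector V 1) \<and>
     inj_on (wick_monomial V g) (ordered_words N) \<and>
     \<not> module.dependent (scl V) (wick_monomial V g ` ordered_words N) \<and>
     module.span (scl V) (wick_monomial V g ` ordered_words N) = carrier V"

definition vertex_automorphism :: "'v::ab_group_add vertex_structure \<Rightarrow> ('v \<Rightarrow> 'v) \<Rightarrow> bool" where
  "vertex_automorphism V \<sigma> \<longleftrightarrow>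
     bij_betw \<sigma> (carrier V) (carrier V) \<and>
     (\<forall>p<2. \<sigma> ` sector V p \<subseteq> sector V p) \<and>
     (\<forall>a\<in>carrier V. \<forall>b\<in>carrier V. \<sigma> (a + b) = \<sigma> a + \<sigma> b) \<and>
     (\<forall>x. \<forall>a\<in>carrier V. \<sigma> (scl V x a) = scl V x (\<sigma> a)) \<and>
     \<sigma> (vac V) = vac V \<and>
     (\<forall>a\<in>carrier V. \<forall>b\<in>carrier V. \<forall>k. \<sigma> (mode V a k b) = mode V (\<sigma> a) k (\<sigma> b))"

definition weight_space :: "'v vertex_structure \<Rightarrow> 'v \<Rightarrow> int \<Rightarrow> 'v set" where
  "weight_space V L k = {a \<in> carrier V. mode V L 1 a = scl V (of_int k) a}"

section \<open>The symplectic fermion algebra and its orbifold\<close>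

text \<open>The generators are \<open>e i\<close>, \<open>f i\<close> with \<open>i < n\<close>, listed as \<open>e 0, \<dots>, e (n-1), f 0, \<dots>, f (n-1)\<close>.\<close>

definition sf_gen :: "nat \<Rightarrow> (nat \<Rightarrow> 'v) \<Rightarrow> (nat \<Rightarrow> 'v) \<Rightarrow> nat \<Rightarrow> 'v" where
  "sf_gen n e f i = (if i < n then e i else f (i - n))"

locale symplectic_fermion_algebra = vertex_superalgebra V
  for n :: nat and V :: "'v::ab_group_add vertex_structure" and e f :: "nat \<Rightarrow> 'v" +
  assumes free: "freely_generated_by_odd V (sf_gen n e f) (2 * n)"
    and ope_ef: "\<lbrakk>i < n; j < n\<rbrakk> \<Longrightarrow>
          has_ope V (e i) (f j) (\<lambda>k. if k = 1 \<and> i = j then vac V else 0)"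
    and ope_fe: "\<lbrakk>i < n; j < n\<rbrakk> \<Longrightarrow>
          has_ope V (f j) (e i) (\<lambda>k. if k = 1 \<and> i = j then - vac V else 0)"
    and ope_ee: "\<lbrakk>i < n; j < n\<rbrakk> \<Longrightarrow> has_ope V (e i) (e j) (\<lambda>k. 0)"
    and ope_ff: "\<lbrakk>i < n; j < n\<rbrakk> \<Longrightarrow> has_ope V (f i) (f j) (\<lambda>k. 0)"

definition sf_conformal ::
    "nat \<Rightarrow> 'v::ab_group_add vertex_structure \<Rightarrow> (nat \<Rightarrow> 'v) \<Rightarrow> (nat \<Rightarrow> 'v) \<Rightarrow> 'v" where
  "sf_conformal n V e f = - (\<Sum>i<n. wick V (e i) (f i))"

text \<open>\<open>sf_j n V e f m\<close> is \<open>j\<^sup>2\<^sup>m\<close>.\<close>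

definition sf_j ::
    "nat \<Rightarrow> 'v::ab_group_add vertex_structure \<Rightarrow> (nat \<Rightarrow> 'v) \<Rightarrow> (nat \<Rightarrow> 'v) \<Rightarrow> nat \<Rightarrow> 'v" where
  "sf_j n V e f m = scl V (1 / 2)
     (\<Sum>i<n. wick V (e i) ((deriv_V V ^^ (2 * m)) (f i))
             + wick V ((deriv_V V ^^ (2 * m)) (e i)) (f i))"

definition symplectic_form :: "nat \<Rightarrow> complex mat" where
  "symplectic_form n = four_block_mat (0\<^sub>m n n) (1\<^sub>m n) (- 1\<^sub>m n) (0\<^sub>m n n)"

definition symplectic_group :: "nat \<Rightarrow> complex mat set" where
  "symplectic_group n = {g \<in> carrier_mat (2 * n) (2 * n).
     transpose_mat g * symplectic_form n * g = symplectic_form n}"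

text \<open>\<open>\<sigma>\<close> is the automorphism by which \<open>g\<close> acts. As \<open>V\<close> is generated by \<open>e i\<close>, \<open>f i\<close>, it is
  determined by \<open>g\<close> on the carrier.\<close>

definition sp_acts_by ::
    "nat \<Rightarrow> 'v::ab_group_add vertex_structure \<Rightarrow> (nat \<Rightarrow> 'v) \<Rightarrow> (nat \<Rightarrow> 'v) \<Rightarrow> complex mat \<Rightarrow> ('v \<Rightarrow> 'v) \<Rightarrow> bool"
  where
  "sp_acts_by n V e f g \<sigma> \<longleftrightarrow> vertex_automorphism V \<sigma> \<and>
     (\<forall>j<2 * n. \<sigma> (sf_gen n e f j) = (\<Sum>i<2 * n. scl V (g $$ (i, j)) (sf_gen n e f i)))"

definition sp_invariants ::
    "nat \<Rightarrow> 'v::ab_group_add vertex_structure \<Rightarrow> (nat \<Rightarrow> 'v) \<Rightarrow> (nat \<Rightarrow> 'v) \<Rightarrow> 'v set" where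
  "sp_invariants n V e f =
     {a \<in> carrier V. \<forall>g\<in>symplectic_group n. \<forall>\<sigma>. sp_acts_by n V e f g \<sigma> \<longrightarrow> \<sigma> a = a}"

definition sp_orbifold ::
    "nat \<Rightarrow> 'v::ab_group_add vertex_structure \<Rightarrow> (nat \<Rightarrow> 'v) \<Rightarrow> (nat \<Rightarrow> 'v) \<Rightarrow> 'v vertex_structure" where
  "sp_orbifold n V e f =
     V\<lparr>carrier := sp_invariants n V e f,
       sector := (\<lambda>p. sector V p \<inter> sp_invariants n V e f)\<rparr>"

section \<open>The Zhu algebra\<close>

text \<open>Here \<open>V\<close> is a vertex algebra (everything is even) with weight spaces \<open>D k\<close>. Zhu's operations
  \<open>a * b\<close> and \<open>a \<circ> b\<close> for \<open>a \<in> D k\<close> are the residues of \<open>Y(a,z) b (1+z)\<^sup>k / z\<close> and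
  \<open>Y(a,z) b (1+z)\<^sup>k / z\<^sup>2\<close>.\<close>

definition zhu_res ::
    "'v::ab_group_add vertex_structure \<Rightarrow> int \<Rightarrow> int \<Rightarrow> 'v \<Rightarrow> 'v \<Rightarrow> 'v" where
  "zhu_res V r k a b = Sum_any (\<lambda>j::nat. scl V (of_int k gchoose j) (mode V a (int j - r) b))"

definition zhu_star ::
    "'v::ab_group_add vertex_structure \<Rightarrow> (int \<Rightarrow> 'v set) \<Rightarrow> 'v \<Rightarrow> 'v \<Rightarrow> 'v" where
  "zhu_star V D a b = Sum_any (\<lambda>k. zhu_res V 1 k ((THE c. decomposition D a c) k) b)"

definition zhu_O :: "'v::ab_group_add vertex_structure \<Rightarrow> (int \<Rightarrow> 'v set) \<Rightarrow> 'v set" where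
  "zhu_O V D = module.span (scl V) {zhu_res V 2 k a b | k a b. a \<in> D k \<and> b \<in> carrier V}"

definition zhu_class :: "'v::ab_group_add vertex_structure \<Rightarrow> (int \<Rightarrow> 'v set) \<Rightarrow> 'v \<Rightarrow> 'v set" where
  "zhu_class V D a = {a + x | x. x \<in> zhu_O V D}"

definition zhu_algebra ::
    "'v::ab_group_add vertex_structure \<Rightarrow> (int \<Rightarrow> 'v set) \<Rightarrow> 'v set ring" where
  "zhu_algebra V D =
     \<lparr>carrier = zhu_class V D ` carrier V,
      monoid.mult = (\<lambda>A B. \<Union>a\<in>A. \<Union>b\<in>B. zhu_class V D (zhu_star V D a b)),
      one = zhu_class V D (vac V),
      zero = zhu_class V D 0,
      add = (\<lambda>A B. \<Union>a\<in>A. \<Union>b\<in>B. zhu_class V D (a + b))\<rparr>"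

text \<open>The polynomial ring \<open>\<complex>[x\<^sub>0, \<dots>, x\<^sub>n\<^sub>-\<^sub>1]\<close>, inside the polynomials in variables indexed by \<open>nat\<close>.\<close>

definition mpoly_ring :: "nat \<Rightarrow> ((nat \<Rightarrow>\<^sub>0 nat) \<Rightarrow>\<^sub>0 complex) ring" where
  "mpoly_ring n =
     \<lparr>carrier = {p. \<forall>m\<in>Poly_Mapping.keys p. Poly_Mapping.keys m \<subseteq> {..<n}},
      monoid.mult = (*), one = 1, zero = 0, add = (+)\<rparr>"

definition mpoly_const :: "complex \<Rightarrow> (nat \<Rightarrow>\<^sub>0 nat) \<Rightarrow>\<^sub>0 complex" where
  "mpoly_const x = Poly_Mapping.single 0 x"

definition mpoly_var :: "nat \<Rightarrow> (nat \<Rightarrow>\<^sub>0 nat) \<Rightarrow>\<^sub>0 complex" where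
  "mpoly_var i = Poly_Mapping.single (Poly_Mapping.single i 1) 1"

section \<open>Admissible modules\<close>

record ('v, 'm) vertex_module = "'m partial_object" +
  mscl :: "complex \<Rightarrow> 'm \<Rightarrow> 'm"
  act :: "'v \<Rightarrow> int \<Rightarrow> 'm \<Rightarrow> 'm"
  level :: "int \<Rightarrow> 'm set"

locale is_vertex_module =
  fixes V :: "'v::ab_group_add vertex_structure" and M :: "('v, 'm::ab_group_add) vertex_module"
  assumes vector_space_M: "vector_space (mscl M)"
    and subspace_M: "module.subspace (mscl M) (carrier M)"
    and act_closed: "\<lbrakk>a \<in> carrier V; u \<in> carrier M\<rbrakk> \<Longrightarrow> act M a k u \<in> carrier M"
    and act_add_left: "\<lbrakk>a \<in> carrier V; b \<in> carrier V; u \<in> carrier M\<rbrakk>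
          \<Longrightarrow> act M (a + b) k u = act M a k u + act M b k u"
    and act_add_right: "\<lbrakk>a \<in> carrier V; u \<in> carrier M; v \<in> carrier M\<rbrakk>
          \<Longrightarrow> act M a k (u + v) = act M a k u + act M a k v"
    and act_scl_left: "\<lbrakk>a \<in> carrier V; u \<in> carrier M\<rbrakk>
          \<Longrightarrow> act M (scl V x a) k u = mscl M x (act M a k u)"
    and act_scl_right: "\<lbrakk>a \<in> carrier V; u \<in> carrier M\<rbrakk>
          \<Longrightarrow> act M a k (mscl M x u) = mscl M x (act M a k u)"
    and act_truncation: "\<lbrakk>a \<in> carrier V; u \<in> carrier M\<rbrakk> \<Longrightarrow> \<exists>N. \<forall>k\<ge>N. act M a k u = 0"
    and act_vac: "u \<in> carrier M \<Longrightarrow> act M (vac V) k u = (if k = -1 then u else 0)"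
    and act_borcherds: "\<lbrakk>a \<in> carrier V; b \<in> carrier V; u \<in> carrier M\<rbrakk>
          \<Longrightarrow> borcherds_identity V (mscl M) (act M) 1 a b u"

text \<open>The grading is over the integers, with zero spaces in negative degrees.\<close>

definition admissible_module ::
    "'v::ab_group_add vertex_structure \<Rightarrow> (int \<Rightarrow> 'v set) \<Rightarrow> ('v, 'm::ab_group_add) vertex_module \<Rightarrow> bool" where
  "admissible_module V D M \<longleftrightarrow>
     is_vertex_module V M \<and>
     is_direct_sum (mscl M) (carrier M) (level M) \<and> (\<forall>k<0. level M k = {0}) \<and>
     (\<forall>m k l. \<forall>a\<in>D m. \<forall>u\<in>level M k. act M a l u \<in> level M (m + k - l - 1))"

definition submodule ::
    "'v vertex_structure \<Rightarrow> ('v, 'm::ab_group_add) vertex_module \<Rightarrow> 'm set \<Rightarrow> bool" where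
  "submodule V M N \<longleftrightarrow> N \<subseteq> carrier M \<and> module.subspace (mscl M) N \<and>
     (\<forall>a\<in>carrier V. \<forall>k. \<forall>u\<in>N. act M a k u \<in> N)"

text \<open>The grading is normalized so that degree zero is the lowest one, as \<open>M \<mapsto> M\<^sub>0\<close> requires.\<close>

definition irreducible_admissible ::
    "'v::ab_group_add vertex_structure \<Rightarrow> (int \<Rightarrow> 'v set) \<Rightarrow> ('v, 'm::ab_group_add) vertex_module \<Rightarrow> bool" where
  "irreducible_admissible V D M \<longleftrightarrow>
     admissible_module V D M \<and> level M 0 \<noteq> {0} \<and>
     (\<forall>N. submodule V M N \<longrightarrow> N = {0} \<or> N = carrier M)"

definition highest_weight_module ::
    "'v::ab_group_add vertex_structure \<Rightarrow> (int \<Rightarrow> 'v set) \<Rightarrow> ('v, 'm::ab_group_add) vertex_module \<Rightarrow> bool" where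
  "highest_weight_module V D M \<longleftrightarrow>
     admissible_module V D M \<and>
     (\<exists>u. u \<noteq> 0 \<and> level M 0 = module.span (mscl M) {u} \<and>
          (\<forall>N. submodule V M N \<and> u \<in> N \<longrightarrow> N = carrier M))"

definition modules_isomorphic ::
    "'v vertex_structure \<Rightarrow> ('v, 'm::ab_group_add) vertex_module \<Rightarrow> ('v, 'k::ab_group_add) vertex_module \<Rightarrow> bool"
  where
  "modules_isomorphic V M N \<longleftrightarrow>
     (\<exists>h. bij_betw h (carrier M) (carrier N) \<and>
          (\<forall>u\<in>carrier M. \<forall>v\<in>carrier M. h (u + v) = h u + h v) \<and>
          (\<forall>x. \<forall>u\<in>carrier M. h (mscl M x u) = mscl N x (h u)) \<and>
          (\<forall>a\<in>carrier V. \<forall>k. \<forall>u\<in>carrier M. h (act M a k u) = act N a k (h u)))"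

text \<open>For \<open>a\<close> of weight \<open>d\<close>, the class \<open>[a]\<close> acts on \<open>M\<^sub>0\<close> by \<open>a(d-1)\<close>; the weight of \<open>j\<^sup>2\<^sup>m\<close> is
  \<open>2m + 2\<close>. So this says that \<open>a\<^sup>2\<^sup>m = [j\<^sup>2\<^sup>m]\<close> acts on \<open>M\<^sub>0\<close> by the scalar \<open>lam $ m\<close>.\<close>

definition top_point ::
    "nat \<Rightarrow> (nat \<Rightarrow> 'v) \<Rightarrow> ('v, 'm::ab_group_add) vertex_module \<Rightarrow> complex vec \<Rightarrow> bool" where
  "top_point n j M lam \<longleftrightarrow> lam \<in> carrier_vec n \<and>
     (\<forall>m<n. \<forall>u\<in>level M 0. act M (j m) (int (2 * m + 2) - 1) u = mscl M (lam $ m) u)"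

end

theory Submission
  imports
    Defs
    "Jordan_Normal_Form.Determinant"
    "HOL-Library.Function_Algebras"
    "HOL-Library.Product_Plus"
    "HOL-Computational_Algebra.Fundamental_Theorem_Algebra"
    "HOL-Computational_Algebra.Polynomial_FPS"
    "HOL-Analysis.Continuum_Not_Denumerable"
begin

text \<open>
  Differentiating the transvections, an invariant is killed by the symplectic Lie algebra. On such
  vectors the dual Casimir operator is \<open>\<Sum> E\<^sup>\<dagger> E\<close> plus the number operator for a Hermitian form, so that
  its kernel is spanned by the vacuum; hence the invariants are generated by quadratic fields. Modulo
  Zhu's \<open>O\<close> these reduce to the \<open>j\<^sup>2\<^sup>m\<close>, whose multiplications commute. For natural numbers \<open>N\<^sub>i\<close> the vector
  \<open>\<Prod>\<^sub>i e\<^sub>i(-1) \<dots> e\<^sub>i(-N\<^sub>i)\<close> is a lowest weight vector, on which \<open>j\<^sup>2\<^sup>m\<close> acts by \<open>\<Sum>\<^sub>i s\<^sub>m(N\<^sub>i(N\<^sub>i+1))\<close> with a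
  polynomial \<open>s\<^sub>m\<close> of degree \<open>m + 1\<close>. Evaluated on these vectors, the relation that a product of more than
  \<open>2n\<close> odd generators vanishes eliminates \<open>j\<^sup>2\<^sup>m\<close> for \<open>m \<ge> n\<close>; as the weights are Zariski dense, the
  remaining \<open>j\<^sup>2\<^sup>m\<close> are independent. The matrix coefficients of words in the modes at these vectors are
  polynomial in the weight; interpolating them at any point of \<open>\<complex>\<^sup>n\<close> yields the module over it.
\<close>

text \<open>The vectors \<open>hv N\<close> serve for more than independence. Commutativity also
  comes from them: by Zhu's commutator formula, the commutator of the multiplications by
  \<open>jq k\<close> and \<open>jq l\<close> is the multiplication by an element at most quadratic
  in the generators. Such an element is a combination of the vacuum and the \<open>jq i\<close>, up
  to something that multiplies everything into \<open>ZO\<close>. Its values at all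
  \<open>hv N\<close> are zero, as values are multiplicative; those of the \<open>jq i\<close> have
  distinct degrees, so the combination vanishes. The obstacle in the elimination: the vanishing
  product, read in the Zhu algebra, has a word with \<open>n + 1\<close> letters as its symbol,
  while the shorter words, among them the wanted \<open>[m]\<close>, enter with unknown
  coefficients. That \<open>[m]\<close> does occur is again seen from values. In the final
  construction a vector is a word in the modes, regarded as the function sending a further word to
  the coefficient of their composite at the lowest weight vector. Vectors with equal coefficients
  are thus equal: the radical of the pairing is divided out from the start, and irreducibility
  follows.\<close>

lemma Sum_any_eq_sum_lessThan:
  fixes f :: "nat \<Rightarrow> 'a::comm_monoid_add" assumes "\<And>j. j \<ge> J \<Longrightarrow> f j = 0" shows "Sum_any f = (\<Sum>j<J. f j)"
  by (rule Sum_any.expand_superset) (use assms in \<open>auto simp: not_less[symmetric]\<close>)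

abbreviation sbinom :: "int \<Rightarrow> nat \<Rightarrow> complex" where "sbinom r j \<equiv> (-1) ^ j * (of_int r gchoose j)"

text \<open>\<open>Sum_any\<close> of a family with infinite support is zero, so the identity
  becomes manageable only with an explicit common bound \<open>J\<close> on the three
  supports.\<close>

lemma borcherds_finite:
  fixes s :: "complex \<Rightarrow> 'm \<Rightarrow> 'm::ab_group_add" and act :: "'v \<Rightarrow> int \<Rightarrow> 'm \<Rightarrow> 'm"
  assumes "borcherds_identity V s act \<epsilon> a b c" and "vector_space s"
    and "\<And>j. j \<ge> J \<Longrightarrow> act (mode V a (n + int j) b) (m + k - int j) c = 0"
    and "\<And>j. j \<ge> J \<Longrightarrow> act a (m + n - int j) (act b (k + int j) c) = 0"
    and "\<And>j. j \<ge> J \<Longrightarrow> act b (n + k - int j) (act a (m + int j) c) = 0"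
  shows "(\<Sum>j<J. s (of_int m gchoose j) (act (mode V a (n + int j) b) (m + k - int j) c)) =
      (\<Sum>j<J. s (sbinom n j) (act a (m + n - int j) (act b (k + int j) c)))
      - (\<Sum>j<J. s (sbinom n j * ((-1) powi n) * \<epsilon>)
                            (act b (n + k - int j) (act a (m + int j) c)))"
proof -
  interpret vector_space s by fact
  show ?thesis using assms(1)[unfolded borcherds_identity_def, rule_format, of m n k]
    by (subst (asm) (1 2 3) Sum_any_eq_sum_lessThan[where J = J]) (simp_all add: assms)
qed

lemma zero_gbinomial: "((0::'a::field_char_0) gchoose j) = (if j = 0 then 1 else 0)" by (cases j) auto

lemmas hom_rules = module_hom.add module_hom.scale module_hom.diff module_hom.neg module_hom.sum module_hom.zero

section \<open>Modes as total linear maps, and special cases of the Borcherds identity\<close>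

context vertex_superalgebra
begin

sublocale vs: vector_space "scl V" by (rule vector_space)

sublocale vp: vector_space_pair "scl V" "scl V" by unfold_locales

abbreviation scale_V (infixr \<open>*s\<close> 75) where "x *s a \<equiv> scl V x a"
abbreviation "C \<equiv> carrier V"
abbreviation "lin \<equiv> module_hom (scl V) (scl V)"

lemma module_hom_def': "lin f \<longleftrightarrow>
    (\<forall>a b. f (a + b) = f a + f b) \<and> (\<forall>x a. f (x *s a) = x *s f a)"
  unfolding module_hom_def module_hom_axioms_def using vs.module_axioms by blast

text \<open>The modes are linear on the carrier only; precomposing with a linear projection onto it makes
  them linear on the whole type.\<close>

definition proj :: "'v \<Rightarrow> 'v" where
  "proj = (SOME p. range p \<subseteq> C \<and> lin p \<and> (\<forall>a\<in>C. p a = a))"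

lemma proj: "range proj \<subseteq> C \<and> lin proj \<and> (\<forall>a\<in>C. proj a = a)"
proof -
  have "lin id" by (simp add: module_hom_def')
  from vp.linear_exists_left_inverse_on[unfolded linear_iff_module_hom, OF this subspace_carrier]
  have "\<exists>p. range p \<subseteq> C \<and> lin p \<and> (\<forall>a\<in>C. p a = a)" by simp
  thus ?thesis unfolding proj_def by (rule someI_ex)
qed

lemma proj_in [simp, intro]: "proj a \<in> C" and proj_id [simp]: "a \<in> C \<Longrightarrow> proj a = a" and proj_hom: "lin proj"
  using proj by (blast, blast, blast)

lemma proj_proj [simp]: "proj (proj a) = proj a" by simp

definition Y :: "'v \<Rightarrow> int \<Rightarrow> 'v \<Rightarrow> 'v" where "Y a k b = mode V (proj a) k (proj b)"

lemmas C_zero [simp, intro] = vs.subspace_0[OF subspace_carrier]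
lemmas C_add [intro] = vs.subspace_add[OF subspace_carrier]
lemmas C_scale [intro] = vs.subspace_scale[OF subspace_carrier]
lemmas C_diff [intro] = vs.subspace_diff[OF subspace_carrier]
lemmas C_neg [intro] = vs.subspace_neg[OF subspace_carrier]
lemmas C_sum [intro] = vs.subspace_sum[OF subspace_carrier]

lemma sector_subset: assumes "p < 2" shows "sector V p \<subseteq> C"
proof
  fix a assume a: "a \<in> sector V p"
  have 0: "0 \<in> sector V 0" "0 \<in> sector V 1"
    using vs.subspace_0[OF subspace_sector, of 0] vs.subspace_0[OF subspace_sector, of 1] by simp_all
  have "p = 0 \<or> p = 1" using assms by auto
  moreover have "a = a + 0" "a = 0 + a" by simp_all
  ultimately show "a \<in> C" using a 0 unfolding carrier_sum by blast
qed

lemma C_vac [simp, intro]: "vac V \<in> C" using vac_even sector_subset[of 0] by auto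

lemma mode_closed: assumes "a \<in> C" "b \<in> C" shows "mode V a k b \<in> C"
proof -
  obtain a0 a1 b0 b1 where ab: "a = a0 + a1" "b = b0 + b1" "a0 \<in> sector V 0" "a1 \<in> sector V 1"
    "b0 \<in> sector V 0" "b1 \<in> sector V 1" using assms unfolding carrier_sum by auto
  hence inC: "a0 \<in> C" "a1 \<in> C" "b0 \<in> C" "b1 \<in> C" using sector_subset[of 0] sector_subset[of 1] by auto
  have "mode V a k b = (mode V a0 k b0 + mode V a0 k b1) + (mode V a1 k b0 + mode V a1 k b1)"
    using inC by (simp add: ab mode_add_left mode_add_right C_add)
  moreover have "mode V a0 k b0 \<in> C" "mode V a0 k b1 \<in> C" "mode V a1 k b0 \<in> C" "mode V a1 k b1 \<in> C"
    using mode_sector[of 0 0 a0 b0] mode_sector[of 0 1 a0 b1] mode_sector[of 1 0 a1 b0]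
      mode_sector[of 1 1 a1 b1] ab sector_subset[of 0] sector_subset[of 1] by auto
  ultimately show ?thesis by (auto intro!: C_add)
qed

lemma Y_in [simp, intro]: "Y a k b \<in> C" by (simp add: Y_def mode_closed)

lemma Y_mode: "\<lbrakk>a \<in> C; b \<in> C\<rbrakk> \<Longrightarrow> Y a k b = mode V a k b" by (simp add: Y_def)

lemma Y_left: "lin (\<lambda>a. Y a k b)" using proj_hom by (auto simp: module_hom_def' Y_def mode_add_left mode_scl_left)

lemma Y_right: "lin (Y a k)" using proj_hom by (auto simp: module_hom_def' Y_def mode_add_right mode_scl_right)

lemmas Y_linear = hom_rules[OF Y_left] hom_rules[OF Y_right]

lemma Y_zero [simp]: "Y 0 k b = 0" "Y a k 0 = 0"
  using module_hom.zero[OF Y_left] module_hom.zero[OF Y_right] by auto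

lemma Y_proj [simp]: "Y (proj a) k b = Y a k b" "Y a k (proj b) = Y a k b" by (simp_all add: Y_def)

lemma Y_truncation: "\<exists>J. \<forall>j\<ge>J. Y a (m + int j) b = 0"
proof -
  obtain N where N: "\<forall>k\<ge>N. mode V (proj a) k (proj b) = 0" using truncation[of "proj a" "proj b"] by auto
  show ?thesis by (intro exI[of _ "nat (N - m)"]) (use N in \<open>auto simp: Y_def\<close>)
qed

lemma Y_vac: "Y (vac V) k a = (if k = -1 then proj a else 0)" by (simp add: Y_def vac_left)

lemma Y_creation: "Y a (-1) (vac V) = proj a" and Y_creation_regular: "k \<ge> 0 \<Longrightarrow> Y a k (vac V) = 0"
  by (auto simp: Y_def creation creation_regular)

lemma Y_borcherds: assumes "p < 2" "q < 2" "a \<in> sector V p" "b \<in> sector V q"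
  shows "borcherds_identity V (scl V) Y ((-1) ^ (p * q)) a b c"
proof -
  have ab: "a \<in> C" "b \<in> C" using sector_subset assms by auto
  have "borcherds_identity V (scl V) (mode V) ((-1) ^ (p * q)) a b (proj c)" by (rule borcherds[OF assms proj_in])
  with ab show ?thesis unfolding borcherds_identity_def by (simp add: Y_def mode_closed)
qed

lemma Y_borcherds_finite: assumes "p < 2" "q < 2" "a \<in> sector V p" "b \<in> sector V q"
    and "\<And>j. j \<ge> J \<Longrightarrow> Y a (n + int j) b = 0" and "\<And>j. j \<ge> J \<Longrightarrow> Y b (k + int j) c = 0"
    and "\<And>j. j \<ge> J \<Longrightarrow> Y a (m + int j) c = 0"
  shows "(\<Sum>j<J. (of_int m gchoose j) *s Y (Y a (n + int j) b) (m + k - int j) c) =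
      (\<Sum>j<J. sbinom n j *s Y a (m + n - int j) (Y b (k + int j) c))
      - (\<Sum>j<J. (sbinom n j * ((-1) powi n) * (-1) ^ (p * q))
                            *s Y b (n + k - int j) (Y a (m + int j) c))"
proof -
  have "a \<in> C" "b \<in> C" using sector_subset assms by auto
  hence ab: "mode V a i b = Y a i b" for i by (simp add: Y_mode)
  show ?thesis using borcherds_finite[OF Y_borcherds[OF assms(1-4)] vector_space, of J n m k c]
    by (simp add: ab assms(5-7))
qed

lemma common_truncation: assumes "\<exists>J::nat. \<forall>j\<ge>J. P j" "\<exists>J. \<forall>j\<ge>J. Q j" "\<exists>J. \<forall>j\<ge>J. R j"
  shows "\<exists>J. (\<forall>j\<ge>J. P j) \<and> (\<forall>j\<ge>J. Q j) \<and> (\<forall>j\<ge>J. R j)"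
proof -
  from assms obtain J1 J2 J3 where "\<forall>j\<ge>J1. P j" "\<forall>j\<ge>J2. Q j" "\<forall>j\<ge>J3. R j" by blast
  thus ?thesis by (intro exI[of _ "max J1 (max J2 J3)"]) auto
qed

lemma sum_lessThan_extend:
  fixes J :: nat assumes "\<And>j. j \<ge> J \<Longrightarrow> h j = (0::'a::comm_monoid_add)" "J \<le> J'"
  shows "(\<Sum>j<J'. h j) = (\<Sum>j<J. h j)" by (rule sum.mono_neutral_right) (use assms in \<open>auto simp: not_less\<close>)

text \<open>The case \<open>n = 0\<close> of the Borcherds identity: on the right only
  \<open>j = 0\<close> survives. Here \<open>J\<close> bounds the products of \<open>a\<close> and
  \<open>b\<close> alone; the bound for the other sums depends on \<open>c\<close> and is removed
  again by \<open>sum_lessThan_extend\<close>.\<close>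

lemma Y_commutator: assumes "p < 2" "q < 2" "a \<in> sector V p" "b \<in> sector V q"
    and J: "\<And>j. j \<ge> J \<Longrightarrow> Y a (int j) b = 0" shows "Y a m (Y b k c) - (-1) ^ (p * q) *s Y b k (Y a m c) =
    (\<Sum>j<J. (of_int m gchoose j) *s Y (Y a (int j) b) (m + k - int j) c)"
proof -
  obtain J0 where "\<forall>j\<ge>J0. Y b (k + int j) c = 0" "\<forall>j\<ge>J0. Y a (m + int j) c = 0"
    using common_truncation[OF Y_truncation[of b k c] Y_truncation[of a m c] Y_truncation[of a m c]] by auto
  hence *: "\<And>j. j \<ge> max (Suc 0) (max J J0) \<Longrightarrow> Y a (0 + int j) b = 0 \<and> Y b (k + int j) c = 0 \<and> Y a (m + int j) c = 0"
    using J by auto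
  let ?J = "max (Suc 0) (max J J0)"
  have "(\<Sum>j<?J. (of_int m gchoose j) *s Y (Y a (int j) b) (m + k - int j) c) =
      (\<Sum>j<J. (of_int m gchoose j) *s Y (Y a (int j) b) (m + k - int j) c)"
    by (rule sum_lessThan_extend) (auto simp: J)
  moreover have "(\<Sum>j<?J. (of_int m gchoose j) *s Y (Y a (int j) b) (m + k - int j) c) =
      Y a m (Y b k c) - (-1) ^ (p * q) *s Y b k (Y a m c)"
  proof -
    show ?thesis using Y_borcherds_finite[OF assms(1-4), of ?J 0 k c m] *
      by (simp add: zero_gbinomial if_distrib[of "\<lambda>x. x *s _"] if_distrib[of "\<lambda>x. _ * x"] if_distrib[of "\<lambda>x. x * _"] sum.delta cong: if_cong)
  qed
  ultimately show ?thesis by simp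
qed

text \<open>The case \<open>m = 0\<close> of the Borcherds identity, where only \<open>j = 0\<close>
  survives on the left: the modes of a product in terms of those of its factors.\<close>

lemma Y_iterate: assumes "p < 2" "q < 2" "a \<in> sector V p" "b \<in> sector V q"
    and J: "\<And>j. j \<ge> J \<Longrightarrow> Y b (k + int j) c = 0" "\<And>j. j \<ge> J \<Longrightarrow> Y a (int j) c = 0" shows "Y (Y a n b) k c =
      (\<Sum>j<J. sbinom n j *s
        (Y a (n - int j) (Y b (k + int j) c)
         - ((-1) powi n * (-1) ^ (p * q)) *s Y b (n + k - int j) (Y a (int j) c)))"
proof -
  let ?h = "\<lambda>j. sbinom n j *s (Y a (n - int j) (Y b (k + int j) c)
    - ((-1) powi n * (-1) ^ (p * q)) *s Y b (n + k - int j) (Y a (int j) c))"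
  obtain J0 where J0: "\<forall>j\<ge>J0. Y a (n + int j) b = 0"  using Y_truncation[of a n b] by auto
  let ?J = "max (Suc 0) (max J J0)"
  have *: "\<And>j. j \<ge> ?J \<Longrightarrow> Y a (n + int j) b = 0 \<and> Y b (k + int j) c = 0 \<and> Y a (0 + int j) c = 0" using J J0 by auto
  have "(\<Sum>j<?J. ?h j) =
     (\<Sum>j<J. ?h j)" by (rule sum_lessThan_extend) (auto simp: J)
  moreover have "Y (Y a n b) k c = (\<Sum>j<?J. ?h j)" using Y_borcherds_finite[OF assms(1-4), of ?J n k c 0] *
      by (simp add: zero_gbinomial if_distrib[of "\<lambda>x. x *s _"] sum.delta
         vs.scale_right_diff_distrib sum_subtractf mult.assoc less_max_iff_disj cong: if_cong)
  ultimately show ?thesis by simp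
qed

abbreviation dV where "dV \<equiv> deriv_V V"

lemma dV_eq: "a \<in> C \<Longrightarrow> dV a = Y a (-2) (vac V)" by (simp add: deriv_V_def Y_mode)

lemma dV_in [intro]: "a \<in> C \<Longrightarrow> dV a \<in> C" by (simp add: dV_eq)

lemma dV_pow_in [intro]: "a \<in> C \<Longrightarrow> (dV ^^ k) a \<in> C" by (induction k) auto

lemma dV_sector: "p < 2 \<Longrightarrow> a \<in> sector V p \<Longrightarrow> dV a \<in> sector V p"
  using mode_sector[OF _ _ _ vac_even, of p a "-2"] by (simp add: deriv_V_def)

lemma minus_two_gbinomial: "(-1)^j * ((-2::complex) gchoose j) = of_nat (Suc j)"
proof -
  have "(- 2::complex) = - (of_nat (Suc (Suc 0)))" by simp
  hence "((-2::complex) gchoose j) = (-1)^j * (of_nat (Suc j) gchoose j)"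
    unfolding gbinomial_minus by (simp add: add.commute)
  also have "(of_nat (Suc j) gchoose j :: complex) = of_nat (Suc j choose j)" by (simp only: binomial_gbinomial)
  finally show ?thesis by (simp add: binomial_symmetric[of j "Suc j"] flip: power_mult_distrib mult.assoc)
qed

text \<open>Apply \<open>Y_iterate\<close> with the vacuum as second factor. Its only nonzero mode
  is \<open>-1\<close>, which leaves the term \<open>j = -1-k\<close> of the first kind if
  \<open>k < 0\<close>, the term \<open>j = k-1\<close> of the second kind if \<open>k > 0\<close>,
  and nothing if \<open>k = 0\<close>.\<close>

lemma Y_dV: assumes "p < 2" "a \<in> sector V p" shows "Y (dV a) k c = - (of_int k *s Y a (k - 1) c)"
proof -
  let ?h = "\<lambda>j. of_nat (Suc j) *s (Y a (- 2 - int j) (Y (vac V) (k + int j) c) - Y (vac V) (k - 2 - int j) (Y a (int j) c))"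
  have a: "a \<in> C" using assms sector_subset by auto
  obtain J0 where J0: "\<forall>j\<ge>J0. Y a (int j) c = 0" "\<forall>j\<ge>J0. Y (vac V) (k + int j) c = 0"
    using common_truncation[OF Y_truncation[of a 0 c] Y_truncation[of "vac V" k c] Y_truncation[of a 0 c]] by auto
  define J where "J = max J0 (max (nat (- k)) (nat k))"
  have J: "j \<ge> J \<Longrightarrow> Y a (int j) c = 0" "j \<ge> J \<Longrightarrow> Y (vac V) (k + int j) c = 0" for j using J0 by (auto simp: J_def)
  have "Y (dV a) k c = (\<Sum>j<J. ?h j)" using Y_iterate[OF assms(1) _ assms(2) vac_even, of J k c "-2"] J
    by (simp add: dV_eq a minus_two_gbinomial del: of_nat_Suc)
  also have "\<dots> = - (of_int k *s Y a (k - 1) c)"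
  proof (cases "k < 0")
    case True
    have "(\<Sum>j<J. ?h j) =
       (\<Sum>j<J. if j = nat (-1-k) then of_nat (Suc j) *s Y a (- 2 - int j) c else 0)"
      by (rule sum.cong) (use True in \<open>auto simp: Y_vac\<close>)
    also have "\<dots> = of_nat (Suc (nat (-1-k))) *s Y a (- 2 - int (nat (-1-k))) c"
      using True by (subst sum.delta) (auto simp: J_def)
    also have "Suc (nat (-1-k)) = nat (- k)" using True by auto
    finally show ?thesis using True by (simp add: of_nat_nat algebra_simps)
  next
    case False
    have "(\<Sum>j<J. ?h j) =
       (\<Sum>j<J. if j = nat (k - 1) then - (of_int k *s Y a (k - 1) c) else 0)"
    proof (rule sum.cong)
      fix j assume "j \<in> {..<J}"
      show "?h j =
        (if j = nat (k - 1) then - (of_int k *s Y a (k - 1) c) else 0)"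
      proof (cases "k = 0")
        case True
        thus ?thesis by (auto simp: Y_vac)
      next
        case kn: False
        show ?thesis
        proof (cases "j = nat (k - 1)")
          case True
          hence "k = int (Suc j)" using False kn by simp
          thus ?thesis by (simp add: Y_vac)
        next
          case jn: False
          hence "k - 2 - int j \<noteq> -1" "k + int j \<noteq> -1" using False kn by auto
          thus ?thesis using jn by (simp add: Y_vac)
        qed
      qed
    qed simp
    also have "\<dots> = - (of_int k *s Y a (k - 1) c)"
    proof (cases "nat (k - 1) < J")
      case True
      thus ?thesis by (simp add: sum.delta)
    next
      case nJ: False
      hence "k = 0 \<or> Y a (k - 1) c = 0" using J(1)[of "nat (k - 1)"] False by (cases "k = 0") auto
      with nJ show ?thesis by auto
    qed
    finally show ?thesis .
  qed
  finally show ?thesis .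
qed

end

subsection \<open>Sorting words of anticommuting letters\<close>

definition before :: "nat \<times> nat \<Rightarrow> nat \<times> nat \<Rightarrow> bool" where
  "before p q \<longleftrightarrow> fst p < fst q \<or> fst p = fst q \<and> snd p > snd q"

lemma ordered_words_eq:
  "ordered_words N = {xs. sorted_wrt before xs \<and> (\<forall>p\<in>set xs. fst p < N)}"
proof -
  have "before = (\<lambda>(i, k) (i', k'). i < i' \<or> i = i' \<and> k > k')" by (auto simp: before_def fun_eq_iff)
  thus ?thesis by (auto simp: ordered_words_def)
qed

lemma before_total: "before p q \<or> p = q \<or> before q p" by (cases p; cases q) (auto simp: before_def)

lemma before_trans: "before p q \<Longrightarrow> before q r \<Longrightarrow> before p r" by (auto simp: before_def)

lemma before_irrefl [simp]: "\<not> before p p" by (simp add: before_def)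

lemma before_asym: "before p q \<Longrightarrow> \<not> before q p" by (auto simp: before_def)

lemma ordered_words_distinct: "xs \<in> ordered_words N \<Longrightarrow> distinct xs" unfolding ordered_words_eq by (induction xs) auto

text \<open>The first component is the sign of the sorting permutation, or \<open>0\<close> if a letter is repeated.\<close>

fun ins_word :: "nat \<times> nat \<Rightarrow> (nat \<times> nat) list \<Rightarrow> complex \<times> (nat \<times> nat) list" where
  "ins_word p [] = (1, [p])"
| "ins_word p (q # S) = (if before p q then (1, p # q # S) else if p = q then (0, [])
     else (- fst (ins_word p S), q # snd (ins_word p S)))"

fun sort_word :: "(nat \<times> nat) list \<Rightarrow> complex \<times> (nat \<times> nat) list" where
  "sort_word [] = (1, [])"
| "sort_word (p # xs) = (if fst (sort_word xs) = 0 then (0, []) else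
     (fst (sort_word xs) * fst (ins_word p (snd (sort_word xs))),
      snd (ins_word p (snd (sort_word xs)))))"

lemma ins_word_mset: "fst (ins_word p S) \<noteq> 0 \<Longrightarrow> mset (snd (ins_word p S)) = add_mset p (mset S)"
  by (induction S) (auto split: if_splits)

lemma ins_word_subset: "set (snd (ins_word p S)) \<subseteq> insert p (set S)" by (induction S) auto

lemma ins_word_sorted: "sorted_wrt before S \<Longrightarrow> sorted_wrt before (snd (ins_word p S))"
proof (induction S)
  case (Cons q S)
  have "set (snd (ins_word p S)) \<subseteq> insert p (set S)" by (rule ins_word_subset)
  thus ?case using Cons before_total[of p q] by (auto intro: before_trans)
qed simp

lemma sort_word_mset: "fst (sort_word xs) \<noteq> 0 \<Longrightarrow> mset (snd (sort_word xs)) = mset xs"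
  by (induction xs) (auto simp: ins_word_mset split: if_splits)

lemma sort_word_set: "set (snd (sort_word xs)) \<subseteq> set xs"
proof (induction xs)
  case (Cons p xs)
  thus ?case using ins_word_subset[of p "snd (sort_word xs)"] by auto
qed simp

lemma sort_word_in: "\<forall>p\<in>set xs. fst p < N \<Longrightarrow> snd (sort_word xs) \<in> ordered_words N"
proof -
  have "sorted_wrt before (snd (sort_word xs))" by (induction xs) (auto intro: ins_word_sorted)
  thus "\<forall>p\<in>set xs. fst p < N \<Longrightarrow> ?thesis" using sort_word_set[of xs] by (auto simp: ordered_words_eq)
qed

lemma sort_word_repeated: "\<not> distinct xs \<Longrightarrow> fst (sort_word xs) = 0"
proof (rule ccontr)
  assume *: "\<not> distinct xs" and "fst (sort_word xs) \<noteq> 0"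
  hence "mset (snd (sort_word xs)) = mset xs" by (simp add: sort_word_mset)
  moreover have "distinct (snd (sort_word xs))"
    using ordered_words_distinct[OF sort_word_in[of xs "Suc (Max (fst ` set xs))"]] by (auto simp: less_Suc_eq_le)
  ultimately show False using * by (metis mset_eq_imp_distinct_iff)
qed

text \<open>Stated abstractly because it is applied to the creation operators, to their transforms
  under a matrix, and to functionals composed with annihilation operators. In the last case
  anticommutation holds only on linear functionals, whence the set \<open>X\<close>.\<close>

lemma foldr_sort_word:
  fixes s :: "complex \<Rightarrow> 'x \<Rightarrow> 'x::ab_group_add" and c :: "nat \<times> nat \<Rightarrow> 'x \<Rightarrow> 'x" assumes "vector_space s"
    and scale: "\<And>p x z. p \<in> P \<Longrightarrow> c p (s z x) = s z (c p x)"
    and anti: "\<And>p q x. p \<in> P \<Longrightarrow> q \<in> P \<Longrightarrow> x \<in> X \<Longrightarrow> c p (c q x) = - c q (c p x)"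
    and closed: "\<And>p x. p \<in> P \<Longrightarrow> x \<in> X \<Longrightarrow> c p x \<in> X" and "set xs \<subseteq> P" and "x \<in> X"
  shows "foldr c xs x = s (fst (sort_word xs)) (foldr c (snd (sort_word xs)) x)"
proof -
  interpret vector_space s by fact
  have X: "foldr c S x \<in> X" if "set S \<subseteq> P" for S using that by (induction S) (auto simp: \<open>x \<in> X\<close> intro: closed)
  have sq: "c p (c p x) = 0" if "p \<in> P" "x \<in> X" for p x
  proof -
    have "c p (c p x) + c p (c p x) = 0" using anti[OF that(1) that] by (metis add.right_inverse)
    hence "s 2 (c p (c p x)) = 0" using scale_left_distrib[of 1 1] by simp
    thus ?thesis by simp
  qed
  have ins: "c p (foldr c S x) = s (fst (ins_word p S)) (foldr c (snd (ins_word p S)) x)"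
    if "p \<in> P" "set S \<subseteq> P" for p S using that(2)
  proof (induction S)
    case (Cons q S)
    hence IH: "c p (foldr c S x) = s (fst (ins_word p S)) (foldr c (snd (ins_word p S)) x)" by simp
    have "q \<in> P" "set S \<subseteq> P" using Cons by simp_all
    hence *: "c p (c q (foldr c S x)) = - c q (c p (foldr c S x))" using that X by (intro anti)
    show ?case
    proof (cases "p = q")
      case True
      thus ?thesis using sq[OF that(1) X[OF \<open>set S \<subseteq> P\<close>]] by simp
    next
      case False
      thus ?thesis using IH * scale[OF \<open>q \<in> P\<close>] by (cases "before p q") simp_all
    qed
  qed simp
  have z: "c p 0 = 0" if "p \<in> P" for p using scale[OF that, of 0 0] by simp
  show ?thesis using \<open>set xs \<subseteq> P\<close>
  proof (induction xs)
    case (Cons p xs)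
    have "set (snd (sort_word xs)) \<subseteq> P" using sort_word_set[of xs] Cons by auto
    thus ?case using Cons by (auto simp: ins scale z)
  qed simp
qed

subsection \<open>The Fock space\<close>

lemma binomial_minus_one: "((-1::complex) gchoose k) = (-1)^k"
proof -
  have "(of_nat k gchoose k :: complex) = 1" by (simp flip: binomial_gbinomial)
  thus ?thesis using gbinomial_minus[of "1::complex" k] by simp
qed

text \<open>The conformal weight of the monomial: \<open>\<partial>\<^sup>k g\<^sub>i\<close> has
  weight \<open>k + 1\<close>.\<close>

definition wt_word :: "(nat \<times> nat) list \<Rightarrow> int" where
  "wt_word xs = (\<Sum>p\<leftarrow>xs. int (snd p) + 1)"

lemma wt_word_simps [simp]: "wt_word [] = 0" "wt_word (p # xs) = int (snd p) + 1 + wt_word xs"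
  by (simp_all add: wt_word_def)

lemma wt_word_append [simp]: "wt_word (xs @ ys) = wt_word xs + wt_word ys" by (simp add: wt_word_def)

lemma wt_word_nonneg: "wt_word xs \<ge> int (length xs)" by (induction xs) auto

context vertex_superalgebra
begin

lemma Y_dV_pow: assumes "p < 2" "a \<in> sector V p"
  shows "Y ((dV ^^ k) a) m c = ((-1)^k * fact k * (of_int m gchoose k)) *s Y a (m - int k) c"
proof (induction k arbitrary: m)
  case (Suc k)
  have "(dV ^^ k) a \<in> sector V p" by (induction k) (auto simp: assms dV_sector)
  hence "Y ((dV ^^ Suc k) a) m c = (- of_int m * ((-1)^k * fact k * (of_int (m - 1) gchoose k)))
      *s Y a (m - 1 - int k) c" using Y_dV[OF assms(1)] by (simp add: Suc)
  moreover have "of_int m * (of_int (m - 1) gchoose k) = of_nat (Suc k) * ((of_int m :: complex) gchoose Suc k)"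
    by (subst gbinomial_absorption'[of "Suc k"]) (simp_all add: field_simps del: of_nat_Suc)
  hence e: "- of_int m * ((-1)^k * fact k * (of_int (m - 1) gchoose k)) =
      (-1)^Suc k * fact (Suc k) * (of_int m gchoose Suc k :: complex)" by (simp add: fact_Suc del: of_nat_Suc)
  moreover have "m - 1 - int k = m - int (Suc k)" by simp
  ultimately show ?case by metis
qed simp

end

context symplectic_fermion_algebra
begin

abbreviation "G \<equiv> sf_gen n e f"

definition dual :: "nat \<Rightarrow> nat" where "dual I = (if I < n then I + n else I - n)"
definition sg :: "nat \<Rightarrow> complex" where "sg I = (if I < n then - 1 else 1)"

lemma dual_simps [simp]: "I < 2*n \<Longrightarrow> dual I < 2*n" "I < 2*n \<Longrightarrow> dual (dual I) = I"
  "I < 2*n \<Longrightarrow> dual I \<noteq> I" "sg I * sg I = 1" "sg I \<noteq> 0" "cnj (sg I) = sg I" by (auto simp: dual_def sg_def)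

lemma sg_dual: "I < 2*n \<Longrightarrow> sg (dual I) = - sg I" by (auto simp: dual_def sg_def)

lemma dual_swap: "I < 2*n \<Longrightarrow> J < 2*n \<Longrightarrow> dual I = J \<longleftrightarrow> dual J = I" by (metis dual_simps(2))

text \<open>The coefficient of the double pole of \<open>G I\<close> and \<open>G J\<close>, which
  is the matrix of the symplectic form.\<close>

definition om :: "nat \<Rightarrow> nat \<Rightarrow> complex" where "om I J = (if J = dual I then - sg I else 0)"

lemma G_sector: "I < 2*n \<Longrightarrow> G I \<in> sector V 1" using free by (auto simp: freely_generated_by_odd_def)

lemma G_in [simp]: "I < 2*n \<Longrightarrow> G I \<in> C" using G_sector sector_subset[of 1] by auto

lemma G_ope: assumes "I < 2*n" "J < 2*n" shows "Y (G I) (int k) (G J) = (if k = 1 then om I J *s vac V else 0)"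
proof -
  have m: "mode V (e i) (int k) (f j) = (if k = 1 \<and> i = j then vac V else 0)"
    "mode V (f j) (int k) (e i) = (if k = 1 \<and> i = j then - vac V else 0)"
    "mode V (e i) (int k) (e j) = 0" "mode V (f i) (int k) (f j) = 0" if "i < n" "j < n" for i j
    using ope_ef[OF that] ope_fe[OF that] ope_ee[OF that] ope_ff[OF that] unfolding has_ope_def by blast+
  have "mode V (G I) (int k) (G J) = (if k = 1 then om I J *s vac V else 0)"
  proof (cases "I < n"; cases "J < n")
    assume "\<not> I < n" "\<not> J < n"
    thus ?thesis using assms m(4)[of "I - n" "J - n"] by (auto simp: sf_gen_def om_def dual_def)
  next
    assume "I < n" "\<not> J < n"
    thus ?thesis using assms m(1)[of I "J - n"] by (auto simp: sf_gen_def om_def dual_def sg_def)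
  next
    assume "\<not> I < n" "J < n"
    thus ?thesis using assms m(2)[of "J" "I - n"] by (auto simp: sf_gen_def om_def dual_def sg_def)
  next
    assume "I < n" "J < n"
    thus ?thesis using m(3)[of I J] by (auto simp: sf_gen_def om_def dual_def)
  qed
  thus ?thesis using assms by (simp add: Y_mode)
qed

lemma G_anticommute: assumes "I < 2*n" "J < 2*n" shows "Y (G I) m (Y (G J) k c) = - Y (G J) k (Y (G I) m c)
     + (if m + k = 0 then (of_int m * om I J) *s proj c else 0)"
proof -
  have "Y (G I) m (Y (G J) k c) + Y (G J) k (Y (G I) m c) =
     (\<Sum>j<2. (of_int m gchoose j) *s Y (Y (G I) (int j) (G J)) (m + k - int j) c)"
    using Y_commutator[of 1 1 "G I" "G J" 2 m k c] G_sector[OF assms(1)] G_sector[OF assms(2)]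
    by (simp add: G_ope assms)
  also have "\<dots> = (if m + k = 0 then (of_int m * om I J) *s proj c else 0)"
    by (auto simp: eval_nat_numeral G_ope[OF assms, of 1, simplified] G_ope[OF assms, of 0, simplified] Y_linear Y_vac)
  finally show ?thesis by (simp add: eq_diff_eq[symmetric])
qed

text \<open>On the vacuum this mode gives \<open>\<partial>\<^sup>k G I / k!\<close>; hence
  monomials in \<open>cr\<close> differ from Wick monomials by factorials.\<close>

definition cr :: "nat \<times> nat \<Rightarrow> 'v \<Rightarrow> 'v" where
  "cr p b = Y (G (fst p)) (- int (snd p) - 1) b"

text \<open>The factor absorbs the mode number and the pairing of \<open>G (dual I)\<close> with
  \<open>G I\<close>, so that \<open>an\<close> and \<open>cr\<close> satisfy the canonical
  anticommutation relations.\<close>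

definition an :: "nat \<times> nat \<Rightarrow> 'v \<Rightarrow> 'v" where
  "an p b = (sg (fst p) / of_nat (Suc (snd p))) *s Y (G (dual (fst p))) (int (snd p) + 1) b"

abbreviation P :: "(nat \<times> nat) set" where "P \<equiv> {p. fst p < 2*n}"
abbreviation "words \<equiv> ordered_words (2*n)"

lemma cr_hom: "lin (cr p)" unfolding cr_def[abs_def] by (rule Y_right)

lemma an_hom: "lin (an p)" using Y_right[of "G (dual (fst p))" "int (snd p) + 1"]
  by (simp add: module_hom_def' an_def vs.scale_right_distrib mult.commute)

lemmas cr_linear = hom_rules[OF cr_hom]
lemmas an_linear = hom_rules[OF an_hom]

lemma cr_an_zero [simp]: "cr p 0 = 0" "an p 0 = 0"
  using module_hom.zero[OF cr_hom] module_hom.zero[OF an_hom] by auto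

lemma cr_an_in [simp, intro]: "cr p b \<in> C" "an p b \<in> C" by (auto simp: cr_def an_def)

lemma cr_an_proj [simp]: "cr p (proj b) = cr p b" "an p (proj b) = an p b" by (simp_all add: cr_def an_def)

lemma cr_cr: "p \<in> P \<Longrightarrow> q \<in> P \<Longrightarrow> cr p (cr q b) = - cr q (cr p b)" unfolding cr_def by (subst G_anticommute) auto

lemma an_an: "p \<in> P \<Longrightarrow> q \<in> P \<Longrightarrow> an p (an q b) = - an q (an p b)"
proof -
  assume "p \<in> P" "q \<in> P"
  hence "Y (G (dual (fst p))) (int (snd p) + 1) (Y (G (dual (fst q))) (int (snd q) + 1) b) =
    - Y (G (dual (fst q))) (int (snd q) + 1) (Y (G (dual (fst p))) (int (snd p) + 1) b)"
    by (subst G_anticommute) auto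
  thus ?thesis by (simp add: an_def Y_linear mult_ac)
qed

lemma an_cr: assumes "p \<in> P" "q \<in> P" shows "an p (cr q b) = (if p = q then proj b else 0) - cr q (an p b)"
proof -
  obtain I k J l where pq: "p = (I, k)" "q = (J, l)" by (cases p; cases q) auto
  have c: "complex_of_nat (Suc k) \<noteq> 0" by (simp del: of_nat_Suc)
  have om: "om (dual I) J = (if I = J then sg I else 0)" using assms by (auto simp: pq om_def sg_dual)
  have k: "of_int (int k + 1) = complex_of_nat (Suc k)" by simp
  have e: "(sg I / of_nat (Suc k)) *s (if int k + 1 + (- int l - 1) = 0
       then (of_int (int k + 1) * om (dual I) J) *s proj b else 0)
     = (if p = q then proj b else 0)" unfolding k om using c by (simp add: pq del: of_nat_Suc)
  have "Y (G (dual I)) (int k + 1) (Y (G J) (- int l - 1) b) =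
     - Y (G J) (- int l - 1) (Y (G (dual I)) (int k + 1) b)
     + (if int k + 1 + (- int l - 1) = 0 then (of_int (int k + 1) * om (dual I) J) *s proj b else 0)"
    using assms by (intro G_anticommute) (auto simp: pq)
  hence "an p (cr q b) = (sg I / of_nat (Suc k)) *s (- Y (G J) (- int l - 1) (Y (G (dual I)) (int k + 1) b))
     + (if p = q then proj b else 0)"
    unfolding e[symmetric] vs.scale_right_distrib[symmetric] by (simp add: an_def cr_def pq)
  thus ?thesis by (simp add: an_def cr_def pq Y_linear)
qed

abbreviation mon :: "(nat \<times> nat) list \<Rightarrow> 'v" where "mon xs \<equiv> foldr cr xs (vac V)"

lemma mon_in [simp, intro]: "mon xs \<in> C" by (cases xs) auto

lemma wick_factor: assumes "I < 2*n" shows "Y ((dV ^^ k) (G I)) (-1) b = fact k *s cr (I, k) b"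
proof -
  have i: "- int k - 1 = - 1 - int k" by simp
  have "(-1)^k * fact k * (-1)^k = (fact k :: complex)"
    by (simp add: mult.commute[of _ "fact k"] mult.assoc flip: power_mult_distrib)
  thus ?thesis using Y_dV_pow[of 1 "G I" k "-1" b] G_sector[OF assms]
    unfolding cr_def fst_conv snd_conv i by (simp add: binomial_minus_one)
qed

lemma wick_monomial_eq: assumes "set xs \<subseteq> P" shows "wick_monomial V G xs = (\<Prod>p\<leftarrow>xs. fact (snd p)) *s mon xs"
  using assms
proof (induction xs)
  case (Cons p xs)
  obtain I k where p: "p = (I, k)" by (cases p) auto
  have I: "I < 2*n" using Cons p by auto
  have "wick_monomial V G (p # xs) = mode V ((dV ^^ k) (G I)) (-1) (wick_monomial V G xs)"
    by (simp add: wick_monomial_def p wick_def)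
  also have "\<dots> = Y ((dV ^^ k) (G I)) (-1) (wick_monomial V G xs)"
    using Cons I by (subst Y_mode) (auto intro!: dV_pow_in)
  also have "\<dots> = fact k *s cr (I, k) ((\<Prod>p\<leftarrow>xs. fact (snd p)) *s mon xs)" using Cons I by (simp add: wick_factor)
  finally show ?case by (simp add: p cr_linear mult.commute)
qed (simp add: wick_monomial_def)

lemma wick_monomial_in: "set xs \<subseteq> P \<Longrightarrow> wick_monomial V G xs \<in> C" by (simp add: wick_monomial_eq C_scale)

lemma words_P: "xs \<in> words \<Longrightarrow> set xs \<subseteq> P" by (auto simp: ordered_words_eq)

lemma Nil_words [simp]: "[] \<in> words" by (simp add: ordered_words_eq)

lemma span_words: "vs.span (mon ` words) = C"
proof
  show "vs.span (mon ` words) \<subseteq> C" by (rule vs.span_minimal) (auto simp: subspace_carrier)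
  have "C = vs.span (wick_monomial V G ` words)" using free by (simp add: freely_generated_by_odd_def)
  also have "\<dots> \<subseteq> vs.span (mon ` words)" by (rule vs.span_minimal)
      (auto simp: wick_monomial_eq[OF words_P] intro!: vs.span_scale intro: vs.span_base)
  finally show "C \<subseteq> vs.span (mon ` words)" .
qed

lemma C_induct [consumes 1, case_names mon zero add scale]:
  assumes "a \<in> C" and "\<And>xs. xs \<in> words \<Longrightarrow> Q (mon xs)" and "Q 0"
    and "\<And>a b. a \<in> C \<Longrightarrow> b \<in> C \<Longrightarrow> Q a \<Longrightarrow> Q b \<Longrightarrow> Q (a + b)" and "\<And>x a. a \<in> C \<Longrightarrow> Q a \<Longrightarrow> Q (x *s a)" shows "Q a"
proof -
  have "a \<in> vs.span (mon ` words)" using assms(1) span_words by simp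
  hence "a \<in> C \<and> Q a" by (rule vs.span_induct)
      (auto simp: vs.subspace_def assms intro!: assms C_add C_scale)
  thus ?thesis by simp
qed

lemma hom_eq_on_C: assumes "module_hom (scl V) s \<phi>" "module_hom (scl V) s \<psi>"
    and "\<And>xs. xs \<in> words \<Longrightarrow> \<phi> (mon xs) = \<psi> (mon xs)" and "a \<in> C" shows "\<phi> a = \<psi> a" using assms(4)
  by (induction rule: C_induct)
    (simp_all add: assms(3) module_hom.add[OF assms(1)] module_hom.add[OF assms(2)]
      module_hom.scale[OF assms(1)] module_hom.scale[OF assms(2)]
      module_hom.zero[OF assms(1)] module_hom.zero[OF assms(2)])

text \<open>The central term in \<open>G_anticommute\<close> is proportional to the mode number, so
  a zero mode anticommutes with all creation operators; it also kills the vacuum. This is why the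
  annihilators start with mode \<open>1\<close>.\<close>

lemma G_zero_mode [simp]: assumes "I < 2*n" shows "Y (G I) 0 c = 0"
proof -
  have z: "Y (G I) 0 (mon xs) = 0" if "set xs \<subseteq> P" for xs using that
  proof (induction xs)
    case (Cons p xs)
    thus ?case using assms by (simp add: cr_def G_anticommute)
  qed (simp add: Y_creation_regular)
  have "Y (G I) 0 (proj c) = 0"
    by (rule hom_eq_on_C[OF Y_right, where \<psi> = "\<lambda>_. 0"]) (auto simp: module_hom_def' z words_P)
  thus ?thesis by simp
qed

lemma mon_sort: "set xs \<subseteq> P \<Longrightarrow> mon xs = fst (sort_word xs) *s mon (snd (sort_word xs))"
  by (rule foldr_sort_word[OF vector_space, of P _ UNIV]) (auto simp: cr_linear intro!: cr_cr)

lemma sort_word_words: "set xs \<subseteq> P \<Longrightarrow> snd (sort_word xs) \<in> words" by (rule sort_word_in) auto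

subsection \<open>Coordinates and the Hermitian form\<close>

text \<open>The coordinate with respect to the ordered \<open>mon\<close> words. The basis supplied
  by free generation consists of Wick monomials; the factorials convert the coordinate, and
  \<open>proj\<close> makes it linear on the whole type.\<close>

definition coef :: "(nat \<times> nat) list \<Rightarrow> 'v \<Rightarrow> complex" where
  "coef S a = (\<Prod>p\<leftarrow>S. fact (snd p)) *
     vs.representation (wick_monomial V G ` words) (proj a) (wick_monomial V G S)"

lemma wick_basis: "\<not> vs.dependent (wick_monomial V G ` words)"
    "vs.span (wick_monomial V G ` words) = C" "inj_on (wick_monomial V G) words"
  using free by (auto simp: freely_generated_by_odd_def)

lemma coef_hom: "module_hom (scl V) (*) (coef S)"
proof -
  have "coef S (a + b) = coef S a + coef S b" for a b unfolding coef_def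
    by (simp add: module_hom.add[OF proj_hom] vs.representation_add wick_basis distrib_left)
  moreover have "coef S (x *s a) = x * coef S a" for x a unfolding coef_def
    by (simp add: module_hom.scale[OF proj_hom] vs.representation_scale wick_basis mult.left_commute)
  ultimately show ?thesis unfolding module_hom_def module_hom_axioms_def using vs.module_axioms
    by (auto simp: Modules.module_def algebra_simps)
qed

lemmas coef_linear [simp] = hom_rules[OF coef_hom]

lemma coef_proj [simp]: "coef S (proj a) = coef S a" by (simp add: coef_def)

lemma fact_prod_nonzero [simp]: "(\<Prod>p\<leftarrow>S. fact (snd p)) \<noteq> (0::complex)" by (induction S) auto

lemma coef_mon: assumes "S \<in> words" "T \<in> words" shows "coef S (mon T) = (if S = T then 1 else 0)"
proof -
  have "coef S (wick_monomial V G T) = (if S = T then (\<Prod>p\<leftarrow>S. fact (snd p)) else 0)" using assms wick_basis(3)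
    by (auto simp: coef_def vs.representation_basis wick_basis wick_monomial_in[OF words_P] inj_on_def)
  hence "(\<Prod>p\<leftarrow>T. fact (snd p)) * coef S (mon T) = (if S = T then (\<Prod>p\<leftarrow>S. fact (snd p)) else 0)"
    using assms by (simp add: wick_monomial_eq words_P)
  thus ?thesis using fact_prod_nonzero[of T] by (auto simp del: fact_prod_nonzero split: if_splits)
qed

definition supp :: "'v \<Rightarrow> (nat \<times> nat) list set" where "supp a = {S \<in> words. coef S a \<noteq> 0}"

lemma supp_iff: "S \<in> supp a \<longleftrightarrow> S \<in> words \<and> coef S a \<noteq> 0" by (simp add: supp_def)

lemma finite_supp [simp]: "finite (supp a)"
proof -
  have "finite (supp (proj a))" using proj_in[of a]
  proof (induction rule: C_induct)
    case (mon xs)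
    have "supp (mon xs) \<subseteq> {xs}" using mon by (auto simp: supp_iff coef_mon split: if_splits)
    thus ?case by (rule finite_subset) simp
  next
    case (add a b)
    have "supp (a + b) \<subseteq> supp a \<union> supp b" by (auto simp: supp_iff)
    thus ?case using add finite_subset by blast
  next
    case (scale x a)
    have "supp (x *s a) \<subseteq> supp a" by (auto simp: supp_iff)
    thus ?case using scale finite_subset by blast
  qed (simp add: supp_def)
  thus ?thesis by (simp add: supp_def)
qed

lemma expand_in: assumes "a \<in> C" "finite U" "supp a \<subseteq> U" "U \<subseteq> words" shows "a = (\<Sum>S\<in>U. coef S a *s mon S)"
proof -
  have "a = (\<Sum>S\<in>supp a. coef S a *s mon S)" using assms(1)
  proof (induction rule: C_induct)
    case (mon xs)
    have "supp (mon xs) = {xs}" using mon by (auto simp: supp_iff coef_mon split: if_splits)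
    thus ?case using mon by (simp add: coef_mon)
  next
    case (add a b)
    let ?U = "supp a \<union> supp b"
    have "supp (a + b) \<subseteq> ?U" by (auto simp: supp_iff)
    hence "(\<Sum>S\<in>supp (a + b). coef S (a + b) *s mon S) = (\<Sum>S\<in>?U. coef S (a + b) *s mon S)"
      by (intro sum.mono_neutral_left) (auto simp: supp_iff simp del: coef_linear)
    also have "\<dots> = (\<Sum>S\<in>?U. coef S a *s mon S) + (\<Sum>S\<in>?U. coef S b *s mon S)"
      by (simp add: vs.scale_left_distrib sum.distrib)
    also have "(\<Sum>S\<in>?U. coef S a *s mon S) = (\<Sum>S\<in>supp a. coef S a *s mon S)"
      by (intro sum.mono_neutral_right) (auto simp: supp_iff)
    also have "(\<Sum>S\<in>?U. coef S b *s mon S) = (\<Sum>S\<in>supp b. coef S b *s mon S)"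
      by (intro sum.mono_neutral_right) (auto simp: supp_iff)
    finally show ?case using add by simp
  next
    case (scale x a)
    show ?case
    proof (cases "x = 0")
      case False
      hence U: "supp (x *s a) = supp a" by (auto simp: supp_iff)
      have "x *s a = (\<Sum>S\<in>supp a. x *s (coef S a *s mon S))"
        using arg_cong[OF scale(2), of "scl V x"] by (simp only: vs.scale_sum_right)
      also have "\<dots> = (\<Sum>S\<in>supp (x *s a). coef S (x *s a) *s mon S)" by (simp add: U)
      finally show ?thesis .
    qed (simp add: supp_def)
  qed (simp add: supp_def)
  also have "\<dots> = (\<Sum>S\<in>U. coef S a *s mon S)" by (intro sum.mono_neutral_left) (use assms in \<open>auto simp: supp_iff\<close>)
  finally show ?thesis .
qed

lemma expand: "a \<in> C \<Longrightarrow> a = (\<Sum>S\<in>supp a. coef S a *s mon S)" by (rule expand_in) (auto simp: supp_iff)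

lemma coef_eqI: assumes "a \<in> C" "b \<in> C" "\<And>S. S \<in> words \<Longrightarrow> coef S a = coef S b" shows "a = b"
proof -
  have "supp a = supp b" using assms by (auto simp: supp_iff)
  hence "(\<Sum>S\<in>supp a. coef S a *s mon S) = (\<Sum>S\<in>supp b. coef S b *s mon S)"
    using assms(3) by (auto simp: supp_iff intro!: sum.cong)
  thus ?thesis using expand[OF assms(1)] expand[OF assms(2)] by simp
qed

lemma cnj_sort_word [simp]: "cnj (fst (sort_word xs)) = fst (sort_word xs)"
proof -
  have "cnj (fst (ins_word p S)) = fst (ins_word p S)" for p S by (induction S) auto
  thus ?thesis by (induction xs) auto
qed

lemma coef_mon_sort: assumes "S \<in> words" "set xs \<subseteq> P"
  shows "coef S (mon xs) = (if S = snd (sort_word xs) then fst (sort_word xs) else 0)"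
  by (subst mon_sort) (use assms in \<open>auto simp: coef_mon sort_word_words\<close>)

lemma coef_Nil_cr: assumes "p \<in> P" shows "coef [] (cr p b) = 0"
proof -
  have z: "coef [] (cr p (mon xs)) = 0" if "xs \<in> words" for xs
  proof -
    have "set (p # xs) \<subseteq> P" using assms words_P[OF that] by auto
    moreover have "fst (sort_word (p # xs)) = 0" if "snd (sort_word (p # xs)) = []"
    proof (rule ccontr)
      assume "fst (sort_word (p # xs)) \<noteq> 0"
      hence "mset (snd (sort_word (p # xs))) = mset (p # xs)" by (rule sort_word_mset)
      thus False unfolding that by simp
    qed
    ultimately show ?thesis using coef_mon_sort[of "[]" "p # xs"] by (auto simp del: sort_word.simps)
  qed
  have "coef [] (cr p (proj b)) = 0"
    by (rule hom_eq_on_C[where s = "(*)" and \<psi> = "\<lambda>_. 0" and \<phi> = "\<lambda>b. coef [] (cr p b)"])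
      (use z in \<open>auto simp: module_hom_def module_hom_axioms_def vs.module_axioms cr_linear
        Modules.module_def algebra_simps\<close>)
  thus ?thesis by simp
qed

lemma an_mon_zero: "p \<in> P \<Longrightarrow> set xs \<subseteq> P \<Longrightarrow> p \<notin> set xs \<Longrightarrow> an p (mon xs) = 0"
proof (induction xs)
  case Nil
  thus ?case by (simp add: an_def Y_creation_regular)
next
  case (Cons q xs)
  thus ?case by (simp add: an_cr)
qed

text \<open>This will be the functional \<open>ip (mon xs)\<close>: each \<open>cr p\<close> on the
  left becomes \<open>an p\<close> on the right, the outermost letter first. In this form its
  behaviour under permutations of \<open>xs\<close> is an instance of
  \<open>foldr_sort_word\<close>.\<close>

definition af :: "(nat \<times> nat) list \<Rightarrow> 'v \<Rightarrow> complex" where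
  "af xs = foldr (\<lambda>p \<phi> b. \<phi> (an p b)) xs (coef [])"

lemma af_simps [simp]: "af [] b = coef [] b" "af (p # xs) b = af xs (an p b)" by (simp_all add: af_def)

lemma af_hom: "module_hom (scl V) (*) (af xs)"
proof (induction xs)
  case (Cons p xs)
  thus ?case by (auto simp: module_hom_def module_hom_axioms_def an_linear)
qed (use coef_hom in \<open>simp add: af_def\<close>)

lemmas af_linear = hom_rules[OF af_hom]

lemma af_proj [simp]: "af xs (proj b) = af xs b" by (cases xs) auto

lemma af_sort: assumes "set xs \<subseteq> P" shows "af xs b = fst (sort_word xs) * af (snd (sort_word xs)) b"
proof -
  have vsp: "vector_space (\<lambda>k (\<phi>::'v \<Rightarrow> complex) b. k * \<phi> b)" by unfold_locales (auto simp: fun_eq_iff algebra_simps)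
  have "af xs = (\<lambda>b. fst (sort_word xs) * af (snd (sort_word xs)) b)" unfolding af_def
  proof (rule foldr_sort_word[OF vsp, of P _ "{\<phi>. module_hom (scl V) (*) \<phi>}"])
    fix p q and \<phi> :: "'v \<Rightarrow> complex"
    assume pq: "p \<in> P" "q \<in> P" and "\<phi> \<in> {\<phi>. module_hom (scl V) (*) \<phi>}"
    hence \<phi>: "module_hom (scl V) (*) \<phi>" by simp
    show "(\<lambda>b. \<phi> (an q (an p b))) = - (\<lambda>b. \<phi> (an p (an q b)))"
    proof
      fix b
      show "\<phi> (an q (an p b)) = (- (\<lambda>b. \<phi> (an p (an q b)))) b"
        using module_hom.neg[OF \<phi>] an_an[OF pq(2,1), of b] by simp
    qed
  next
    fix p and \<phi> :: "'v \<Rightarrow> complex"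
    assume "\<phi> \<in> {\<phi>. module_hom (scl V) (*) \<phi>}"
    thus "(\<lambda>b. \<phi> (an p b)) \<in> {\<phi>. module_hom (scl V) (*) \<phi>}"
      by (auto simp: module_hom_def module_hom_axioms_def an_linear)
  qed (use assms coef_hom in auto)
  thus ?thesis by (rule fun_cong)
qed

lemma af_cr_zero: "q \<in> P \<Longrightarrow> set S \<subseteq> P \<Longrightarrow> q \<notin> set S \<Longrightarrow> af S (cr q b) = 0"
  by (induction S arbitrary: b) (auto simp: coef_Nil_cr an_cr af_linear)

lemma words_Cons: "p # S \<in> words \<longleftrightarrow> p \<in> P \<and> (\<forall>q\<in>set S. before p q) \<and> S \<in> words" by (auto simp: ordered_words_eq)

text \<open>Compare the first letters. If they agree, they cancel. Otherwise the smaller one does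
  not occur in the other, ordered word, and so it anticommutes through to the vacuum or to
  \<open>coef []\<close>.\<close>

lemma af_mon: "S \<in> words \<Longrightarrow> T \<in> words \<Longrightarrow> af S (mon T) = (if S = T then 1 else 0)"
proof (induction S arbitrary: T)
  case Nil
  thus ?case by (simp add: coef_mon)
next
  case (Cons p S)
  have p: "p \<in> P" "\<forall>q\<in>set S. before p q" "S \<in> words" using Cons.prems by (auto simp: words_Cons)
  show ?case
  proof (cases T)
    case Nil
    thus ?thesis using an_mon_zero[of p "[]"] p by (simp add: af_linear)
  next
    case (Cons q T')
    hence q: "q \<in> P" "\<forall>r\<in>set T'. before q r" "T' \<in> words" using \<open>T \<in> words\<close> by (auto simp: words_Cons)
    consider "p = q" | "before p q" | "before q p" using before_total[of p q] by blast
    thus ?thesis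
    proof cases
      case 1
      hence "an q (mon T') = 0" using q by (intro an_mon_zero words_P) auto
      thus ?thesis using 1 Cons q Cons.IH[OF p(3) q(3)] by (simp add: an_cr)
    next
      case 2
      hence "p \<notin> set (q # T')" using q 2 before_asym[OF 2] by auto
      hence "an p (mon T) = 0" using p \<open>T \<in> words\<close> unfolding Cons by (intro an_mon_zero words_P)
      thus ?thesis using 2 Cons by (auto simp: af_linear)
    next
      case 3
      hence "q \<notin> set (p # S)" using p 3 before_asym[OF 3] by auto
      hence "af (p # S) (cr q (mon T')) = 0" using q words_P[OF \<open>p # S \<in> words\<close>] by (intro af_cr_zero)
      thus ?thesis using 3 Cons by auto
    qed
  qed
qed

lemma af_coef: assumes "S \<in> words" shows "af S b = coef S b"
proof -
  have "af S (proj b) = coef S (proj b)"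
    by (rule hom_eq_on_C[OF af_hom coef_hom]) (simp_all add: af_mon coef_mon assms)
  thus ?thesis by simp
qed

text \<open>The Hermitian form, conjugate linear on the left, for which the ordered monomials are
  orthonormal. The adjoint of \<open>cr p\<close> is \<open>an p\<close>.\<close>

definition ip :: "'v \<Rightarrow> 'v \<Rightarrow> complex" where
  "ip a b = (\<Sum>S\<in>supp a. cnj (coef S a) * coef S b)"

lemma ip_expand: assumes "finite U" "supp a \<subseteq> U" "U \<subseteq> words" shows "ip a b = (\<Sum>S\<in>U. cnj (coef S a) * coef S b)"
  unfolding ip_def by (rule sum.mono_neutral_left) (use assms in \<open>auto simp: supp_iff\<close>)

lemma ip_right: "ip a (b + b') = ip a b + ip a b'" "ip a (x *s b) = x * ip a b"
  by (simp_all add: ip_def distrib_left sum.distrib sum_distrib_left mult.left_commute)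

lemma ip_left: "ip (a + a') b = ip a b + ip a' b" "ip (x *s a) b = cnj x * ip a b"
proof -
  let ?U = "supp a \<union> supp a' \<union> supp (a + a') \<union> supp (x *s a)"
  have U: "finite ?U" "?U \<subseteq> words" by (auto simp: supp_iff)
  show "ip (a + a') b = ip a b + ip a' b"
    using ip_expand[OF U(1) _ U(2), of "a + a'" b] ip_expand[OF U(1) _ U(2), of "a" b]
      ip_expand[OF U(1) _ U(2), of "a'" b] by (simp add: le_supI2 le_supI1 distrib_right sum.distrib)
  show "ip (x *s a) b = cnj x * ip a b"
    using ip_expand[OF U(1) _ U(2), of "x *s a" b] ip_expand[OF U(1) _ U(2), of "a" b]
    by (simp add: le_supI2 le_supI1 sum_distrib_left mult.assoc)
qed

lemma ip_zero [simp]: "ip 0 b = 0" "ip a 0 = 0" by (simp_all add: ip_def)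

lemma ip_sum: "ip a (sum h A) = (\<Sum>i\<in>A. ip a (h i))" "ip (sum h A) b = (\<Sum>i\<in>A. ip (h i) b)"
  by (induction A rule: infinite_finite_induct) (auto simp: ip_right ip_left)

lemma ip_proj [simp]: "ip (proj a) b = ip a b" "ip a (proj b) = ip a b" by (simp_all add: ip_def supp_def)

lemma ip_sym: "ip b a = cnj (ip a b)"
proof -
  let ?U = "supp a \<union> supp b"
  have U: "finite ?U" "?U \<subseteq> words" by (auto simp: supp_iff)
  show ?thesis using ip_expand[OF U(1) _ U(2), of a b] ip_expand[OF U(1) _ U(2), of b a] by (simp add: mult.commute)
qed

lemma ip_self: "ip a a = of_real (\<Sum>S\<in>supp a. (cmod (coef S a))\<^sup>2)"
proof -
  have "cnj (coef S a) * coef S a = of_real ((cmod (coef S a))\<^sup>2)" for S by (metis complex_norm_square mult.commute)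
  thus ?thesis by (simp add: ip_def)
qed

lemma ip_self_nonneg: "Re (ip a a) \<ge> 0" by (simp add: ip_self sum_nonneg)

lemma ip_self_zero: assumes "Re (ip a a) = 0" "a \<in> C" shows "a = 0"
proof -
  have "\<forall>S\<in>supp a. (cmod (coef S a))\<^sup>2 = 0"
    using assms by (subst sum_nonneg_eq_0_iff[symmetric]) (auto simp: ip_self)
  hence "supp a = {}" by (auto simp: supp_iff)
  thus ?thesis using expand[OF assms(2)] by simp
qed

lemma ip_mon: assumes "set xs \<subseteq> P" shows "ip (mon xs) b = af xs b"
proof -
  let ?S = "snd (sort_word xs)"
  have S: "?S \<in> words" by (rule sort_word_words[OF assms])
  have "supp (mon ?S) = {?S}" using S by (auto simp: supp_iff coef_mon split: if_splits)
  hence "ip (mon ?S) b = coef ?S b" using S by (simp add: ip_def coef_mon)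
  thus ?thesis
    using mon_sort[OF assms] af_sort[OF assms, of b] af_coef[OF S, of b] by (metis ip_left(2) cnj_sort_word)
qed

lemma ip_cr: assumes "p \<in> P" shows "ip (cr p a) b = ip a (an p b)"
proof -
  have "ip (cr p (proj a)) b = ip (proj a) (an p b)" using proj_in[of a]
  proof (induction rule: C_induct)
    case (mon xs)
    have "ip (mon (p # xs)) b = af (p # xs) b" using assms words_P[OF mon] by (intro ip_mon) auto
    thus ?case using ip_mon[OF words_P[OF mon]] by simp
  qed (simp_all add: ip_left cr_linear)
  thus ?thesis by simp
qed

lemma ip_an: "p \<in> P \<Longrightarrow> ip (an p a) b = ip a (cr p b)"
  using ip_cr[of p b a] ip_sym[of "cr p b" a] ip_sym[of b "an p a"] by simp

end

text \<open>For a family rather than a set, so that a repetition already is a relation. Applied to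
  the iterates of an operator it yields an annihilating polynomial.\<close>

lemma (in vector_space) finite_span_relation:
  fixes x :: "nat \<Rightarrow> 'b" assumes "finite B" "\<And>i. x i \<in> span B"
  shows "\<exists>(c :: nat \<Rightarrow> 'a) m. (\<exists>i\<le>m. c i \<noteq> 0) \<and> (\<Sum>i\<le>m. c i *s x i) = 0"
proof (cases "inj x")
  case True
  have "card (x ` {..card B}) = Suc (card B)" using True by (subst card_image) (auto intro: inj_on_subset)
  hence "dependent (x ` {..card B})"
    using independent_span_bound[OF assms(1), of "x ` {..card B}"] assms(2) by fastforce
  then obtain u where u: "\<exists>v\<in>x ` {..card B}. u v \<noteq> 0" "(\<Sum>v\<in>x ` {..card B}. u v *s v) = 0"
    by (auto simp: dependent_finite)
  hence "(\<Sum>i\<le>card B. u (x i) *s x i) = 0" using True by (subst (asm) sum.reindex) (auto intro: inj_on_subset)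
  with u(1) show ?thesis by (intro exI[of _ "\<lambda>i. u (x i)"] exI[of _ "card B"]) auto
next
  case False
  then obtain i j where ij: "i < j" "x i = x j" by (metis injI linorder_neqE_nat)
  let ?c = "\<lambda>k. if k = i then 1 else if k = j then -1 else 0"
  have "(\<Sum>k\<le>j. ?c k *s x k) = (\<Sum>k\<in>{i, j}. ?c k *s x k)" using ij by (intro sum.mono_neutral_right) auto
  hence "(\<Sum>k\<le>j. ?c k *s x k) = 0" using ij by simp
  thus ?thesis using ij by (intro exI[of _ ?c] exI[of _ j]) auto
qed

context symplectic_fermion_algebra
begin

subsection \<open>The filtration by length and weight\<close>

definition F :: "int \<Rightarrow> int \<Rightarrow> 'v set" where
  "F d h = vs.span (mon ` {xs. set xs \<subseteq> P \<and> int (length xs) \<le> d \<and> wt_word xs \<le> h})"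

lemma F_subspace: "vs.subspace (F d h)" by (simp add: F_def)

lemmas F_zero [simp, intro] = vs.subspace_0[OF F_subspace]
lemmas F_add [intro] = vs.subspace_add[OF F_subspace]
lemmas F_scale [intro] = vs.subspace_scale[OF F_subspace]
lemmas F_diff [intro] = vs.subspace_diff[OF F_subspace]
lemmas F_neg [intro] = vs.subspace_neg[OF F_subspace]
lemmas F_sum [intro] = vs.subspace_sum[OF F_subspace]

lemma F_mon: "set xs \<subseteq> P \<Longrightarrow> int (length xs) \<le> d \<Longrightarrow> wt_word xs \<le> h \<Longrightarrow> mon xs \<in> F d h"
  unfolding F_def by (intro vs.span_base) auto

lemma F_mono: "d \<le> d' \<Longrightarrow> h \<le> h' \<Longrightarrow> F d h \<subseteq> F d' h'" unfolding F_def by (intro vs.span_mono) auto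

lemma F_subset_C: "F d h \<subseteq> C" unfolding F_def by (rule vs.span_minimal) (auto simp: subspace_carrier)

lemma F_in_C: "a \<in> F d h \<Longrightarrow> a \<in> C" using F_subset_C by auto

lemma F_induct [consumes 1, case_names mon zero add scale]: assumes "a \<in> F d h"
    and "\<And>xs. set xs \<subseteq> P \<Longrightarrow> int (length xs) \<le> d \<Longrightarrow> wt_word xs \<le> h \<Longrightarrow> Q (mon xs)" and "Q 0"
    and "\<And>a b. Q a \<Longrightarrow> Q b \<Longrightarrow> Q (a + b)" and "\<And>x a. Q a \<Longrightarrow> Q (x *s a)" shows "Q a" using assms(1)[unfolded F_def]
  by (rule vs.span_induct) (auto simp: vs.subspace_def assms intro!: assms)

lemma F_negative: assumes "d < 0 \<or> h < 0" shows "F d h = {0}"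
proof -
  have "{xs. set xs \<subseteq> P \<and> int (length xs) \<le> d \<and> wt_word xs \<le> h} = {}"
    using assms wt_word_nonneg by (auto, smt (verit) of_nat_0_le_iff)
  thus ?thesis unfolding F_def by (simp only: image_empty vs.span_empty)
qed

lemma F_exhaust: assumes "a \<in> C" shows "\<exists>d h. a \<in> F d h" using assms
proof (induction rule: C_induct)
  case (mon xs)
  thus ?case using F_mon[OF words_P[OF mon]] by blast
next
  case (add a b)
  then obtain d h d' h' where "a \<in> F d h" "b \<in> F d' h'" by blast
  hence "a \<in> F (max d d') (max h h')" "b \<in> F (max d d') (max h h')"
    using F_mono[of d "max d d'" h "max h h'"] F_mono[of d' "max d d'" h' "max h h'"] by auto
  thus ?case by blast
qed auto

lemma cr_F: assumes "p \<in> P" "a \<in> F d h" shows "cr p a \<in> F (d + 1) (h + int (snd p) + 1)" using assms(2)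
proof (induction rule: F_induct)
  case (mon xs)
  have "mon (p # xs) \<in> F (d + 1) (h + int (snd p) + 1)" using mon assms(1) by (intro F_mon) auto
  thus ?case by simp
qed (auto simp: cr_linear)

lemma an_mon_F: "p \<in> P \<Longrightarrow> set xs \<subseteq> P \<Longrightarrow>
    an p (mon xs) \<in> F (int (length xs) - 1) (wt_word xs - int (snd p) - 1)"
proof (induction xs)
  case Nil
  thus ?case using an_mon_zero[of p "[]"] by simp
next
  case (Cons q xs)
  have "cr q (an p (mon xs)) \<in> F (int (length xs) - 1 + 1) (wt_word xs - int (snd p) - 1 + int (snd q) + 1)"
    using Cons by (intro cr_F) auto
  moreover have "mon xs \<in> F (int (length xs)) (wt_word xs)" using Cons by (intro F_mon) auto
  ultimately show ?case using Cons by (auto simp: an_cr algebra_simps intro!: F_diff)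
qed

lemma an_F: assumes "p \<in> P" "a \<in> F d h" shows "an p a \<in> F (d - 1) (h - int (snd p) - 1)" using assms(2)
proof (induction rule: F_induct)
  case (mon xs)
  thus ?case
    using an_mon_F[OF assms(1), of xs] F_mono[of "int (length xs) - 1" "d - 1" "wt_word xs - int (snd p) - 1" "h - int (snd p) - 1"]
    by auto
qed (auto simp: an_linear)

lemma finite_F: "\<exists>B. finite B \<and> F d h \<subseteq> vs.span B"
proof -
  let ?L = "{..<2*n} \<times> {..<nat h}"
  let ?B = "mon ` {xs. set xs \<subseteq> ?L \<and> length xs \<le> nat d}"
  have L: "set xs \<subseteq> ?L" if "set xs \<subseteq> P" "wt_word xs \<le> h" for xs
  proof
    fix p assume "p \<in> set xs"
    hence "int (snd p) + 1 \<le> wt_word xs" using wt_word_nonneg by (induction xs) (auto, smt (verit) of_nat_0_le_iff)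
    thus "p \<in> ?L" using that \<open>p \<in> set xs\<close> by (cases p) auto
  qed
  have "F d h \<subseteq> vs.span ?B" unfolding F_def
  proof (rule vs.span_mono, rule image_mono, rule subsetI)
    fix xs assume "xs \<in> {xs. set xs \<subseteq> P \<and> int (length xs) \<le> d \<and> wt_word xs \<le> h}"
    thus "xs \<in> {xs. set xs \<subseteq> ?L \<and> length xs \<le> nat d}" using L[of xs] by auto
  qed
  moreover have "finite ?B" by (intro finite_imageI finite_lists_length_le) auto
  ultimately show ?thesis by blast
qed

lemma an_F_zero: assumes "p \<in> P" "a \<in> F d h" "h \<le> int (snd p)" shows "an p a = 0"
  using an_F[OF assms(1,2)] F_negative[of "d - 1" "h - int (snd p) - 1"] assms(3) by auto

text \<open>The coefficient at a word \<open>p # T\<close> is, by \<open>af_coef\<close>, a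
  functional of \<open>an p a\<close>.\<close>

lemma annihilated_is_vac: assumes "a \<in> C" "\<And>p. p \<in> P \<Longrightarrow> an p a = 0" shows "a = coef [] a *s vac V"
proof (rule coef_eqI)
  fix S assume S: "S \<in> words"
  have "coef S (vac V) = (if S = [] then 1 else 0)" using coef_mon[OF S Nil_words] by simp
  moreover have "coef S a = 0" if "S \<noteq> []"
  proof -
    from that obtain p T where "S = p # T" by (cases S) auto
    thus ?thesis using af_coef[OF S, of a] assms(2)[of p] words_P[OF S] by (simp add: af_linear)
  qed
  ultimately show "coef S a = coef S (coef [] a *s vac V)" by auto
qed (use assms in auto)

subsection \<open>Invariants of the symplectic Lie algebra\<close>

text \<open>The matrix units of \<open>gl(2n)\<close> acting on letters as derivations. The cutoff
  \<open>K\<close> makes the sum finite and does no harm on vectors of weight at most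
  \<open>K\<close>.\<close>

definition E :: "nat \<Rightarrow> nat \<Rightarrow> nat \<Rightarrow> 'v \<Rightarrow> 'v" where
  "E K I J a = (\<Sum>k<K. cr (I, k) (an (J, k) a))"

text \<open>Two letters contracted with the symplectic form, which makes the operator commute with
  the symplectic group. \<open>Qd\<close> is its adjoint.\<close>

definition Q :: "nat \<Rightarrow> nat \<Rightarrow> 'v \<Rightarrow> 'v" where
  "Q k l a = (\<Sum>I<2*n. sg I *s cr (I, k) (cr (dual I, l) a))"

definition Qd :: "nat \<Rightarrow> nat \<Rightarrow> 'v \<Rightarrow> 'v" where
  "Qd k l a = (\<Sum>I<2*n. sg I *s an (dual I, l) (an (I, k) a))"

definition QQ :: "nat \<Rightarrow> 'v \<Rightarrow> 'v" where
  "QQ K a = (\<Sum>k<K. \<Sum>l<K. Q k l (Qd k l a))"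

text \<open>The symplectic Lie algebra is spanned by the operators \<open>E K I J - (sg I * sg J) E K (dual J) (dual I)\<close>.\<close>

definition spinv :: "nat \<Rightarrow> 'v set" where
  "spinv K = {a \<in> C. \<forall>I<2*n. \<forall>J<2*n. E K I J a = (sg I * sg J) *s E K (dual J) (dual I) a}"

lemma hom_sum: "finite A \<Longrightarrow> (\<And>i. i \<in> A \<Longrightarrow> lin (h i)) \<Longrightarrow>
    lin (\<lambda>a. \<Sum>i\<in>A. h i a)" by (auto simp: module_hom_def' sum.distrib vs.scale_sum_right)

lemma hom_scale: "lin h \<Longrightarrow> lin (\<lambda>a. x *s h a)" by (auto simp: module_hom_def' vs.scale_right_distrib mult.commute)

lemma hom_comp: "lin g \<Longrightarrow> lin h \<Longrightarrow>
    lin (\<lambda>a. g (h a))" by (auto simp: module_hom_def')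

lemma E_hom: "lin (E K I J)" unfolding E_def[abs_def] by (intro hom_sum finite_lessThan hom_comp[OF cr_hom an_hom])
lemma Q_hom: "lin (Q k l)"
  unfolding Q_def[abs_def] by (intro hom_sum finite_lessThan hom_scale hom_comp[OF cr_hom cr_hom])
lemma Qd_hom: "lin (Qd k l)"
  unfolding Qd_def[abs_def] by (intro hom_sum finite_lessThan hom_scale hom_comp[OF an_hom an_hom])
lemma QQ_hom: "lin (QQ K)" unfolding QQ_def[abs_def] by (intro hom_sum finite_lessThan hom_comp[OF Q_hom Qd_hom])

lemmas E_linear = hom_rules[OF E_hom]
lemmas Q_linear = hom_rules[OF Q_hom]
lemmas Qd_linear = hom_rules[OF Qd_hom]
lemmas QQ_linear = hom_rules[OF QQ_hom]

lemma Q_in [simp, intro]: "Q k l a \<in> C" and Qd_in [simp, intro]: "Qd k l a \<in> C"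
  and E_in [simp, intro]: "E K I J a \<in> C" and QQ_in [simp, intro]: "QQ K a \<in> C"
  by (auto simp: Q_def Qd_def E_def QQ_def intro!: C_sum C_scale)

lemma spinv_subspace: "vs.subspace (spinv K)"
  by (auto simp: vs.subspace_def spinv_def E_linear vs.scale_right_distrib mult_ac intro: C_add C_scale)

lemmas spinv_sum = vs.subspace_sum[OF spinv_subspace]

lemma E_cr: assumes "I < 2*n" "J < 2*n" "A < 2*n" "k < K"
  shows "E K I J (cr (A, k) a) = (if J = A then cr (I, k) a else 0) + cr (A, k) (E K I J a)"
proof -
  have "cr (I, l) (an (J, l) (cr (A, k) a)) =
      (if l = k then if J = A then cr (I, k) a else 0 else 0) + cr (A, k) (cr (I, l) (an (J, l) a))" for l
    using assms cr_cr[of "(I, l)" "(A, k)" "an (J, l) a"] by (auto simp: an_cr cr_linear)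
  thus ?thesis using assms(4) by (simp add: E_def sum.distrib cr_linear)
qed

lemma E_an: assumes "I < 2*n" "J < 2*n" "A < 2*n" "k < K"
  shows "E K I J (an (A, k) a) = an (A, k) (E K I J a) - (if I = A then an (J, k) a else 0)"
proof -
  have "an (A, k) (cr (I, l) (an (J, l) a)) = cr (I, l) (an (J, l) (an (A, k) a))
     + (if l = k then if I = A then an (J, k) a else 0 else 0)" for l
    using assms an_an[of "(A, k)" "(J, l)" a] by (auto simp: an_cr cr_linear)
  thus ?thesis using assms(4) by (simp add: E_def sum.distrib an_linear)
qed

lemma sum_delta_dual: assumes "J < 2*n"
  shows "(\<Sum>A<2*n. sg A *s (if J = dual A then h A else 0)) = - sg J *s h (dual J)"
proof -
  have "(\<Sum>A<2*n. sg A *s (if J = dual A then h A else 0)) = (\<Sum>A<2*n. if A = dual J then sg A *s h A else 0)"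
    by (rule sum.cong) (use assms in auto)
  thus ?thesis using assms by (simp add: sg_dual)
qed

lemma sum_delta_sg: assumes "J < 2*n" shows "(\<Sum>A<2*n. sg A *s (if J = A then h A else 0)) = sg J *s h J"
proof -
  have "(\<Sum>A<2*n. sg A *s (if J = A then h A else 0)) = (\<Sum>A<2*n. if A = J then sg A *s h A else 0)"
    by (rule sum.cong) auto
  thus ?thesis using assms by simp
qed

lemma E_Q: assumes "I < 2*n" "J < 2*n" "k < K" "l < K"
  shows "E K I J (Q k l a) = sg J *s cr (I, k) (cr (dual J, l) a)
     - sg J *s cr (dual J, k) (cr (I, l) a) + Q k l (E K I J a)"
proof -
  have "E K I J (Q k l a) = (\<Sum>A<2*n. sg A *s (if J = A then cr (I, k) (cr (dual A, l) a) else 0))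
    + (\<Sum>A<2*n. sg A *s (if J = dual A then cr (A, k) (cr (I, l) a) else 0)) + Q k l (E K I J a)"
    unfolding Q_def E_linear sum.distrib[symmetric] vs.scale_right_distrib[symmetric]
    by (rule sum.cong) (use assms in \<open>auto simp: E_cr cr_linear add_ac\<close>)
  thus ?thesis unfolding sum_delta_dual[OF assms(2)] sum_delta_sg[OF assms(2)] by simp
qed

lemma E_Qd: assumes "I < 2*n" "J < 2*n" "k < K" "l < K"
  shows "E K I J (Qd k l a) = Qd k l (E K I J a) + sg I *s an (J, l) (an (dual I, k) a)
     - sg I *s an (dual I, l) (an (J, k) a)"
proof -
  have "E K I J (Qd k l a) = Qd k l (E K I J a)
     - (\<Sum>A<2*n. sg A *s (if I = dual A then an (J, l) (an (A, k) a) else 0))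
     - (\<Sum>A<2*n. sg A *s (if I = A then an (dual A, l) (an (J, k) a) else 0))"
    unfolding Qd_def E_linear sum_subtractf[symmetric] vs.scale_right_diff_distrib[symmetric]
    by (rule sum.cong) (use assms in \<open>auto simp: E_an an_linear\<close>)
  thus ?thesis
    by (simp only: sum_delta_dual[OF assms(1)] sum_delta_sg[OF assms(1)] vs.scale_minus_left diff_minus_eq_add)
qed

text \<open>The two terms by which \<open>E K I J\<close> fails to commute with \<open>Q k l\<close>
  obey the same mirror relation under \<open>(I, J) \<mapsto> (dual J, dual I)\<close> as the one
  defining \<open>spinv\<close>.\<close>

lemma Q_inv: assumes "a \<in> spinv K" "k < K" "l < K" shows "Q k l a \<in> spinv K"
proof -
  have "E K I J (Q k l a) = (sg I * sg J) *s E K (dual J) (dual I) (Q k l a)" if IJ: "I < 2*n" "J < 2*n" for I J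
  proof -
    have "E K I J a = (sg I * sg J) *s E K (dual J) (dual I) a" using assms that unfolding spinv_def by blast
    hence e: "Q k l (E K I J a) = (sg I * sg J) *s Q k l (E K (dual J) (dual I) a)" by (simp only: Q_linear)
    have m: "sg I * sg J * sg I = sg J" by (auto simp: sg_def)
    show ?thesis
      unfolding E_Q[OF IJ assms(2,3)] E_Q[OF dual_simps(1)[OF IJ(2)] dual_simps(1)[OF IJ(1)] assms(2,3)] e
      by (simp add: dual_simps(2) IJ sg_dual vs.scale_right_distrib vs.scale_right_diff_distrib m)
  qed
  thus ?thesis unfolding spinv_def by blast
qed

lemma Qd_inv: assumes "a \<in> spinv K" "k < K" "l < K" shows "Qd k l a \<in> spinv K"
proof -
  have "E K I J (Qd k l a) = (sg I * sg J) *s E K (dual J) (dual I) (Qd k l a)" if IJ: "I < 2*n" "J < 2*n" for I J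
  proof -
    have "E K I J a = (sg I * sg J) *s E K (dual J) (dual I) a" using assms that unfolding spinv_def by blast
    hence e: "Qd k l (E K I J a) = (sg I * sg J) *s Qd k l (E K (dual J) (dual I) a)" by (simp only: Qd_linear)
    have m: "sg I * sg J * sg J = sg I" by (auto simp: sg_def)
    show ?thesis
      unfolding E_Qd[OF IJ assms(2,3)] E_Qd[OF dual_simps(1)[OF IJ(2)] dual_simps(1)[OF IJ(1)] assms(2,3)] e
      by (simp add: dual_simps(2) IJ sg_dual vs.scale_right_distrib vs.scale_right_diff_distrib m)
  qed
  thus ?thesis unfolding spinv_def by blast
qed

text \<open>Howe duality between the Casimir operators, restricted to the invariants of one side.\<close>

lemma casimir: assumes "a \<in> spinv K"
  shows "QQ K a = (\<Sum>I<2*n. \<Sum>J<2*n. E K J I (E K I J a)) + (\<Sum>J<2*n. \<Sum>k<K. cr (J, k) (an (J, k) a))"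
proof -
  let ?c = "\<lambda>I J k l. (sg I * sg J) *s cr (J, k) (cr (dual J, l) (an (I, k) (an (dual I, l) a)))"
  let ?d = "\<lambda>I J k l. (sg I * sg J) *s (if k = l \<and> I = dual J then cr (J, k) (an (dual I, l) a) else 0)"
  let ?b = "\<lambda>I J k l. (sg I * sg J) *s ((if k = l \<and> I = dual J then cr (J, k) (an (dual I, l) a) else 0)
    - cr (J, k) (cr (dual J, l) (an (I, k) (an (dual I, l) a))))"
  have "E K J I (E K I J a) = (\<Sum>k<K. \<Sum>l<K. ?b I J k l)" if "I < 2*n" "J < 2*n" for I J
  proof -
    \<comment> \<open>Invariance replaces the inner operator by its mirror image. Then the two
      creators and the two annihilators are each paired by \<open>dual\<close>, as in
      \<open>Q\<close> and \<open>Qd\<close>.\<close>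
    have "E K I J a = (sg I * sg J) *s E K (dual J) (dual I) a" using assms that unfolding spinv_def by blast
    hence "E K J I (E K I J a) = (\<Sum>l<K. (sg I * sg J) *s E K J I (cr (dual J, l) (an (dual I, l) a)))"
      by (simp only: E_linear E_def[of K "dual J"] vs.scale_sum_right)
    also have "\<dots> = (\<Sum>l<K. \<Sum>k<K. ?b I J k l)" unfolding E_def vs.scale_sum_right
      by (intro sum.cong) (use that in \<open>auto simp: an_cr cr_linear\<close>)
    finally show ?thesis by (subst sum.swap)
  qed
  hence "(\<Sum>I<2*n. \<Sum>J<2*n. E K J I (E K I J a)) =
      (\<Sum>J<2*n. \<Sum>I<2*n. \<Sum>k<K. \<Sum>l<K. ?d I J k l)
      - (\<Sum>I<2*n. \<Sum>J<2*n. \<Sum>k<K. \<Sum>l<K. ?c I J k l)"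
    by (subst (3) sum.swap) (simp add: sum_subtractf vs.scale_right_diff_distrib)
  also have "(\<Sum>J<2*n. \<Sum>I<2*n. \<Sum>k<K. \<Sum>l<K. ?d I J k l) =
      (\<Sum>J<2*n. \<Sum>k<K. - cr (J, k) (an (J, k) a))"
  proof (rule sum.cong)
    fix J assume J: "J \<in> {..<2*n}"
    have delta: "(\<Sum>l<K. x *s (if k = l then h l else 0)) = x *s h k" if "k < K" for k x and h :: "nat \<Rightarrow> 'v"
      using that by (simp add: if_distrib[of "\<lambda>y. x *s y"] cong: if_cong)
    have "(\<Sum>I<2*n. \<Sum>k<K. \<Sum>l<K. ?d I J k l) =
      (\<Sum>I<2*n. if I = dual J then (\<Sum>k<K. (sg I * sg J) *s cr (J, k) (an (dual I, k) a)) else 0)"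
      by (intro sum.cong refl) (auto simp: delta intro!: sum.cong)
    thus "(\<Sum>I<2*n. \<Sum>k<K. \<Sum>l<K. ?d I J k l) = (\<Sum>k<K. - cr (J, k) (an (J, k) a))" using J by (simp add: sg_dual)
  qed simp
  also have "(\<Sum>I<2*n. \<Sum>J<2*n. \<Sum>k<K. \<Sum>l<K. ?c I J k l)
     = - QQ K a"
  proof -
    have "QQ K a = (\<Sum>k<K. \<Sum>l<K. \<Sum>J<2*n. \<Sum>I<2*n. (sg I * sg J) *s cr (J, k) (cr (dual J, l) (an (dual I, l) (an (I, k) a))))"
      unfolding QQ_def Q_def Qd_def by (simp add: cr_linear vs.scale_sum_right mult.commute)
    also have "\<dots> = (\<Sum>k<K. \<Sum>l<K. \<Sum>J<2*n. \<Sum>I<2*n. - (?c I J k l))"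
    proof (intro sum.cong refl)
      fix k l I J assume "I \<in> {..<2*n}"
      hence "an (dual I, l) (an (I, k) a) = - an (I, k) (an (dual I, l) a)" by (intro an_an) auto
      thus "(sg I * sg J) *s cr (J, k) (cr (dual J, l) (an (dual I, l) (an (I, k) a)))
        = - (?c I J k l)" by (simp add: cr_linear)
    qed
    also have "\<dots> = - (\<Sum>I<2*n. \<Sum>J<2*n. \<Sum>k<K. \<Sum>l<K. ?c I J k l)" unfolding sum_negf
      by (subst sum.swap[of _ "{..<2*n}" "{..<2*n}"], subst (2) sum.swap, subst (3) sum.swap, subst sum.swap, subst (2) sum.swap) simp
    finally show ?thesis by simp
  qed
  finally show ?thesis by (simp add: sum_negf)
qed

lemma ip_Q: "ip (Q k l a) b = ip a (Qd k l b)"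
proof -
  have "ip (cr (I, k) (cr (dual I, l) a)) b = ip a (an (dual I, l) (an (I, k) b))" if "I < 2*n" for I
    using that by (simp add: ip_cr)
  thus ?thesis by (simp add: Q_def Qd_def ip_sum ip_left ip_right)
qed

lemma ip_Qd: "ip (Qd k l a) b = ip a (Q k l b)"
  using ip_Q[of k l b a] ip_sym[of "Q k l b" a] ip_sym[of b "Qd k l a"] by simp

lemma ip_QQ: "ip (QQ K a) b = ip a (QQ K b)" by (simp add: QQ_def ip_sum ip_Q ip_Qd)

lemma ip_E: "I < 2*n \<Longrightarrow> J < 2*n \<Longrightarrow> ip a (E K J I b) = ip (E K I J a) b" by (simp add: E_def ip_sum ip_cr ip_an)

text \<open>Pairing \<open>casimir\<close> with \<open>a\<close> gives a sum of squared norms, since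
  \<open>E K J I\<close> is adjoint to \<open>E K I J\<close>. So \<open>an p a\<close> is zero for
  \<open>snd p < K\<close>, and for weight reasons also beyond the cutoff.\<close>

lemma QQ_kernel: assumes "a \<in> spinv K" "a \<in> F d h" "h \<le> int K" "QQ K a = 0" shows "a = coef [] a *s vac V"
proof (rule annihilated_is_vac)
  show aC: "a \<in> C" using assms F_in_C by blast
  have "ip a (QQ K a) = (\<Sum>I<2*n. \<Sum>J<2*n. ip (E K I J a) (E K I J a))
      + (\<Sum>J<2*n. \<Sum>k<K. ip (an (J, k) a) (an (J, k) a))"
    unfolding casimir[OF assms(1)] ip_right ip_sum by (auto simp: ip_E ip_an intro!: sum.cong)
  from arg_cong[OF this, of Re]
  have "Re (\<Sum>I<2*n. \<Sum>J<2*n. ip (E K I J a) (E K I J a))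
      + (\<Sum>J<2*n. \<Sum>k<K. Re (ip (an (J, k) a) (an (J, k) a))) = 0" by (simp add: assms(4))
  moreover have "Re (\<Sum>I<2*n. \<Sum>J<2*n. ip (E K I J a) (E K I J a)) \<ge> 0" by (simp add: sum_nonneg ip_self_nonneg)
  ultimately have "(\<Sum>J<2*n. \<Sum>k<K. Re (ip (an (J, k) a) (an (J, k) a))) \<le> 0" by linarith
  hence *: "(\<Sum>J<2*n. \<Sum>k<K. Re (ip (an (J, k) a) (an (J, k) a))) = 0" by (intro antisym sum_nonneg ip_self_nonneg)
  fix p assume p: "p \<in> P"
  obtain J l where Jl: "p = (J, l)" by (cases p)
  show "an p a = 0"
  proof (cases "l < K")
    case True
    have "(\<Sum>k<K. Re (ip (an (J, k) a) (an (J, k) a))) = 0"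
      using * p Jl by (subst (asm) sum_nonneg_eq_0_iff) (auto intro: sum_nonneg simp: ip_self_nonneg)
    hence "Re (ip (an (J, l) a) (an (J, l) a)) = 0"
      using True by (subst (asm) sum_nonneg_eq_0_iff) (auto simp: ip_self_nonneg)
    thus ?thesis using ip_self_zero[of "an p a"] by (simp add: Jl)
  next
    case False
    thus ?thesis using an_F_zero[OF p assms(2)] assms(3) Jl by auto
  qed
qed

lemma Qd_F: assumes "a \<in> F d h" shows "Qd k l a \<in> F (d - 2) (h - int k - int l - 2)"
proof -
  have "an (dual I, l) (an (I, k) a) \<in> F (d - 1 - 1) (h - int k - 1 - int l - 1)" if "I < 2*n" for I
    using an_F[of "(dual I, l)" "an (I, k) a" "d - 1" "h - int k - 1"] an_F[of "(I, k)" a d h] that assms by simp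
  moreover have "d - 1 - 1 = d - 2" "h - int k - 1 - int l - 1 = h - int k - int l - 2" by auto
  ultimately show ?thesis unfolding Qd_def by (auto intro!: F_sum F_scale)
qed

lemma Q_F: assumes "a \<in> F d h" shows "Q k l a \<in> F (d + 2) (h + int k + int l + 2)"
proof -
  have "cr (I, k) (cr (dual I, l) a) \<in> F (d + 1 + 1) (h + int l + 1 + int k + 1)" if "I < 2*n" for I
    using cr_F[of "(I, k)" "cr (dual I, l) a" "d + 1" "h + int l + 1"] cr_F[of "(dual I, l)" a d h] that assms by simp
  moreover have "d + 1 + 1 = d + 2" "h + int l + 1 + int k + 1 = h + int k + int l + 2" by auto
  ultimately show ?thesis unfolding Q_def by (auto intro!: F_sum F_scale)
qed

lemma QQ_F: assumes "a \<in> F d h" shows "QQ K a \<in> F d h"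
proof -
  have "Q k l (Qd k l a) \<in> F d h" for k l using Q_F[OF Qd_F[OF assms, of k l], of k l] by simp
  thus ?thesis unfolding QQ_def by (intro F_sum)
qed

lemma QQ_spinv: "a \<in> spinv K \<Longrightarrow> QQ K a \<in> spinv K" unfolding QQ_def by (auto intro!: spinv_sum Q_inv Qd_inv)

text \<open>As \<open>QQ K\<close> is Hermitian and preserves a finite-dimensional space containing \<open>a\<close>, \<open>a\<close> is the
  sum of an element of its kernel and an element of its range.\<close>

lemma spinv_decompose: assumes "a \<in> spinv K" "a \<in> F d h" "h \<le> int K"
  shows "\<exists>z b. b \<in> spinv K \<and> b \<in> F d h \<and> a = z *s vac V + QQ K b"
proof -
  define U where "U = spinv K \<inter> F d h"
  have U: "vs.subspace U" unfolding U_def by (intro vs.subspace_inter spinv_subspace F_subspace)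
  have QU: "QQ K b \<in> U" if "b \<in> U" for b using that QQ_F QQ_spinv by (auto simp: U_def)
  have aU: "a \<in> U" using assms by (simp add: U_def)
  define x where "x i = (QQ K ^^ i) a" for i
  have xU: "x i \<in> U" for i by (induction i) (auto simp: x_def aU QU)
  obtain B where "finite B" "F d h \<subseteq> vs.span B" using finite_F by blast
  hence "\<And>i. x i \<in> vs.span B" using xU unfolding U_def by blast
  from vs.finite_span_relation[of B x, OF \<open>finite B\<close> this]
  obtain c m where c: "\<exists>i\<le>m. c i \<noteq> 0" "(\<Sum>i\<le>m. c i *s x i) = 0" by blast
  \<comment> \<open>Split the lowest power off the relation among the iterates: with
    \<open>y = c i0 *s a + QQ K b\<close> it reads \<open>(QQ K ^^ i0) y = 0\<close>, and for a
    Hermitian operator this implies \<open>QQ K y = 0\<close>.\<close>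
  define i0 where "i0 = (LEAST i. c i \<noteq> 0)"
  have i0: "c i0 \<noteq> 0" "i0 \<le> m" "\<And>i. i < i0 \<Longrightarrow> c i = 0"
  proof -
    obtain i where i: "i \<le> m" "c i \<noteq> 0" using c(1) by blast
    show "c i0 \<noteq> 0" unfolding i0_def by (rule LeastI[of "\<lambda>i. c i \<noteq> 0", OF i(2)])
    show "i0 \<le> m" unfolding i0_def using Least_le[of "\<lambda>i. c i \<noteq> 0", OF i(2)] i(1) by simp
    show "c i = 0" if "i < i0" for i using not_less_Least[OF that[unfolded i0_def]] by simp
  qed
  define b where "b = (\<Sum>i\<in>{i0<..m}. c i *s x (i - Suc i0))"
  define y where "y = c i0 *s a + QQ K b"
  have bU: "b \<in> U" unfolding b_def by (intro vs.subspace_sum[OF U] vs.subspace_scale[OF U] xU)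
  have yU: "y \<in> U" unfolding y_def by (intro vs.subspace_add[OF U] vs.subspace_scale[OF U] aU QU bU)
  have pow_hom: "lin (QQ K ^^ i)" for i
  proof (induction i)
    case (Suc i)
    thus ?case by (auto simp: module_hom_def' QQ_linear)
  qed (simp add: module_hom_def')
  have "y = (\<Sum>i\<in>{i0..m}. c i *s x (i - i0))"
  proof -
    have "QQ K b = (\<Sum>i\<in>{i0<..m}. c i *s x (i - i0))" unfolding b_def QQ_linear
    proof (intro sum.cong refl)
      fix i assume "i \<in> {i0<..m}"
      hence "i - i0 = Suc (i - Suc i0)" by auto
      thus "c i *s QQ K (x (i - Suc i0)) = c i *s x (i - i0)" by (simp add: x_def)
    qed
    moreover have "{i0..m} = insert i0 {i0<..m}" using i0 by auto
    ultimately show ?thesis by (simp add: y_def x_def)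
  qed
  hence "(QQ K ^^ i0) y = (\<Sum>i\<in>{i0..m}. c i *s (QQ K ^^ i0) (x (i - i0)))"
    by (simp only: module_hom.sum[OF pow_hom] module_hom.scale[OF pow_hom])
  also have "\<dots> = (\<Sum>i\<in>{i0..m}. c i *s x i)"
  proof (intro sum.cong refl)
    fix i assume "i \<in> {i0..m}"
    hence "x i = (QQ K ^^ i0) (x (i - i0))"
      unfolding x_def by (metis atLeastAtMost_iff comp_apply funpow_add le_add_diff_inverse)
    thus "c i *s (QQ K ^^ i0) (x (i - i0)) = c i *s x i" by simp
  qed
  also have "\<dots> = (\<Sum>i\<le>m. c i *s x i)" by (rule sum.mono_neutral_left) (auto simp: i0(3))
  finally have ker: "(QQ K ^^ i0) y = 0" using c(2) by simp
  have "QQ K y = 0" using ker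
  proof (induction i0)
    case 0
    thus ?case by (simp add: QQ_linear)
  next
    case (Suc i)
    show ?case
    proof (cases i)
      case 0
      thus ?thesis using Suc by simp
    next
      case (Suc i')
      let ?z = "(QQ K ^^ i') y"
      have "QQ K (QQ K ?z) = 0" using Suc.prems Suc by simp
      hence "ip (QQ K ?z) (QQ K ?z) = 0" by (simp add: ip_QQ)
      hence "QQ K ?z = 0" using ip_self_zero[of "QQ K ?z"] by simp
      thus ?thesis using Suc.IH Suc by simp
    qed
  qed
  hence "y = coef [] y *s vac V" using QQ_kernel[of y K d h] yU assms(3) by (simp add: U_def)
  hence "a = (coef [] y / c i0) *s vac V + QQ K ((- 1 / c i0) *s b)"
  proof -
    have "(1 / c i0) *s y = a + (1 / c i0) *s QQ K b" using i0(1) by (simp add: y_def vs.scale_right_distrib)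
    moreover have "(1 / c i0) *s y = (coef [] y / c i0) *s vac V"
      using \<open>y = coef [] y *s vac V\<close> by (metis vs.scale_scale mult.commute times_divide_eq_right mult.right_neutral)
    ultimately show ?thesis by (simp add: QQ_linear eq_diff_eq[symmetric])
  qed
  moreover have "(- 1 / c i0) *s b \<in> U" using bU by (rule vs.subspace_scale[OF U])
  ultimately show ?thesis by (auto simp: U_def)
qed

subsection \<open>The action of the symplectic group\<close>

lemma G_large: assumes "a \<in> F d h" "I < 2*n" "j \<ge> nat h + 1" shows "Y (G I) (int j) a = 0"
proof -
  obtain k where k: "j = Suc k" using assms(3) by (cases j) auto
  have "an (dual I, k) a = 0" using assms by (intro an_F_zero[OF _ assms(1)]) (auto simp: k)
  moreover have "int j = int k + 1" by (simp add: k)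
  ultimately show ?thesis using assms(2) by (simp add: an_def del: of_nat_Suc)
qed

lemma mon_sector: "set xs \<subseteq> P \<Longrightarrow> mon xs \<in> sector V (length xs mod 2)"
proof (induction xs)
  case Nil
  thus ?case by (simp add: vac_even)
next
  case (Cons p xs)
  hence "mode V (G (fst p)) (- int (snd p) - 1) (mon xs) \<in> sector V ((1 + length xs mod 2) mod 2)"
    by (intro mode_sector G_sector) auto
  moreover have "cr p (mon xs) = mode V (G (fst p)) (- int (snd p) - 1) (mon xs)"
    using Cons.prems by (simp add: cr_def[of p] Y_mode)
  ultimately have "cr p (mon xs) \<in> sector V ((1 + length xs mod 2) mod 2)" by simp
  thus ?case by (simp add: mod_simps)
qed

lemma coef_combination: assumes "finite U" "U \<subseteq> words" "S \<in> words"
  shows "coef S (\<Sum>T\<in>U. x T *s mon T) = (if S \<in> U then x S else 0)"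
proof -
  have "coef S (\<Sum>T\<in>U. x T *s mon T) = (\<Sum>T\<in>U. if T = S then x T else 0)"
    unfolding coef_linear using assms by (intro sum.cong) (auto simp: coef_mon)
  thus ?thesis using assms(1) by simp
qed

text \<open>Split \<open>a\<close> into its even and its odd words. The part of the wrong parity is
  also the difference of two elements of the sector \<open>p\<close>, so it lies in both sectors and
  is zero.\<close>

lemma sector_supp: assumes "p < 2" "a \<in> sector V p" "S \<in> supp a" shows "length S mod 2 = p"
proof (rule ccontr)
  assume np: "length S mod 2 \<noteq> p"
  have aC: "a \<in> C" using sector_subset[OF assms(1)] assms(2) by auto
  define A where "A q = (\<Sum>T\<in>{T \<in> supp a. length T mod 2 = q}. coef T a *s mon T)" for q
  have A: "A q \<in> sector V q" if "q < 2" for q unfolding A_def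
    by (intro vs.subspace_sum[OF subspace_sector[OF that]] vs.subspace_scale[OF subspace_sector[OF that]])
      (use mon_sector words_P in \<open>auto simp: supp_iff\<close>)
  have "a = (\<Sum>T\<in>supp a. coef T a *s mon T)" by (rule expand[OF aC])
  also have "\<dots> = A 0 + A 1"
  proof -
    have "supp a \<inter> {T. length T mod 2 = 0} = {T \<in> supp a. length T mod 2 = 0}"
      "supp a - {T. length T mod 2 = 0} = {T \<in> supp a. length T mod 2 = 1}" by auto
    thus ?thesis unfolding A_def by (subst sum.Int_Diff[of _ _ "{T. length T mod 2 = 0}"]) simp_all
  qed
  finally have a: "a = A 0 + A 1" .
  have "A (1 - p) = 0"
  proof (cases "p = 0")
    case True
    hence "A 1 \<in> sector V 0" using vs.subspace_diff[OF subspace_sector[of 0], of a "A 0"] A[of 0] assms(2) a by simp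
    thus ?thesis using A[of 1] sector_disjoint True by auto
  next
    case False
    hence p: "p = 1" using assms(1) by simp
    hence "A 0 \<in> sector V 1" using vs.subspace_diff[OF subspace_sector[of 1], of a "A 1"] A[of 1] assms(2) a by simp
    thus ?thesis using A[of 0] sector_disjoint p by auto
  qed
  moreover have "length S mod 2 = 1 - p" using np assms(1) by auto
  hence "coef S (A (1 - p)) = coef S a" unfolding A_def using assms(3) finite_subset[OF _ finite_supp[of a]]
    by (subst coef_combination) (auto simp: supp_iff subset_iff)
  ultimately show False using assms(3) by (simp add: supp_iff)
qed

definition tw :: "(nat \<Rightarrow> nat \<Rightarrow> complex) \<Rightarrow> nat \<Rightarrow> int \<Rightarrow> 'v \<Rightarrow> 'v" where
  "tw g I m b = (\<Sum>J<2*n. g J I *s Y (G J) m b)"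

abbreviation crt :: "(nat \<Rightarrow> nat \<Rightarrow> complex) \<Rightarrow> nat \<times> nat \<Rightarrow> 'v \<Rightarrow> 'v" where
  "crt g p \<equiv> tw g (fst p) (- int (snd p) - 1)"

definition sympl :: "(nat \<Rightarrow> nat \<Rightarrow> complex) \<Rightarrow> bool" where
  "sympl g \<longleftrightarrow> (\<forall>J<2*n. \<forall>L<2*n. (\<Sum>I<2*n. \<Sum>K<2*n. g I J * om I K * g K L) = om J L)"

text \<open>Substitution of the transformed generators in ordered monomials. For symplectic
  \<open>g\<close> this is the automorphism by which \<open>g\<close> acts; its uniqueness on the
  carrier is \<open>acts_by_gact\<close>.\<close>

definition gact :: "(nat \<Rightarrow> nat \<Rightarrow> complex) \<Rightarrow> 'v \<Rightarrow> 'v" where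
  "gact g a = (\<Sum>S\<in>supp a. coef S a *s foldr (crt g) S (vac V))"

lemma tw_hom: "lin (tw g I m)" unfolding tw_def[abs_def] by (intro hom_sum finite_lessThan hom_scale Y_right)

lemmas tw_linear = hom_rules[OF tw_hom]

lemma tw_in [simp, intro]: "tw g I m b \<in> C" unfolding tw_def by (intro C_sum C_scale Y_in)

text \<open>The central terms add up to the form transported by \<open>g\<close>, which is
  \<open>om\<close> again: the transformed generators satisfy the original relations.\<close>

lemma tw_anticommute: assumes "sympl g" "I < 2*n" "J < 2*n" shows "tw g I m (tw g J k c) = - tw g J k (tw g I m c)
     + (if m + k = 0 then (of_int m * om I J) *s proj c else 0)"
proof -
  have "tw g I m (tw g J k c) = (\<Sum>A<2*n. \<Sum>B<2*n. (g A I * g B J) *s Y (G A) m (Y (G B) k c))"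
    by (simp add: tw_def Y_linear vs.scale_sum_right)
  also have "\<dots> = (\<Sum>A<2*n. \<Sum>B<2*n. - ((g A I * g B J) *s Y (G B) k (Y (G A) m c))
      + (if m + k = 0 then (g A I * om A B * g B J * of_int m) *s proj c else 0))" by (intro sum.cong refl)
      (auto simp: G_anticommute[of _ _ m k] vs.scale_right_distrib vs.scale_right_diff_distrib algebra_simps)
  also have "\<dots> = - (\<Sum>A<2*n. \<Sum>B<2*n. (g A I * g B J) *s Y (G B) k (Y (G A) m c))
      + (if m + k = 0 then ((\<Sum>A<2*n. \<Sum>B<2*n. g A I * om A B * g B J) * of_int m) *s proj c else 0)"
    by (auto simp: sum.distrib sum_negf sum_subtractf vs.scale_sum_left sum_distrib_right)
  also have "(\<Sum>A<2*n. \<Sum>B<2*n. (g A I * g B J) *s Y (G B) k (Y (G A) m c)) = tw g J k (tw g I m c)"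
    by (subst sum.swap) (simp add: tw_def Y_linear vs.scale_sum_right mult.commute)
  also have "(\<Sum>A<2*n. \<Sum>B<2*n. g A I * om A B * g B J) = om I J" using assms by (simp add: sympl_def)
  finally show ?thesis by (simp add: mult.commute)
qed

lemma tw_regular: "m \<ge> 0 \<Longrightarrow> tw g I m (vac V) = 0" by (simp add: tw_def Y_creation_regular)

lemma gact_expand: assumes "finite U" "supp a \<subseteq> U" "U \<subseteq> words"
  shows "gact g a = (\<Sum>S\<in>U. coef S a *s foldr (crt g) S (vac V))"
  unfolding gact_def by (rule sum.mono_neutral_left) (use assms in \<open>auto simp: supp_iff\<close>)

lemma gact_hom: "lin (gact g)"
proof -
  have "gact g (a + b) = gact g a + gact g b" for a b
  proof -
    let ?U = "supp a \<union> supp b"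
    have U: "finite ?U" "?U \<subseteq> words" "supp (a + b) \<subseteq> ?U" by (auto simp: supp_iff)
    show ?thesis using gact_expand[OF U(1,3,2)] gact_expand[OF U(1) _ U(2), of a] gact_expand[OF U(1) _ U(2), of b]
      by (simp add: vs.scale_left_distrib sum.distrib)
  qed
  moreover have "gact g (x *s a) = x *s gact g a" for x a
  proof -
    have "supp (x *s a) \<subseteq> supp a" "supp a \<subseteq> words" by (auto simp: supp_iff)
    thus ?thesis using gact_expand[of "supp a" "x *s a" g] by (simp add: gact_def vs.scale_sum_right)
  qed
  ultimately show ?thesis by (simp add: module_hom_def')
qed

lemmas gact_linear = hom_rules[OF gact_hom]

lemma foldr_tw_in [simp, intro]: "foldr (crt g) xs (vac V) \<in> C" by (cases xs) auto

lemma gact_in [simp, intro]: "gact g a \<in> C" unfolding gact_def by (intro C_sum C_scale foldr_tw_in)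

lemma gact_proj [simp]: "gact g (proj a) = gact g a" by (simp add: gact_def supp_def)

lemma gact_mon: assumes "sympl g" "set xs \<subseteq> P" shows "gact g (mon xs) = foldr (crt g) xs (vac V)"
proof -
  let ?S = "snd (sort_word xs)"
  have S: "?S \<in> words" by (rule sort_word_words[OF assms(2)])
  have "supp (mon ?S) = {?S}" using S by (auto simp: supp_iff coef_mon split: if_splits)
  hence "gact g (mon ?S) = foldr (crt g) ?S (vac V)" using S by (simp add: gact_def coef_mon)
  moreover have "foldr (crt g) xs (vac V) = fst (sort_word xs) *s foldr (crt g) ?S (vac V)"
  proof (rule foldr_sort_word[OF vector_space _ _ _ assms(2), of _ UNIV])
    fix p q :: "nat \<times> nat" and x
    assume "p \<in> P" "q \<in> P"
    thus "crt g p (crt g q x) = - crt g q (crt g p x)" by (subst tw_anticommute[OF assms(1)]) auto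
  qed (simp_all add: tw_linear)
  ultimately show ?thesis by (subst mon_sort[OF assms(2)]) (simp add: gact_linear)
qed

lemma gact_vac [simp]: "sympl g \<Longrightarrow> gact g (vac V) = vac V" using gact_mon[of g "[]"] by simp

text \<open>A negative mode is a creation operator and merely prolongs the word. A nonnegative mode
  is moved through the word to the vacuum, by the same relations on both sides.\<close>

lemma gact_Y_G: assumes "sympl g" "I < 2*n" shows "gact g (Y (G I) m b) = tw g I m (gact g b)"
proof -
  have *: "gact g (Y (G I) m (mon xs)) = tw g I m (gact g (mon xs))" if "set xs \<subseteq> P" for xs
  proof (cases "m < 0")
    case True
    hence "Y (G I) m (mon xs) = mon ((I, nat (- m - 1)) # xs)" by (simp add: cr_def)
    moreover have "gact g (mon ((I, nat (- m - 1)) # xs)) = tw g I m (gact g (mon xs))"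
      using assms that True by (subst (1 2) gact_mon) auto
    ultimately show ?thesis by simp
  next
    case False
    show ?thesis using that
    proof (induction xs)
      case Nil
      thus ?case using False assms by (simp add: Y_creation_regular tw_regular gact_linear)
    next
      case (Cons p xs)
      obtain J k where p: "p = (J, k)" "J < 2*n" using Cons by (cases p) auto
      have "Y (G I) m (mon (p # xs)) = - cr p (Y (G I) m (mon xs))
          + (if m + (- int k - 1) = 0 then (of_int m * om I J) *s mon xs else 0)"
        using G_anticommute[of I J m "- int k - 1" "mon xs"] assms p by (simp add: cr_def)
      moreover have "gact g (cr p b) = crt g p (gact g b)" if "b \<in> C" for b using that
      proof (induction rule: C_induct)
        case (mon xs)
        have "set (p # xs) \<subseteq> P" using p words_P[OF mon] by auto
        thus ?case using gact_mon[OF assms(1), of "p # xs"] gact_mon[OF assms(1), of xs] by simp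
      qed (simp_all add: gact_linear tw_linear cr_linear)
      ultimately have "gact g (Y (G I) m (mon (p # xs))) = - tw g J (- int k - 1) (tw g I m (gact g (mon xs)))
          + (if m + (- int k - 1) = 0 then (of_int m * om I J) *s gact g (mon xs) else 0)"
        using Cons p by (simp add: gact_linear)
      also have "\<dots> = tw g I m (tw g J (- int k - 1) (gact g (mon xs)))"
        using tw_anticommute[OF assms p(2), of m "- int k - 1" "gact g (mon xs)"] by simp
      also have "tw g J (- int k - 1) (gact g (mon xs)) = gact g (mon (p # xs))"
        using Cons.prems p by (subst (1 2) gact_mon[OF assms(1)]) auto
      finally show ?case .
    qed
  qed
  have "gact g (Y (G I) m (proj b)) = tw g I m (gact g (proj b))" using proj_in[of b]
    by (induction rule: C_induct) (simp_all add: * words_P Y_linear gact_linear tw_linear)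
  thus ?thesis by simp
qed

lemma foldr_tw_sector: "set xs \<subseteq> P \<Longrightarrow> foldr (crt g) xs (vac V) \<in> sector V (length xs mod 2)"
proof (induction xs)
  case Nil
  thus ?case by (simp add: vac_even)
next
  case (Cons p xs)
  let ?b = "foldr (crt g) xs (vac V)"
  have "Y (G J) (- int (snd p) - 1) ?b \<in> sector V ((1 + length xs mod 2) mod 2)" if "J < 2*n" for J
    using mode_sector[of 1 "length xs mod 2" "G J" ?b] that Cons G_sector[OF that] by (simp add: Y_mode)
  hence "crt g p ?b \<in> sector V ((1 + length xs mod 2) mod 2)"
    unfolding tw_def by (intro vs.subspace_sum vs.subspace_scale subspace_sector) auto
  thus ?case by (simp add: mod_simps)
qed

lemma gact_sector: assumes "sympl g" "p < 2" "a \<in> sector V p" shows "gact g a \<in> sector V p" unfolding gact_def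
proof (intro vs.subspace_sum[OF subspace_sector[OF assms(2)]] vs.subspace_scale[OF subspace_sector[OF assms(2)]])
  fix S assume S: "S \<in> supp a"
  thus "foldr (crt g) S (vac V) \<in> sector V p"
    using foldr_tw_sector[of S g] sector_supp[OF assms(2,3) S] words_P by (auto simp: supp_iff)
qed

lemma tw_eq: "tw g I m b = Y (\<Sum>J<2*n. g J I *s G J) m b" by (simp add: tw_def Y_linear)

lemma gact_G: assumes "sympl g" "I < 2*n" shows "gact g (G I) = (\<Sum>J<2*n. g J I *s G J)"
proof -
  have "gact g (Y (G I) (-1) (vac V)) = tw g I (-1) (vac V)" using gact_Y_G[OF assms] assms by simp
  thus ?thesis using assms by (auto simp: tw_def Y_creation intro!: sum.cong)
qed

text \<open>Induction on a word for \<open>a\<close>: \<open>Y_iterate\<close> expresses the modes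
  of \<open>cr p\<close> applied to a word by those of a generator and of the word. One bound
  \<open>?J\<close> must serve both before and after applying \<open>gact g\<close>.\<close>

lemma gact_Y: assumes "sympl g" "a \<in> C" shows "gact g (Y a m b) = Y (gact g a) m (gact g b)"
proof -
  have *: "gact g (Y (mon xs) m b) = Y (gact g (mon xs)) m (gact g b)" if "set xs \<subseteq> P" for xs m b using that
  proof (induction xs arbitrary: m b)
    case Nil
    thus ?case using assms by (simp add: Y_vac gact_linear)
  next
    case (Cons p xs)
    obtain I k where p: "p = (I, k)" "I < 2*n" using Cons by (cases p) auto
    let ?q = "length xs mod 2"
    let ?G = "\<Sum>J<2*n. g J I *s G J"
    let ?b = "gact g b"
    let ?a = "mon xs"
    let ?a' = "gact g (mon xs)"
    have q: "?q < 2" by simp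
    have a: "?a \<in> sector V ?q" "?a' \<in> sector V ?q"
      using mon_sector[of xs] gact_sector[OF assms(1) q, of ?a] Cons by auto
    have G': "?G \<in> sector V 1"
      by (intro vs.subspace_sum[OF subspace_sector] vs.subspace_scale[OF subspace_sector] G_sector) auto
    obtain J1 where J1: "\<forall>j\<ge>J1. Y ?a (m + int j) b = 0" "\<forall>j\<ge>J1. Y (G I) (int j) b = 0"
        "\<forall>j\<ge>J1. Y ?a' (m + int j) ?b = 0"
      using common_truncation[OF Y_truncation[of ?a m b] Y_truncation[of "G I" 0 b, simplified] Y_truncation[of ?a' m ?b]] by auto
    obtain J2 where J2: "\<forall>j\<ge>J2. Y ?G (int j) ?b = 0" using Y_truncation[of ?G 0 ?b] by auto
    let ?J = "max J1 J2"
    have "Y (mon (p # xs)) m b = Y (Y (G I) (- int k - 1) ?a) m b" by (simp add: cr_def p)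
    also have "\<dots> = (\<Sum>j<?J. ((-1) ^ j * (of_int (- int k - 1) gchoose j)) *s
        (Y (G I) (- int k - 1 - int j) (Y ?a (m + int j) b)
         - ((-1) powi (- int k - 1) * (-1) ^ (1 * ?q)) *s Y ?a (- int k - 1 + m - int j) (Y (G I) (int j) b)))"
      using J1 p a q by (intro Y_iterate G_sector) auto
    finally have "gact g (Y (mon (p # xs)) m b) = (\<Sum>j<?J. ((-1) ^ j * (of_int (- int k - 1) gchoose j)) *s
        (Y ?G (- int k - 1 - int j) (Y ?a' (m + int j) ?b)
         - ((-1) powi (- int k - 1) * (-1) ^ (1 * ?q)) *s Y ?a' (- int k - 1 + m - int j) (Y ?G (int j) ?b)))"
      using Cons p assms by (simp only: gact_linear gact_Y_G[OF assms(1) p(2)] tw_eq) (simp add: gact_Y_G[OF assms(1) p(2)] tw_eq)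
    also have "\<dots> = Y (Y ?G (- int k - 1) ?a') m ?b" using J1 J2 p a q G' by (intro Y_iterate[symmetric]) auto
    also have "Y ?G (- int k - 1) ?a' = gact g (mon (p # xs))"
      using gact_mon[OF assms(1), of "p # xs"] gact_mon[OF assms(1), of xs] Cons p by (simp add: tw_eq)
    finally show ?case .
  qed
  show ?thesis using assms(2) by (induction rule: C_induct) (simp_all add: * words_P Y_linear gact_linear)
qed

lemma sum_om: assumes "A < 2*n" shows "(\<Sum>B<2*n. om A B * h B) = - sg A * h (dual A)"
proof -
  have "(\<Sum>B<2*n. om A B * h B) = (\<Sum>B<2*n. if B = dual A then - sg A * h (dual A) else 0)"
    by (rule sum.cong) (auto simp: om_def)
  thus ?thesis using assms by simp
qed

lemma sympl_iff: "sympl g \<longleftrightarrow> (\<forall>J<2*n. \<forall>L<2*n.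
    (\<Sum>A<2*n. sg A * g A J * g (dual A) L) = (if L = dual J then sg J else 0))"
proof -
  have "(\<Sum>I<2*n. \<Sum>K<2*n. g I J * om I K * g K L) = - (\<Sum>A<2*n. sg A * g A J * g (dual A) L)" for J L
  proof -
    have "(\<Sum>K<2*n. g I J * om I K * g K L) = - (sg I * g I J * g (dual I) L)" if "I < 2*n" for I
      using sum_om[OF that, of "\<lambda>K. g K L"] by (simp add: mult.assoc flip: sum_distrib_left)
    thus ?thesis by (simp add: sum_negf)
  qed
  thus ?thesis by (auto simp: sympl_def om_def neg_equal_iff_equal)
qed

text \<open>The entries of \<open>\<Omega>\<^sup>-\<^sup>1 g\<^sup>T \<Omega>\<close>, the inverse
  of a symplectic \<open>g\<close>.\<close>

definition sinv :: "(nat \<Rightarrow> nat \<Rightarrow> complex) \<Rightarrow> nat \<Rightarrow> nat \<Rightarrow> complex" where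
  "sinv g J A = sg J * sg A * g (dual A) (dual J)"

lemma sinv: assumes "sympl g" "J < 2*n" "L < 2*n"
  shows "(\<Sum>A<2*n. sinv g J A * g A L) = (if J = L then 1 else 0)" "(\<Sum>A<2*n. g J A * sinv g A L) = (if J = L then 1 else 0)"
proof -
  have left: "(\<Sum>A<2*n. sinv g J A * g A L) = (if J = L then 1 else 0)" if JL: "J < 2*n" "L < 2*n" for J L
  proof -
    have "(\<Sum>A<2*n. sinv g J A * g A L) = (\<Sum>A<2*n. sinv g J (dual A) * g (dual A) L)"
      by (rule sum.reindex_bij_witness[of _ dual dual]) auto
    also have "\<dots> = - sg J * (\<Sum>A<2*n. sg A * g A (dual J) * g (dual A) L)"
      unfolding sum_distrib_left by (rule sum.cong) (auto simp: sinv_def sg_dual)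
    also have "(\<Sum>A<2*n. sg A * g A (dual J) * g (dual A) L) = (if L = dual (dual J) then sg (dual J) else 0)"
      using assms(1) JL unfolding sympl_iff by simp
    finally show ?thesis using JL by (auto simp: sg_dual)
  qed
  show "(\<Sum>A<2*n. sinv g J A * g A L) = (if J = L then 1 else 0)" by (rule left[OF assms(2,3)])
  \<comment> \<open>A left inverse of a square matrix is also a right inverse. The second relation
    is what yields \<open>sympl_transpose\<close>.\<close>
  let ?m = "\<lambda>h :: nat \<Rightarrow> nat \<Rightarrow> complex. mat (2*n) (2*n) (\<lambda>(i, j). h i j)"
  have "?m (sinv g) * ?m g = 1\<^sub>m (2*n)" by (intro eq_matI) (auto simp: left scalar_prod_def atLeast0LessThan)
  hence "?m g * ?m (sinv g) = 1\<^sub>m (2*n)" by (rule mat_mult_left_right_inverse[rotated 2]) auto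
  hence "(?m g * ?m (sinv g)) $$ (J, L) = (if J = L then 1 else 0)" using assms by simp
  thus "(\<Sum>A<2*n. g J A * sinv g A L) = (if J = L then 1 else 0)"
    using assms by (simp add: scalar_prod_def atLeast0LessThan)
qed

lemma sympl_transpose: assumes "sympl g" "A < 2*n" "B < 2*n"
  shows "(\<Sum>J<2*n. sg J * g A J * g B (dual J)) = (if B = dual A then sg A else 0)"
proof -
  have "(\<Sum>J<2*n. g A J * sinv g J (dual B)) = sg (dual B) * (\<Sum>J<2*n. sg J * g A J * g B (dual J))"
    unfolding sum_distrib_left using assms(3) by (intro sum.cong refl) (simp add: sinv_def)
  hence "sg (dual B) * (\<Sum>J<2*n. sg J * g A J * g B (dual J)) = (if A = dual B then 1 else 0)"
    using sinv(2)[OF assms(1,2) dual_simps(1)[OF assms(3)]] by (simp only:)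
  hence "sg (dual B) * (sg (dual B) * (\<Sum>J<2*n. sg J * g A J * g B (dual J))) = (if B = dual A then sg A else 0)"
    using assms by (auto simp: sg_dual dual_swap[of B A])
  thus ?thesis by (simp flip: mult.assoc)
qed

lemma sympl_sinv: assumes "sympl g" shows "sympl (sinv g)" unfolding sympl_iff
proof (intro allI impI)
  fix J L assume JL: "J < 2*n" "L < 2*n"
  have "(\<Sum>A<2*n. sg A * sinv g A J * sinv g (dual A) L)
    = (\<Sum>A<2*n. - (sg J * sg L) * (sg A * g (dual L) A * g (dual J) (dual A)))"
    by (rule sum.cong) (auto simp: sinv_def sg_def dual_def)
  also have "\<dots> = - (sg J * sg L) * (if dual J = dual (dual L) then sg (dual L) else 0)"
    using JL sympl_transpose[OF assms, of "dual L" "dual J"] by (simp only: dual_simps sum_distrib_left[symmetric])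
  finally show "(\<Sum>A<2*n. sg A * sinv g A J * sinv g (dual A) L) = (if L = dual J then sg J else 0)"
    using JL by (auto simp: sg_dual)
qed

lemma gact_inverse: assumes "sympl g" "sympl \<delta>" "a \<in> C"
    and "\<And>I J. I < 2*n \<Longrightarrow> J < 2*n \<Longrightarrow> (\<Sum>K<2*n. g I K * \<delta> K J) = (if I = J then 1 else 0)" shows "gact g (gact \<delta> a) = a"
proof -
  have "gact g (gact \<delta> (mon xs)) = mon xs" if "set xs \<subseteq> P" for xs using that
  proof (induction xs)
    case (Cons p xs)
    obtain I k where p: "p = (I, k)" "I < 2*n" using Cons by (cases p) auto
    have "gact g (gact \<delta> (mon (p # xs))) = gact g (tw \<delta> I (- int k - 1) (gact \<delta> (mon xs)))"
      using p by (simp add: cr_def gact_Y_G[OF assms(2)])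
    also have "\<dots> = (\<Sum>K<2*n. \<delta> K I *s tw g K (- int k - 1) (gact g (gact \<delta> (mon xs))))"
      unfolding tw_def[of \<delta>] gact_linear by (intro sum.cong) (auto simp: gact_Y_G[OF assms(1)])
    also have "\<dots> = (\<Sum>K<2*n. \<Sum>J<2*n. (g J K * \<delta> K I) *s Y (G J) (- int k - 1) (mon xs))"
      using Cons by (simp add: tw_def vs.scale_sum_right mult.commute)
    also have "\<dots> = (\<Sum>J<2*n. (\<Sum>K<2*n. g J K * \<delta> K I) *s Y (G J) (- int k - 1) (mon xs))"
      by (subst sum.swap) (simp add: vs.scale_sum_left)
    also have "\<dots> = (\<Sum>J<2*n. if J = I then Y (G J) (- int k - 1) (mon xs) else 0)"
      by (rule sum.cong) (use p in \<open>auto simp: assms(4)\<close>)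
    finally show ?case using p by (simp add: cr_def[of "(I, k)"])
  qed (use assms in simp)
  thus ?thesis using assms(3) by (induction rule: C_induct[OF assms(3)]) (simp_all add: words_P gact_linear)
qed

lemma gact_automorphism: assumes "sympl g" shows "vertex_automorphism V (gact g)" unfolding vertex_automorphism_def
proof (intro conjI)
  show "bij_betw (gact g) C C" by (rule bij_betwI[of _ _ _ "gact (sinv g)"])
      (use gact_inverse[OF assms sympl_sinv[OF assms]] gact_inverse[OF sympl_sinv[OF assms] assms] sinv[OF assms] in auto)
qed (use assms in \<open>auto simp: gact_linear gact_sector Y_mode[symmetric] gact_Y\<close>)

lemma symplectic_form_entry: "i < 2*n \<Longrightarrow> j < 2*n \<Longrightarrow> symplectic_form n $$ (i, j) = om i j"
  by (auto simp: symplectic_form_def om_def dual_def sg_def)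

lemma symplectic_group_iff: assumes "g \<in> carrier_mat (2*n) (2*n)"
  shows "g \<in> symplectic_group n \<longleftrightarrow> sympl (\<lambda>i j. g $$ (i, j))"
proof -
  have S: "symplectic_form n \<in> carrier_mat (2*n) (2*n)" by (auto simp: symplectic_form_def mult_2)
  have "(transpose_mat g * symplectic_form n * g) $$ (J, L) = (\<Sum>I<2*n. \<Sum>K<2*n. g $$ (I, J) * om I K * g $$ (K, L))"
    if "J < 2*n" "L < 2*n" for J L
  proof -
    have "(transpose_mat g * symplectic_form n * g) $$ (J, L) =
        (\<Sum>I<2*n. g $$ (I, J) * (\<Sum>K<2*n. symplectic_form n $$ (I, K) * g $$ (K, L)))"
      using assms S that by (auto simp: scalar_prod_def atLeast0LessThan intro!: sum.cong)
    thus ?thesis by (simp add: symplectic_form_entry sum_distrib_left mult.assoc)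
  qed
  moreover have "transpose_mat g * symplectic_form n * g \<in> carrier_mat (2*n) (2*n)" using assms S by auto
  ultimately show ?thesis using assms S unfolding symplectic_group_def sympl_def
    by (auto simp: mat_eq_iff symplectic_form_entry)
qed

abbreviation "W \<equiv> sp_orbifold n V e f"
abbreviation "WC \<equiv> sp_invariants n V e f"

lemma W_simps [simp]: "carrier W = WC" "scl W = scl V" "vac W = vac V" "mode W = mode V"
  by (simp_all add: sp_orbifold_def)

lemma gact_acts: assumes "sympl g" "a \<in> WC" shows "gact g a = a"
proof -
  let ?g = "mat (2*n) (2*n) (\<lambda>(i, j). g i j)"
  have "sympl (\<lambda>i j. ?g $$ (i, j))" using assms(1) by (simp add: sympl_def)
  hence "?g \<in> symplectic_group n" by (subst symplectic_group_iff) auto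
  moreover have "sp_acts_by n V e f ?g (gact g)"
    using gact_automorphism[OF assms(1)] by (simp add: sp_acts_by_def gact_G[OF assms(1)])
  ultimately show ?thesis using assms(2) by (auto simp: sp_invariants_def)
qed

lemma sum_sg_dual: "(\<Sum>A<2*n. sg A * v A * v (dual A)) = (0::complex)"
proof -
  have "(\<Sum>A<2*n. sg A * v A * v (dual A)) = (\<Sum>A<2*n. sg (dual A) * v (dual A) * v (dual (dual A)))"
    by (rule sum.reindex_bij_witness[of _ dual dual]) auto
  also have "\<dots> = - (\<Sum>A<2*n. sg A * v A * v (dual A))"
    unfolding sum_negf[symmetric] by (rule sum.cong) (auto simp: sg_dual)
  finally show ?thesis by simp
qed

text \<open>The transvection \<open>x \<mapsto> x + t \<omega>(v, x) v\<close>. As it is polynomial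
  in \<open>t\<close>, it can be differentiated by comparing coefficients.\<close>

definition tv :: "(nat \<Rightarrow> complex) \<Rightarrow> complex \<Rightarrow> nat \<Rightarrow> nat \<Rightarrow> complex" where
  "tv v t J I = (if J = I then 1 else 0) + t * (sg I * v (dual I)) * v J"

lemma sympl_tv: "sympl (tv v t)" unfolding sympl_iff
proof (intro allI impI)
  fix J L assume JL: "J < 2*n" "L < 2*n"
  let ?j = "t * (sg J * v (dual J))" and ?l = "t * (sg L * v (dual L))"
  have "(\<Sum>A<2*n. sg A * tv v t A J * tv v t (dual A) L) =
     (\<Sum>A<2*n. (if A = J then (if dual J = L then sg J else 0) + sg J * ?l * v (dual J) else 0)
        + (if A = dual L then sg (dual L) * ?j * v (dual L) else 0)
        + ?j * ?l * (sg A * v A * v (dual A)))" by (rule sum.cong) (use JL in \<open>auto simp: tv_def algebra_simps\<close>)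
  also have "\<dots> = (if dual J = L then sg J else 0) + sg J * ?l * v (dual J) + sg (dual L) * ?j * v (dual L)"
    using JL by (simp add: sum.distrib sum_sg_dual flip: sum_distrib_left)
  also have "\<dots> = (if L = dual J then sg J else 0)" using JL by (auto simp: sg_dual)
  finally show "(\<Sum>A<2*n. sg A * tv v t A J * tv v t (dual A) L) = (if L = dual J then sg J else 0)" .
qed

text \<open>The maximal torus: \<open>e i\<close> is scaled by \<open>\<tau> i\<close> and
  \<open>f i\<close> by the inverse.\<close>

definition dil :: "(nat \<Rightarrow> complex) \<Rightarrow> nat \<Rightarrow> nat \<Rightarrow> complex" where
  "dil \<tau> J I = (if J = I then if I < n then \<tau> I else 1 / \<tau> (I - n) else 0)"

lemma sympl_dil: assumes "\<And>i. i < n \<Longrightarrow> \<tau> i \<noteq> 0" shows "sympl (dil \<tau>)" unfolding sympl_iff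
proof (intro allI impI)
  fix J L assume JL: "J < 2*n" "L < 2*n"
  have "(\<Sum>A<2*n. sg A * dil \<tau> A J * dil \<tau> (dual A) L) = (\<Sum>A<2*n. if A = J then sg J * dil \<tau> J J * dil \<tau> (dual J) L else 0)"
    by (rule sum.cong) (auto simp: dil_def)
  thus "(\<Sum>A<2*n. sg A * dil \<tau> A J * dil \<tau> (dual A) L) = (if L = dual J then sg J else 0)"
    using JL assms[of J] assms[of "J - n"] by (auto simp: dil_def dual_def)
qed

subsection \<open>Infinitesimal invariance\<close>

text \<open>A polynomial curve with value \<open>a\<close> and derivative \<open>b\<close> at
  \<open>0\<close>; the derivative is taken purely algebraically.\<close>

definition jet :: "(complex \<Rightarrow> 'v) \<Rightarrow> 'v \<Rightarrow> 'v \<Rightarrow> bool" where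
  "jet \<phi> a b \<longleftrightarrow> (\<exists>R c. c 0 = a \<and> c 1 = b \<and> (\<forall>r>R. c r = 0) \<and> (\<forall>t. \<phi> t = (\<Sum>r\<le>R. t ^ r *s c r)))"

lemma jet_extend:
  fixes c :: "nat \<Rightarrow> 'v" assumes "\<forall>r>R. c r = 0" "R \<le> R'" shows "(\<Sum>r\<le>R'. t ^ r *s c r) = (\<Sum>r\<le>R. t ^ r *s c r)"
  by (rule sum.mono_neutral_right) (use assms in auto)

lemma jet_const: "jet (\<lambda>t. a) a 0"
  unfolding jet_def by (intro exI[of _ 0] exI[of _ "\<lambda>r. if r = 0 then a else 0"]) auto

lemma jet_add: assumes "jet \<phi> a b" "jet \<psi> a' b'" shows "jet (\<lambda>t. \<phi> t + \<psi> t) (a + a') (b + b')"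
proof -
  obtain R c where c: "c 0 = a" "c 1 = b" "\<forall>r>R. c r = 0" "\<And>t. \<phi> t = (\<Sum>r\<le>R. t ^ r *s c r)"
    using assms(1) unfolding jet_def by blast
  obtain R' c' where c': "c' 0 = a'" "c' 1 = b'" "\<forall>r>R'. c' r = 0" "\<And>t. \<psi> t = (\<Sum>r\<le>R'. t ^ r *s c' r)"
    using assms(2) unfolding jet_def by blast
  have "\<phi> t + \<psi> t = (\<Sum>r\<le>max R R'. t ^ r *s (c r + c' r))" for t
    unfolding c(4) c'(4) vs.scale_right_distrib sum.distrib
    by (simp only: jet_extend[OF c(3) max.cobounded1] jet_extend[OF c'(3) max.cobounded2])
  thus ?thesis unfolding jet_def using c c' by (intro exI[of _ "max R R'"] exI[of _ "\<lambda>r. c r + c' r"]) auto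
qed

lemma jet_hom: assumes "jet \<phi> a b" "lin h" shows "jet (\<lambda>t. h (\<phi> t)) (h a) (h b)"
proof -
  obtain R c where c: "c 0 = a" "c 1 = b" "\<forall>r>R. c r = 0" "\<And>t. \<phi> t = (\<Sum>r\<le>R. t ^ r *s c r)"
    using assms(1) unfolding jet_def by blast
  show ?thesis unfolding jet_def using c module_hom.zero[OF assms(2)] by (intro exI[of _ R] exI[of _ "\<lambda>r. h (c r)"])
      (auto simp: module_hom.sum[OF assms(2)] module_hom.scale[OF assms(2)])
qed

lemma jet_times: assumes "jet \<phi> a b" shows "jet (\<lambda>t. t *s \<phi> t) 0 a"
proof -
  obtain R c where c: "c 0 = a" "c 1 = b" "\<forall>r>R. c r = 0" "\<And>t. \<phi> t = (\<Sum>r\<le>R. t ^ r *s c r)"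
    using assms(1) unfolding jet_def by blast
  let ?c = "\<lambda>r. case r of 0 \<Rightarrow> 0 | Suc r \<Rightarrow> c r"
  have "t *s \<phi> t = (\<Sum>r\<le>Suc R. t ^ r *s ?c r)" for t
    unfolding c(4) by (subst sum.atMost_Suc_shift) (simp add: vs.scale_sum_right)
  moreover have "\<forall>r>Suc R. ?c r = 0" using c(3) by (auto split: nat.splits)
  ultimately show ?thesis unfolding jet_def using c by (intro exI[of _ "Suc R"] exI[of _ ?c]) auto
qed

text \<open>The derivative of \<open>gact (tv v t)\<close> at \<open>t = 0\<close>, an element of
  the symplectic Lie algebra.\<close>

definition dv :: "nat \<Rightarrow> (nat \<Rightarrow> complex) \<Rightarrow> 'v \<Rightarrow> 'v" where
  "dv K v a = (\<Sum>I<2*n. \<Sum>J<2*n. (v I * v (dual J) * sg J) *s E K I J a)"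

lemma dv_hom: "lin (dv K v)" unfolding dv_def[abs_def] by (intro hom_sum finite_lessThan hom_scale E_hom)

lemma dv_cr: assumes "A < 2*n" "k < K"
  shows "dv K v (cr (A, k) b) = cr (A, k) (dv K v b) + (\<Sum>I<2*n. (v I * v (dual A) * sg A) *s cr (I, k) b)"
proof -
  have "dv K v (cr (A, k) b) = (\<Sum>I<2*n. \<Sum>J<2*n. (if J = A then (v I * v (dual J) * sg J) *s cr (I, k) b else 0)
      + cr (A, k) ((v I * v (dual J) * sg J) *s E K I J b))"
    unfolding dv_def by (intro sum.cong refl) (use assms in \<open>auto simp: E_cr cr_linear vs.scale_right_distrib\<close>)
  thus ?thesis using assms by (simp add: sum.distrib dv_def cr_linear)
qed

lemma wt_letter: "p \<in> set xs \<Longrightarrow> int (snd p) + 1 \<le> wt_word xs"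
proof (induction xs)
  case (Cons q xs)
  thus ?case using wt_word_nonneg[of xs] by auto
qed simp

lemma jet_mon:
  "set xs \<subseteq> P \<Longrightarrow> (\<forall>p\<in>set xs. snd p < K) \<Longrightarrow> jet (\<lambda>t. foldr (crt (tv v t)) xs (vac V)) (mon xs) (dv K v (mon xs))"
proof (induction xs)
  case Nil
  have "dv K v (vac V) = 0" using an_mon_zero[of _ "[]"] by (simp add: dv_def E_def)
  thus ?case using jet_const[of "vac V"] by simp
next
  case (Cons p xs)
  obtain A k where p: "p = (A, k)" "A < 2*n" "k < K" using Cons by (cases p) auto
  let ?B = "\<lambda>b. \<Sum>I<2*n. (v I * v (dual A) * sg A) *s cr (I, k) b"
  have B: "lin ?B" by (intro hom_sum finite_lessThan hom_scale cr_hom)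
  have "crt (tv v t) p b = cr p b + t *s ?B b" for t b
  proof -
    have "crt (tv v t) p b = (\<Sum>J<2*n. (if J = A then cr (J, k) b else 0) + t *s ((v J * v (dual A) * sg A) *s cr (J, k) b))"
      unfolding tw_def by (rule sum.cong) (auto simp: tv_def p cr_def vs.scale_left_distrib mult_ac)
    thus ?thesis using p by (simp add: sum.distrib vs.scale_sum_right)
  qed
  moreover have "jet (\<lambda>t. foldr (crt (tv v t)) xs (vac V)) (mon xs) (dv K v (mon xs))" using Cons by simp
  hence "jet (\<lambda>t. cr p (foldr (crt (tv v t)) xs (vac V)) + t *s ?B (foldr (crt (tv v t)) xs (vac V)))
     (cr p (mon xs) + 0) (cr p (dv K v (mon xs)) + ?B (mon xs))"
    using B by (intro jet_add jet_hom[OF _ cr_hom] jet_times[OF jet_hom])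
  ultimately show ?case using p by (simp add: dv_cr)
qed

lemma jet_gact: assumes "a \<in> F d h" "h \<le> int K" shows "jet (\<lambda>t. gact (tv v t) a) a (dv K v a)" using assms(1)
proof (induction rule: F_induct)
  case (mon xs)
  have "snd p < K" if "p \<in> set xs" for p using wt_letter[OF that] mon assms(2) by simp
  hence "jet (\<lambda>t. foldr (crt (tv v t)) xs (vac V)) (mon xs) (dv K v (mon xs))" using mon by (intro jet_mon) auto
  thus ?case using mon by (simp add: gact_mon[OF sympl_tv])
next
  case zero
  show ?case using jet_const[of 0] by (simp add: gact_linear module_hom.zero[OF dv_hom])
next
  case (add a b)
  from jet_add[OF this] show ?case by (simp add: gact_linear module_hom.add[OF dv_hom])
next
  case (scale x a)
  have "lin (scl V x)" by (simp add: module_hom_def' vs.scale_right_distrib)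
  from jet_hom[OF scale this] show ?case by (simp only: gact_linear module_hom.scale[OF dv_hom])
qed

lemma jet_constant: assumes "jet (\<lambda>t. a) a b" "a \<in> C" "b \<in> C" shows "b = 0"
proof (rule coef_eqI[OF assms(3)])
  fix S
  obtain R c where c: "c 0 = a" "c 1 = b" "\<forall>r>R. c r = 0" "\<And>t. a = (\<Sum>r\<le>R. t ^ r *s c r)"
    using assms(1) unfolding jet_def by blast
  let ?d = "\<lambda>r. if r = 0 then 0 else coef S (c r)"
  have "(\<Sum>r\<le>R. ?d r * t ^ r) = 0" for t
  proof -
    have "coef S a = (\<Sum>r\<le>R. t ^ r * coef S (c r))" by (subst c(4)[of t]) simp
    also have "\<dots> = (\<Sum>r\<le>R. (if r = 0 then coef S a else 0) + ?d r * t ^ r)" by (rule sum.cong) (auto simp: c(1))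
    finally show ?thesis by (simp add: sum.distrib)
  qed
  hence "\<forall>r\<le>R. ?d r = 0" using polyfun_eq_0[of ?d R] by blast
  thus "coef S b = coef S 0" using c(2,3) by (cases "1 \<le> R") (auto simp: not_le)
qed simp

lemma dv_zero: assumes "a \<in> WC" "a \<in> F d h" "h \<le> int K" shows "dv K v a = 0"
proof (rule jet_constant)
  show "jet (\<lambda>t. a) a (dv K v a)" using jet_gact[OF assms(2,3), of v] by (simp add: gact_acts[OF sympl_tv assms(1)])
  show "dv K v a \<in> C" unfolding dv_def by (intro C_sum C_scale E_in)
qed (use assms F_in_C in blast)

text \<open>\<open>dv K v\<close> depends quadratically on \<open>v\<close>. Its polarization at the
  unit vectors of \<open>A\<close> and \<open>dual B\<close> isolates the combination of
  \<open>E K A B\<close> and its mirror image.\<close>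

lemma W_spinv: assumes "a \<in> WC" "a \<in> F d h" "h \<le> int K" shows "a \<in> spinv K"
proof -
  have *: "sg B *s E K A B a + sg (dual A) *s E K (dual B) (dual A) a = 0" if "A < 2*n" "B < 2*n" for A B
  proof -
    let ?X = "\<lambda>v w. \<Sum>I<2*n. \<Sum>J<2*n. (v I * w (dual J) * sg J) *s E K I J a"
    let ?d = "\<lambda>A I. if I = A then 1 else (0::complex)"
    have X: "?X (?d A) (?d B) = sg (dual B) *s E K A (dual B) a" if "A < 2*n" "B < 2*n" for A B
    proof -
      have "(\<Sum>J<2*n. (?d A I * ?d B (dual J) * sg J) *s E K I J a) = (if I = A then sg (dual B) *s E K A (dual B) a else 0)" for I
      proof -
        have "(\<Sum>J<2*n. (?d A I * ?d B (dual J) * sg J) *s E K I J a) =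
          (\<Sum>J<2*n. if J = dual B then if I = A then sg (dual B) *s E K A (dual B) a else 0 else 0)"
          by (rule sum.cong) (use that in auto)
        thus ?thesis using that by simp
      qed
      thus ?thesis using that by simp
    qed
    have "?X (?d A) (?d A) + ?X (?d A) (?d (dual B)) + ?X (?d (dual B)) (?d A) + ?X (?d (dual B)) (?d (dual B))
       = dv K (\<lambda>I. ?d A I + ?d (dual B) I) a"
      unfolding dv_def sum.distrib[symmetric] vs.scale_left_distrib[symmetric] by (intro sum.cong refl) (simp add: algebra_simps)
    moreover have "?X (?d A) (?d A) = 0" "?X (?d (dual B)) (?d (dual B)) = 0"
      using dv_zero[OF assms, of "?d A"] dv_zero[OF assms, of "?d (dual B)"] unfolding dv_def by auto
    ultimately have "?X (?d A) (?d (dual B)) + ?X (?d (dual B)) (?d A) = 0"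
      by (simp only: dv_zero[OF assms] add_0 add.right_neutral)
    thus ?thesis using that by (simp only: X dual_simps(1,2))
  qed
  have "E K A B a = (sg A * sg B) *s E K (dual B) (dual A) a" if "A < 2*n" "B < 2*n" for A B
  proof -
    have "sg B *s (sg B *s E K A B a + sg (dual A) *s E K (dual B) (dual A) a) = 0" unfolding *[OF that] by simp
    hence "E K A B a + (sg B * sg (dual A)) *s E K (dual B) (dual A) a = 0" by (simp add: vs.scale_right_distrib)
    thus ?thesis using that by (simp add: sg_dual mult.commute add_eq_0_iff2)
  qed
  moreover have "a \<in> C" using assms F_in_C by blast
  ultimately show ?thesis unfolding spinv_def by blast
qed

end

text \<open>Subtracting \<open>\<mu> i\<close> times the sum from its image under \<open>T\<close>
  removes the \<open>i\<close>-th component and rescales the others by nonzero factors. It will be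
  used for the weight operator, with the invariants or a submodule as \<open>S\<close>.\<close>

lemma eigen_components:
  fixes s :: "complex \<Rightarrow> 'x \<Rightarrow> 'x::ab_group_add"
  assumes "vector_space s" and T: "module_hom s s T" and S: "module.subspace s S" and TS: "\<And>x. x \<in> S \<Longrightarrow> T x \<in> S"
    and "finite A" "inj_on \<mu> A" "\<And>i. i \<in> A \<Longrightarrow> T (x i) = s (\<mu> i) (x i)" "(\<Sum>i\<in>A. x i) \<in> S" "i \<in> A" shows "x i \<in> S"
proof -
  interpret vector_space s by fact
  have "\<forall>i\<in>A. x i \<in> S" using assms(5-8)
  proof (induction A arbitrary: x rule: finite_induct)
    case (insert i A)
    let ?y = "\<Sum>j\<in>insert i A. x j"
    have "T ?y - s (\<mu> i) ?y = (\<Sum>j\<in>A. s (\<mu> j - \<mu> i) (x j))"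
      using insert by (simp add: module_hom.sum[OF T] module_hom.add[OF T] scale_sum_right
          scale_right_distrib scale_left_diff_distrib sum_subtractf)
    moreover have "T ?y - s (\<mu> i) ?y \<in> S"
      using insert.prems(3) by (intro subspace_diff[OF S] subspace_scale[OF S] TS)
    ultimately have "\<forall>j\<in>A. s (\<mu> j - \<mu> i) (x j) \<in> S"
      using insert by (intro insert.IH) (auto simp: module_hom.scale[OF T] mult.commute)
    hence A: "x j \<in> S" if "j \<in> A" for j
    proof -
      have ne: "\<mu> j - \<mu> i \<noteq> 0" using that insert by (auto simp: inj_on_def)
      have "s (1 / (\<mu> j - \<mu> i)) (s (\<mu> j - \<mu> i) (x j)) \<in> S"
        by (rule subspace_scale[OF S]) (use \<open>\<forall>j\<in>A. s (\<mu> j - \<mu> i) (x j) \<in> S\<close> that in blast)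
      thus ?thesis using ne by simp
    qed
    have "?y - (\<Sum>j\<in>A. x j) = x i" using insert by simp
    moreover have "?y - (\<Sum>j\<in>A. x j) \<in> S" by (rule subspace_diff[OF S insert.prems(3) subspace_sum[OF S A]])
    ultimately have "x i \<in> S" by (simp only:)
    with A show ?case by simp
  qed simp
  thus ?thesis using assms by blast
qed

section \<open>Invariants of the symplectic group and the first fundamental theorem\<close>

context symplectic_fermion_algebra
begin

lemma gact_Q: assumes "sympl g" shows "gact g (Q k l b) = Q k l (gact g b)"
proof -
  let ?b = "gact g b"
  have "gact g (Q k l b) = (\<Sum>I<2*n. \<Sum>A<2*n. \<Sum>B<2*n. (sg I * g A I * g B (dual I)) *s cr (A, k) (cr (B, l) ?b))"
  proof -
    have "gact g (cr (I, k) (cr (dual I, l) b)) = (\<Sum>A<2*n. \<Sum>B<2*n. (g A I * g B (dual I)) *s cr (A, k) (cr (B, l) ?b))"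
      if "I < 2*n" for I using that by (simp add: cr_def gact_Y_G[OF assms] tw_def Y_linear vs.scale_sum_right)
    thus ?thesis unfolding Q_def gact_linear by (intro sum.cong refl) (simp add: vs.scale_sum_right mult.assoc)
  qed
  also have "\<dots> = (\<Sum>A<2*n. \<Sum>B<2*n. (\<Sum>I<2*n. sg I * g A I * g B (dual I)) *s cr (A, k) (cr (B, l) ?b))"
    unfolding vs.scale_sum_left by (subst sum.swap, rule sum.cong[OF refl], subst sum.swap, rule refl)
  also have "\<dots> = (\<Sum>A<2*n. \<Sum>B<2*n. if B = dual A then sg A *s cr (A, k) (cr (dual A, l) ?b) else 0)"
    by (intro sum.cong refl) (auto simp: sympl_transpose[OF assms])
  finally show ?thesis by (simp add: Q_def)
qed

text \<open>Both maps agree on the generators and respect all modes, and the modes of the generators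
  create all words.\<close>

lemma acts_by_gact: assumes "sp_acts_by n V e f g \<sigma>" "g \<in> symplectic_group n" "a \<in> C"
  shows "\<sigma> a = gact (\<lambda>i j. g $$ (i, j)) a" "sympl (\<lambda>i j. g $$ (i, j))"
proof -
  let ?\<gamma> = "\<lambda>i j. g $$ (i, j)"
  have g: "g \<in> carrier_mat (2*n) (2*n)" using assms(2) by (simp add: symplectic_group_def)
  show s: "sympl ?\<gamma>" using assms(2) by (simp add: symplectic_group_iff[OF g])
  have aut: "vertex_automorphism V \<sigma>" and G: "\<And>j. j < 2*n \<Longrightarrow> \<sigma> (G j) = (\<Sum>i<2*n. g $$ (i, j) *s G i)"
    using assms(1) by (auto simp: sp_acts_by_def)
  have add: "\<sigma> (a + b) = \<sigma> a + \<sigma> b" and scale: "\<sigma> (x *s a) = x *s \<sigma> a" and vac: "\<sigma> (vac V) = vac V"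
    and mode: "\<sigma> (mode V a m b) = mode V (\<sigma> a) m (\<sigma> b)" and inC: "\<sigma> a \<in> C" if "a \<in> C" "b \<in> C" for a b m x
    using aut that by (auto simp: vertex_automorphism_def bij_betw_def)
  have *: "\<sigma> (mon xs) = gact ?\<gamma> (mon xs)" if "set xs \<subseteq> P" for xs using that
  proof (induction xs)
    case Nil
    thus ?case using s vac[OF C_zero C_zero] by simp
  next
    case (Cons p xs)
    obtain I k where p: "p = (I, k)" "I < 2*n" using Cons by (cases p) auto
    have "\<sigma> (mon (p # xs)) = \<sigma> (mode V (G I) (- int k - 1) (mon xs))"
      using p by (simp add: cr_def[of "(I, k)"] Y_mode)
    also have "\<dots> = mode V (\<sigma> (G I)) (- int k - 1) (\<sigma> (mon xs))" using p by (intro mode) auto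
    also have "\<dots> = Y (\<Sum>i<2*n. g $$ (i, I) *s G i) (- int k - 1) (gact ?\<gamma> (mon xs))"
      using Cons p by (subst Y_mode) (auto simp: G intro!: C_sum C_scale)
    also have "\<dots> = gact ?\<gamma> (mon (p # xs))" using p by (simp add: cr_def[of "(I, k)"] gact_Y_G[OF s] tw_eq)
    finally show ?case .
  qed
  show "\<sigma> a = gact ?\<gamma> a" using assms(3)
  proof (induction rule: C_induct)
    case zero
    have "\<sigma> 0 = \<sigma> (0 *s vac V)" by simp
    also have "\<dots> = 0" by (subst scale[OF C_vac C_vac]) simp
    finally show ?case by (simp add: gact_linear)
  qed (simp_all add: * words_P add scale gact_linear)
qed

lemma WC_C: "a \<in> WC \<Longrightarrow> a \<in> C" by (simp add: sp_invariants_def)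

lemma WC_iff: "a \<in> WC \<longleftrightarrow> a \<in> C \<and> (\<forall>g. sympl g \<longrightarrow> gact g a = a)"
  using WC_C gact_acts acts_by_gact by (auto simp: sp_invariants_def) metis

lemma WC_subspace: "vs.subspace WC" by (auto simp: vs.subspace_def WC_iff gact_linear intro: C_add C_scale)

lemmas WC_zero [simp, intro] = vs.subspace_0[OF WC_subspace]
lemmas WC_add [intro] = vs.subspace_add[OF WC_subspace]
lemmas WC_scale [intro] = vs.subspace_scale[OF WC_subspace]
lemmas WC_diff [intro] = vs.subspace_diff[OF WC_subspace]
lemmas WC_neg [intro] = vs.subspace_neg[OF WC_subspace]
lemmas WC_sum [intro] = vs.subspace_sum[OF WC_subspace]

lemma WC_vac [simp, intro]: "vac V \<in> WC" by (simp add: WC_iff)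

lemma WC_Y [intro]: assumes "a \<in> WC" "b \<in> WC" shows "Y a k b \<in> WC" using assms by (auto simp: WC_iff gact_Y)

lemma WC_Q [intro]: "b \<in> WC \<Longrightarrow> Q k l b \<in> WC" by (auto simp: WC_iff gact_Q)

text \<open>The way back from the Lie algebra to the group: \<open>a\<close> is composed of the
  vacuum and of \<open>Q k l\<close> applied to shorter invariants of the Lie algebra, and
  \<open>Q k l\<close> commutes with \<open>gact\<close>.\<close>

lemma spinv_WC: "a \<in> spinv K \<Longrightarrow> a \<in> F d h \<Longrightarrow> h \<le> int K \<Longrightarrow> a \<in> WC"
proof (induction "nat (d + 1)" arbitrary: a d h rule: less_induct)
  case less
  show ?case
  proof (cases "d < 0")
    case True
    thus ?thesis using less F_negative[of d h] by auto
  next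
    case False
    obtain z b where b: "b \<in> spinv K" "b \<in> F d h" "a = z *s vac V + QQ K b"
      using spinv_decompose[OF less.prems] by blast
    have "Qd k l b \<in> WC" if "k < K" "l < K" for k l using that less.prems(3) False
      by (intro less.hyps[OF _ Qd_inv[OF b(1) that] Qd_F[OF b(2), of k l]]) auto
    thus ?thesis unfolding b(3) QQ_def by (auto intro!: WC_add WC_scale WC_sum WC_Q)
  qed
qed

text \<open>The first fundamental theorem of invariant theory for the symplectic group.\<close>

lemma WC_decompose: assumes "w \<in> WC" "w \<in> F d h"
  obtains z b where "w = z *s vac V + (\<Sum>k<nat h. \<Sum>l<nat h. Q k l (b k l))"
    "\<And>k l. k < nat h \<Longrightarrow> l < nat h \<Longrightarrow> b k l \<in> WC \<and> b k l \<in> F (d - 2) (h - int k - int l - 2)"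
proof -
  have h: "h \<le> int (nat h)" by simp
  obtain z b where b: "b \<in> spinv (nat h)" "b \<in> F d h" "w = z *s vac V + QQ (nat h) b"
    using spinv_decompose[OF W_spinv[OF assms h] assms(2) h] by blast
  have "Qd k l b \<in> WC \<and> Qd k l b \<in> F (d - 2) (h - int k - int l - 2)" if "k < nat h" "l < nat h" for k l
    using spinv_WC[OF Qd_inv[OF b(1) that] Qd_F[OF b(2)]] Qd_F[OF b(2), of k l] that by auto
  thus ?thesis using b(3) by (intro that[of z "\<lambda>k l. Qd k l b"]) (auto simp: QQ_def)
qed

lemma Q_even: "b \<in> sector V 0 \<Longrightarrow> Q k l b \<in> sector V 0"
proof -
  assume b: "b \<in> sector V 0"
  have "cr (I, k) (cr (dual I, l) b) \<in> sector V 0" if "I < 2*n" for I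
  proof -
    have "b \<in> C" using b sector_subset[of 0] by auto
    hence "cr (dual I, l) b \<in> sector V 1"
      using mode_sector[of 1 0 "G (dual I)" b] b that G_sector[of "dual I"] by (simp add: cr_def Y_mode)
    thus ?thesis
      using mode_sector[of 1 1 "G I" "cr (dual I, l) b"] that G_sector[of I] by (simp add: cr_def[of "(I, k)"] Y_mode)
  qed
  thus ?thesis unfolding Q_def
    by (intro vs.subspace_sum[OF subspace_sector] vs.subspace_scale[OF subspace_sector]) auto
qed

text \<open>Induction along \<open>WC_decompose\<close>, as \<open>Q k l\<close> preserves the even
  part. This is the purely even situation that Zhu's construction and the Borcherds identity without
  signs presuppose.\<close>

lemma WC_even: assumes "w \<in> WC" shows "w \<in> sector V 0"
proof -
  have "w \<in> F d h \<Longrightarrow> w \<in> WC \<Longrightarrow> w \<in> sector V 0" for d h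
  proof (induction "nat (d + 1)" arbitrary: w d h rule: less_induct)
    case less
    show ?case
    proof (cases "d < 0")
      case True
      thus ?thesis using less F_negative[of d h] vs.subspace_0[OF subspace_sector, of 0] by auto
    next
      case False
      obtain z b where b: "w = z *s vac V + (\<Sum>k<nat h. \<Sum>l<nat h. Q k l (b k l))"
        "\<And>k l. k < nat h \<Longrightarrow> l < nat h \<Longrightarrow> b k l \<in> WC \<and> b k l \<in> F (d - 2) (h - int k - int l - 2)"
        using WC_decompose[OF less.prems(2,1)] by blast
      have "b k l \<in> sector V 0" if "k < nat h" "l < nat h" for k l
        using b(2)[OF that] False by (intro less.hyps[of "d - 2" _ "h - int k - int l - 2"]) auto
      thus ?thesis unfolding b(1)
        by (intro vs.subspace_add vs.subspace_scale vs.subspace_sum subspace_sector vac_even Q_even) auto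
    qed
  qed
  thus ?thesis using F_exhaust[OF WC_C[OF assms]] assms by blast
qed

end

section \<open>The conformal vector and its modes\<close>

context vertex_superalgebra
begin

lemma dV_Y: assumes "p < 2" "q < 2" "a \<in> sector V p" "b \<in> sector V q"
  shows "dV (Y a m b) = Y (dV a) m b + Y a m (dV b)"
proof -
  have ab: "a \<in> C" "b \<in> C" using assms sector_subset by auto
  have "dV (Y a m b) = Y (Y a m b) (-2) (vac V)" by (simp add: dV_eq)
  also have "\<dots> = (\<Sum>j<2. sbinom m j *s
        (Y a (m - int j) (Y b (-2 + int j) (vac V))
         - ((-1) powi m * (-1) ^ (p * q)) *s Y b (m + (-2) - int j) (Y a (int j) (vac V))))"
    by (intro Y_iterate assms) (auto simp: Y_creation_regular)
  also have "\<dots> = Y a m (dV b) - of_int m *s Y a (m - 1) b"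
    using ab by (simp add: eval_nat_numeral Y_creation_regular Y_creation dV_eq)
  finally show ?thesis by (simp add: Y_dV[OF assms(1,3)])
qed

end

context symplectic_fermion_algebra
begin

abbreviation "Lc \<equiv> sf_conformal n V e f"

lemma sum_double: "(\<Sum>I<2*n. h I) = (\<Sum>i<n. h i + h (i + n) :: 'z::comm_monoid_add)"
proof -
  have "(\<Sum>I<2*n. h I) = (\<Sum>I<n. h I) + (\<Sum>I\<in>{n..<2*n}. h I)"
    by (subst sum.union_disjoint[symmetric]) (auto intro!: sum.cong)
  also have "(\<Sum>I\<in>{n..<2*n}. h I) = (\<Sum>i<n. h (i + n))"
    by (rule sum.reindex_bij_witness[of _ "\<lambda>i. i + n" "\<lambda>I. I - n"]) auto
  finally show ?thesis by (simp add: sum.distrib)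
qed

lemma Q_expand: "Q k l b = - (\<Sum>i<n. cr (i, k) (cr (i + n, l) b) + cr (i, l) (cr (i + n, k) b))"
proof -
  have "Q k l b = (\<Sum>i<n. - cr (i, k) (cr (i + n, l) b) + cr (i + n, k) (cr (i, l) b))"
    unfolding Q_def sum_double by (rule sum.cong) (auto simp: dual_def sg_def)
  also have "\<dots> = (\<Sum>i<n. - (cr (i, k) (cr (i + n, l) b) + cr (i, l) (cr (i + n, k) b)))"
  proof (rule sum.cong)
    fix i assume "i \<in> {..<n}"
    hence "cr (i + n, k) (cr (i, l) b) = - cr (i, l) (cr (i + n, k) b)" by (intro cr_cr) auto
    thus "- cr (i, k) (cr (i + n, l) b) + cr (i + n, k) (cr (i, l) b) =
      - (cr (i, k) (cr (i + n, l) b) + cr (i, l) (cr (i + n, k) b))" by simp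
  qed simp
  finally show ?thesis by (simp only: sum_negf)
qed

lemma Q_sym: "Q k l b = Q l k b" unfolding Q_expand by (simp add: add.commute)

lemma G_vac: "I < 2*n \<Longrightarrow> cr (I, 0) (vac V) = G I" by (simp add: cr_def Y_creation)

lemma dV_G_vac: assumes "I < 2*n" shows "(dV ^^ k) (G I) = fact k *s cr (I, k) (vac V)"
proof -
  have "(dV ^^ k) (G I) \<in> C" using assms by (intro dV_pow_in) simp
  thus ?thesis using wick_factor[OF assms, of k "vac V"] by (simp add: Y_creation)
qed

lemma G_e_f: "i < n \<Longrightarrow> e i = G i" "i < n \<Longrightarrow> f i = G (i + n)" by (auto simp: sf_gen_def)

lemma wick_e_f: assumes "i < n"
  shows "wick V ((dV ^^ k) (e i)) ((dV ^^ l) (f i)) = (fact k * fact l) *s cr (i, k) (cr (i + n, l) (vac V))"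
proof -
  have i: "i < 2*n" "i + n < 2*n" using assms by auto
  have "wick V ((dV ^^ k) (e i)) ((dV ^^ l) (f i)) = Y ((dV ^^ k) (G i)) (-1) ((dV ^^ l) (G (i + n)))"
    using i dV_pow_in[OF G_in[OF i(1)]] dV_pow_in[OF G_in[OF i(2)]] by (simp add: wick_def G_e_f assms Y_mode)
  thus ?thesis unfolding wick_factor[OF i(1)] dV_G_vac[OF i(2)] by (simp add: cr_linear)
qed

lemma sf_j_eq: "sf_j n V e f m = (- fact (2*m) / 2) *s Q 0 (2*m) (vac V)"
proof -
  have "sf_j n V e f m = (1 / 2) *s (\<Sum>i<n. fact (2*m) *s
      (cr (i, 0) (cr (i + n, 2*m) (vac V)) + cr (i, 2*m) (cr (i + n, 0) (vac V))))" unfolding sf_j_def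
    using wick_e_f[of _ 0 "2*m"] wick_e_f[of _ "2*m" 0]
    by (intro arg_cong[of _ _ "scl V (1 / 2)"] sum.cong refl) (auto simp: vs.scale_right_distrib)
  thus ?thesis by (simp add: Q_expand flip: vs.scale_sum_right)
qed

lemma Lc_eq: "Lc = (1 / 2) *s Q 0 0 (vac V)"
proof -
  have "Lc = - (\<Sum>i<n. cr (i, 0) (cr (i + n, 0) (vac V)))" unfolding sf_conformal_def using wick_e_f[of _ 0 0]
    by (intro arg_cong[of _ _ uminus] sum.cong refl) auto
  also have "\<dots> = (1 / 2) *s Q 0 0 (vac V)"
  proof -
    have "x = (1 / 2) *s (x + x)" for x
      using vs.scale_left_distrib[of "1/2" "1/2" x] by (simp add: vs.scale_right_distrib)
    thus ?thesis by (simp add: Q_expand sum.distrib flip: minus_add_distrib)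
  qed
  finally show ?thesis .
qed

lemma Lc_sum: "Lc = (1 / 2) *s (\<Sum>I<2*n. sg I *s Y (G I) (-1) (G (dual I)))"
proof -
  have "cr (I, 0) (cr (dual I, 0) (vac V)) = Y (G I) (-1) (G (dual I))" if "I < 2*n" for I
    using that by (simp add: G_vac cr_def[of "(I, 0)"])
  thus ?thesis unfolding Lc_eq Q_def by (simp cong: sum.cong_simp)
qed

lemma Lc_WC [simp, intro]: "Lc \<in> WC" unfolding Lc_eq by (intro WC_scale WC_Q WC_vac)

text \<open>The only poles are double ones, so the indices \<open>A\<close> and
  \<open>dual A\<close> alone contribute. They contribute the same vector, which the factor
  \<open>1/2\<close> in \<open>Lc_sum\<close> compensates.\<close>

lemma Lc_G: assumes "A < 2*n" shows "Y Lc (int k) (G A) = (if k = 0 then dV (G A) else if k = 1 then G A else 0)"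
proof -
  let ?v = "Y (G A) (int k - 2) (vac V)"
  have *: "sg I *s Y (Y (G I) (-1) (G (dual I))) (int k) (G A) =
      (if I = A then if k < 2 then ?v else 0 else 0) + (if I = dual A then if k < 2 then ?v else 0 else 0)"
    if I: "I < 2*n" for I
  proof -
    have dI: "dual I < 2*n" using I by simp
    have z: "Y (G B) (int j) (G A) = 0" if "j \<ge> 2" "B < 2*n" for B j
      using G_ope[OF that(2) assms, of j] that(1) by simp
    have o: "om (dual I) A = (if I = A then sg I else 0)" "om I A = (if I = dual A then - sg I else 0)"
      using I assms by (auto simp: om_def sg_dual)
    have "Y (Y (G I) (-1) (G (dual I))) (int k) (G A) =
      (\<Sum>j<2. ((-1) ^ j * (of_int (-1) gchoose j)) *s
        (Y (G I) (-1 - int j) (Y (G (dual I)) (int k + int j) (G A))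
         - ((-1) powi (-1) * (-1) ^ (1 * 1)) *s Y (G (dual I)) (-1 + int k - int j) (Y (G I) (int j) (G A))))"
      using z[OF _ dI] z[OF _ I] by (intro Y_iterate G_sector I dI) (auto simp flip: of_nat_add)
    also have "\<dots> = (if k < 2 then om (dual I) A *s Y (G I) (int k - 2) (vac V)
        - om I A *s Y (G (dual I)) (int k - 2) (vac V) else 0)"
    proof -
      have 1: "Y (G (dual I)) (int k + int j) (G A) = (if k + j = 1 then om (dual I) A *s vac V else 0)" for j
        using G_ope[OF dI assms, of "k + j"] by simp
      have 2: "Y (G I) (int j) (G A) = (if j = 1 then om I A *s vac V else 0)" for j
        using G_ope[OF I assms, of j] by simp
      consider "k = 0" | "k = 1" | "k \<ge> 2" by linarith
      thus ?thesis unfolding 1 2 by cases (simp_all add: eval_nat_numeral Y_linear Y_creation_regular)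
    qed
    finally show ?thesis unfolding o using I assms not_sym[OF dual_simps(3)[OF assms]] by (auto simp: sg_dual)
  qed
  have "Y Lc (int k) (G A) = (1 / 2) *s (\<Sum>I<2*n. sg I *s Y (Y (G I) (-1) (G (dual I))) (int k) (G A))"
    unfolding Lc_sum by (simp only: Y_linear)
  also have "\<dots> = (1 / 2) *s ((if k < 2 then ?v else 0) + (if k < 2 then ?v else 0))"
    using assms by (simp add: * sum.distrib)
  also have "\<dots> = (if k < 2 then ?v else 0)" by (simp flip: vs.scale_left_distrib add: vs.scale_right_distrib)
  also have "\<dots> = (if k = 0 then dV (G A) else if k = 1 then G A else 0)"
    using assms by (auto simp: dV_eq Y_creation)
  finally show ?thesis .
qed

lemma Lc_mode_G: assumes "A < 2*n" shows "Y Lc 1 (Y (G A) k b) = Y (G A) k (Y Lc 1 b) - of_int k *s Y (G A) k b"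
    and "Y Lc 0 (Y (G A) k b) = Y (G A) k (Y Lc 0 b) - of_int k *s Y (G A) (k - 1) b"
proof -
  have c: "Y Lc m (Y (G A) k b) - (-1) ^ (0 * 1) *s Y (G A) k (Y Lc m b) =
    (\<Sum>j<2. (of_int m gchoose j) *s Y (Y Lc (int j) (G A)) (m + k - int j) b)" for m
    by (rule Y_commutator) (use G_sector[OF assms] in \<open>auto simp: WC_even assms Lc_G\<close>)
  have d: "Y (dV (G A)) m b = - (of_int m *s Y (G A) (m - 1) b)" for m
    using Y_dV[of 1 "G A" m b] G_sector[OF assms] by simp
  have L01: "Y Lc 0 (G A) = dV (G A)" "Y Lc 1 (G A) = G A" using Lc_G[OF assms, of 0] Lc_G[OF assms, of 1] by auto
  show "Y Lc 1 (Y (G A) k b) = Y (G A) k (Y Lc 1 b) - of_int k *s Y (G A) k b"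
    using c[of 1] by (simp add: eval_nat_numeral L01 d vs.scale_left_distrib diff_eq_eq add.commute)
  show "Y Lc 0 (Y (G A) k b) = Y (G A) k (Y Lc 0 b) - of_int k *s Y (G A) (k - 1) b"
    using c[of 0] by (simp add: eval_nat_numeral L01 d diff_eq_eq)
qed

lemma Lc_mon: "set xs \<subseteq> P \<Longrightarrow> Y Lc 1 (mon xs) = of_int (wt_word xs) *s mon xs"
proof (induction xs)
  case (Cons p xs)
  thus ?case by (simp add: cr_def[of p] Lc_mode_G Y_linear vs.scale_left_distrib vs.scale_left_diff_distrib)
qed (simp add: Y_creation_regular)

lemma Lc_zero_mode: assumes "a \<in> C" shows "Y Lc 0 a = dV a"
proof -
  have dh: "lin (\<lambda>a. Y a (-2) (vac V))" by (rule Y_left)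
  have "Y Lc 0 (mon xs) = Y (mon xs) (-2) (vac V)" if "set xs \<subseteq> P" for xs using that
  proof (induction xs)
    case Nil
    show ?case by (simp add: Y_creation_regular Y_vac)
  next
    case (Cons p xs)
    obtain I k where p: "p = (I, k)" "I < 2*n" using Cons by (cases p) auto
    have "dV (mon (p # xs)) = dV (Y (G I) (- int k - 1) (mon xs))" by (simp add: p cr_def[of "(I, k)"])
    also have "\<dots> = Y (dV (G I)) (- int k - 1) (mon xs) + Y (G I) (- int k - 1) (dV (mon xs))"
      using p mon_sector[of xs] Cons by (intro dV_Y[of 1 "length xs mod 2"] G_sector) auto
    also have "\<dots> = Y Lc 0 (mon (p # xs))" using Y_dV[OF _ G_sector[OF p(2)], of "- int k - 1" "mon xs"] Cons p
      by (simp add: cr_def[of "(I, k)"] Lc_mode_G dV_eq vs.scale_left_diff_distrib)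
    finally show ?case by (simp add: dV_eq cr_def[of p])
  qed
  hence "Y Lc 0 a = Y a (-2) (vac V)" by - (rule hom_eq_on_C[OF Y_right dh _ assms], simp add: words_P)
  thus ?thesis by (simp add: dV_eq assms)
qed

lemma one_gbinomial: "((1::complex) gchoose j) = (if j < 2 then 1 else 0)"
proof -
  have "((of_nat 1 :: complex) gchoose j) = of_nat (1 choose j)" by (simp only: binomial_gbinomial)
  thus ?thesis by (cases j) (auto simp: binomial_eq_0 less_2_cases_iff)
qed

lemma Lc_mode: assumes "p < 2" "a \<in> sector V p"
  shows "Y Lc 1 (Y a k b) = Y a k (Y Lc 1 b) - of_int (k + 1) *s Y a k b + Y (Y Lc 1 a) k b"
proof -
  have a: "a \<in> C" using assms sector_subset by auto
  obtain J0 where "\<forall>j\<ge>J0. Y Lc (0 + int j) a = 0" using Y_truncation[of Lc 0 a] by auto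
  hence J: "\<And>j. j \<ge> J0 + 2 \<Longrightarrow> Y Lc (int j) a = 0" by auto
  have "Y Lc 1 (Y a k b) - (-1) ^ (0 * p) *s Y a k (Y Lc 1 b) =
    (\<Sum>j<J0 + 2. (of_int 1 gchoose j) *s Y (Y Lc (int j) a) (1 + k - int j) b)"
    by (rule Y_commutator) (use assms J in \<open>auto simp: WC_even\<close>)
  also have "\<dots> = (\<Sum>j<2. (of_int 1 gchoose j) *s Y (Y Lc (int j) a) (1 + k - int j) b)"
    by (rule sum.mono_neutral_right) (auto simp: one_gbinomial)
  also have "\<dots> = - (of_int (k + 1) *s Y a k b) + Y (Y Lc 1 a) k b"
    using Y_dV[OF assms, of "1 + k" b] by (simp add: eval_nat_numeral Lc_zero_mode a add.commute)
  finally show ?thesis by (simp add: algebra_simps)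
qed

lemma coef_Lc: assumes "S \<in> words" shows "coef S (Y Lc 1 b) = of_int (wt_word S) * coef S b"
proof -
  have "coef S (Y Lc 1 (proj b)) = of_int (wt_word S) * coef S (proj b)" using proj_in[of b]
  proof (induction rule: C_induct)
    case (mon xs)
    thus ?case using assms by (simp add: Lc_mon words_P coef_mon)
  qed (simp_all add: Y_linear algebra_simps)
  thus ?thesis by simp
qed

subsection \<open>Weight components\<close>

definition wc :: "int \<Rightarrow> 'v \<Rightarrow> 'v" where
  "wc p a = (\<Sum>S\<in>{S \<in> supp a. wt_word S = p}. coef S a *s mon S)"

lemma wc_in [simp, intro]: "wc p a \<in> C" unfolding wc_def by (intro C_sum C_scale mon_in)

lemma coef_wc: assumes "S \<in> words" shows "coef S (wc p a) = (if wt_word S = p then coef S a else 0)"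
proof -
  have "finite {S \<in> supp a. wt_word S = p}" by (rule finite_subset[OF _ finite_supp[of a]]) auto
  thus ?thesis unfolding wc_def using assms by (subst coef_combination) (auto simp: supp_iff)
qed

lemma wc_hom: "lin (wc p)" unfolding module_hom_def' by (auto intro!: coef_eqI C_add C_scale simp: coef_wc)

lemmas wc_linear = hom_rules[OF wc_hom]

definition wts :: "'v \<Rightarrow> int set" where "wts a = wt_word ` supp a"

lemma finite_wts [simp]: "finite (wts a)" by (simp add: wts_def)

lemma wc_eq_0: "p \<notin> wts a \<Longrightarrow> wc p a = 0" unfolding wts_def by (intro coef_eqI) (auto simp: coef_wc supp_iff)

lemma wc_neg: "p < 0 \<Longrightarrow> wc p a = 0"
  using wt_word_nonneg by (intro wc_eq_0) (auto simp: wts_def, smt (verit) of_nat_0_le_iff)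

lemma wc_sum: assumes "a \<in> C" "finite A" "wts a \<subseteq> A" shows "(\<Sum>p\<in>A. wc p a) = a"
proof (rule coef_eqI)
  fix S assume S: "S \<in> words"
  have "coef S (\<Sum>p\<in>A. wc p a) = (\<Sum>p\<in>A. if p = wt_word S then coef S a else 0)"
    unfolding coef_linear by (rule sum.cong) (auto simp: coef_wc S)
  moreover have "coef S a = 0" if "wt_word S \<notin> A" using assms(3) S that by (auto simp: wts_def supp_def)
  ultimately show "coef S (\<Sum>p\<in>A. wc p a) = coef S a" using assms(2) by auto
qed (use assms in auto)

lemma Lc_wc: "Y Lc 1 (wc p a) = of_int p *s wc p a" by (intro coef_eqI C_scale) (auto simp: coef_Lc coef_wc)

lemma wc_eigen: assumes "a \<in> C" "Y Lc 1 a = of_int p *s a" shows "wc q a = (if q = p then a else 0)"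
proof -
  have "of_int (wt_word S) * coef S a = of_int p * coef S a" if "S \<in> words" for S
    using coef_Lc[OF that, of a] assms(2) by auto
  hence "coef S a = 0" if "S \<in> words" "wt_word S \<noteq> p" for S using that by (metis mult_cancel_right of_int_eq_iff)
  thus ?thesis using assms(1) by (intro coef_eqI) (auto simp: coef_wc)
qed

abbreviation "DD \<equiv> weight_space W Lc"

lemma DD_iff: "a \<in> DD p \<longleftrightarrow> a \<in> WC \<and> Y Lc 1 a = of_int p *s a" by (auto simp: weight_space_def Y_mode WC_C)

lemma DD_WC: "a \<in> DD p \<Longrightarrow> a \<in> WC" by (simp add: DD_iff)

lemma DD_subspace: "vs.subspace (DD p)"
  by (auto simp: vs.subspace_def DD_iff Y_linear vs.scale_right_distrib mult.commute)

lemma wc_DD: "a \<in> DD p \<Longrightarrow> wc q a = (if q = p then a else 0)" by (rule wc_eigen) (auto simp: DD_iff WC_C)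

lemma wc_WC: assumes "a \<in> WC" shows "wc p a \<in> WC"
proof (cases "p \<in> wts a")
  case True
  show ?thesis
  proof (rule eigen_components[OF vector_space Y_right[of Lc 1] WC_subspace _ finite_wts[of a], of of_int "\<lambda>p. wc p a" p])
    show "(\<Sum>i\<in>wts a. wc i a) \<in> WC" using wc_sum[OF WC_C[OF assms] finite_wts order_refl] assms by simp
  qed (auto simp: Lc_wc True inj_on_def)
qed (simp add: wc_eq_0)

lemma wc_in_DD: "a \<in> WC \<Longrightarrow> wc p a \<in> DD p" by (simp add: DD_iff wc_WC Lc_wc)

lemma DD_neg: assumes "p < 0" "a \<in> DD p" shows "a = 0" using wc_DD[OF assms(2), of p] wc_neg[OF assms(1)] by simp

text \<open>This evaluates the choice made by \<open>THE\<close> in \<open>zhu_star\<close>.\<close>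

lemma decomposition_wc: assumes "a \<in> WC" shows "(THE c. decomposition DD a c) = (\<lambda>p. wc p a)"
proof (rule the_equality)
  have fin: "{p. wc p a \<noteq> 0} \<subseteq> wts a" using wc_eq_0 by auto
  have "a = Sum_any (\<lambda>p. wc p a)"
    by (subst Sum_any.expand_superset[OF finite_wts fin]) (simp add: wc_sum WC_C assms)
  thus "decomposition DD a (\<lambda>p. wc p a)" using finite_subset[OF fin] assms by (simp add: decomposition_def wc_in_DD)
next
  fix c assume c: "decomposition DD a c"
  have "wc p a = c p" for p
  proof -
    have "wc p a = (\<Sum>q\<in>{q. c q \<noteq> 0}. wc p (c q))"
      using c by (simp add: decomposition_def Sum_any.expand_set wc_linear)
    also have "\<dots> = (\<Sum>q\<in>{q. c q \<noteq> 0}. if q = p then c p else 0)"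
    proof (rule sum.cong)
      fix q
      have "c q \<in> DD q" using c by (simp add: decomposition_def)
      from wc_DD[OF this, of p] show "wc p (c q) = (if q = p then c p else 0)" by auto
    qed simp
    finally show ?thesis using c by (auto simp: decomposition_def)
  qed
  thus "c = (\<lambda>p. wc p a)" by auto
qed

lemma DD_Y: assumes "a \<in> DD p" "b \<in> DD q" shows "Y a k b \<in> DD (p + q - k - 1)"
proof -
  have "a \<in> sector V 0" using assms by (simp add: WC_even DD_WC)
  hence "Y Lc 1 (Y a k b) = of_int (p + q - k - 1) *s Y a k b"
    using Lc_mode[of 0 a k b] assms by (simp add: DD_iff Y_linear vs.scale_left_distrib vs.scale_left_diff_distrib)
  thus ?thesis using assms by (simp add: DD_iff WC_Y)
qed

lemma vac_DD: "vac V \<in> DD 0" and Lc_DD: "Lc \<in> DD 2"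
proof -
  show "vac V \<in> DD 0" by (simp add: DD_iff Y_creation_regular)
  have "set [(I, 0), (dual I, 0)] \<subseteq> P" if "I < 2*n" for I using that by simp
  from Lc_mon[OF this] have "Y Lc 1 (cr (I, 0) (cr (dual I, 0) (vac V))) = 2 *s cr (I, 0) (cr (dual I, 0) (vac V))"
    if "I < 2*n" for I using that by simp
  hence "Y Lc 1 Lc = 2 *s Lc" by (subst (2 3) Lc_eq) (simp add: Q_def Y_linear vs.scale_sum_right)
  thus "Lc \<in> DD 2" by (simp add: DD_iff)
qed

subsection \<open>Zhu's products\<close>

text \<open>The residue of \<open>Y(a,z) b u(z) z\<^sup>-\<^sup>t\<close>.\<close>

definition Res :: "'v \<Rightarrow> complex poly \<Rightarrow> int \<Rightarrow> 'v \<Rightarrow> 'v" where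
  "Res a u t b = (\<Sum>i\<le>degree u. coeff u i *s Y a (int i - t) b)"

abbreviation "opX \<equiv> [:1, 1:] :: complex poly"

lemma Res_bound: "degree u \<le> m \<Longrightarrow> Res a u t b = (\<Sum>i\<le>m. coeff u i *s Y a (int i - t) b)"
  unfolding Res_def by (rule sum.mono_neutral_left) (auto simp: coeff_eq_0)

lemma Res_add: "Res a (u + u') t b = Res a u t b + Res a u' t b"
proof -
  let ?m = "max (degree u) (degree u')"
  have "degree (u + u') \<le> ?m" by (rule degree_add_le_max)
  thus ?thesis by (simp add: Res_bound[of _ ?m] vs.scale_left_distrib sum.distrib)
qed

lemma Res_smult: "Res a (smult x u) t b = x *s Res a u t b"
  using Res_bound[of "smult x u" "degree u" a t b] degree_smult_le[of x u] by (simp add: Res_def vs.scale_sum_right)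

lemma Res_0 [simp]: "Res a 0 t b = 0" by (simp add: Res_def)

lemma Res_sum: "Res a (\<Sum>i\<in>A. u i) t b = (\<Sum>i\<in>A. Res a (u i) t b)"
  by (induction A rule: infinite_finite_induct) (auto simp: Res_add)

lemma Res_pCons: "Res a (pCons 0 u) t b = Res a u (t - 1) b"
proof -
  have "Res a (pCons 0 u) t b = (\<Sum>i\<le>Suc (degree u). coeff (pCons 0 u) i *s Y a (int i - t) b)"
    by (rule Res_bound) (simp add: degree_pCons_le)
  thus ?thesis by (subst (asm) sum.atMost_Suc_shift) (simp add: Res_def algebra_simps)
qed

lemma Res_monom_mult: "Res a (monom 1 i * u) t b = Res a u (t - int i) b"
  by (induction i arbitrary: t) (simp_all add: monom_Suc Res_pCons algebra_simps monom_0 flip: one_pCons)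

lemma Res_opX: "Res a (u * opX) t b = Res a u t b + Res a u (t - 1) b" by (simp add: Res_add Res_pCons)

lemma Res_hom_left: "lin (\<lambda>a. Res a u t b)" unfolding Res_def by (intro hom_sum finite_atMost hom_scale Y_left)

lemma Res_hom_right: "lin (\<lambda>b. Res a u t b)" unfolding Res_def by (intro hom_sum finite_atMost hom_scale Y_right)

lemmas Res_linear = hom_rules[OF Res_hom_left] hom_rules[OF Res_hom_right]

lemma Res_WC [intro]: "a \<in> WC \<Longrightarrow> b \<in> WC \<Longrightarrow> Res a u t b \<in> WC" unfolding Res_def by (intro WC_sum WC_scale WC_Y)

lemma Y_dV_WC: "a \<in> WC \<Longrightarrow> Y (dV a) k c = - (of_int k *s Y a (k - 1) c)" using Y_dV[of 0 a] WC_even by simp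

text \<open>Integration by parts under the residue.\<close>

lemma Res_dV: assumes "a \<in> WC" shows "Res (dV a) u t b = of_int t *s Res a u (t + 1) b - Res a (pderiv u) t b"
proof -
  let ?d = "degree u"
  have "Res (dV a) u t b = (\<Sum>i\<le>?d. (of_int t * coeff u i) *s Y a (int i - (t + 1)) b)
      - (\<Sum>i\<le>?d. (of_nat i * coeff u i) *s Y a (int i - 1 - t) b)" unfolding Res_def sum_subtractf[symmetric]
    by (intro sum.cong refl) (simp add: Y_dV_WC assms algebra_simps)
  also have "(\<Sum>i\<le>?d. (of_int t * coeff u i) *s Y a (int i - (t + 1)) b) = of_int t *s Res a u (t + 1) b"
    by (simp add: Res_def vs.scale_sum_right)
  also have "(\<Sum>i\<le>?d. (of_nat i * coeff u i) *s Y a (int i - 1 - t) b) = Res a (pderiv u) t b"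
  proof (cases ?d)
    case 0
    hence "pderiv u = 0" by (simp add: pderiv_eq_0_iff)
    thus ?thesis using 0 by simp
  next
    case (Suc m)
    have "degree (pderiv u) \<le> m" using Suc by (simp add: degree_pderiv)
    hence "Res a (pderiv u) t b = (\<Sum>i\<le>m. (of_nat (Suc i) * coeff u (Suc i)) *s Y a (int i - t) b)"
      by (simp only: Res_bound coeff_pderiv)
    moreover have s: "int (Suc i) - 1 - t = int i - t" for i by simp
    ultimately show ?thesis unfolding Suc by (subst sum.atMost_Suc_shift) (simp add: s del: of_nat_Suc)
  qed
  finally show ?thesis .
qed

lemma dV_DD: assumes "a \<in> DD p" shows "dV a \<in> DD (p + 1)"
  using DD_Y[OF assms vac_DD, of "-2"] WC_C[OF DD_WC[OF assms]] by (simp add: dV_eq add.commute)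

lemma pderiv_opX_power: "pderiv (opX ^ Suc p) = smult (of_nat (Suc p)) (opX ^ p)"
  unfolding pderiv_power_Suc by (simp add: pderiv_pCons)

lemma Res_dV_opX: assumes "a \<in> WC" shows "Res (dV a) (opX ^ Suc p) t b = of_int t *s Res a (opX ^ p) (t + 1) b
    + (of_int t - of_nat (Suc p)) *s Res a (opX ^ p) t b"
proof -
  have "Res a (opX ^ Suc p) (t + 1) b = Res a (opX ^ p) (t + 1) b + Res a (opX ^ p) t b"
    unfolding power_Suc2 Res_opX by simp
  thus ?thesis unfolding Res_dV[OF assms] pderiv_opX_power Res_smult
    by (simp add: vs.scale_right_distrib vs.scale_left_diff_distrib vs.scale_left_distrib)
qed

text \<open>Zhu's product as a bilinear map on the whole type. Taking \<open>nat p\<close> is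
  harmless, because components of negative weight vanish.\<close>

definition st :: "'v \<Rightarrow> 'v \<Rightarrow> 'v" where
  "st a b = (\<Sum>p\<in>wts a. Res (wc p a) (opX ^ nat p) 1 b)"

lemma st_expand: "finite A \<Longrightarrow> wts a \<subseteq> A \<Longrightarrow> st a b = (\<Sum>p\<in>A. Res (wc p a) (opX ^ nat p) 1 b)"
  unfolding st_def by (rule sum.mono_neutral_left) (auto simp: wc_eq_0 Res_linear)

lemma st_hom_left: "lin (\<lambda>a. st a b)"
proof -
  have "st (a + a') b = st a b + st a' b" for a a'
  proof -
    let ?A = "wts a \<union> wts a' \<union> wts (a + a')"
    have A: "finite ?A" by simp
    show ?thesis using st_expand[OF A, of "a + a'" b] st_expand[OF A, of a b] st_expand[OF A, of a' b]
      by (simp add: Un_assoc le_supI1 le_supI2 wc_linear Res_linear sum.distrib)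
  qed
  moreover have "st (x *s a) b = x *s st a b" for x a
  proof -
    let ?A = "wts a \<union> wts (x *s a)"
    have A: "finite ?A" by simp
    show ?thesis using st_expand[OF A, of "x *s a" b] st_expand[OF A, of a b]
      by (simp add: wc_linear Res_linear vs.scale_sum_right)
  qed
  ultimately show ?thesis by (simp add: module_hom_def')
qed

lemma st_hom_right: "lin (st a)" unfolding st_def[abs_def] by (intro hom_sum finite_wts Res_hom_right)

lemmas st_linear = hom_rules[OF st_hom_left] hom_rules[OF st_hom_right]

lemma st_WC [intro]: "a \<in> WC \<Longrightarrow> b \<in> WC \<Longrightarrow> st a b \<in> WC" unfolding st_def by (intro WC_sum Res_WC wc_WC)

lemma st_DD: assumes "a \<in> DD (int p)" shows "st a b = Res a (opX ^ p) 1 b"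
proof (cases "a = 0")
  case True
  thus ?thesis by (simp add: st_linear Res_linear)
next
  case False
  have "st a b = (\<Sum>q\<in>insert (int p) (wts a). Res (wc q a) (opX ^ nat q) 1 b)" by (rule st_expand) auto
  also have "\<dots> = (\<Sum>q\<in>insert (int p) (wts a). if q = int p then Res a (opX ^ p) 1 b else 0)"
    by (rule sum.cong) (auto simp: wc_DD[OF assms] Res_linear)
  finally show ?thesis by simp
qed

lemma coeff_opX_power: "coeff (opX ^ p) i = of_nat (p choose i)"
proof (cases "i \<le> p")
  case False
  moreover have "degree (opX ^ p) = p" by (simp add: degree_power_eq)
  ultimately show ?thesis by (simp add: coeff_eq_0 binomial_eq_0)
qed (simp add: coeff_linear_poly_power)

lemma zhu_res_eq: assumes "a \<in> WC" "b \<in> WC" shows "zhu_res W r (int p) a b = Res a (opX ^ p) r b"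
proof -
  have "zhu_res W r (int p) a b = Sum_any (\<lambda>j::nat. of_nat (p choose j) *s Y a (int j - r) b)"
    using assms by (simp add: zhu_res_def Y_mode WC_C binomial_gbinomial)
  also have "\<dots> = (\<Sum>j\<le>p. of_nat (p choose j) *s Y a (int j - r) b)"
    by (rule Sum_any.expand_superset) (auto intro: ccontr)
  also have "\<dots> = Res a (opX ^ p) r b" by (subst Res_bound[of _ p]) (auto simp: coeff_opX_power degree_power_eq)
  finally show ?thesis .
qed

lemma zhu_star_eq: assumes "a \<in> WC" "b \<in> WC" shows "zhu_star W DD a b = st a b"
proof -
  have *: "zhu_res W 1 p (wc p a) b = Res (wc p a) (opX ^ nat p) 1 b" for p
  proof (cases "p < 0")
    case True
    hence "wc p a = 0" by (rule wc_neg)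
    thus ?thesis using assms by (simp add: zhu_res_def Y_mode[OF C_zero WC_C, symmetric] Res_linear)
  next
    case False
    thus ?thesis using zhu_res_eq[OF wc_WC[OF assms(1)] assms(2), of 1 "nat p"] by simp
  qed
  show ?thesis unfolding zhu_star_def decomposition_wc[OF assms(1)] * st_def
    by (rule Sum_any.expand_superset) (auto, metis wc_eq_0 Res_linear(6))
qed

abbreviation "ZO \<equiv> zhu_O W DD"

text \<open>Negative weights contribute only zero, so the powers of \<open>1 + z\<close> may be
  taken to be polynomials.\<close>

lemma ZO_eq: "ZO = vs.span {Res a (opX ^ p) 2 b | p a b. a \<in> DD (int p) \<and> b \<in> WC}"
proof -
  let ?A = "{zhu_res W 2 k a b | k a b. a \<in> DD k \<and> b \<in> WC}"
  let ?B = "{Res a (opX ^ p) 2 b | p a b. a \<in> DD (int p) \<and> b \<in> WC}"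
  have "w \<in> insert 0 ?B" if "w \<in> ?A" for w
  proof -
    from that obtain k a b where w: "w = zhu_res W 2 k a b" "a \<in> DD k" "b \<in> WC" by blast
    show ?thesis
    proof (cases "k < 0")
      case True
      hence "a = 0" using DD_neg w by blast
      hence "w = 0" using w by (simp add: zhu_res_def Y_mode[OF C_zero WC_C, symmetric])
      thus ?thesis by simp
    next
      case False
      hence "w = Res a (opX ^ nat k) 2 b" "a \<in> DD (int (nat k))"
        using w zhu_res_eq[OF DD_WC[OF w(2)] w(3), of 2 "nat k"] by auto
      thus ?thesis using w(3) by blast
    qed
  qed
  hence "vs.span ?A \<subseteq> vs.span (insert 0 ?B)" by (intro vs.span_mono) blast
  moreover have "w \<in> ?A" if "w \<in> ?B" for w
  proof -
    from that obtain p a b where w: "w = Res a (opX ^ p) 2 b" "a \<in> DD (int p)" "b \<in> WC" by blast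
    hence "w = zhu_res W 2 (int p) a b" using zhu_res_eq[OF DD_WC[OF w(2)] w(3)] by simp
    thus ?thesis using w by blast
  qed
  hence "vs.span ?B \<subseteq> vs.span ?A" by (intro vs.span_mono) blast
  ultimately show ?thesis unfolding zhu_O_def W_simps by (simp only: vs.span_insert_0 set_eq_subset)
qed

lemma ZO_subspace: "vs.subspace ZO" unfolding ZO_eq by (rule vs.subspace_span)

lemmas ZO_zero [simp, intro] = vs.subspace_0[OF ZO_subspace]
lemmas ZO_add = vs.subspace_add[OF ZO_subspace]
lemmas ZO_scale = vs.subspace_scale[OF ZO_subspace]
lemmas ZO_diff = vs.subspace_diff[OF ZO_subspace]
lemmas ZO_neg = vs.subspace_neg[OF ZO_subspace]
lemmas ZO_sum = vs.subspace_sum[OF ZO_subspace]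

lemma ZO_WC: "w \<in> ZO \<Longrightarrow> w \<in> WC"
proof -
  have "ZO \<subseteq> WC" unfolding ZO_eq by (rule vs.span_minimal[OF _ WC_subspace]) (auto intro: Res_WC DD_WC)
  thus "w \<in> ZO \<Longrightarrow> w \<in> WC" by blast
qed

text \<open>Induction on the order of the pole. By \<open>Res_dV_opX\<close> the residue of
  \<open>dV a\<close> with pole order \<open>t\<close> is \<open>t\<close> times the one of
  \<open>a\<close> with order \<open>t + 1\<close>, up to a multiple of the one with order
  \<open>t\<close>; and \<open>t \<ge> 2\<close> is invertible.\<close>

lemma Res_ZO: "a \<in> DD (int p) \<Longrightarrow> b \<in> WC \<Longrightarrow> Res a (opX ^ p) (int r + 2) b \<in> ZO"
proof (induction r arbitrary: a p)
  case 0
  thus ?case unfolding ZO_eq by (intro vs.span_base) auto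
next
  case (Suc r)
  let ?t = "int r + 2"
  have "dV a \<in> DD (int (Suc p))" using dV_DD[OF Suc.prems(1)] by (simp add: add.commute)
  hence 1: "Res (dV a) (opX ^ Suc p) ?t b \<in> ZO" using Suc by blast
  have 2: "Res a (opX ^ p) ?t b \<in> ZO" using Suc by blast
  have "of_int ?t *s Res a (opX ^ p) (?t + 1) b =
    Res (dV a) (opX ^ Suc p) ?t b - (of_int ?t - of_nat (Suc p)) *s Res a (opX ^ p) ?t b"
    unfolding Res_dV_opX[OF DD_WC[OF Suc.prems(1)]] by simp
  hence "of_int ?t *s Res a (opX ^ p) (?t + 1) b \<in> ZO" using ZO_diff[OF 1 ZO_scale[OF 2]] by (simp only:)
  hence "(1 / of_int ?t) *s of_int ?t *s Res a (opX ^ p) (?t + 1) b \<in> ZO" by (rule ZO_scale)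
  moreover have "complex_of_int ?t \<noteq> 0" by (simp only: of_int_eq_0_iff)
  moreover have "?t + 1 = int (Suc r) + 2" by simp
  ultimately show ?case by (metis (no_types, lifting) nonzero_divide_eq_eq vs.scale_one vs.scale_scale)
qed

text \<open>In the expansion of
  \<open>(1+z)\<^sup>s / z\<^sup>s\<^sup>+\<^sup>2\<^sup>+\<^sup>r\<close> all poles have order at
  least \<open>2\<close>.\<close>

lemma Res_ZO_shift: assumes "a \<in> DD (int p)" "b \<in> WC" shows "Res a (opX ^ (p + s)) (int s + 2 + int r) b \<in> ZO"
proof (induction s arbitrary: r)
  case 0
  thus ?case using Res_ZO[OF assms, of r] by (simp add: add.commute)
next
  case (Suc s)
  have "Res a (opX ^ (p + Suc s)) (int (Suc s) + 2 + int r) b =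
    Res a (opX ^ (p + s)) (int s + 2 + int (Suc r)) b + Res a (opX ^ (p + s)) (int s + 2 + int r) b"
    unfolding add_Suc_right power_Suc2 Res_opX by (simp add: algebra_simps)
  thus ?case using ZO_add[OF Suc[of "Suc r"] Suc[of r]] by (simp only:)
qed

text \<open>In the expansion of \<open>(1+z)\<^sup>s / z\<^sup>s\<^sup>+\<^sup>1\<close> the simple
  pole has coefficient \<open>1\<close>; all other terms have higher order and fall into
  \<open>ZO\<close>.\<close>

lemma Res_star_shift: assumes "a \<in> DD (int p)" "b \<in> WC"
  shows "Res a (opX ^ (p + s)) (int s + 1) b - Res a (opX ^ p) 1 b \<in> ZO"
proof (induction s)
  case (Suc s)
  have "Res a (opX ^ (p + Suc s)) (int (Suc s) + 1) b - Res a (opX ^ p) 1 b =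
    Res a (opX ^ (p + s)) (int s + 2 + int 0) b + (Res a (opX ^ (p + s)) (int s + 1) b - Res a (opX ^ p) 1 b)"
    unfolding add_Suc_right power_Suc2 Res_opX by (simp add: algebra_simps)
  thus ?case using ZO_add[OF Res_ZO_shift[OF assms, of s 0] Suc] by (simp only:)
qed simp

text \<open>\<open>[\<partial>a] = - wt(a) [a]\<close> in the Zhu algebra.\<close>

lemma dV_star: assumes "a \<in> DD (int p)" "w \<in> WC" shows "st (dV a + of_nat p *s a) w \<in> ZO"
proof -
  have d: "dV a \<in> DD (int (Suc p))" using dV_DD[OF assms(1)] by (simp add: add.commute)
  have "st (dV a + of_nat p *s a) w = Res (dV a) (opX ^ Suc p) 1 w + of_nat p *s Res a (opX ^ p) 1 w"
    by (simp only: st_linear st_DD[OF d] st_DD[OF assms(1)])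
  also have "\<dots> = Res a (opX ^ p) (int 0 + 2) w"
    unfolding Res_dV_opX[OF DD_WC[OF assms(1)]] by (simp add: vs.scale_left_diff_distrib vs.scale_left_distrib)
  finally show ?thesis using Res_ZO[OF assms, of 0] by (simp only:)
qed

lemma Res_vac: assumes "a \<in> WC"
  shows "Res a (opX ^ p) 1 (vac V) = a" "Res a (opX ^ p) 2 (vac V) = dV a + of_nat p *s a"
proof -
  have d: "degree (opX ^ p) \<le> Suc p" by (simp add: degree_power_eq)
  have a: "a \<in> C" using assms WC_C by blast
  have "Res a (opX ^ p) 1 (vac V) = (\<Sum>i\<in>{0}. of_nat (p choose i) *s Y a (int i - 1) (vac V))"
    unfolding Res_bound[OF d] coeff_opX_power by (rule sum.mono_neutral_right) (auto simp: Y_creation_regular)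
  thus "Res a (opX ^ p) 1 (vac V) = a" using a by (simp add: Y_creation)
  have "Res a (opX ^ p) 2 (vac V) = (\<Sum>i\<in>{0, 1}. of_nat (p choose i) *s Y a (int i - 2) (vac V))"
    unfolding Res_bound[OF d] coeff_opX_power by (rule sum.mono_neutral_right) (auto simp: Y_creation_regular)
  thus "Res a (opX ^ p) 2 (vac V) = dV a + of_nat p *s a" using a by (simp add: Y_creation dV_eq)
qed

lemma st_vac: assumes "a \<in> WC" shows "st a (vac V) = a"
  unfolding st_def using wc_sum[OF WC_C[OF assms] finite_wts order_refl] by (simp add: Res_vac wc_WC assms)

subsection \<open>Commutators of Zhu multiplications\<close>

lemma alternating_binomial:
  "(\<Sum>i\<le>j. (-1) ^ (j - i) * (of_nat (m choose i) :: complex)) = (of_int (int m - 1) gchoose j)"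
proof -
  have "(\<Sum>i\<le>j. (-1) ^ (j - i) * (of_nat (m choose i) :: complex)) = (-1) ^ j * (\<Sum>i\<le>j. (of_nat m gchoose i) * (-1) ^ i)"
    unfolding sum_distrib_left
    by (rule sum.cong) (auto simp: binomial_gbinomial power_diff_conv_inverse minus_one_power_iff)
  also have "\<dots> = (of_nat m - 1 gchoose j)"
    unfolding gbinomial_sum_lower_neg by (simp flip: mult.assoc power_mult_distrib)
  finally show ?thesis by simp
qed

text \<open>The \<open>j\<close>-th divided derivative of \<open>(1+z)\<^sup>p / z\<close>, multiplied by \<open>z\<^sup>j\<^sup>+\<^sup>1\<close>.\<close>

definition divder :: "nat \<Rightarrow> nat \<Rightarrow> complex poly" where
  "divder p j = (\<Sum>i\<le>j. smult ((-1) ^ (j - i) * of_nat (p choose i)) (monom 1 i * opX ^ (p - i)))"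

lemma coeff_divder: "coeff (divder p j) m = of_nat (p choose m) * (of_int (int m - 1) gchoose j)"
proof -
  have "coeff (smult ((-1) ^ (j - i) * of_nat (p choose i)) (monom 1 i * opX ^ (p - i))) m
    = of_nat (p choose m) * ((-1) ^ (j - i) * of_nat (m choose i))" for i
  proof (cases "i \<le> m \<and> m \<le> p")
    case True
    hence "(p choose i) * ((p - i) choose (m - i)) = (p choose m) * (m choose i)"
      using choose_mult[of i m p] by simp
    hence "(of_nat (p choose i) * of_nat ((p - i) choose (m - i)) :: complex) = of_nat (p choose m) * of_nat (m choose i)"
      by (simp only: of_nat_mult[symmetric])
    thus ?thesis using True by (simp add: coeff_monom_mult coeff_opX_power mult_ac)
  next
    case False
    moreover have "(p choose i) * ((p - i) choose (m - i)) = 0" if "p < m" "i \<le> m"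
      using that by (cases "i \<le> p") (auto simp: binomial_eq_0)
    ultimately show ?thesis
      by (auto simp: coeff_monom_mult coeff_opX_power binomial_eq_0 not_le simp flip: of_nat_mult)
  qed
  thus ?thesis by (simp only: divder_def coeff_sum sum_distrib_left[symmetric] alternating_binomial)
qed

lemma divder_expand: "divder p j = (\<Sum>i\<le>p. smult (coeff (divder p j) i) (monom 1 i))"
proof -
  have "degree (divder p j) \<le> p" by (rule degree_le) (simp add: coeff_divder binomial_eq_0)
  from poly_as_sum_of_monoms'[OF this] show ?thesis by (simp add: smult_monom)
qed

lemma Res_opX_power: "Res a (opX ^ p) t d = (\<Sum>i\<le>p. of_nat (p choose i) *s Y a (int i - t) d)"
  by (subst Res_bound[of _ p]) (auto simp: degree_power_eq coeff_opX_power)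

lemma Res_divder:
  "Res y (divder p j * opX ^ q) s c
     = (\<Sum>i\<le>p. \<Sum>l\<le>q. (of_nat (p choose i) * of_nat (q choose l) * (of_int (int i - 1) gchoose j)) *s Y y (int i + int l - s) c)"
proof -
  have "Res y (divder p j * opX ^ q) s c = (\<Sum>i\<le>p. coeff (divder p j) i *s Res y (opX ^ q) (s - int i) c)"
    by (subst divder_expand) (simp only: sum_distrib_right mult_smult_left Res_sum Res_smult Res_monom_mult)
  also have "\<dots> = (\<Sum>i\<le>p. \<Sum>l\<le>q. (of_nat (p choose i) * of_nat (q choose l) * (of_int (int i - 1) gchoose j)) *s Y y (int i + int l - s) c)"
    unfolding coeff_divder Res_opX_power vs.scale_sum_right by (intro sum.cong refl) (simp add: algebra_simps)
  finally show ?thesis .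
qed

text \<open>The commutator formula brings in the coefficients of the divided derivatives of
  \<open>(1+z)\<^sup>p / z\<close>, and \<open>divder\<close> rewrites these in powers of
  \<open>1 + z\<close>. The exponent \<open>p + q - i\<close> exceeds the weight of
  \<open>Y a (int j) b\<close> by \<open>j + 1 - i\<close>, and the pole order grows by the same
  amount, as the shift lemmas require.\<close>

lemma Res_commutator: assumes "a \<in> DD (int p)" "b \<in> DD (int q)" and J: "\<And>j. j \<ge> J \<Longrightarrow> Y a (int j) b = 0"
  shows "Res a (opX ^ p) 1 (Res b (opX ^ q) t c) - Res b (opX ^ q) t (Res a (opX ^ p) 1 c) =
    (\<Sum>j<J. \<Sum>i\<le>min j p. ((-1) ^ (j - i) * of_nat (p choose i)) *s
        Res (Y a (int j) b) (opX ^ (p + q - i)) (t + int j + 1 - int i) c)"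
proof -
  let ?m = "\<lambda>i l. of_nat (p choose i) * of_nat (q choose l)" and ?e = "\<lambda>i j. (-1) ^ (j - i) * of_nat (p choose i)"
  let ?g = "\<lambda>i j l. (of_nat (p choose i) * of_nat (q choose l) * (of_int (int i - 1) gchoose j)) *s
    Y (Y a (int j) b) (int i + int l - (t + int j + 1)) c"
  have ev: "a \<in> sector V 0" "b \<in> sector V 0" using assms by (auto intro: WC_even DD_WC)
  have c: "Y a m (Y b k c) - Y b k (Y a m c) = (\<Sum>j<J. (of_int m gchoose j) *s Y (Y a (int j) b) (m + k - int j) c)" for m k
    using Y_commutator[OF _ _ ev J, where m = m and k = k and c = c] by simp
  have "Res a (opX ^ p) 1 (Res b (opX ^ q) t c) - Res b (opX ^ q) t (Res a (opX ^ p) 1 c) =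
      (\<Sum>i\<le>p. \<Sum>l\<le>q. ?m i l *s (Y a (int i - 1) (Y b (int l - t) c) - Y b (int l - t) (Y a (int i - 1) c)))"
  proof -
    have "Res b (opX ^ q) t (Res a (opX ^ p) 1 c) = (\<Sum>i\<le>p. \<Sum>l\<le>q. ?m i l *s Y b (int l - t) (Y a (int i - 1) c))"
      unfolding Res_opX_power Y_linear vs.scale_sum_right by (subst sum.swap) (simp add: mult.commute)
    moreover have "Res a (opX ^ p) 1 (Res b (opX ^ q) t c) = (\<Sum>i\<le>p. \<Sum>l\<le>q. ?m i l *s Y a (int i - 1) (Y b (int l - t) c))"
      unfolding Res_opX_power Y_linear vs.scale_sum_right by simp
    ultimately show ?thesis by (simp add: sum_subtractf vs.scale_right_diff_distrib)
  qed
  also have "\<dots> = (\<Sum>j<J. \<Sum>i\<le>p. \<Sum>l\<le>q. ?g i j l)"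
  proof -
    have "(\<Sum>i\<le>p. \<Sum>l\<le>q. ?m i l *s (Y a (int i - 1) (Y b (int l - t) c) - Y b (int l - t) (Y a (int i - 1) c))) =
       (\<Sum>i\<le>p. \<Sum>l\<le>q. \<Sum>j<J. ?g i j l)"
      unfolding c vs.scale_sum_right by (intro sum.cong refl) (simp add: algebra_simps)
    also have "\<dots> = (\<Sum>i\<le>p. \<Sum>j<J. \<Sum>l\<le>q. ?g i j l)" by (rule sum.cong[OF refl]) (rule sum.swap)
    finally show ?thesis by (subst (asm) sum.swap[of _ "{..<J}" "{..p}"])
  qed
  also have "\<dots> = (\<Sum>j<J. \<Sum>i\<le>min j p. ?e i j *s
        Res (Y a (int j) b) (opX ^ (p + q - i)) (t + int j + 1 - int i) c)"
  proof (rule sum.cong[OF refl])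
    fix j
    let ?y = "Y a (int j) b" and ?s = "t + int j + 1"
    have "(\<Sum>i\<le>p. \<Sum>l\<le>q. ?g i j l)
      = Res ?y (divder p j * opX ^ q) ?s c" by (rule Res_divder[symmetric])
    also have "\<dots> = (\<Sum>i\<le>j. ?e i j *s Res ?y (opX ^ (p - i + q)) (?s - int i) c)"
      by (simp only: divder_def sum_distrib_right mult_smult_left Res_sum Res_smult mult.assoc Res_monom_mult power_add[symmetric])
    also have "\<dots> = (\<Sum>i\<le>min j p. ?e i j *s Res ?y (opX ^ (p - i + q)) (?s - int i) c)"
      by (rule sum.mono_neutral_right) (auto simp: binomial_eq_0)
    also have "\<dots> = (\<Sum>i\<le>min j p. ?e i j *s Res ?y (opX ^ (p + q - i)) (?s - int i) c)" by (rule sum.cong) auto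
    finally show "(\<Sum>i\<le>p. \<Sum>l\<le>q. ?g i j l) = (\<Sum>i\<le>min j p. ?e i j *s
        Res ?y (opX ^ (p + q - i)) (?s - int i) c)" .
  qed
  finally show ?thesis .
qed

lemma Y_pos_DD: assumes "a \<in> DD (int p)" "b \<in> DD (int q)" "p + q \<le> j" shows "Y a (int j) b = 0"
  by (rule DD_neg[OF _ DD_Y[OF assms(1,2), of "int j"]]) (use assms(3) in auto)

text \<open>For a generator of \<open>ZO\<close>, the commutator consists of residues covered by
  \<open>Res_ZO_shift\<close>, and the product in the reverse order is itself a generator.\<close>

lemma st_ZO: assumes a: "a \<in> DD (int p)" and "w \<in> ZO" shows "st a w \<in> ZO" using assms(2) unfolding ZO_eq
proof (induction rule: vs.span_induct)
  case base
  have "{x. st a x \<in> vs.span {Res a (opX ^ p) 2 b |p a b. a \<in> DD (int p) \<and> b \<in> WC}} = {x. st a x \<in> ZO}"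
    by (simp only: ZO_eq)
  thus ?case using ZO_subspace by (auto simp: vs.subspace_def st_linear)
next
  case (step w)
  then obtain q b c where w: "w = Res b (opX ^ q) 2 c" and b: "b \<in> DD (int q)" and c: "c \<in> WC" by blast
  have st: "st a d = Res a (opX ^ p) 1 d" for d by (rule st_DD[OF a])
  have *: "Res (Y a (int j) b) (opX ^ (p + q - i)) (2 + int j + 1 - int i) c \<in> ZO" if ji: "i \<le> min j p" "j < p + q" for i j
  proof -
    have "int p + int q - int j - 1 = int (p + q - j - 1)" using that by auto
    hence r: "Y a (int j) b \<in> DD (int (p + q - j - 1))" using DD_Y[OF a b, of "int j"] by (simp only:)
    have 1: "p + q - i = (p + q - j - 1) + (j + 1 - i)" using that by auto
    have 2: "2 + int j + 1 - int i = int (j + 1 - i) + 2 + int 0" using that by auto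
    show ?thesis unfolding 1 2 by (rule Res_ZO_shift[OF r c])
  qed
  have "Res a (opX ^ p) 1 (Res b (opX ^ q) 2 c) - Res b (opX ^ q) 2 (Res a (opX ^ p) 1 c) \<in> ZO"
    by (simp only: Res_commutator[OF a b Y_pos_DD[OF a b], where t = 2 and c = c])
      (intro ZO_sum ZO_scale *, auto)
  moreover have "Res b (opX ^ q) 2 (Res a (opX ^ p) 1 c) \<in> ZO"
    using Res_ZO[OF b, of "Res a (opX ^ p) 1 c" 0] Res_WC[OF DD_WC[OF a] c] by simp
  ultimately have "st a w \<in> ZO" unfolding w st using ZO_add by fastforce
  thus ?case by (simp only: ZO_eq)
qed

text \<open>By \<open>Res_star_shift\<close>, every residue in \<open>Res_commutator\<close> is
  modulo \<open>ZO\<close> the product with \<open>Y a (int j) b\<close>. The coefficients left over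
  are summed by \<open>alternating_binomial\<close>.\<close>

lemma st_commutator: assumes a: "a \<in> DD (int p)" and b: "b \<in> DD (int q)" and c: "c \<in> WC"
  shows "st a (st b c) - st b (st a c) - st (\<Sum>j<p+q. (of_int (int p - 1) gchoose j) *s Y a (int j) b) c \<in> ZO"
proof -
  have y: "Y a (int j) b \<in> DD (int (p + q - j - 1))" if "j < p + q" for j
  proof -
    have "int p + int q - int j - 1 = int (p + q - j - 1)" using that by auto
    thus ?thesis using DD_Y[OF a b, of "int j"] by (simp only:)
  qed
  have "st (\<Sum>j<p+q. (of_int (int p - 1) gchoose j) *s Y a (int j) b) c =
     (\<Sum>j<p+q. \<Sum>i\<le>min j p. ((-1) ^ (j - i) * of_nat (p choose i)) *s st (Y a (int j) b) c)"
  proof -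
    have "(of_int (int p - 1) gchoose j) *s st (Y a (int j) b) c =
      (\<Sum>i\<le>min j p. ((-1) ^ (j - i) * of_nat (p choose i)) *s st (Y a (int j) b) c)" for j
    proof -
      have "(\<Sum>i\<le>min j p. (-1) ^ (j - i) * of_nat (p choose i)) = (\<Sum>i\<le>j. (-1) ^ (j - i) * of_nat (p choose i) :: complex)"
        by (rule sum.mono_neutral_left) (auto simp: binomial_eq_0)
      thus ?thesis unfolding vs.scale_sum_left[symmetric] alternating_binomial by simp
    qed
    thus ?thesis by (simp only: st_linear)
  qed
  hence "st a (st b c) - st b (st a c) - st (\<Sum>j<p+q. (of_int (int p - 1) gchoose j) *s Y a (int j) b) c
    = (\<Sum>j<p+q. \<Sum>i\<le>min j p. ((-1) ^ (j - i) * of_nat (p choose i)) *s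
        (Res (Y a (int j) b) (opX ^ (p + q - i)) (1 + int j + 1 - int i) c - st (Y a (int j) b) c))"
    using Res_commutator[OF a b Y_pos_DD[OF a b], where t = 1 and c = c]
    by (simp add: st_DD[OF a] st_DD[OF b] vs.scale_right_diff_distrib sum_subtractf)
  moreover have "Res (Y a (int j) b) (opX ^ (p + q - i)) (1 + int j + 1 - int i) c - st (Y a (int j) b) c \<in> ZO"
    if "i \<le> min j p" "j < p + q" for i j
  proof -
    have 1: "p + q - i = (p + q - j - 1) + (j + 1 - i)" using that by auto
    have 2: "1 + int j + 1 - int i = int (j + 1 - i) + 1" using that by auto
    show ?thesis unfolding 1 2 st_DD[OF y[OF that(2)]] by (rule Res_star_shift[OF y[OF that(2)] c])
  qed
  ultimately show ?thesis by (simp only:) (intro ZO_sum ZO_scale, auto)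
qed

subsection \<open>Quadratic fields\<close>

abbreviation xq :: "nat \<Rightarrow> nat \<Rightarrow> 'v" where "xq k l \<equiv> Q k l (vac V)"

lemma cr_vac_mode: assumes "A < 2*n"
  shows "Y (cr (A, l) (vac V)) m c = ((-1) ^ l * (of_int m gchoose l)) *s Y (G A) (m - int l) c"
proof -
  have "fact l *s Y (cr (A, l) (vac V)) m c = Y ((dV ^^ l) (G A)) m c"
    unfolding dV_G_vac[OF assms] by (simp add: Y_linear)
  also have "\<dots> = fact l *s (((-1) ^ l * (of_int m gchoose l)) *s Y (G A) (m - int l) c)"
    using Y_dV_pow[of 1 "G A" l m c] G_sector[OF assms] by (simp add: mult_ac)
  finally show ?thesis by (rule vs.scale_left_imp_eq[OF fact_nonzero])
qed

text \<open>The shift by \<open>l\<close> comes from the derivative on the second factor. With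
  \<open>m \<ge> -1\<close>, all inner modes vanish from \<open>j = J + l + 1\<close> on.\<close>

lemma quad_mode: assumes I: "I < 2*n" and J: "\<And>A j. A < 2*n \<Longrightarrow> j \<ge> J \<Longrightarrow> Y (G A) (int j) c = 0" and m: "m \<ge> -1"
  shows "Y (cr (I, k) (cr (dual I, l) (vac V))) m c =
    (\<Sum>j<J+l+1. ((-1) ^ j * (of_int (- int k - 1) gchoose j)) *s
      (((-1) ^ l * (of_int (m + int j) gchoose l)) *s Y (G I) (- int k - 1 - int j) (Y (G (dual I)) (m + int j - int l) c)
       + ((-1) powi (- int k - 1) * ((-1) ^ l * (of_int (- int k - 1 + m - int j) gchoose l))) *s
          Y (G (dual I)) (- int k - 1 + m - int j - int l) (Y (G I) (int j) c)))"
proof -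
  have dI: "dual I < 2*n" using I by simp
  have v: "cr (dual I, l) (vac V) \<in> sector V 1" using mon_sector[of "[(dual I, l)]"] dI by simp
  have "Y (cr (dual I, l) (vac V)) (m + int j) c = 0" if "j \<ge> J + l + 1" for j
  proof -
    have "m + int j - int l = int (nat (m + int j - int l))" "nat (m + int j - int l) \<ge> J" using that m by auto
    hence "Y (G (dual I)) (m + int j - int l) c = 0" using J[OF dI, of "nat (m + int j - int l)"] by simp
    thus ?thesis by (simp add: cr_vac_mode[OF dI])
  qed
  hence "Y (Y (G I) (- int k - 1) (cr (dual I, l) (vac V))) m c =
      (\<Sum>j<J+l+1. ((-1) ^ j * (of_int (- int k - 1) gchoose j)) *s
        (Y (G I) (- int k - 1 - int j) (Y (cr (dual I, l) (vac V)) (m + int j) c)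
         - ((-1) powi (- int k - 1) * (-1) ^ (1 * 1)) *s Y (cr (dual I, l) (vac V)) (- int k - 1 + m - int j) (Y (G I) (int j) c)))"
    using J[OF I] by (intro Y_iterate G_sector I v) auto
  thus ?thesis by (simp add: cr_def[of "(I, k)"] cr_vac_mode[OF dI] Y_linear)
qed

lemma G_mode_F: assumes "I < 2*n" "a \<in> F d h"
  shows "Y (G I) m a \<in> F (d + 1) (h - m)" "m \<ge> 0 \<Longrightarrow> Y (G I) m a \<in> F (d - 1) (h - m)"
proof -
  show *: "Y (G I) m a \<in> F (d - 1) (h - m)" if "m \<ge> 0" for m
  proof (cases "m = 0")
    case False
    define k where "k = nat (m - 1)"
    have k: "m = int k + 1" using False that by (simp add: k_def)
    have "complex_of_nat (Suc k) \<noteq> 0" by (simp del: of_nat_Suc)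
    hence "Y (G I) m a = (of_nat (Suc k) * sg (dual I)) *s an (dual I, k) a"
      using assms(1) by (simp add: an_def k del: of_nat_Suc)
    moreover have "an (dual I, k) a \<in> F (d - 1) (h - m)"
      using an_F[of "(dual I, k)" a d h] assms by (simp add: k diff_diff_eq)
    ultimately show ?thesis by (simp only: F_scale)
  qed (use assms in simp)
  show "Y (G I) m a \<in> F (d + 1) (h - m)"
  proof (cases "m \<ge> 0")
    case True
    thus ?thesis using *[OF True] F_mono[of "d - 1" "d + 1" "h - m" "h - m"] by auto
  next
    case False
    hence "Y (G I) m a = cr (I, nat (- m - 1)) a" by (simp add: cr_def)
    thus ?thesis using cr_F[of "(I, nat (- m - 1))" a d h] assms False by (simp add: algebra_simps)
  qed
qed

lemma gbinomial_small: "0 \<le> x \<Longrightarrow> x < int l \<Longrightarrow> (of_int x gchoose l :: complex) = 0"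
proof -
  assume "0 \<le> x" "x < int l"
  hence "x = int (nat x)" "nat x < l" by auto
  hence "(of_int x :: complex) = of_nat (nat x)" by (metis of_int_of_nat_eq)
  thus ?thesis using \<open>nat x < l\<close> by (simp add: binomial_eq_0 flip: binomial_gbinomial)
qed

text \<open>In \<open>x\<^sub>(\<^sub>m\<^sub>)\<close> with \<open>m \<ge> 0\<close> every term contains an annihilation operator; for \<open>m = -1\<close>
  there is one exception, the product of two creation operators.\<close>

lemma quad_mode_F: assumes I: "I < 2*n" and c: "c \<in> F d h" and m: "m \<ge> -1"
  shows "Y (cr (I, k) (cr (dual I, l) (vac V))) m c - (if m = -1 then cr (I, k) (cr (dual I, l) c) else 0)
      \<in> F d (h + int k + int l + 1 - m)"
proof -
  have dI: "dual I < 2*n" using I by simp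
  define J where "J = nat h + 1"
  have J: "\<And>A j. A < 2*n \<Longrightarrow> j \<ge> J \<Longrightarrow> Y (G A) (int j) c = 0" using G_large[OF c] by (simp add: J_def)
  let ?h = "h + int k + int l + 1 - m"
  define T1 where "T1 j = ((-1) ^ l * (of_int (m + int j) gchoose l)) *s Y (G I) (- int k - 1 - int j) (Y (G (dual I)) (m + int j - int l) c)" for j
  define T2 where "T2 j = ((-1) powi (- int k - 1) * ((-1) ^ l * (of_int (- int k - 1 + m - int j) gchoose l))) *s
          Y (G (dual I)) (- int k - 1 + m - int j - int l) (Y (G I) (int j) c)" for j
  have T1: "T1 j \<in> F d ?h" if "m \<ge> 0 \<or> j > 0" for j
  \<comment> \<open>If \<open>m + j < l\<close>, the inner mode would be a creator; but then
    \<open>0 \<le> m + j\<close>, and the binomial coefficient is zero.\<close>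
  proof (cases "m + int j < int l")
    case True
    thus ?thesis using gbinomial_small[of "m + int j" l] that m by (auto simp: T1_def)
  next
    case False
    have "Y (G I) (- int k - 1 - int j) (Y (G (dual I)) (m + int j - int l) c)
       \<in> F (d - 1 + 1) (h - (m + int j - int l) - (- int k - 1 - int j))"
      using False by (intro G_mode_F(1)[OF I] G_mode_F(2)[OF dI c]) auto
    moreover have "d - 1 + 1 = d" "h - (m + int j - int l) - (- int k - 1 - int j) = ?h" by auto
    ultimately show ?thesis unfolding T1_def by (auto intro: F_scale)
  qed
  have T2: "T2 j \<in> F d ?h" for j
  proof -
    have "Y (G (dual I)) (- int k - 1 + m - int j - int l) (Y (G I) (int j) c)
      \<in> F (d - 1 + 1) (h - int j - (- int k - 1 + m - int j - int l))"
      by (intro G_mode_F(1)[OF dI] G_mode_F(2)[OF I c]) auto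
    moreover have "d - 1 + 1 = d" "h - int j - (- int k - 1 + m - int j - int l) = ?h" by auto
    ultimately show ?thesis unfolding T2_def by (auto intro: F_scale)
  qed
  have e: "Y (cr (I, k) (cr (dual I, l) (vac V))) m c =
      (\<Sum>j<J+l+1. ((-1) ^ j * (of_int (- int k - 1) gchoose j)) *s (T1 j + T2 j))"
    unfolding T1_def T2_def by (rule quad_mode[OF I J m])
  show ?thesis
  proof (cases "m = -1")
    case False
    hence "\<And>j. T1 j \<in> F d ?h" using T1 m by simp
    thus ?thesis using False T2 unfolding e by (auto intro!: F_sum F_scale F_add)
  next
    case True
    have i: "- 1 + int 0 - int l = - int l - 1" by simp
    have "T1 0 = cr (I, k) (cr (dual I, l) c)"
      unfolding T1_def True i by (simp add: cr_def binomial_minus_one flip: power_mult_distrib)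
    moreover have "Y (cr (I, k) (cr (dual I, l) (vac V))) m c = T1 0 + (T2 0 + (\<Sum>j<J+l. ((-1) ^ Suc j * (of_int (- int k - 1) gchoose Suc j)) *s (T1 (Suc j) + T2 (Suc j))))"
      unfolding e add.right_neutral Suc_eq_plus1[symmetric] by (subst sum.lessThan_Suc_shift) simp
    moreover have "T2 0 + (\<Sum>j<J+l. ((-1) ^ Suc j * (of_int (- int k - 1) gchoose Suc j)) *s (T1 (Suc j) + T2 (Suc j))) \<in> F d ?h"
      by (intro F_add T2 F_sum F_scale T1) simp
    ultimately show ?thesis using True by simp
  qed
qed

lemma xq_mode_F: assumes "c \<in> F d h" "m \<ge> -1"
  shows "Y (xq k l) m c - (if m = -1 then Q k l c else 0) \<in> F d (h + int k + int l + 1 - m)"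
proof -
  have "Y (xq k l) m c - (if m = -1 then Q k l c else 0) = (\<Sum>I<2*n. sg I *s
     (Y (cr (I, k) (cr (dual I, l) (vac V))) m c - (if m = -1 then cr (I, k) (cr (dual I, l) c) else 0)))"
    by (auto simp: Q_def Y_linear sum_subtractf vs.scale_right_diff_distrib)
  also have "\<dots> \<in> F d (h + int k + int l + 1 - m)" using quad_mode_F[OF _ assms] by (intro F_sum F_scale) auto
  finally show ?thesis .
qed

lemma xq_WC [simp, intro]: "xq k l \<in> WC" by (intro WC_Q WC_vac)

lemma Q_weight: assumes "Y Lc 1 b = of_int p *s b" shows "Y Lc 1 (Q k l b) = of_int (p + int k + int l + 2) *s Q k l b"
proof -
  have two: "2 *s x = x + x" for x using vs.scale_left_distrib[of 1 1 x] by simp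
  have "Y Lc 1 (cr (I, k) (cr (dual I, l) b)) = of_int (p + int k + int l + 2) *s cr (I, k) (cr (dual I, l) b)" if "I < 2*n" for I
    using that by (simp add: cr_def Lc_mode_G assms Y_linear vs.scale_left_distrib vs.scale_left_diff_distrib two)
  thus ?thesis by (simp add: Q_def Y_linear vs.scale_sum_right mult.commute)
qed

lemma xq_DD: "xq k l \<in> DD (int (k + l + 2))"
  using Q_weight[of "vac V" 0 k l] by (simp add: DD_iff Y_creation_regular add.assoc)

lemma dV_xq: "dV (xq k l) = of_nat (Suc k) *s xq (Suc k) l + of_nat (Suc l) *s xq k (Suc l)"
proof -
  have dh: "lin (\<lambda>a. Y a (-2) (vac V))" by (rule Y_left)
  have cr: "dV (cr (A, k) b) = of_nat (Suc k) *s cr (A, Suc k) b + cr (A, k) (dV b)"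
    if "A < 2*n" "b \<in> sector V q" "q < 2" for A k b q
  proof -
    have i: "- int k - 1 - 1 = - int (Suc k) - 1" and s: "complex_of_int (- int k - 1) = - of_nat (Suc k)" by auto
    have "Y (dV (G A)) (- int k - 1) b = of_nat (Suc k) *s cr (A, Suc k) b"
      using Y_dV[OF _ G_sector[OF that(1)], of "- int k - 1" b] unfolding i s by (simp add: cr_def del: of_nat_Suc)
    thus ?thesis using dV_Y[of 1 q "G A" b "- int k - 1"] G_sector[OF that(1)] that by (simp add: cr_def del: of_nat_Suc)
  qed
  have dvac: "dV (vac V) = 0" by (simp add: dV_eq Y_vac)
  have "dV (cr (I, k) (cr (dual I, l) (vac V))) = of_nat (Suc k) *s cr (I, Suc k) (cr (dual I, l) (vac V))
    + of_nat (Suc l) *s cr (I, k) (cr (dual I, Suc l) (vac V))" if I: "I < 2*n" for I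
  proof -
    have "cr (dual I, l) (vac V) \<in> sector V 1" using mon_sector[of "[(dual I, l)]"] I by simp
    thus ?thesis using cr[OF I, of "cr (dual I, l) (vac V)" 1 k] cr[of "dual I" "vac V" 0 l] vac_even I
      by (simp add: cr_linear dvac del: of_nat_Suc)
  qed
  moreover have "dV (xq k l) = (\<Sum>I<2*n. sg I *s dV (cr (I, k) (cr (dual I, l) (vac V))))"
  proof -
    have "Y (xq k l) (-2) (vac V) = (\<Sum>I<2*n. sg I *s Y (cr (I, k) (cr (dual I, l) (vac V))) (-2) (vac V))"
      unfolding Q_def by (simp only: Y_linear)
    thus ?thesis by (simp add: dV_eq)
  qed
  ultimately show ?thesis
    by (simp add: Q_def vs.scale_right_distrib sum.distrib vs.scale_sum_right mult.commute del: of_nat_Suc)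
qed

end

subsection \<open>Actions on lowest weight vectors\<close>

text \<open>The common ground of \<open>V\<close> itself, of a module, and of a product of two
  modules. The identity carries its truncation hypotheses along, so that it can hold for every
  vector of the type.\<close>

locale orbifold_action = symplectic_fermion_algebra n V e f + M: vector_space s
  for n :: nat and V :: "'v::ab_group_add vertex_structure" and e f :: "nat \<Rightarrow> 'v"
    and s :: "complex \<Rightarrow> 'm \<Rightarrow> 'm::ab_group_add" +
  fixes A :: "'v \<Rightarrow> int \<Rightarrow> 'm \<Rightarrow> 'm" assumes A_left: "module_hom (scl V) s (\<lambda>a. A a k u)"
    and A_right: "module_hom s s (A a k)" and A_borcherds: "\<lbrakk>a \<in> WC; b \<in> WC; \<And>j. j \<ge> J \<Longrightarrow> Y a (r + int j) b = 0;
        \<And>j. j \<ge> J \<Longrightarrow> A b (k + int j) u = 0; \<And>j. j \<ge> J \<Longrightarrow> A a (m + int j) u = 0\<rbrakk> \<Longrightarrow>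
      (\<Sum>j<J. s (of_int m gchoose j) (A (Y a (r + int j) b) (m + k - int j) u)) =
      (\<Sum>j<J. s (sbinom r j) (A a (m + r - int j) (A b (k + int j) u)))
      - (\<Sum>j<J. s (sbinom r j * (-1) powi r) (A b (r + k - int j) (A a (m + int j) u)))"
begin

lemmas A_linear = hom_rules[OF A_left] hom_rules[OF A_right]

text \<open>Vectors killed by all modes of negative degree: the mode \<open>l\<close> of a field of
  weight \<open>p\<close> has degree \<open>p - l - 1\<close>.\<close>

definition low :: "'m set" where
  "low = {u. \<forall>p. \<forall>a\<in>DD p. \<forall>l\<ge>p. A a l u = 0}"

lemma lowD: "u \<in> low \<Longrightarrow> a \<in> DD p \<Longrightarrow> l \<ge> p \<Longrightarrow> A a l u = 0" by (simp add: low_def)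

text \<open>Zhu's \<open>o(a)\<close>, the sum of the modes of degree zero of the homogeneous parts
  of \<open>a\<close>.\<close>

definition zm :: "'v \<Rightarrow> 'm \<Rightarrow> 'm" where
  "zm a u = (\<Sum>p\<in>wts a. A (wc p a) (p - 1) u)"

lemma zm_expand: "finite B \<Longrightarrow> wts a \<subseteq> B \<Longrightarrow> zm a u = (\<Sum>p\<in>B. A (wc p a) (p - 1) u)"
  unfolding zm_def by (rule sum.mono_neutral_left) (auto simp: wc_eq_0 A_linear)

lemma zm_left: "module_hom (scl V) s (\<lambda>a. zm a u)"
proof -
  have "zm (a + a') u = zm a u + zm a' u" for a a'
  proof -
    let ?B = "wts a \<union> wts a' \<union> wts (a + a')"
    have B: "finite ?B" by simp
    show ?thesis using zm_expand[OF B, of "a + a'" u] zm_expand[OF B, of a u] zm_expand[OF B, of a' u]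
      by (simp add: Un_assoc le_supI1 le_supI2 wc_linear A_linear sum.distrib)
  qed
  moreover have "zm (x *s a) u = s x (zm a u)" for x a
  proof -
    let ?B = "wts a \<union> wts (x *s a)"
    have B: "finite ?B" by simp
    show ?thesis using zm_expand[OF B, of "x *s a" u] zm_expand[OF B, of a u]
      by (simp add: wc_linear A_linear M.scale_sum_right)
  qed
  ultimately show ?thesis
    unfolding module_hom_def module_hom_axioms_def using vs.module_axioms M.module_axioms by blast
qed

lemma zm_right: "module_hom s s (zm a)" unfolding module_hom_def module_hom_axioms_def
  using M.module_axioms by (simp add: zm_def A_linear sum.distrib M.scale_sum_right)

lemmas zm_linear = hom_rules[OF zm_left] hom_rules[OF zm_right]

lemma zm_DD: assumes "a \<in> DD p" shows "zm a u = A a (p - 1) u"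
proof -
  have "zm a u = (\<Sum>q\<in>insert p (wts a). A (wc q a) (q - 1) u)" by (rule zm_expand) auto
  also have "\<dots> = (\<Sum>q\<in>insert p (wts a). if q = p then A a (p - 1) u else 0)"
    by (rule sum.cong) (auto simp: wc_DD[OF assms] A_linear)
  finally show ?thesis by simp
qed

lemma zm_Res: assumes a: "a \<in> DD (int p)" and b: "b \<in> DD q" shows "zm (Res a (opX ^ p) t b) u =
    (\<Sum>j\<le>p. s (of_nat (p choose j)) (A (Y a (int j - t) b) (int p + q - int j + t - 2) u))"
proof -
  have "Y a (int j - t) b \<in> DD (int p + q - int j + t - 1)" for j
    using DD_Y[OF a b, of "int j - t"] by (simp add: algebra_simps)
  from zm_DD[OF this] have "zm (Y a (int j - t) b) u = A (Y a (int j - t) b) (int p + q - int j + t - 2) u" for j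
    by (simp add: diff_diff_eq)
  thus ?thesis by (simp add: Res_opX_power zm_linear)
qed

text \<open>The Borcherds identity at \<open>m = p\<close>, where the second sum on the right kills
  \<open>u\<close>. With \<open>r = -1\<close> and \<open>k = q - 1\<close> just the product of the
  zero modes remains; with \<open>r = -2\<close> and \<open>k = q\<close> nothing remains.\<close>

lemma zm_st_DD: assumes u: "u \<in> low" and a: "a \<in> DD (int p)" and b: "b \<in> DD q"
  shows "zm (st a b) u = zm a (zm b u)" and "zm (Res a (opX ^ p) 2 b) u = 0"
proof -
  have ab: "a \<in> WC" "b \<in> WC" using a b DD_WC by auto
  define J where "J = p + nat q + 3"
  have z: "Y a (r + int j) b = 0" if "j \<ge> J" "r \<ge> -2" for j r
    by (rule DD_neg[OF _ DD_Y[OF a b]]) (use that in \<open>simp add: J_def\<close>)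
  have z1: "Y a (int j - 1) b = 0" and z2: "Y a (int j - 2) b = 0" if "j \<ge> J" for j
    using z[OF that, of "-1"] z[OF that, of "-2"] by simp_all
  have tr: "(\<Sum>j<J. s (of_int (int p) gchoose j) (h j)) = (\<Sum>j\<le>p. s (of_nat (p choose j)) (h j))" for h
  proof -
    have "(\<Sum>j<J. s (of_int (int p) gchoose j) (h j)) = (\<Sum>j<J. s (of_nat (p choose j)) (h j))"
      by (simp add: binomial_gbinomial)
    also have "\<dots> = (\<Sum>j\<le>p. s (of_nat (p choose j)) (h j))"
      by (rule sum.mono_neutral_right) (auto simp: J_def binomial_eq_0)
    finally show ?thesis .
  qed
  have au: "A a (int p + int j) u = 0" for j by (rule lowD[OF u a]) simp
  have "zm (st a b) u = (\<Sum>j<J. s (of_int (int p) gchoose j) (A (Y a (-1 + int j) b) (int p + (q - 1) - int j) u))"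
    unfolding st_DD[OF a] zm_Res[OF a b] tr by (intro sum.cong refl) (simp add: algebra_simps)
  also have "\<dots> = (\<Sum>j<J. s ((-1) ^ j * (of_int (-1) gchoose j)) (A a (int p + (-1) - int j) (A b (q - 1 + int j) u)))"
    using lowD[OF u b] au z1 z2 by (subst A_borcherds[OF ab]) (auto simp: A_linear J_def)
  also have "\<dots> = (\<Sum>j\<in>{0}. s ((-1) ^ j * (of_int (-1) gchoose j)) (A a (int p + (-1) - int j) (A b (q - 1 + int j) u)))"
    by (rule sum.mono_neutral_right) (use lowD[OF u b] in \<open>auto simp: A_linear J_def\<close>)
  finally show "zm (st a b) u = zm a (zm b u)" by (simp add: zm_DD[OF a] zm_DD[OF b])
  have "zm (Res a (opX ^ p) 2 b) u = (\<Sum>j<J. s (of_int (int p) gchoose j) (A (Y a (-2 + int j) b) (int p + q - int j) u))"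
    unfolding zm_Res[OF a b] tr by (intro sum.cong refl) (simp add: algebra_simps)
  also have "\<dots> = 0" using lowD[OF u b] au z1 z2 by (subst A_borcherds[OF ab]) (auto simp: A_linear J_def)
  finally show "zm (Res a (opX ^ p) 2 b) u = 0" .
qed

lemma zm_st: assumes u: "u \<in> low" and "a \<in> WC" "b \<in> WC" shows "zm (st a b) u = zm a (zm b u)"
proof -
  have "zm (st (wc p a) (wc q b)) u = zm (wc p a) (zm (wc q b) u)" for p q
  proof (cases "p < 0")
    case True
    thus ?thesis by (simp add: wc_neg st_linear zm_linear)
  next
    case False
    thus ?thesis using zm_st_DD(1)[OF u, of "wc p a" "nat p" "wc q b" q] wc_in_DD assms by simp
  qed
  hence "zm (st (\<Sum>p\<in>wts a. wc p a) (\<Sum>q\<in>wts b. wc q b)) u = zm (\<Sum>p\<in>wts a. wc p a) (zm (\<Sum>q\<in>wts b. wc q b) u)"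
    by (simp only: st_linear zm_linear)
  thus ?thesis by (simp only: wc_sum[OF WC_C[OF assms(2)] finite_wts order_refl] wc_sum[OF WC_C[OF assms(3)] finite_wts order_refl])
qed

lemma zm_ZO: assumes u: "u \<in> low" and "w \<in> ZO" shows "zm w u = 0" using assms(2) unfolding ZO_eq
proof (induction rule: vs.span_induct)
  case base
  show ?case by (auto simp: vs.subspace_def zm_linear)
next
  case (step w)
  then obtain p a b where w: "w = Res a (opX ^ p) 2 b" and a: "a \<in> DD (int p)" and b: "b \<in> WC" by blast
  have "zm (Res a (opX ^ p) 2 (wc q b)) u = 0" for q using zm_st_DD(2)[OF u a wc_in_DD[OF b]] .
  hence "zm (Res a (opX ^ p) 2 (\<Sum>q\<in>wts b. wc q b)) u = 0" by (simp only: Res_linear zm_linear) simp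
  thus ?case unfolding w by (simp only: wc_sum[OF WC_C[OF b] finite_wts order_refl])
qed

text \<open>The linear combinations below do not depend on the lowest weight vector \<open>u\<close>.\<close>

definition reducible :: "('m \<Rightarrow> 'm) \<Rightarrow> bool" where
  "reducible \<phi> \<longleftrightarrow> (\<exists>c :: (int \<times> int) \<Rightarrow> 'v. \<exists>B. finite B \<and> (\<forall>(p, k)\<in>B. c (p, k) \<in> DD p) \<and>
     (\<forall>u\<in>low. \<phi> u = (\<Sum>(p, k)\<in>B. A (c (p, k)) k u)))"

lemma reducible_add: assumes "reducible \<phi>" "reducible \<psi>" shows "reducible (\<lambda>u. \<phi> u + \<psi> u)"
proof -
  obtain c B where c: "finite B" "\<forall>(p, k)\<in>B. c (p, k) \<in> DD p" "\<forall>u\<in>low. \<phi> u = (\<Sum>(p, k)\<in>B. A (c (p, k)) k u)"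
    using assms(1) unfolding reducible_def by blast
  obtain c' B' where c': "finite B'" "\<forall>(p, k)\<in>B'. c' (p, k) \<in> DD p" "\<forall>u\<in>low. \<psi> u = (\<Sum>(p, k)\<in>B'. A (c' (p, k)) k u)"
    using assms(2) unfolding reducible_def by blast
  define d where "d q = (if q \<in> B then c q else 0) + (if q \<in> B' then c' q else 0)" for q
  have 1: "(\<Sum>q\<in>B \<union> B'. A (if q \<in> B then c q else 0) (snd q) u) = (\<Sum>q\<in>B. A (c q) (snd q) u)" for u
    by (subst sum.mono_neutral_right[of "B \<union> B'" B]) (auto simp: A_linear c(1) c'(1))
  have 2: "(\<Sum>q\<in>B \<union> B'. A (if q \<in> B' then c' q else 0) (snd q) u) = (\<Sum>q\<in>B'. A (c' q) (snd q) u)" for u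
    by (subst sum.mono_neutral_right[of "B \<union> B'" B']) (auto simp: A_linear c(1) c'(1))
  have "\<phi> u + \<psi> u = (\<Sum>(p, k)\<in>B \<union> B'. A (d (p, k)) k u)" if "u \<in> low" for u
  proof -
    have "(\<Sum>(p, k)\<in>B \<union> B'. A (d (p, k)) k u) = (\<Sum>q\<in>B \<union> B'. A (d q) (snd q) u)" by (simp add: case_prod_beta)
    thus ?thesis using c(3) c'(3) that by (simp add: d_def A_linear sum.distrib case_prod_beta 1 2)
  qed
  moreover have "\<forall>(p, k)\<in>B \<union> B'. d (p, k) \<in> DD p"
    using c(2) c'(2) by (auto simp: d_def intro!: vs.subspace_add[OF DD_subspace] vs.subspace_0[OF DD_subspace])
  ultimately show ?thesis unfolding reducible_def using c(1) c'(1) by (intro exI[of _ d] exI[of _ "B \<union> B'"]) simp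
qed

lemma reducible_zero: "reducible (\<lambda>u. 0)" unfolding reducible_def by (intro exI[of _ "\<lambda>_. 0"] exI[of _ "{}"]) simp

lemma reducible_scale: assumes "reducible \<phi>" shows "reducible (\<lambda>u. s x (\<phi> u))"
proof -
  obtain c B where c: "finite B" "\<forall>(p, k)\<in>B. c (p, k) \<in> DD p" "\<forall>u\<in>low. \<phi> u = (\<Sum>(p, k)\<in>B. A (c (p, k)) k u)"
    using assms unfolding reducible_def by blast
  thus ?thesis unfolding reducible_def by (intro exI[of _ "\<lambda>q. x *s c q"] exI[of _ B])
      (auto simp: A_linear M.scale_sum_right case_prod_beta intro!: vs.subspace_scale[OF DD_subspace])
qed

lemma reducible_sum: "(\<And>i. i \<in> I \<Longrightarrow> reducible (\<phi> i)) \<Longrightarrow> reducible (\<lambda>u. \<Sum>i\<in>I. \<phi> i u)"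
  by (induction I rule: infinite_finite_induct) (auto simp: reducible_zero reducible_add)

lemma reducible_cong: "(\<And>u. u \<in> low \<Longrightarrow> \<phi> u = \<psi> u) \<Longrightarrow> reducible \<phi> \<longleftrightarrow> reducible \<psi>" unfolding reducible_def by simp

lemma reducible_A: "a \<in> DD p \<Longrightarrow> reducible (\<lambda>u. A a k u)"
  unfolding reducible_def by (intro exI[of _ "\<lambda>_. a"] exI[of _ "{(p, k)}"]) simp

text \<open>In the Borcherds identity take \<open>m = p\<close>, which removes the second sum on
  lowest weight vectors, and \<open>r = k - p\<close>, which makes the term \<open>j = 0\<close> the
  given product. The other products have a larger inner mode, and from the mode \<open>q\<close> on
  the inner factor is zero.\<close>

lemma reducible_A_A: assumes a: "a \<in> DD p" and b: "b \<in> DD q" shows "reducible (\<lambda>u. A a k (A b l u))"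
proof (induction "nat (q - l)" arbitrary: k l rule: less_induct)
  case less
  show ?case
  proof (cases "l \<ge> q")
    case True
    hence "reducible (\<lambda>u. A a k (A b l u)) \<longleftrightarrow> reducible (\<lambda>u. 0)"
      by (intro reducible_cong) (simp add: lowD[OF _ b] A_linear)
    thus ?thesis using reducible_zero by simp
  next
    case False
    define r where "r = k - p"
    define J where "J = nat (q - l) + nat (p + q - r) + 1"
    have ab: "a \<in> WC" "b \<in> WC" using a b DD_WC by auto
    have z: "Y a (r + int j) b = 0" if "j \<ge> J" for j
      by (rule DD_neg[OF _ DD_Y[OF a b]]) (use that in \<open>simp add: J_def\<close>)
    let ?L = "\<lambda>u. \<Sum>j<J. s (of_int p gchoose j) (A (Y a (r + int j) b) (p + l - int j) u)"
    let ?R = "\<lambda>u. \<Sum>j<J-1. s ((-1) ^ Suc j * (of_int r gchoose Suc j)) (A a (p + r - int (Suc j)) (A b (l + int (Suc j)) u))"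
    have "A a k (A b l u) = ?L u + s (-1) (?R u)" if u: "u \<in> low" for u
    proof -
      have "?L u = (\<Sum>j<J. s (sbinom r j) (A a (p + r - int j) (A b (l + int j) u)))"
        using lowD[OF u a] lowD[OF u b] z False by (subst A_borcherds[OF ab]) (auto simp: A_linear J_def)
      also have "\<dots> = A a k (A b l u) + ?R u"
      proof -
        let ?t = "\<lambda>j. s (sbinom r j) (A a (p + r - int j) (A b (l + int j) u))"
        have "(\<Sum>j<J. ?t j) = (\<Sum>j<Suc (J - 1). ?t j)" by (simp add: J_def)
        also have "\<dots> = ?t 0 + ?R u" by (rule sum.lessThan_Suc_shift)
        finally show ?thesis by (simp add: r_def)
      qed
      finally show ?thesis by simp
    qed
    hence "reducible (\<lambda>u. A a k (A b l u)) \<longleftrightarrow> reducible (\<lambda>u. ?L u + s (-1) (?R u))" by (rule reducible_cong)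
    moreover have "reducible ?L" by (intro reducible_sum reducible_scale reducible_A[OF DD_Y[OF a b]])
    moreover have "reducible ?R" using False by (intro reducible_sum reducible_scale less) auto
    ultimately show ?thesis using reducible_add reducible_scale by blast
  qed
qed

lemma reducible_A_comp: assumes "reducible \<phi>" "a \<in> DD p" shows "reducible (\<lambda>u. A a k (\<phi> u))"
proof -
  obtain c B where c: "finite B" "\<forall>(p, k)\<in>B. c (p, k) \<in> DD p" "\<forall>u\<in>low. \<phi> u = (\<Sum>(p, k)\<in>B. A (c (p, k)) k u)"
    using assms(1) unfolding reducible_def by blast
  have "reducible (\<lambda>u. \<Sum>q\<in>B. A a k (A (c q) (snd q) u))"
    using c(2) by (intro reducible_sum) (auto intro!: reducible_A_A[OF assms(2)])
  moreover have "reducible (\<lambda>u. A a k (\<phi> u)) \<longleftrightarrow> reducible (\<lambda>u. \<Sum>q\<in>B. A a k (A (c q) (snd q) u))"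
    using c(3) by (intro reducible_cong) (simp add: A_linear case_prod_beta)
  ultimately show ?thesis by simp
qed

end

sublocale symplectic_fermion_algebra \<subseteq> VA: orbifold_action n V e f "scl V" Y
proof (unfold_locales, goal_cases)
  case (5 a b J r k u m)
  thus ?case using Y_borcherds_finite[of 0 0 a b J r k u m] by (simp add: WC_even)
qed (simp_all add: Y_linear)

subsection \<open>Lowest weight vectors in charged sectors\<close>

lemma sorted_wrt_before_unique:
  "sorted_wrt before xs \<Longrightarrow> sorted_wrt before ys \<Longrightarrow> set xs = set ys \<Longrightarrow> xs = ys"
proof (induction xs arbitrary: ys)
  case (Cons x xs)
  then obtain y ys' where ys: "ys = y # ys'" by (cases ys) auto
  have xy: "x = y"
  proof (rule ccontr)
    assume "x \<noteq> y"
    hence "x \<in> set ys'" "y \<in> set xs" using Cons.prems(3) ys by auto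
    hence "before x y" "before y x" using Cons.prems(1,2) ys by auto
    thus False using before_asym by blast
  qed
  have "x \<notin> set xs" "y \<notin> set ys'" using Cons.prems(1,2) ys by auto
  hence "set xs = set ys'" using Cons.prems(3) ys xy by auto
  thus ?case using Cons ys xy by simp
qed simp

context symplectic_fermion_algebra
begin

text \<open>A filled Fermi sea. Within a block the derivative order decreases, as
  \<open>ordered_words\<close> demands.\<close>

definition hw :: "(nat \<Rightarrow> nat) \<Rightarrow> (nat \<times> nat) list" where
  "hw N = concat (map (\<lambda>i. map (Pair i) (rev [0..<N i])) [0..<n])"

abbreviation hv :: "(nat \<Rightarrow> nat) \<Rightarrow> 'v" where "hv N \<equiv> mon (hw N)"

lemma set_hw: "set (hw N) = {p. fst p < n \<and> snd p < N (fst p)}" by (auto simp: hw_def)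

lemma hw_words [simp, intro]: "hw N \<in> words"
proof -
  have "sorted_wrt before (concat (map (\<lambda>i. map (Pair i) (rev [0..<N i])) [0..<m]))" for m
  proof (induction m)
    case (Suc m)
    have "sorted_wrt before (map (Pair m) (rev [0..<k]))" for k by (induction k) (auto simp: before_def)
    moreover have "\<forall>p\<in>set (concat (map (\<lambda>i. map (Pair i) (rev [0..<N i])) [0..<m])). \<forall>k. before p (m, k)"
      by (auto simp: before_def)
    ultimately show ?case using Suc by (auto simp: sorted_wrt_append)
  qed simp
  thus ?thesis by (auto simp: ordered_words_eq hw_def)
qed

definition cnt :: "nat \<Rightarrow> (nat \<times> nat) list \<Rightarrow> nat" where
  "cnt I xs = length (filter (\<lambda>p. fst p = I) xs)"

lemma cnt_simps [simp]: "cnt I [] = 0" "cnt I (p # xs) = (if fst p = I then Suc (cnt I xs) else cnt I xs)"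
  by (auto simp: cnt_def)

lemma cnt_hw: "cnt I (hw N) = (if I < n then N I else 0)"
proof -
  have "cnt I (concat (map (\<lambda>i. map (Pair i) (rev [0..<N i])) [0..<m])) = (if I < m then N I else 0)" for m
    by (induction m) (auto simp: cnt_def filter_concat comp_def less_Suc_eq)
  thus ?thesis by (simp add: hw_def)
qed

text \<open>The energy of a letter relative to the Fermi level \<open>N i + 1/2\<close>, doubled to be an integer;
  it is odd, so \<open>hw N\<close> is the only word of minimal energy.\<close>

definition energy :: "(nat \<Rightarrow> nat) \<Rightarrow> nat \<times> nat \<Rightarrow> int" where
  "energy N p = 2 * (int (snd p) + 1) + (if fst p < n then - (2 * int (N (fst p)) + 1) else 2 * int (N (fst p - n)) + 1)"

lemma sum_energy: assumes "set T \<subseteq> P"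
  shows "(\<Sum>p\<leftarrow>T. energy N p) = 2 * wt_word T - (\<Sum>i<n. (2 * int (N i) + 1) * (int (cnt i T) - int (cnt (i + n) T)))"
  using assms
proof (induction T)
  case (Cons p T)
  obtain I k where p: "p = (I, k)" "I < 2*n" using Cons by (cases p) auto
  let ?f = "\<lambda>T i. (2 * int (N i) + 1) * (int (cnt i T) - int (cnt (i + n) T))"
  have "(\<Sum>i<n. ?f (p # T) i) = (\<Sum>i<n. ?f T i + (if i = I then 2 * int (N i) + 1 else 0)
      - (if i = I - n \<and> \<not> I < n then 2 * int (N i) + 1 else 0))" by (rule sum.cong) (auto simp: p algebra_simps)
  also have "\<dots> = (\<Sum>i<n. ?f T i) + (if I < n then 2 * int (N I) + 1 else 0) - (if I < n then 0 else 2 * int (N (I - n)) + 1)"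
    using p by (auto simp: sum.distrib sum_subtractf)
  finally show ?case using Cons by (simp add: energy_def p)
qed simp

text \<open>For equal charges, the inequality of weights is one of total energies. Letters outside
  \<open>hw N\<close> have positive energy and those inside negative energy, so the symmetric
  difference of the two words must be empty.\<close>

lemma hw_unique:
  assumes T: "T \<in> words" and cnt: "\<And>i. i < n \<Longrightarrow> cnt i T = N i + cnt (i + n) T" and wt: "wt_word T \<le> wt_word (hw N)"
  shows "T = hw N"
proof -
  let ?S = "set T" and ?H = "set (hw N)"
  have ds: "distinct T" "distinct (hw N)" using ordered_words_distinct[OF T] ordered_words_distinct[OF hw_words] by auto
  have "(\<Sum>p\<leftarrow>T. energy N p) \<le> (\<Sum>p\<leftarrow>hw N. energy N p)"
    using wt by (simp add: sum_energy words_P[OF T] words_P[OF hw_words] cnt cnt_hw)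
  hence "sum (energy N) ?S \<le> sum (energy N) ?H" using ds by (simp add: sum_list_distinct_conv_sum_set)
  moreover have "sum (energy N) ?S = sum (energy N) (?S \<inter> ?H) + sum (energy N) (?S - ?H)"
    by (rule sum.Int_Diff) simp
  moreover have "sum (energy N) ?H = sum (energy N) (?S \<inter> ?H) + sum (energy N) (?H - ?S)"
    using sum.Int_Diff[of ?H "energy N" ?S] by (simp add: Int_commute)
  ultimately have le: "sum (energy N) (?S - ?H) \<le> sum (energy N) (?H - ?S)" by simp
  have pos: "energy N p > 0" if "p \<in> ?S - ?H" for p using that words_P[OF T] by (auto simp: set_hw energy_def)
  have neg: "energy N p < 0" if "p \<in> ?H - ?S" for p using that by (auto simp: set_hw energy_def)
  have "?S - ?H = {}"
  proof (rule ccontr)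
    assume "?S - ?H \<noteq> {}"
    hence "sum (energy N) (?S - ?H) > 0" by (intro sum_pos pos) auto
    moreover have "sum (energy N) (?H - ?S) \<le> 0" using neg by (intro sum_nonpos) force
    ultimately show False using le by simp
  qed
  moreover from this have "sum (energy N) (?H - ?S) \<ge> 0" using le by (simp only: sum.empty)
  hence "?H - ?S = {}"
  proof (rule contrapos_pp)
    assume "?H - ?S \<noteq> {}"
    hence "0 < (\<Sum>p\<in>?H - ?S. - energy N p)" using neg by (intro sum_pos) auto
    thus "\<not> 0 \<le> sum (energy N) (?H - ?S)" by (simp add: sum_negf)
  qed
  ultimately have "?S = ?H" by auto
  thus ?thesis using T hw_words[of N] by (intro sorted_wrt_before_unique) (auto simp: ordered_words_eq)
qed

definition chi :: "(nat \<Rightarrow> complex) \<Rightarrow> nat \<times> nat \<Rightarrow> complex" where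
  "chi \<tau> p = (if fst p < n then \<tau> (fst p) else 1 / \<tau> (fst p - n))"

lemma tw_dil: "I < 2*n \<Longrightarrow> tw (dil \<tau>) I m b = chi \<tau> (I, k) *s Y (G I) m b"
proof -
  assume I: "I < 2*n"
  have "tw (dil \<tau>) I m b = (\<Sum>J<2*n. if J = I then chi \<tau> (I, k) *s Y (G I) m b else 0)"
    unfolding tw_def by (rule sum.cong) (auto simp: dil_def chi_def)
  thus ?thesis using I by simp
qed

lemma gact_dil_mon: assumes "\<And>i. i < n \<Longrightarrow> \<tau> i \<noteq> 0" "set xs \<subseteq> P"
  shows "gact (dil \<tau>) (mon xs) = (\<Prod>p\<leftarrow>xs. chi \<tau> p) *s mon xs"
proof -
  have "foldr (crt (dil \<tau>)) xs (vac V) = (\<Prod>p\<leftarrow>xs. chi \<tau> p) *s mon xs" using assms(2)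
  proof (induction xs)
    case (Cons p xs)
    hence "crt (dil \<tau>) p b = chi \<tau> p *s cr p b" for b using tw_dil[of "fst p" \<tau> _ b "snd p"] by (simp add: cr_def)
    thus ?case using Cons by (simp add: cr_linear mult.commute)
  qed simp
  thus ?thesis by (simp add: gact_mon[OF sympl_dil[OF assms(1)] assms(2)])
qed

text \<open>Vectors on which the torus acts by the same character as on \<open>hv N\<close>. The
  torus acts by automorphisms fixing the invariants, whose modes therefore preserve the
  charge.\<close>

definition charged :: "(nat \<Rightarrow> nat) \<Rightarrow> 'v \<Rightarrow> bool" where
  "charged N b \<longleftrightarrow> b \<in> C \<and> (\<forall>\<tau>. (\<forall>i<n. \<tau> i \<noteq> 0) \<longrightarrow> gact (dil \<tau>) b = (\<Prod>i<n. \<tau> i ^ N i) *s b)"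

lemma charged_hv: "charged N (hv N)"
proof -
  have "(\<Prod>p\<leftarrow>concat (map (\<lambda>i. map (Pair i) (rev [0..<N i])) [0..<m]). chi \<tau> p) = (\<Prod>i<m. \<tau> i ^ N i)" if "m \<le> n" for m \<tau>
    using that
  proof (induction m)
    case (Suc m)
    have "(\<Prod>p\<leftarrow>map (Pair m) (rev [0..<k]). chi \<tau> p) = \<tau> m ^ k" for k
      using Suc.prems by (induction k) (auto simp: chi_def)
    thus ?case using Suc by simp
  qed simp
  hence "(\<Prod>p\<leftarrow>hw N. chi \<tau> p) = (\<Prod>i<n. \<tau> i ^ N i)" for \<tau> by (simp add: hw_def)
  thus ?thesis by (auto simp: charged_def gact_dil_mon words_P)
qed

lemma charged_Y: assumes "charged N b" "a \<in> WC" shows "charged N (Y a k b)"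
  using assms gact_acts[OF sympl_dil assms(2)] by (auto simp: charged_def gact_Y[OF sympl_dil] WC_C Y_linear)

lemma charged_supp: assumes "charged N b" "T \<in> supp b" "i < n" shows "cnt i T = N i + cnt (i + n) T"
proof -
  \<comment> \<open>The number \<open>2\<close> is not a root of unity, so its powers determine the
    charge at \<open>i\<close>.\<close>
  let ?\<tau> = "\<lambda>j. if j = i then 2 else (1::complex)"
  have T: "T \<in> words" using assms(2) by (simp add: supp_iff)
  have "coef T (gact (dil ?\<tau>) (proj b)) = (\<Prod>p\<leftarrow>T. chi ?\<tau> p) * coef T (proj b)" using proj_in[of b]
  proof (induction rule: C_induct)
    case (mon xs)
    thus ?case using T by (simp add: gact_dil_mon words_P coef_mon)
  qed (simp_all add: gact_linear algebra_simps)
  moreover have "gact (dil ?\<tau>) b = (\<Prod>j<n. ?\<tau> j ^ N j) *s b" using assms(1) by (simp add: charged_def)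
  moreover have "(\<Prod>j<n. ?\<tau> j ^ N j) = 2 ^ N i"
  proof -
    have "(\<Prod>j<n. ?\<tau> j ^ N j) = (\<Prod>j<n. if j = i then 2 ^ N i else 1)" by (rule prod.cong) auto
    thus ?thesis using assms(3) by simp
  qed
  ultimately have "(\<Prod>p\<leftarrow>T. chi ?\<tau> p) = 2 ^ N i" using assms(2) by (simp add: supp_iff)
  moreover have "(\<Prod>p\<leftarrow>T. chi ?\<tau> p) * 2 ^ cnt (i + n) T = 2 ^ cnt i T" using words_P[OF T] assms(3)
  proof (induction T)
    case (Cons p T)
    hence "fst p < 2*n" by auto
    have "chi ?\<tau> p * 2 ^ (if fst p = i + n then 1 else 0) = 2 ^ (if fst p = i then 1 else 0)"
      using assms(3) \<open>fst p < 2*n\<close> by (auto simp: chi_def)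
    hence "(chi ?\<tau> p * 2 ^ (if fst p = i + n then 1 else 0)) * ((\<Prod>p\<leftarrow>T. chi ?\<tau> p) * 2 ^ cnt (i + n) T)
        = 2 ^ (if fst p = i then 1 else 0) * 2 ^ cnt i T" using Cons by simp
    thus ?case by (auto simp: algebra_simps split: if_splits)
  qed simp
  ultimately have "(2::complex) ^ (N i + cnt (i + n) T) = 2 ^ cnt i T" by (simp add: power_add)
  hence "norm ((2::complex) ^ (N i + cnt (i + n) T)) = norm ((2::complex) ^ cnt i T)" by simp
  hence "(2::real) ^ (N i + cnt (i + n) T) = 2 ^ cnt i T" by (simp add: norm_power)
  thus ?thesis by simp
qed

definition at_level :: "(nat \<Rightarrow> nat) \<Rightarrow> int \<Rightarrow> 'v \<Rightarrow> bool" where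
  "at_level N d b \<longleftrightarrow> charged N b \<and> Y Lc 1 b = of_int (wt_word (hw N) + d) *s b"

lemma at_level_hv: "at_level N 0 (hv N)" by (simp add: at_level_def charged_hv Lc_mon words_P)

lemma at_level_Y: assumes "at_level N d b" "a \<in> DD p" shows "at_level N (d + p - k - 1) (Y a k b)"
proof -
  have "a \<in> sector V 0" using assms by (simp add: WC_even DD_WC)
  hence "Y Lc 1 (Y a k b) = of_int (wt_word (hw N) + (d + p - k - 1)) *s Y a k b"
    using Lc_mode[of 0 a k b] assms by (simp add: at_level_def DD_iff Y_linear vs.scale_left_distrib vs.scale_left_diff_distrib)
  thus ?thesis using assms by (simp add: at_level_def charged_Y DD_WC)
qed

lemma at_level_supp: assumes "at_level N d b" "T \<in> supp b" shows "d \<ge> 0" "d = 0 \<Longrightarrow> T = hw N" "d \<noteq> 0 \<Longrightarrow> T \<noteq> hw N"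
proof -
  have T: "T \<in> words" using assms by (simp add: supp_iff)
  have "of_int (wt_word T) * coef T b = of_int (wt_word (hw N) + d) * coef T b"
    using coef_Lc[OF T, of b] assms(1) by (auto simp: at_level_def)
  hence "complex_of_int (wt_word T) = of_int (wt_word (hw N) + d)" using assms(2) by (simp add: supp_iff)
  hence wt: "wt_word T = wt_word (hw N) + d" by (simp only: of_int_eq_iff)
  have cnt: "\<And>i. i < n \<Longrightarrow> cnt i T = N i + cnt (i + n) T" using charged_supp assms by (auto simp: at_level_def)
  have eq: "T = hw N" if "d \<le> 0" using hw_unique[OF T cnt] wt that by simp
  show "d \<ge> 0" using eq wt by (cases "d \<le> 0") auto
  show "d = 0 \<Longrightarrow> T = hw N" using eq by simp
  show "d \<noteq> 0 \<Longrightarrow> T \<noteq> hw N" using wt by auto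
qed

lemma at_level_neg: assumes "at_level N d b" "d < 0" shows "b = 0"
proof -
  have "supp b = {}" using at_level_supp(1)[OF assms(1)] assms(2) by force
  thus ?thesis using expand[of b] assms(1) by (simp add: at_level_def charged_def)
qed

lemma at_level_0: assumes "at_level N 0 b" shows "b = coef (hw N) b *s hv N"
proof -
  have "supp b \<subseteq> {hw N}" using at_level_supp(2)[OF assms] by auto
  thus ?thesis using expand_in[of b "{hw N}"] assms by (simp add: at_level_def charged_def)
qed

lemma coef_hv [simp]: "coef (hw N) (hv N) = 1" by (simp add: coef_mon)

lemma hv_low: "hv N \<in> VA.low" unfolding VA.low_def using at_level_neg[OF at_level_Y[OF at_level_hv]] by auto

text \<open>The eigenvalue of the zero mode of \<open>a\<close> on \<open>hv N\<close>. On the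
  invariants it is multiplicative for \<open>st\<close> and zero on \<open>ZO\<close>, that is, a
  character of the Zhu algebra for every \<open>N\<close>.\<close>

definition ev :: "(nat \<Rightarrow> nat) \<Rightarrow> 'v \<Rightarrow> complex" where
  "ev N a = coef (hw N) (VA.zm a (hv N))"

lemma ev_linear: "ev N (a + b) = ev N a + ev N b" "ev N (x *s a) = x * ev N a"
  "ev N (a - b) = ev N a - ev N b" "ev N 0 = 0" "ev N (sum h A) = (\<Sum>i\<in>A. ev N (h i))"
  by (simp_all add: ev_def VA.zm_linear)

lemma at_level_combination:  assumes "at_level N d b" "at_level N d b'"
  shows "at_level N d (b + b')" "at_level N d (x *s b)"
  using assms by (auto simp: at_level_def charged_def gact_linear Y_linear vs.scale_right_distrib mult.commute intro: C_add C_scale)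

lemma at_level_zero: "at_level N d 0" by (simp add: at_level_def charged_def gact_linear)

lemma at_level_sum: "(\<And>i. i \<in> I \<Longrightarrow> at_level N d (h i)) \<Longrightarrow> at_level N d (sum h I)"
  by (induction I rule: infinite_finite_induct) (auto simp: at_level_zero at_level_combination)

lemma zm_hv: assumes "a \<in> WC" shows "VA.zm a (hv N) = ev N a *s hv N"
proof -
  have "at_level N 0 (VA.zm a (hv N))" unfolding VA.zm_def
  proof (rule at_level_sum)
    fix p
    show "at_level N 0 (Y (wc p a) (p - 1) (hv N))"
      using at_level_Y[OF at_level_hv wc_in_DD[OF assms], of N p "p - 1"] by simp
  qed
  from at_level_0[OF this] show ?thesis by (simp add: ev_def)
qed

lemma ev_st: assumes "a \<in> WC" "b \<in> WC" shows "ev N (st a b) = ev N a * ev N b"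
  unfolding ev_def VA.zm_st[OF hv_low assms] by (simp add: zm_hv[OF assms(2)] zm_hv[OF assms(1)] VA.zm_linear)

lemma ev_ZO: "w \<in> ZO \<Longrightarrow> ev N w = 0" by (simp add: ev_def VA.zm_ZO[OF hv_low])

lemma ev_vac [simp]: "ev N (vac V) = 1" by (simp add: ev_def VA.zm_DD[OF vac_DD] Y_vac)

lemma number_mon: assumes "T \<in> words" "p \<in> P" shows "cr p (an p (mon T)) = (if p \<in> set T then mon T else 0)"
proof (cases "p \<in> set T")
  case True
  then obtain T1 T2 where T: "T = T1 @ p # T2" by (auto simp: in_set_conv_decomp)
  have d: "p \<notin> set T1" "p \<notin> set T2" using ordered_words_distinct[OF assms(1)] T by auto
  have P: "set T1 \<subseteq> P" "set T2 \<subseteq> P" using words_P[OF assms(1)] T by auto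
  have base: "cr p (an p (mon (p # T2))) = mon (p # T2)"
    using an_mon_zero[OF assms(2) P(2) d(2)] assms(2) by (simp add: an_cr)
  have "cr p (an p (mon (T1 @ p # T2))) = mon (T1 @ p # T2)" using P(1) d(1)
  proof (induction T1)
    case (Cons q T1)
    let ?b = "mon (T1 @ p # T2)"
    have q: "q \<in> P" "p \<noteq> q" using Cons.prems by auto
    have "cr p (an p (cr q ?b)) = - cr p (cr q (an p ?b))"
      using an_cr[OF assms(2) q(1), of ?b] q(2) by (simp add: cr_linear)
    also have "\<dots> = cr q (cr p (an p ?b))" using cr_cr[OF assms(2) q(1), of "an p ?b"] by simp
    also have "\<dots> = cr q ?b" using Cons by simp
    finally show ?case by simp
  qed (use base in simp)
  thus ?thesis using True T by simp
next
  case False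
  thus ?thesis using an_mon_zero[OF assms(2) words_P[OF assms(1)]] by simp
qed

lemma number_hv: assumes "I < 2*n" shows "Y (G I) (- int q) (Y (G (dual I)) (int q) (hv N)) =
    (if I < n \<and> 0 < q \<and> q \<le> N I then - of_nat q else 0) *s hv N"
proof (cases q)
  case 0
  thus ?thesis using assms by simp
next
  case (Suc k)
  have i: "int (Suc k) = int k + 1" "- int (Suc k) = - int k - 1" by auto
  have "complex_of_nat (Suc k) \<noteq> 0" by (simp del: of_nat_Suc)
  hence "Y (G (dual I)) (int q) b = (of_nat (Suc k) * sg I) *s an (I, k) b" for b
    unfolding Suc i by (simp add: an_def mult_ac del: of_nat_Suc)
  moreover have "Y (G I) (- int q) b = cr (I, k) b" for b unfolding Suc i by (simp add: cr_def)
  ultimately have "Y (G I) (- int q) (Y (G (dual I)) (int q) (hv N)) = (of_nat q * sg I) *s cr (I, k) (an (I, k) (hv N))"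
    by (simp add: cr_linear Suc del: of_nat_Suc)
  also have "\<dots> = (if I < n \<and> 0 < q \<and> q \<le> N I then - of_nat q else 0) *s hv N"
    using assms by (subst number_mon[OF hw_words]) (auto simp: set_hw sg_def Suc)
  finally show ?thesis .
qed

text \<open>In \<open>quad_mode\<close>, every term of the zero mode is a multiple of a number
  operator, for which \<open>hv N\<close> is an eigenvector. For the pair \<open>e i\<close>,
  \<open>f i\<close> the index \<open>i\<close> yields the first binomial and the index
  \<open>i + n\<close> the second.\<close>

lemma ev_xq:
  "ev N (xq 0 (2*m)) = (\<Sum>i<n. \<Sum>q\<in>{1..N i}. of_nat q *
     ((of_nat (2*m) + of_nat q gchoose (2*m)) + (of_nat (2*m) - of_nat q gchoose (2*m))))"
proof -
  let ?l = "2*m"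
  obtain d h where F: "hv N \<in> F d h" using F_exhaust[OF mon_in] by blast
  define J where "J = nat h + 1 + (\<Sum>i<n. N i)"
  have J: "\<And>A j. A < 2*n \<Longrightarrow> j \<ge> J \<Longrightarrow> Y (G A) (int j) (hv N) = 0" using G_large[OF F] by (simp add: J_def)
  have NJ: "N i \<le> J" if "i < n" for i using member_le_sum[of i "{..<n}" N] that by (simp add: J_def)
  define K where "K = J + ?l + 1"
  define c1 where "c1 q = (of_nat ?l + of_nat q gchoose ?l :: complex) * of_nat q" for q :: nat
  define c2 where "c2 q = (of_nat ?l - of_nat q gchoose ?l :: complex) * of_nat q" for q :: nat
  have u: "Y (cr (I, 0) (cr (dual I, ?l) (vac V))) (int ?l + 1) (hv N) =
     ((\<Sum>q<K. if I < n \<and> Suc q \<le> N I then - c1 (Suc q) else 0)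
      + (\<Sum>q<K. if \<not> I < n \<and> 0 < q \<and> q \<le> N (I - n) then c2 q else 0)) *s hv N" if I: "I < 2*n" for I
  proof -
    have dI: "dual I < 2*n" using I by simp
    have "Y (cr (I, 0) (cr (dual I, ?l) (vac V))) (int ?l + 1) (hv N) =
      (\<Sum>q<K. ((-1) ^ q * (of_int (- int 0 - 1) gchoose q)) *s
      (((-1) ^ ?l * (of_int (int ?l + 1 + int q) gchoose ?l)) *s Y (G I) (- int 0 - 1 - int q) (Y (G (dual I)) (int ?l + 1 + int q - int ?l) (hv N))
       + ((-1) powi (- int 0 - 1) * ((-1) ^ ?l * (of_int (- int 0 - 1 + (int ?l + 1) - int q) gchoose ?l))) *s
          Y (G (dual I)) (- int 0 - 1 + (int ?l + 1) - int q - int ?l) (Y (G I) (int q) (hv N))))"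
      unfolding K_def by (rule quad_mode[OF I J]) auto
    also have "\<dots> = (\<Sum>q<K. ((if I < n \<and> Suc q \<le> N I then - c1 (Suc q) else 0)
         + (if \<not> I < n \<and> 0 < q \<and> q \<le> N (I - n) then c2 q else 0)) *s hv N)"
    proof (rule sum.cong[OF refl])
      fix q
      have sgn: "(-1) ^ q * (of_int (- int 0 - 1) gchoose q) = (1::complex)"
        by (simp add: binomial_minus_one flip: power_mult_distrib)
      have e: "- int 0 - 1 = -1" "-1 - int q = - int (Suc q)" "int ?l + 1 + int q - int ?l = int (Suc q)"
        "-1 + (int ?l + 1) - int q - int ?l = - int q" by auto
      have g1: "(of_int (int ?l + 1 + int q) :: complex) = of_nat ?l + of_nat (Suc q)"
        "(of_int (- 1 + (int ?l + 1) - int q) :: complex) = of_nat ?l - of_nat q" by auto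
      have n1: "Y (G I) (- int (Suc q)) (Y (G (dual I)) (int (Suc q)) (hv N)) =
          (if I < n \<and> Suc q \<le> N I then - of_nat (Suc q) else 0) *s hv N" using number_hv[OF I, of "Suc q" N] by simp
      have n2: "Y (G (dual I)) (- int q) (Y (G I) (int q) (hv N)) =
          (if \<not> I < n \<and> 0 < q \<and> q \<le> N (I - n) then - of_nat q else 0) *s hv N"
        using number_hv[OF dI, of q N] dual_simps(2)[OF I] I by (auto simp: dual_def)
      show "((-1) ^ q * (of_int (- int 0 - 1) gchoose q)) *s
      (((-1) ^ ?l * (of_int (int ?l + 1 + int q) gchoose ?l)) *s Y (G I) (- int 0 - 1 - int q) (Y (G (dual I)) (int ?l + 1 + int q - int ?l) (hv N))
       + ((-1) powi (- int 0 - 1) * ((-1) ^ ?l * (of_int (- int 0 - 1 + (int ?l + 1) - int q) gchoose ?l))) *s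
          Y (G (dual I)) (- int 0 - 1 + (int ?l + 1) - int q - int ?l) (Y (G I) (int q) (hv N)))
        = ((if I < n \<and> Suc q \<le> N I then - c1 (Suc q) else 0)
         + (if \<not> I < n \<and> 0 < q \<and> q \<le> N (I - n) then c2 q else 0)) *s hv N" unfolding sgn unfolding e g1 n1 n2
        by (auto simp: c1_def c2_def vs.scale_left_distrib simp del: of_nat_Suc of_nat_mult)
    qed
    finally show ?thesis by (simp only: vs.scale_sum_left[symmetric] sum.distrib)
  qed
  have r1: "(\<Sum>q<K. if Suc q \<le> N i then - c1 (Suc q) else 0) = - (\<Sum>q\<in>{1..N i}. c1 q)" if "i < n" for i
  proof -
    have "(\<Sum>q<K. if Suc q \<le> N i then - c1 (Suc q) else 0) = (\<Sum>q<N i. - c1 (Suc q))"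
      using NJ[OF that] by (intro sum.mono_neutral_cong_right) (auto simp: K_def)
    also have "\<dots> = (\<Sum>q\<in>{1..N i}. - c1 q)" by (rule sum.reindex_bij_witness[of _ "\<lambda>q. q - 1" Suc]) auto
    finally show ?thesis by (simp add: sum_negf)
  qed
  have r2: "(\<Sum>q<K. if 0 < q \<and> q \<le> N i then c2 q else 0) = (\<Sum>q\<in>{1..N i}. c2 q)" if "i < n" for i
    using NJ[OF that] by (intro sum.mono_neutral_cong_right) (auto simp: K_def)
  have "VA.zm (xq 0 ?l) (hv N) = Y (xq 0 ?l) (int ?l + 1) (hv N)"
    using VA.zm_DD[OF xq_DD[of 0 ?l], of "hv N"] by (simp add: algebra_simps)
  also have "\<dots> = (\<Sum>I<2*n. sg I *s Y (cr (I, 0) (cr (dual I, ?l) (vac V))) (int ?l + 1) (hv N))"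
    by (subst Q_def) (simp only: Y_linear)
  also have "\<dots> = (\<Sum>i<n. (\<Sum>q\<in>{1..N i}. c1 q) *s hv N + (\<Sum>q\<in>{1..N i}. c2 q) *s hv N)" unfolding sum_double
  proof (rule sum.cong[OF refl])
    fix i assume "i \<in> {..<n}"
    hence i: "i < n" "i < 2*n" "i + n < 2*n" by auto
    show "sg i *s Y (cr (i, 0) (cr (dual i, ?l) (vac V))) (int ?l + 1) (hv N) +
        sg (i + n) *s Y (cr (i + n, 0) (cr (dual (i + n), ?l) (vac V))) (int ?l + 1) (hv N)
      = (\<Sum>q\<in>{1..N i}. c1 q) *s hv N + (\<Sum>q\<in>{1..N i}. c2 q) *s hv N"
      unfolding u[OF i(2)] u[OF i(3)] using i r1[OF i(1)] r2[OF i(1)] by (simp add: sg_def)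
  qed
  also have "\<dots> = (\<Sum>i<n. (\<Sum>q\<in>{1..N i}. c1 q) + (\<Sum>q\<in>{1..N i}. c2 q)) *s hv N"
    by (simp add: vs.scale_sum_left vs.scale_left_distrib)
  finally have "ev N (xq 0 ?l) = (\<Sum>i<n. (\<Sum>q\<in>{1..N i}. c1 q) + (\<Sum>q\<in>{1..N i}. c2 q))" by (simp add: ev_def)
  also have "\<dots> = (\<Sum>i<n. \<Sum>q\<in>{1..N i}. of_nat q *
     ((of_nat ?l + of_nat q gchoose ?l) + (of_nat ?l - of_nat q gchoose ?l)))"
    by (simp add: c1_def c2_def sum.distrib[symmetric] algebra_simps)
  finally show ?thesis .
qed

end

section \<open>Polynomials\<close>

abbreviation "lookup \<equiv> Poly_Mapping.lookup"
abbreviation "keys \<equiv> Poly_Mapping.keys"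
abbreviation "single \<equiv> Poly_Mapping.single"

subsection \<open>Evaluation of polynomials in several variables\<close>

definition monomial_eval :: "(nat \<Rightarrow> complex) \<Rightarrow> (nat \<Rightarrow>\<^sub>0 nat) \<Rightarrow> complex" where
  "monomial_eval x m = (\<Prod>i\<in>keys m. x i ^ lookup m i)"

definition mpoly_eval :: "(nat \<Rightarrow> complex) \<Rightarrow> ((nat \<Rightarrow>\<^sub>0 nat) \<Rightarrow>\<^sub>0 complex) \<Rightarrow> complex" where
  "mpoly_eval x p = (\<Sum>m\<in>keys p. lookup p m * monomial_eval x m)"

lemma monomial_eval_superset:
  "finite A \<Longrightarrow> keys m \<subseteq> A \<Longrightarrow> monomial_eval x m = (\<Prod>i\<in>A. x i ^ lookup m i)"
  unfolding monomial_eval_def by (rule prod.mono_neutral_left) (auto simp: in_keys_iff)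

lemma monomial_eval_add: "monomial_eval x (m + m') = monomial_eval x m * monomial_eval x m'"
proof -
  let ?A = "keys m \<union> keys m'"
  have "keys (m + m') \<subseteq> ?A" by (rule Poly_Mapping.keys_add)
  thus ?thesis by (simp add: monomial_eval_superset[of ?A] lookup_add power_add prod.distrib)
qed

lemma monomial_eval_simps [simp]: "monomial_eval x 0 = 1" "monomial_eval x (single i k) = x i ^ k"
  by (auto simp: monomial_eval_def)

lemma mpoly_eval_add: "mpoly_eval x (p + q) = mpoly_eval x p + mpoly_eval x q"
  unfolding mpoly_eval_def by (rule setsum_keys_plus_distrib) (auto simp: algebra_simps)

lemma mpoly_eval_single [simp]: "mpoly_eval x (single m c) = c * monomial_eval x m" by (auto simp: mpoly_eval_def)

lemma mpoly_eval_0 [simp]: "mpoly_eval x 0 = 0" by (simp add: mpoly_eval_def)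

lemma mpoly_eval_sum: "mpoly_eval x (\<Sum>i\<in>A. p i) = (\<Sum>i\<in>A. mpoly_eval x (p i))"
  by (induction A rule: infinite_finite_induct) (auto simp: mpoly_eval_add)

lemma mpoly_expand: "p = (\<Sum>m\<in>keys p. single m (lookup p m))"
proof (rule poly_mapping_eqI)
  fix k
  have "(\<Sum>m\<in>keys p. lookup (single m (lookup p m)) k)
     = (\<Sum>m\<in>keys p. if m = k then lookup p k else 0)" by (rule sum.cong) (auto simp: lookup_single)
  thus "lookup p k = lookup (\<Sum>m\<in>keys p. single m (lookup p m)) k" by (simp add: lookup_sum in_keys_iff)
qed

lemma mpoly_eval_mult: "mpoly_eval x (p * q) = mpoly_eval x p * mpoly_eval x q"
proof -
  have "p * q = (\<Sum>m\<in>keys p. \<Sum>m'\<in>keys q.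
      single (m + m') (lookup p m * lookup q m'))"
    by (subst (1) mpoly_expand[of p], subst (1) mpoly_expand[of q]) (simp only: sum_product mult_single)
  hence "mpoly_eval x (p * q) = (\<Sum>m\<in>keys p. \<Sum>m'\<in>keys q.
      (lookup p m * monomial_eval x m) * (lookup q m' * monomial_eval x m'))"
    by (simp only: mpoly_eval_sum mpoly_eval_single monomial_eval_add) (simp add: mult_ac)
  thus ?thesis by (simp add: mpoly_eval_def sum_product)
qed

lemma mpoly_eval_diff: "mpoly_eval x (p - q) = mpoly_eval x p - mpoly_eval x q"
  using mpoly_eval_add[of x "p - q" q] by simp

lemma digits_unique:
  fixes a b :: "nat \<Rightarrow> nat"
  assumes "\<And>i. i < n \<Longrightarrow> a i < B \<and> b i < B" "(\<Sum>i<n. a i * B ^ i) = (\<Sum>i<n. b i * B ^ i)" "i < n"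
  shows "a i = b i" using assms
proof (induction n arbitrary: a b i)
  case (Suc n)
  have B: "a 0 < B" "b 0 < B" using Suc.prems(1)[of 0] by auto
  have s: "(\<Sum>i<Suc n. c i * B ^ i) = c 0 + B * (\<Sum>i<n. c (Suc i) * B ^ i)" for c :: "nat \<Rightarrow> nat"
    by (subst sum.lessThan_Suc_shift) (simp add: sum_distrib_left mult_ac)
  have eq: "a 0 + B * (\<Sum>i<n. a (Suc i) * B ^ i) = b 0 + B * (\<Sum>i<n. b (Suc i) * B ^ i)"
    using Suc.prems(2) by (simp only: s)
  have 0: "a 0 = b 0" using arg_cong[OF eq, of "\<lambda>x. x mod B"] B by (simp only: mod_mult_self2 mod_less)
  have s': "(\<Sum>i<n. a (Suc i) * B ^ i) = (\<Sum>i<n. b (Suc i) * B ^ i)"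
    using eq B unfolding 0 add_left_cancel mult_cancel1 by auto
  have "a (Suc i) = b (Suc i)" if "i < n" for i by (rule Suc.IH[OF _ s' that]) (use Suc.prems(1) in simp)
  thus ?case using 0 Suc.prems(3) by (cases i) auto
qed simp

text \<open>Kronecker substitution \<open>x\<^sub>i = z\<^bsup>B\<^sup>i\<^esup>\<close>.\<close>

lemma mpoly_eval_zero: assumes P: "\<And>m. m \<in> keys P \<Longrightarrow> keys m \<subseteq> {..<n}" and zero: "\<And>x. mpoly_eval x P = 0"
  shows "P = 0"
proof -
  define B where "B = Suc (\<Sum>m\<in>keys P. \<Sum>i<n. lookup m i)"
  define \<kappa> where "\<kappa> m = (\<Sum>i<n. lookup m i * B ^ i)" for m
  have B: "lookup m i < B" if "m \<in> keys P" "i < n" for m i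
  proof -
    have "lookup m i \<le> (\<Sum>i<n. lookup m i)" using that by (intro member_le_sum) auto
    also have "\<dots> \<le> (\<Sum>m\<in>keys P. \<Sum>i<n. lookup m i)" using that by (intro member_le_sum) auto
    finally show ?thesis by (simp add: B_def)
  qed
  have inj: "m = m'" if "m \<in> keys P" "m' \<in> keys P" "\<kappa> m = \<kappa> m'" for m m'
  proof (rule poly_mapping_eqI)
    fix i
    show "lookup m i = lookup m' i"
    proof (cases "i < n")
      case True
      show ?thesis by (rule digits_unique[OF _ that(3)[unfolded \<kappa>_def] True]) (use B that in auto)
    next
      case False
      hence "i \<notin> keys m" "i \<notin> keys m'" using P that by force+
      thus ?thesis by (simp add: in_keys_iff)
    qed
  qed
  define p where "p = (\<Sum>m\<in>keys P. monom (lookup P m) (\<kappa> m))"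
  have "poly p z = mpoly_eval (\<lambda>i. z ^ B ^ i) P" for z
  proof -
    have "monomial_eval (\<lambda>i. z ^ B ^ i) m = z ^ \<kappa> m" if "m \<in> keys P" for m
      by (simp add: monomial_eval_superset[OF _ P[OF that]] \<kappa>_def power_sum mult.commute flip: power_mult)
    thus ?thesis by (simp add: p_def poly_sum poly_monom mpoly_eval_def)
  qed
  hence "\<forall>z. poly p z = 0" using zero by simp
  hence p: "p = 0" by (simp only: poly_all_0_iff_0)
  have "keys P = {}"
  proof (rule ccontr)
    assume "keys P \<noteq> {}"
    then obtain m where m: "m \<in> keys P" by blast
    have "coeff p (\<kappa> m) = (\<Sum>m'\<in>keys P. if m' = m then lookup P m else 0)"
      unfolding p_def coeff_sum by (rule sum.cong) (use inj m in auto)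
    thus False using m p by (simp add: in_keys_iff)
  qed
  thus ?thesis by simp
qed

subsection \<open>Power sums\<close>

text \<open>The \<open>t i\<close> are the inverses of the roots, filled up with zeros if the degree
  is less than \<open>n\<close>.\<close>

lemma linear_factors:
  fixes F :: "complex poly" assumes "degree F \<le> n" "coeff F 0 = 1" shows "\<exists>t. F = (\<Prod>i<n. [:1, - t i:])" using assms
proof (induction n arbitrary: F)
  case 0
  hence "F = [:1:]" by (metis degree_eq_zeroE le_zero_eq coeff_pCons_0)
  thus ?case by simp
next
  case (Suc n)
  show ?case
  proof (cases "degree F = 0")
    case True
    hence "F = [:1:]" using Suc.prems by (metis degree_eq_zeroE coeff_pCons_0)
    thus ?thesis by (intro exI[of _ "\<lambda>_. 0"]) (simp flip: one_pCons)
  next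
    case False
    hence "\<not> constant (poly F)" by (simp add: constant_degree)
    then obtain z where z: "poly F z = 0" using fundamental_theorem_of_algebra by blast
    have z0: "z \<noteq> 0" using z Suc.prems(2) by (auto simp: poly_0_coeff_0)
    obtain H where H: "F = [:- z, 1:] * H" using z by (auto simp: poly_eq_0_iff_dvd dvd_def)
    have "H \<noteq> 0" using H Suc.prems(2) by auto
    hence "degree F = Suc (degree H)" unfolding H by (subst degree_mult_eq) auto
    moreover have "coeff (smult (- z) H) 0 = 1" using H Suc.prems(2) by (simp add: coeff_mult)
    ultimately obtain t where t: "smult (- z) H = (\<Prod>i<n. [:1, - t i:])"
      using Suc.IH[of "smult (- z) H"] Suc.prems(1) z0 by auto
    have "[:- z, 1:] = smult (- z) [:1, - (1 / z):]" using z0 by simp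
    hence "F = smult (- z) H * [:1, - (1 / z):]" unfolding H by (simp only: mult_smult_left mult_smult_right mult.commute)
    also have "\<dots> = (\<Prod>i<Suc n. [:1, - (t(n := 1 / z)) i:])" unfolding t by simp
    finally show ?thesis by blast
  qed
qed

text \<open>Newton's identities, as the logarithmic derivative of the product.\<close>

lemma newton_identity:
  fixes t :: "nat \<Rightarrow> complex" shows "fps_deriv (\<Prod>i<n. 1 - fps_const (t i) * fps_X) =
     - ((\<Prod>i<n. 1 - fps_const (t i) * fps_X) * Abs_fps (\<lambda>k. \<Sum>i<n. t i ^ Suc k))"
proof (induction n)
  case 0
  have "Abs_fps (\<lambda>k. \<Sum>i<0. t i ^ Suc k) = 0" by (simp add: fps_eq_iff)
  thus ?case by simp
next
  case (Suc n)
  let ?G = "Abs_fps (\<lambda>k. t n ^ Suc k)"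
  let ?F = "\<Prod>i<n. 1 - fps_const (t i) * fps_X" and ?S = "Abs_fps (\<lambda>k. \<Sum>i<n. t i ^ Suc k)"
  have s: "Abs_fps (\<lambda>k. \<Sum>i<Suc n. t i ^ Suc k) = ?S + ?G" by (simp add: fps_eq_iff)
  have g: "(1 - fps_const (t n) * fps_X) * ?G = fps_const (t n)"
  proof (rule fps_ext)
    fix k
    show "fps_nth ((1 - fps_const (t n) * fps_X) * ?G) k = fps_nth (fps_const (t n)) k"
      by (cases k) (simp_all add: algebra_simps mult.assoc)
  qed
  have "fps_deriv (\<Prod>i<Suc n. 1 - fps_const (t i) * fps_X) = fps_deriv ?F * (1 - fps_const (t n) * fps_X) - ?F * fps_const (t n)"
    by (simp add: algebra_simps)
  also have "\<dots> = - (?F * ?S * (1 - fps_const (t n) * fps_X)) - ?F * ((1 - fps_const (t n) * fps_X) * ?G)"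
    unfolding g Suc.IH by (simp add: algebra_simps)
  also have "\<dots> = - ((\<Prod>i<Suc n. 1 - fps_const (t i) * fps_X) * (?S + ?G))" by (simp add: algebra_simps)
  finally show ?case unfolding s .
qed

lemma newton_coefficients:
  fixes p :: "nat \<Rightarrow> complex" shows "\<exists>c. c 0 = 1 \<and> (\<forall>k<n. of_nat (Suc k) * c (Suc k) = - (\<Sum>i\<le>k. c i * p (k - i)))"
proof (induction n)
  case 0
  show ?case by (intro exI[of _ "\<lambda>_. 1"]) simp
next
  case (Suc n)
  then obtain c where c: "c 0 = 1" "\<forall>k<n. of_nat (Suc k) * c (Suc k) = - (\<Sum>i\<le>k. c i * p (k - i))" by blast
  define c' where "c' = c(Suc n := - (\<Sum>i\<le>n. c i * p (n - i)) / of_nat (Suc n))"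
  have "(\<Sum>i\<le>k. c' i * p (k - i)) = (\<Sum>i\<le>k. c i * p (k - i))" if "k \<le> n" for k
    by (rule sum.cong) (use that in \<open>auto simp: c'_def\<close>)
  moreover have "complex_of_nat (Suc n) \<noteq> 0" by (simp del: of_nat_Suc)
  ultimately have "c' 0 = 1 \<and> (\<forall>k<Suc n. of_nat (Suc k) * c' (Suc k) = - (\<Sum>i\<le>k. c' i * p (k - i)))"
    using c by (auto simp: c'_def less_Suc_eq simp del: of_nat_Suc)
  thus ?case by blast
qed

text \<open>Newton's recursion turns the prescribed power sums into coefficients of a polynomial.
  The inverses of its roots satisfy the same recursion, which also determines the power sums from
  the coefficients.\<close>

lemma power_sums_surjective:
  fixes p :: "nat \<Rightarrow> complex" shows "\<exists>t. \<forall>k<n. (\<Sum>i<n. t i ^ Suc k) = p k"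
proof -
  obtain c where c: "c 0 = 1" "\<And>k. k < n \<Longrightarrow> of_nat (Suc k) * c (Suc k) = - (\<Sum>i\<le>k. c i * p (k - i))"
    using newton_coefficients by metis
  define F where "F = (\<Sum>k\<le>n. monom (c k) k)"
  have F: "coeff F k = (if k \<le> n then c k else 0)" for k by (simp add: F_def coeff_sum)
  have "degree F \<le> n" using F by (intro degree_le) auto
  then obtain t where t: "F = (\<Prod>i<n. [:1, - t i:])" using linear_factors[of F n] F c(1) by auto
  have "fps_of_poly F = (\<Prod>i<n. 1 - fps_const (t i) * fps_X)"
    unfolding t fps_of_poly_prod by (rule prod.cong) (simp_all add: fps_of_poly_linear' flip: fps_const_neg)
  hence "fps_deriv (fps_of_poly F) = - (fps_of_poly F * Abs_fps (\<lambda>k. \<Sum>i<n. t i ^ Suc k))"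
    using newton_identity[of t n] by simp
  hence nth: "fps_nth (fps_deriv (fps_of_poly F)) k = fps_nth (- (fps_of_poly F * Abs_fps (\<lambda>k. \<Sum>i<n. t i ^ Suc k))) k" for k by simp
  hence rec: "of_nat (Suc k) * c (Suc k) = - (\<Sum>i\<le>k. c i * (\<Sum>j<n. t j ^ Suc (k - i)))" if "k < n" for k
  proof -
    have "(\<Sum>i\<le>k. coeff F i * (\<Sum>j<n. t j ^ Suc (k - i))) = (\<Sum>i\<le>k. c i * (\<Sum>j<n. t j ^ Suc (k - i)))"
      by (rule sum.cong) (use that in \<open>auto simp: F\<close>)
    thus ?thesis using that nth[of k] F[of "Suc k"] by (simp add: fps_mult_nth atLeast0AtMost del: of_nat_Suc)
  qed
  have "(\<Sum>i<n. t i ^ Suc k) = p k" if "k < n" for k using that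
  proof (induction k rule: less_induct)
    case (less k)
    have "(\<Sum>i\<le>k. c i * (\<Sum>j<n. t j ^ Suc (k - i))) = (\<Sum>i\<le>k. c i * p (k - i))"
      using rec[OF less.prems] c(2)[OF less.prems] by simp
    moreover have "(\<Sum>i\<in>{..k} - {0}. c i * (\<Sum>j<n. t j ^ Suc (k - i))) = (\<Sum>i\<in>{..k} - {0}. c i * p (k - i))"
      by (rule sum.cong[OF refl]) (use less in auto)
    ultimately show ?case by (simp add: sum.remove[of "{..k}" 0] c(1))
  qed
  thus ?thesis by blast
qed

lemma triangular_system:
  fixes a :: "nat \<Rightarrow> nat \<Rightarrow> complex" assumes "\<And>m. m < n \<Longrightarrow> a m m \<noteq> 0" shows "\<exists>p. \<forall>m<n. (\<Sum>k\<le>m. a m k * p k) = y m"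
  using assms
proof (induction n)
  case (Suc n)
  then obtain p where p: "\<forall>m<n. (\<Sum>k\<le>m. a m k * p k) = y m" by auto
  define q where "q = p(n := (y n - (\<Sum>k<n. a n k * p k)) / a n n)"
  have "(\<Sum>k\<le>m. a m k * q k) = (\<Sum>k\<le>m. a m k * p k)" if "m < n" for m
    by (rule sum.cong) (use that in \<open>auto simp: q_def\<close>)
  moreover have "(\<Sum>k\<le>n. a n k * q k) = y n"
    using Suc.prems[of n] by (simp add: q_def lessThan_Suc_atMost[symmetric])
  ultimately have "\<forall>m<Suc n. (\<Sum>k\<le>m. a m k * q k) = y m" using p by (auto simp: less_Suc_eq)
  thus ?case by blast
qed simp

text \<open>Polynomials of degree \<open>m + 1\<close> without constant term are triangular in the
  powers, so that power sums suffice.\<close>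

lemma polynomial_sums_surjective:
  fixes u :: "nat \<Rightarrow> complex poly" assumes u: "\<And>m. degree (u m) = Suc m" "\<And>m. coeff (u m) 0 = 0"
  shows "\<exists>t. \<forall>m<n. (\<Sum>i<n. poly (u m) (t i)) = y m"
proof -
  have "coeff (u m) (Suc m) \<noteq> 0" for m using u(1)[of m] by (metis leading_coeff_0_iff degree_0 nat.distinct(1))
  then obtain p where p: "\<And>m. m < n \<Longrightarrow> (\<Sum>k\<le>m. coeff (u m) (Suc k) * p k) = y m"
    using triangular_system[of n "\<lambda>m k. coeff (u m) (Suc k)" y] by auto
  obtain t where t: "\<And>k. k < n \<Longrightarrow> (\<Sum>i<n. t i ^ Suc k) = p k" using power_sums_surjective by metis
  have "(\<Sum>i<n. poly (u m) (t i)) = y m" if "m < n" for m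
  proof -
    have "poly (u m) x = (\<Sum>k\<le>m. coeff (u m) (Suc k) * x ^ Suc k)" for x
      by (simp add: poly_altdef u(1) sum.atMost_Suc_shift u(2) del: sum.atMost_Suc)
    hence "(\<Sum>i<n. poly (u m) (t i)) = (\<Sum>k\<le>m. coeff (u m) (Suc k) * (\<Sum>i<n. t i ^ Suc k))"
      by (subst sum_distrib_left, subst sum.swap) simp
    also have "\<dots> = (\<Sum>k\<le>m. coeff (u m) (Suc k) * p k)" by (rule sum.cong) (use t that in auto)
    finally show ?thesis using p that by simp
  qed
  thus ?thesis by blast
qed

lemma infinite_grid: "infinite (range (\<lambda>k::nat. of_nat k * (of_nat k + 1) :: complex))"
proof -
  have "inj (\<lambda>k::nat. of_nat k * (of_nat k + 1) :: complex)"
  proof (rule injI)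
    fix k l :: nat assume "of_nat k * (of_nat k + 1) = (of_nat l * (of_nat l + 1) :: complex)"
    hence "of_nat (k * (k + 1)) = (of_nat (l * (l + 1)) :: complex)" by (simp add: algebra_simps)
    hence e: "k * (k + 1) = l * (l + 1)" by (simp only: of_nat_eq_iff)
    have "k * (k + 1) < l * (l + 1)" if "k < l" for k l :: nat using that by (intro mult_strict_mono) auto
    thus "k = l" using e by (metis linorder_neqE_nat nat_neq_iff)
  qed
  thus ?thesis using range_inj_infinite by blast
qed

lemma poly_zero_on_infinite: "infinite S \<Longrightarrow> (\<And>z. z \<in> S \<Longrightarrow> poly p z = 0) \<Longrightarrow> p = (0 :: complex poly)"
  using poly_roots_finite[of p] finite_subset[of S "{z. poly p z = 0}"] by auto

text \<open>With the other variables fixed, the evaluation is a polynomial in one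
  \<open>t i\<close>; infinitely many zeros free this variable. After \<open>n\<close> steps it
  vanishes for all \<open>t\<close>, and the sums of the \<open>u m\<close> take all values in
  \<open>\<complex>\<^sup>n\<close>.\<close>

lemma mpoly_zero_dense:
  fixes u :: "nat \<Rightarrow> complex poly" assumes u: "\<And>m. degree (u m) = Suc m" "\<And>m. coeff (u m) 0 = 0"
    and P: "\<And>m. m \<in> keys P \<Longrightarrow> keys m \<subseteq> {..<n}"
    and zero: "\<And>N. mpoly_eval (\<lambda>m. \<Sum>i<n. poly (u m) (of_nat (N i) * (of_nat (N i) + 1))) P = 0" shows "P = 0"
proof (rule mpoly_eval_zero[OF P])
  fix x
  let ?S = "range (\<lambda>k::nat. of_nat k * (of_nat k + 1) :: complex)"
  define \<Phi> where "\<Phi> t = mpoly_eval (\<lambda>m. \<Sum>i<n. poly (u m) (t i)) P" for t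
  have poly: "\<exists>p. \<forall>z. \<Phi> (t(i := z)) = poly p z" if "i < n" for t i
  proof -
    define q where "q k = u k + [:\<Sum>j\<in>{..<n}-{i}. poly (u k) (t j):]" for k
    have q: "poly (q k) z = (\<Sum>j<n. poly (u k) ((t(i := z)) j))" for k z
    proof -
      have "(\<Sum>j\<in>{..<n}-{i}. poly (u k) ((t(i := z)) j)) = (\<Sum>j\<in>{..<n}-{i}. poly (u k) (t j))" by (rule sum.cong) auto
      thus ?thesis using that by (simp add: q_def sum.remove[of "{..<n}" i])
    qed
    show ?thesis by (intro exI[of _ "\<Sum>m\<in>keys P. smult (lookup P m) (\<Prod>k\<in>keys m. q k ^ lookup m k)"])
        (simp add: \<Phi>_def mpoly_eval_def monomial_eval_def poly_sum poly_prod poly_power q)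
  qed
  have all: "\<Phi> t = 0" if "k \<le> n" "\<And>j. k \<le> j \<Longrightarrow> j < n \<Longrightarrow> t j \<in> ?S" for k t using that
  proof (induction k arbitrary: t)
    case 0
    hence "\<forall>j. \<exists>N::nat. j < n \<longrightarrow> t j = of_nat N * (of_nat N + 1)" by auto
    then obtain N where "\<forall>j. j < n \<longrightarrow> t j = of_nat (N j) * (of_nat (N j :: nat) + 1)" by metis
    thus ?case using zero[of N] by (simp add: \<Phi>_def)
  next
    case (Suc k)
    obtain p where p: "\<And>z. \<Phi> (t(k := z)) = poly p z" using poly[of k t] Suc.prems by auto
    have "poly p z = 0" if "z \<in> ?S" for z
      unfolding p[symmetric] using Suc.prems that by (intro Suc.IH) (auto simp: le_less_Suc_eq)
    hence "p = 0" by (rule poly_zero_on_infinite[OF infinite_grid])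
    thus ?case using p[of "t k"] by simp
  qed
  obtain t where t: "\<And>m. m < n \<Longrightarrow> (\<Sum>i<n. poly (u m) (t i)) = x m" using polynomial_sums_surjective[OF u] by metis
  have "mpoly_eval x P = \<Phi> t" unfolding \<Phi>_def mpoly_eval_def monomial_eval_def
    by (intro sum.cong prod.cong refl arg_cong2[of _ _ _ _ "(*)"] arg_cong2[of _ _ _ _ "(^)"]) (use t P in force)
  thus "mpoly_eval x P = 0" using all[of n t] by simp
qed

subsection \<open>Sums of polynomials over an interval\<close>

text \<open>The polynomial in \<open>q\<^sup>2\<close> left when
  \<open>(q(q+1))\<^sup>l - (q(q-1))\<^sup>l\<close>, an odd function, is divided by
  \<open>q\<close>. The recursion is the one of \<open>a\<^sup>l - b\<^sup>l\<close> with
  \<open>a + b = 2q\<^sup>2\<close> and \<open>ab = q\<^sup>2(q\<^sup>2-1)\<close>.\<close>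

fun odd_part :: "nat \<Rightarrow> complex poly" where
  "odd_part 0 = 0"
| "odd_part (Suc 0) = [:2:]"
| "odd_part (Suc (Suc l)) = smult 2 (pCons 0 (odd_part (Suc l))) - (pCons 0 (pCons 0 (odd_part l)) - pCons 0 (odd_part l))"

lemma odd_part: "(q * (q + 1)) ^ l - (q * (q - 1)) ^ l = q * poly (odd_part l) (q\<^sup>2)"
proof (induction l rule: odd_part.induct)
  case (3 l)
  have "a ^ Suc (Suc l) - b ^ Suc (Suc l) = (a + b) * (a ^ Suc l - b ^ Suc l) - a * b * (a ^ l - b ^ l)" for a b :: complex
    by (simp add: algebra_simps)
  moreover have "q * (q + 1) + q * (q - 1) = 2*q\<^sup>2" "q * (q + 1) * (q * (q - 1)) = q\<^sup>2 * (q\<^sup>2 - 1)"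
    by (simp_all add: algebra_simps power2_eq_square)
  ultimately have "(q * (q + 1)) ^ Suc (Suc l) - (q * (q - 1)) ^ Suc (Suc l)
    = 2*q\<^sup>2 * (q * poly (odd_part (Suc l)) (q\<^sup>2)) - q\<^sup>2 * (q\<^sup>2 - 1) * (q * poly (odd_part l) (q\<^sup>2))" by (simp only: 3)
  thus ?case by (simp add: algebra_simps)
qed (simp_all add: algebra_simps)

lemma coeff_odd_part: "l \<le> i \<Longrightarrow> coeff (odd_part l) i = 0" "coeff (odd_part (Suc l)) l = 2 * of_nat (Suc l)"
proof -
  show *: "l \<le> i \<Longrightarrow> coeff (odd_part l) i = 0" for l i
  proof (induction l arbitrary: i rule: odd_part.induct)
    case (3 l)
    then obtain j where "i = Suc (Suc j)" "l \<le> j" by (metis Suc_le_D Suc_le_mono)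
    thus ?case using 3 by simp
  qed (auto simp: coeff_pCons split: nat.split)
  have "coeff (pCons 0 (odd_part l)) l = 2 * of_nat l" for l
  proof (induction l rule: odd_part.induct)
    case (3 l)
    thus ?case by (simp add: *)
  qed simp_all
  from this[of "Suc l"] show "coeff (odd_part (Suc l)) l = 2 * of_nat (Suc l)" by simp
qed

text \<open>The polynomials \<open>odd_part (Suc m)\<close> have degree \<open>m\<close>, so they
  form a triangular basis; each step removes the top coefficient of \<open>\<beta>\<close>.\<close>

lemma antidifference: assumes "\<And>i. i \<ge> m \<Longrightarrow> coeff \<beta> i = 0"
  shows "\<exists>u. (\<forall>i>m. coeff u i = 0) \<and> coeff u 0 = 0 \<and> (m > 0 \<longrightarrow> coeff u m = coeff \<beta> (m - 1) / (2 * of_nat m)) \<and>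
    (\<forall>q. poly u (q * (q + 1)) - poly u (q * (q - 1)) = q * poly \<beta> (q\<^sup>2 :: complex))" using assms
proof (induction m arbitrary: \<beta>)
  case 0
  hence "\<beta> = 0" by (simp add: poly_eq_iff)
  thus ?case by (intro exI[of _ 0]) simp
next
  case (Suc m)
  define c where "c = coeff \<beta> m / (2 * of_nat (Suc m))"
  have cm: "c * (2 * of_nat (Suc m)) = coeff \<beta> m" by (simp add: c_def del: of_nat_Suc)
  define \<beta>' where "\<beta>' = \<beta> - smult c (odd_part (Suc m))"
  have "coeff \<beta>' i = 0" if "i \<ge> m" for i
  proof (cases "i = m")
    case True
    thus ?thesis using cm by (simp add: \<beta>'_def coeff_odd_part(2) del: of_nat_Suc)
  next
    case False
    thus ?thesis using Suc.prems[of i] coeff_odd_part(1)[of "Suc m" i] that by (simp add: \<beta>'_def)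
  qed
  then obtain u where u: "\<forall>i>m. coeff u i = 0" "coeff u 0 = 0"
    "\<And>q. poly u (q * (q + 1)) - poly u (q * (q - 1)) = q * poly \<beta>' (q\<^sup>2)" using Suc.IH[of \<beta>'] by auto
  let ?u = "u + monom c (Suc m)"
  have "poly ?u (q * (q + 1)) - poly ?u (q * (q - 1)) = q * poly \<beta> (q\<^sup>2)" for q
  proof -
    have "poly ?u (q * (q + 1)) - poly ?u (q * (q - 1)) =
      (poly u (q * (q + 1)) - poly u (q * (q - 1))) + c * ((q * (q + 1)) ^ Suc m - (q * (q - 1)) ^ Suc m)"
      by (simp add: poly_monom algebra_simps)
    also have "\<dots> = q * poly \<beta> (q\<^sup>2)" unfolding u odd_part by (simp add: \<beta>'_def algebra_simps)
    finally show ?thesis .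
  qed
  thus ?case using u(1,2) by (intro exI[of _ ?u]) (auto simp: c_def simp del: of_nat_Suc)
qed

lemma even_function_poly:
  fixes b :: "complex poly" assumes "degree b \<le> 2*m"
  shows "\<exists>\<beta>. (\<forall>i>m. coeff \<beta> i = 0) \<and> coeff \<beta> m = 2 * coeff b (2*m) \<and> (\<forall>x. poly b x + poly b (- x) = poly \<beta> (x\<^sup>2))"
proof -
  define \<beta> where "\<beta> = (\<Sum>i\<le>m. monom (2 * coeff b (2*i)) i)"
  have "coeff \<beta> i = (if i \<le> m then 2 * coeff b (2*i) else 0)" for i by (simp add: \<beta>_def coeff_sum)
  moreover have "poly b x + poly b (- x) = poly \<beta> (x\<^sup>2)" for x
  proof -
    have b: "poly b y = (\<Sum>i\<le>2*m. coeff b i * y ^ i)" for y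
      by (subst (1) poly_as_sum_of_monoms'[OF assms, symmetric]) (simp add: poly_sum poly_monom)
    have "poly b x + poly b (- x) = (\<Sum>i\<le>2*m. coeff b i * (x ^ i + (- x) ^ i))"
      by (simp add: b sum.distrib algebra_simps)
    also have "\<dots> = (\<Sum>i\<in>(\<lambda>i. 2*i) ` {..m}. coeff b i * (x ^ i + (- x) ^ i))"
    proof (rule sum.mono_neutral_right)
      show "\<forall>i\<in>{..2*m} - (\<lambda>i. 2*i) ` {..m}. coeff b i * (x ^ i + (- x) ^ i) = 0"
      proof
        fix i assume "i \<in> {..2*m} - (\<lambda>i. 2*i) ` {..m}"
        hence "odd i" by (auto elim!: evenE)
        thus "coeff b i * (x ^ i + (- x) ^ i) = 0" by simp
      qed
    qed auto
    also have "\<dots> = poly \<beta> (x\<^sup>2)"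
      by (subst sum.reindex) (auto simp: inj_on_def \<beta>_def poly_sum poly_monom power_mult intro!: sum.cong)
    finally show ?thesis .
  qed
  ultimately show ?thesis by (intro exI[of _ \<beta>]) auto
qed

text \<open>The symmetrized binomial is even in \<open>q\<close>, so the summand is the difference
  of the values of one polynomial at \<open>q(q+1)\<close> and at \<open>q(q-1)\<close>. The latter
  is the former argument at \<open>q - 1\<close>, and the sum telescopes.\<close>

lemma eigenvalue_poly:
  "\<exists>u. degree u = Suc m \<and> coeff u 0 = 0 \<and> (\<forall>N::nat. (\<Sum>q\<in>{1..N}. of_nat q *
     ((of_nat (2*m) + of_nat q gchoose (2*m)) + (of_nat (2*m) - of_nat q gchoose (2*m))))
    = poly u (of_nat N * (of_nat N + 1) :: complex))"
proof -
  define b :: "complex poly" where "b = smult (1 / fact (2*m)) (\<Prod>i=0..<2*m. [:of_nat (2*m) - of_nat i, 1:])"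
  have b: "poly b x = (of_nat (2*m) + x gchoose (2*m))" for x
    by (simp add: b_def gbinomial_prod_rev poly_prod algebra_simps)
  have d: "degree (\<Prod>i=0..<2*m. [:of_nat (2*m) - of_nat i, 1 :: complex:]) = 2*m"
    by (subst degree_prod_sum_eq) auto
  have lc: "lead_coeff (\<Prod>i=0..<2*m. [:of_nat (2*m) - of_nat i, 1 :: complex:]) = 1" by (simp add: lead_coeff_prod)
  have "degree b = 2*m" "coeff b (2*m) = 1 / fact (2*m)" using d lc by (auto simp: b_def)
  then obtain \<beta> where \<beta>: "\<forall>i>m. coeff \<beta> i = 0" "coeff \<beta> m \<noteq> 0" "\<And>x. poly b x + poly b (- x) = poly \<beta> (x\<^sup>2)"
    using even_function_poly[of b m] by auto
  obtain u where u: "\<forall>i>Suc m. coeff u i = 0" "coeff u 0 = 0" "coeff u (Suc m) = coeff \<beta> m / (2 * of_nat (Suc m))"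
    "\<And>q. poly u (q * (q + 1)) - poly u (q * (q - 1)) = q * poly \<beta> (q\<^sup>2)"
    using antidifference[of "Suc m" \<beta>] \<beta>(1) by (auto simp: less_eq_Suc_le[symmetric])
  have "coeff u (Suc m) \<noteq> 0" using \<beta>(2) u(3) by (simp del: of_nat_Suc)
  moreover from this u(1) have "degree u = Suc m" by (intro antisym degree_le le_degree) auto
  moreover have "(\<Sum>q\<in>{1..N}. of_nat q *
     ((of_nat (2*m) + of_nat q gchoose (2*m)) + (of_nat (2*m) - of_nat q gchoose (2*m))))
    = poly u (of_nat N * (of_nat N + 1))" for N :: nat
  proof (induction N)
    case 0
    thus ?case using u(2) by (simp add: poly_0_coeff_0)
  next
    case (Suc N)
    have "of_nat (Suc N) * ((of_nat (2*m) + of_nat (Suc N) gchoose (2*m)) + (of_nat (2*m) - of_nat (Suc N) gchoose (2*m)))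
       = (of_nat (Suc N) * poly \<beta> ((of_nat (Suc N))\<^sup>2) :: complex)"
      unfolding \<beta>(3)[symmetric] b by (simp only: add_uminus_conv_diff)
    also have "\<dots> = poly u (of_nat (Suc N) * (of_nat (Suc N) + 1)) - poly u (of_nat (Suc N) * (of_nat (Suc N) - 1))"
      unfolding u(4) ..
    also have "(of_nat (Suc N) * (of_nat (Suc N) - 1) :: complex) = of_nat N * (of_nat N + 1)"
      by (simp add: algebra_simps)
    finally show ?case using Suc.IH by simp
  qed
  ultimately show ?thesis using u(2) by blast
qed

text \<open>Such a \<open>p\<close> is a multiple of the product of the \<open>x - c\<close> with
  \<open>c \<le> n\<close>; its linear coefficient is
  \<open>\<rho> = (-1)\<^sup>n n!\<close>.\<close>

lemma coeff_one_vanishing: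
  "\<exists>\<rho>\<noteq>0. \<forall>p :: complex poly. degree p \<le> Suc n \<longrightarrow> (\<forall>c\<le>n. poly p (of_nat c) = 0) \<longrightarrow> coeff p 1 = \<rho> * coeff p (Suc n)"
proof -
  define R :: "complex poly" where "R = (\<Prod>c\<le>n. [:- of_nat c, 1:])"
  have R: "degree R = Suc n" "lead_coeff R = 1"
    unfolding R_def by (subst degree_prod_sum_eq) (auto simp: lead_coeff_prod)
  have "coeff p 1 = coeff R 1 * coeff p (Suc n)" if p: "degree p \<le> Suc n" "\<And>c. c \<le> n \<Longrightarrow> poly p (of_nat c) = 0" for p
  proof -
    define q where "q = p - smult (coeff p (Suc n)) R"
    have "coeff q i = 0" if "i \<ge> Suc n" for i using that R p(1) by (cases "i = Suc n") (auto simp: q_def coeff_eq_0)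
    hence dq: "q = 0 \<or> degree q < Suc n" by (metis leading_coeff_0_iff linorder_not_less)
    have "poly q (of_nat c) = 0" if "c \<le> n" for c using p(2)[OF that] that by (auto simp: q_def R_def poly_prod)
    hence "of_nat ` {..n} \<subseteq> {z. poly q z = 0}" by auto
    hence "q = 0"
    proof (rule contrapos_pp)
      assume q: "q \<noteq> 0"
      have "card (complex_of_nat ` {..n}) = Suc n" by (simp add: card_image inj_on_def)
      thus "\<not> complex_of_nat ` {..n} \<subseteq> {z. poly q z = 0}"
        using dq q card_poly_roots_bound[of q] card_mono[OF poly_roots_finite[OF q], of "of_nat ` {..n}"] by linarith
    qed
    hence "p = smult (coeff p (Suc n)) R" by (simp add: q_def)
    thus ?thesis by (metis coeff_smult mult.commute)
  qed
  moreover have "coeff R 1 \<noteq> 0"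
  proof -
    have "R = [:0, 1:] * (\<Prod>c<n. [:- of_nat (Suc c), 1:])" unfolding R_def by (subst prod.atMost_shift) simp
    hence "coeff R 1 = coeff (\<Prod>c<n. [:- of_nat (Suc c), 1 :: complex:]) 0" by simp
    also have "\<dots> = (\<Prod>c<n. - of_nat (Suc c))" unfolding poly_0_coeff_0[symmetric] poly_prod by simp
    finally show ?thesis by (simp del: of_nat_Suc)
  qed
  ultimately show ?thesis by blast
qed

lemma independent_degrees:
  fixes u :: "nat \<Rightarrow> complex poly"
  assumes u: "\<And>m. degree (u m) = Suc m" and zero: "[:c:] + (\<Sum>k<K. smult (a k) (u k)) = 0"
  shows "c = 0 \<and> (\<forall>k<K. a k = 0)" using zero
proof (induction K)
  case (Suc K)
  have nz: "coeff (u K) (Suc K) \<noteq> 0" using u[of K] by (metis leading_coeff_0_iff degree_0 nat.distinct(1))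
  have "coeff (\<Sum>k<K. smult (a k) (u k)) (Suc K) = 0"
    unfolding coeff_sum by (rule sum.neutral) (auto simp: u coeff_eq_0)
  moreover have "coeff ([:c:] + (\<Sum>k<Suc K. smult (a k) (u k))) (Suc K) = 0" using Suc.prems by (simp only: coeff_0)
  ultimately have "a K * coeff (u K) (Suc K) = 0"
    unfolding sum.lessThan_Suc coeff_add by (simp only: coeff_pCons_Suc coeff_0 coeff_smult add_0)
  hence "a K = 0" using nz by simp
  hence "[:c:] + (\<Sum>k<K. smult (a k) (u k)) = 0" using Suc.prems by simp
  thus ?case using Suc.IH \<open>a K = 0\<close> less_Suc_eq by metis
qed simp

section \<open>The Zhu algebra\<close>

lemma (in vector_space) span_image_sum:
  "x \<in> span (g ` S) \<Longrightarrow> \<exists>A c. finite A \<and> A \<subseteq> S \<and> x = (\<Sum>i\<in>A. scale (c i) (g i))"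
proof (induction rule: span_induct_alt)
  case base
  show ?case by (intro exI[of _ "{}"]) simp
next
  case (step c x y)
  then obtain i A d where i: "i \<in> S" "x = g i" and A: "finite A" "A \<subseteq> S" "y = (\<Sum>i\<in>A. scale (d i) (g i))" by auto
  define d' where "d' j = (if j \<in> A then d j else 0) + (if j = i then c else 0)" for j
  have "(\<Sum>j\<in>insert i A. scale (d' j) (g j)) =
     (\<Sum>j\<in>insert i A. scale (if j \<in> A then d j else 0) (g j)) + (\<Sum>j\<in>insert i A. if j = i then scale c (g i) else 0)"
    unfolding sum.distrib[symmetric] by (rule sum.cong) (auto simp: d'_def scale_left_distrib)
  also have "(\<Sum>j\<in>insert i A. scale (if j \<in> A then d j else 0) (g j)) = y"
    unfolding A(3) by (rule sum.mono_neutral_cong_right) (use A(1) in auto)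
  finally have "scale c x + y = (\<Sum>j\<in>insert i A. scale (d' j) (g j))" using A(1) i(2) by (simp add: add.commute)
  thus ?case using i(1) A(1,2) by (intro exI[of _ "insert i A"] exI[of _ d']) auto
qed

context symplectic_fermion_algebra
begin

abbreviation jq :: "nat \<Rightarrow> 'v" where "jq m \<equiv> sf_j n V e f m"

abbreviation (input) jc :: "nat \<Rightarrow> complex" where "jc m \<equiv> - fact (2*m) / 2"

lemma jq_xq: "jq m = jc m *s xq 0 (2*m)" "xq 0 (2*m) = (1 / jc m) *s jq m" by (simp_all add: sf_j_eq)

lemma jq_DD: "jq m \<in> DD (int (2*m + 2))"
  unfolding jq_xq(1) using xq_DD[of 0 "2*m"] by (intro vs.subspace_scale[OF DD_subspace]) simp

lemma jq_WC [simp, intro]: "jq m \<in> WC" using jq_DD DD_WC by blast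

definition jpoly :: "nat \<Rightarrow> complex poly" where
  "jpoly m = (SOME u. degree u = Suc m \<and> coeff u 0 = 0 \<and>
     (\<forall>N. ev N (jq m) = (\<Sum>i<n. poly u (of_nat (N i) * (of_nat (N i) + 1)))))"

lemma jpoly: "degree (jpoly m) = Suc m" "coeff (jpoly m) 0 = 0"
  "ev N (jq m) = (\<Sum>i<n. poly (jpoly m) (of_nat (N i) * (of_nat (N i) + 1)))"
proof -
  obtain u where u: "degree u = Suc m" "coeff u 0 = 0" "\<And>N::nat. (\<Sum>q\<in>{1..N}. of_nat q *
     ((of_nat (2*m) + of_nat q gchoose (2*m)) + (of_nat (2*m) - of_nat q gchoose (2*m))))
    = poly u (of_nat N * (of_nat N + 1) :: complex)" using eigenvalue_poly[of m] by blast
  have "ev N (jq m) = (\<Sum>i<n. poly (smult (jc m) u) (of_nat (N i) * (of_nat (N i) + 1)))" for N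
    unfolding jq_xq(1) ev_linear ev_xq u(3) by (simp add: sum_distrib_left)
  hence "\<exists>u. degree u = Suc m \<and> coeff u 0 = 0 \<and>
     (\<forall>N. ev N (jq m) = (\<Sum>i<n. poly u (of_nat (N i) * (of_nat (N i) + 1))))"
    using u by (intro exI[of _ "smult (jc m) u"]) simp
  from someI_ex[OF this]
  show "degree (jpoly m) = Suc m" "coeff (jpoly m) 0 = 0"
    "ev N (jq m) = (\<Sum>i<n. poly (jpoly m) (of_nat (N i) * (of_nat (N i) + 1)))" unfolding jpoly_def by blast+
qed

text \<open>Zero entries contribute nothing, as \<open>jpoly m\<close> has no constant term. The
  number \<open>c\<close> of equal entries will be the variable in the elimination.\<close>

lemma ev_jq_block: assumes "c \<le> n"
  shows "ev (\<lambda>i. if i < c then \<nu> else 0) (jq m) = of_nat c * poly (jpoly m) (of_nat \<nu> * (of_nat \<nu> + 1))"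
proof -
  have "ev (\<lambda>i. if i < c then \<nu> else 0) (jq m)
      = (\<Sum>i<n. if i < c then poly (jpoly m) (of_nat \<nu> * (of_nat \<nu> + 1)) else 0)"
    unfolding jpoly(3) by (rule sum.cong) (auto simp: poly_0_coeff_0 jpoly(2))
  also have "\<dots> = (\<Sum>i<c. poly (jpoly m) (of_nat \<nu> * (of_nat \<nu> + 1)))"
    using assms by (intro sum.mono_neutral_cong_right) auto
  finally show ?thesis by simp
qed

subsection \<open>Quadratic fields modulo the elements acting as zero\<close>

text \<open>A congruence modulo \<open>nul\<close>, unlike one modulo \<open>ZO\<close>, may by
  definition be multiplied from the right by any invariant.\<close>

definition nul :: "'v set" where "nul = {y \<in> WC. \<forall>c\<in>WC. st y c \<in> ZO}"

lemma nul_subspace: "vs.subspace nul" by (auto simp: vs.subspace_def nul_def st_linear ZO_add ZO_scale)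

lemma nul_ZO: "y \<in> nul \<Longrightarrow> y \<in> ZO"
proof -
  assume "y \<in> nul"
  hence "y \<in> WC" "st y (vac V) \<in> ZO" by (auto simp: nul_def)
  thus ?thesis by (simp add: st_vac)
qed

lemma dV_nul: assumes "a \<in> DD (int p)" shows "dV a + of_nat p *s a \<in> nul"
proof -
  have "dV a \<in> WC" using DD_WC[OF dV_DD[OF assms]] .
  thus ?thesis using dV_star[OF assms] DD_WC[OF assms] by (auto simp: nul_def)
qed

definition TT :: "nat \<Rightarrow> 'v set" where
  "TT s = {z. \<exists>c \<alpha>. z - (c *s vac V + (\<Sum>k\<le>s div 2. \<alpha> k *s jq k)) \<in> nul}"

lemma TT_subspace: "vs.subspace (TT s)" unfolding vs.subspace_def
proof (intro conjI ballI allI)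
  show "0 \<in> TT s"
    unfolding TT_def using vs.subspace_0[OF nul_subspace] by (auto intro!: exI[of _ 0] exI[of _ "\<lambda>_. 0"])
next
  fix x y assume "x \<in> TT s" "y \<in> TT s"
  then obtain c \<alpha> c' \<alpha>' where "x - (c *s vac V + (\<Sum>k\<le>s div 2. \<alpha> k *s jq k)) \<in> nul"
     "y - (c' *s vac V + (\<Sum>k\<le>s div 2. \<alpha>' k *s jq k)) \<in> nul" unfolding TT_def by blast
  from vs.subspace_add[OF nul_subspace this]
  have "x + y - ((c + c') *s vac V + (\<Sum>k\<le>s div 2. (\<alpha> k + \<alpha>' k) *s jq k)) \<in> nul"
    by (simp add: vs.scale_left_distrib sum.distrib algebra_simps)
  thus "x + y \<in> TT s" unfolding TT_def mem_Collect_eq by (intro exI[of _ "c + c'"] exI[of _ "\<lambda>k. \<alpha> k + \<alpha>' k"])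
next
  fix a x assume "x \<in> TT s"
  then obtain c \<alpha> where "x - (c *s vac V + (\<Sum>k\<le>s div 2. \<alpha> k *s jq k)) \<in> nul" unfolding TT_def by blast
  from vs.subspace_scale[OF nul_subspace this, of a]
  have "a *s x - ((a * c) *s vac V + (\<Sum>k\<le>s div 2. (a * \<alpha> k) *s jq k)) \<in> nul"
    by (simp add: vs.scale_right_diff_distrib vs.scale_right_distrib vs.scale_sum_right)
  thus "a *s x \<in> TT s" unfolding TT_def mem_Collect_eq by (intro exI[of _ "a * c"] exI[of _ "\<lambda>k. a * \<alpha> k"])
qed

lemma TT_nul: assumes "z \<in> nul" shows "z \<in> TT s"
proof -
  have "z - (0 *s vac V + (\<Sum>k\<le>s div 2. 0 *s jq k)) \<in> nul" using assms by simp
  thus ?thesis unfolding TT_def mem_Collect_eq by (intro exI[of _ 0] exI[of _ "\<lambda>_. 0"])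
qed

lemma TT_vac: "vac V \<in> TT s"
proof -
  have "vac V - (1 *s vac V + (\<Sum>k\<le>s div 2. 0 *s jq k)) \<in> nul" using vs.subspace_0[OF nul_subspace] by simp
  thus ?thesis unfolding TT_def mem_Collect_eq by (intro exI[of _ 1] exI[of _ "\<lambda>_. 0"])
qed

lemma TT_mono: assumes "s \<le> s'" shows "TT s \<subseteq> TT s'"
proof
  fix z assume "z \<in> TT s"
  then obtain c \<alpha> where z: "z - (c *s vac V + (\<Sum>k\<le>s div 2. \<alpha> k *s jq k)) \<in> nul" unfolding TT_def by blast
  have "(\<Sum>k\<le>s' div 2. (if k \<le> s div 2 then \<alpha> k else 0) *s jq k) = (\<Sum>k\<le>s div 2. \<alpha> k *s jq k)"
    by (rule sum.mono_neutral_cong_right) (use div_le_mono[OF assms, of 2] in auto)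
  hence "z - (c *s vac V + (\<Sum>k\<le>s' div 2. (if k \<le> s div 2 then \<alpha> k else 0) *s jq k)) \<in> nul" using z by simp
  thus "z \<in> TT s'" unfolding TT_def mem_Collect_eq
    by (intro exI[of _ c] exI[of _ "\<lambda>k. if k \<le> s div 2 then \<alpha> k else 0"])
qed

lemma TT_jq: assumes "2*k \<le> s" shows "jq k \<in> TT s"
proof -
  have "(\<Sum>i\<le>s div 2. (if i = k then 1 else 0) *s jq i) = (\<Sum>i\<le>s div 2. if i = k then jq k else 0)"
    by (rule sum.cong) auto
  hence "jq k - (0 *s vac V + (\<Sum>i\<le>s div 2. (if i = k then 1 else 0) *s jq i)) \<in> nul"
    using assms vs.subspace_0[OF nul_subspace] by (simp add: less_eq_div_iff_mult_less_eq mult.commute)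
  thus ?thesis unfolding TT_def mem_Collect_eq by (intro exI[of _ 0] exI[of _ "\<lambda>i. if i = k then 1 else 0"])
qed

text \<open>Since \<open>dV a \<equiv> - p a\<close>, all \<open>xq k l\<close> with \<open>k + l = s\<close> are multiples of \<open>xq 0 s\<close> up to lower
  terms; for odd \<open>s\<close> the symmetry of \<open>xq\<close> gives \<open>xq 0 s \<equiv> - xq 0 s\<close>.\<close>

lemma xq_TT: "k + l = s \<Longrightarrow> xq k l \<in> TT s"
proof (induction s arbitrary: k l rule: less_induct)
  case (less s)
  note add = vs.subspace_add[OF TT_subspace] and scale = vs.subspace_scale[OF TT_subspace]
    and diff = vs.subspace_diff[OF TT_subspace]
  have step: "of_nat (Suc k) *s xq (Suc k) l + of_nat (Suc l) *s xq k (Suc l) \<in> TT s" if "Suc (k + l) = s" for k l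
  proof -
    have "xq k l \<in> TT s" using less.IH[of "k + l" k l] TT_mono[of "k + l" s] that by auto
    moreover have "dV (xq k l) + of_nat (k + l + 2) *s xq k l \<in> TT s" by (rule TT_nul[OF dV_nul[OF xq_DD]])
    ultimately have "(dV (xq k l) + of_nat (k + l + 2) *s xq k l) - of_nat (k + l + 2) *s xq k l \<in> TT s"
      using diff scale by blast
    thus ?thesis by (simp only: add_diff_cancel_right' dV_xq)
  qed
  have shift: "\<exists>\<beta>. xq k l - ((-1) ^ k * \<beta>) *s xq 0 s \<in> TT s \<and> (l = 0 \<longrightarrow> \<beta> = 1)" if "k + l = s" for k l
  proof -
    have "xq k l - ((-1) ^ k * of_nat (s choose k)) *s xq 0 s \<in> TT s" if "k + l = s" for k l using that
    proof (induction k arbitrary: l)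
      case 0
      thus ?case using vs.subspace_0[OF TT_subspace] by simp
    next
      case (Suc k)
      have l: "s - k = Suc l" using Suc.prems by auto
      have ch: "of_nat (Suc k) * complex_of_nat (s choose Suc k) = of_nat (Suc l) * of_nat (s choose k)"
        using binomial_absorb_comp[of s k] binomial_absorption[of k s] l
        by (metis (no_types) Suc_times_binomial_eq binomial_absorption of_nat_mult mult.commute choose_mult_lemma)
      have "xq k (Suc l) - ((-1) ^ k * of_nat (s choose k)) *s xq 0 s \<in> TT s" using Suc by simp
      from diff[OF step[of k l] scale[OF this, of "of_nat (Suc l)"]]
      have "of_nat (Suc k) *s xq (Suc k) l + (of_nat (Suc l) * ((-1) ^ k * of_nat (s choose k))) *s xq 0 s \<in> TT s"
        using Suc.prems by (simp add: vs.scale_right_diff_distrib del: of_nat_Suc)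
      also have "of_nat (Suc l) * ((-1) ^ k * of_nat (s choose k)) = of_nat (Suc k) * (- ((-1) ^ Suc k * of_nat (s choose Suc k)) :: complex)"
        using ch by (simp add: algebra_simps del: of_nat_Suc)
      finally have "(1 / of_nat (Suc k)) *s (of_nat (Suc k) *s xq (Suc k) l
           + (of_nat (Suc k) * (- ((-1) ^ Suc k * of_nat (s choose Suc k)))) *s xq 0 s) \<in> TT s" by (rule scale)
      moreover have "complex_of_nat (Suc k) \<noteq> 0" by (simp del: of_nat_Suc)
      ultimately show ?case by (simp add: vs.scale_right_distrib del: of_nat_Suc)
    qed
    thus ?thesis using that by (intro exI[of _ "of_nat (s choose k)"]) auto
  qed
  have "xq 0 s \<in> TT s"
  proof (cases "even s")
    case True
    then obtain m where "s = 2*m" by (elim evenE)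
    thus ?thesis unfolding \<open>s = 2*m\<close> jq_xq(2) by (intro scale TT_jq) simp
  next
    case False
    hence "xq s 0 + xq 0 s \<in> TT s" using shift[of s 0] by auto
    hence "(1 / 2) *s (xq 0 s + xq 0 s) \<in> TT s" using Q_sym[of s 0 "vac V"] by (intro scale) simp
    moreover have "(1 / 2) *s (xq 0 s + xq 0 s) = xq 0 s"
      by (simp add: vs.scale_right_distrib flip: vs.scale_left_distrib)
    ultimately show ?thesis by simp
  qed
  thus ?case using shift[OF less.prems] add scale by (metis diff_add_cancel)
qed

lemma vac_F: "vac V \<in> F 0 0" using F_mon[of "[]" 0 0] by simp

text \<open>\<open>WC_decompose\<close> is used twice: the arguments of the \<open>Q k l\<close>
  have length zero, and invariants of length zero are multiples of the vacuum.\<close>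

lemma F2_TT: assumes "z \<in> WC" "z \<in> F 2 h" shows "\<exists>s. z \<in> TT s"
proof -
  obtain c b where z: "z = c *s vac V + (\<Sum>k<nat h. \<Sum>l<nat h. Q k l (b k l))"
    and b: "\<And>k l. k < nat h \<Longrightarrow> l < nat h \<Longrightarrow> b k l \<in> WC \<and> b k l \<in> F (2 - 2) (h - int k - int l - 2)"
    using WC_decompose[OF assms] by blast
  have "Q k l (b k l) \<in> TT (2 * nat h)" if kl: "k < nat h" "l < nat h" for k l
  proof -
    obtain c' b' where b1: "b k l = c' *s vac V + (\<Sum>k'<nat (h - int k - int l - 2). \<Sum>l'<nat (h - int k - int l - 2). Q k' l' (b' k' l'))"
      and b': "\<And>k' l'. k' < nat (h - int k - int l - 2) \<Longrightarrow> l' < nat (h - int k - int l - 2) \<Longrightarrow>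
          b' k' l' \<in> WC \<and> b' k' l' \<in> F (0 - 2) (h - int k - int l - 2 - int k' - int l' - 2)"
      using WC_decompose[of "b k l" 0 "h - int k - int l - 2"] b[OF kl] by auto
    have "Q k' l' (b' k' l') = 0" if "k' < nat (h - int k - int l - 2)" "l' < nat (h - int k - int l - 2)" for k' l'
      using b'[OF that] F_negative[of "0 - 2"] by (simp add: Q_linear)
    hence "b k l = c' *s vac V" unfolding b1 by simp
    hence "Q k l (b k l) = c' *s xq k l" by (simp add: Q_linear)
    moreover have "xq k l \<in> TT (2 * nat h)" using xq_TT[OF refl, of k l] TT_mono[of "k + l" "2 * nat h"] kl by auto
    ultimately show ?thesis using vs.subspace_scale[OF TT_subspace] by simp
  qed
  hence "z \<in> TT (2 * nat h)"
    unfolding z by (intro vs.subspace_add[OF TT_subspace] vs.subspace_scale[OF TT_subspace] TT_vac vs.subspace_sum[OF TT_subspace]) auto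
  thus ?thesis by blast
qed

text \<open>At weights with a single nonzero entry the values of the \<open>jq k\<close> are
  polynomials of distinct degrees, so all coefficients vanish. This needs at least one
  entry.\<close>

lemma TT_ev_zero: assumes n: "0 < n" and z: "z \<in> TT s" and zero: "\<And>N. ev N z = 0" shows "z \<in> nul"
proof -
  obtain c \<alpha> where y: "z - (c *s vac V + (\<Sum>k\<le>s div 2. \<alpha> k *s jq k)) \<in> nul" (is "?y \<in> nul") using z unfolding TT_def by blast
  have e: "c + (\<Sum>k<Suc (s div 2). \<alpha> k * ev N (jq k)) = 0" for N
  proof -
    have "c + (\<Sum>k<Suc (s div 2). \<alpha> k * ev N (jq k)) = ev N z - ev N ?y"
      by (simp add: ev_linear lessThan_Suc_atMost del: sum.lessThan_Suc)
    thus ?thesis by (simp only: ev_ZO[OF nul_ZO[OF y]] zero diff_self)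
  qed
  have "poly ([:c:] + (\<Sum>k<Suc (s div 2). smult (\<alpha> k) (jpoly k))) (of_nat \<nu> * (of_nat \<nu> + 1)) = 0" for \<nu> :: nat
    using e[of "\<lambda>i. if i < 1 then \<nu> else 0", unfolded ev_jq_block[OF n[unfolded less_eq_Suc_le, folded One_nat_def]]]
    by (simp add: poly_sum del: sum.lessThan_Suc)
  hence "[:c:] + (\<Sum>k<Suc (s div 2). smult (\<alpha> k) (jpoly k)) = 0"
    by (intro poly_zero_on_infinite[OF infinite_grid]) auto
  from independent_degrees[OF jpoly(1) this] have "c = 0" "\<And>k. k \<le> s div 2 \<Longrightarrow> \<alpha> k = 0" by auto
  hence "c *s vac V + (\<Sum>k\<le>s div 2. \<alpha> k *s jq k) = 0" by simp
  thus ?thesis using y by (simp only: diff_0_right)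
qed

text \<open>The commutator is the multiplication by \<open>z\<close>. Nonnegative modes of a
  quadratic field do not raise the length, so \<open>z\<close> has length at most two; and its
  values vanish, as one sees by applying the commutator to the vacuum.\<close>

lemma st_jq_commute: assumes n: "0 < n" and c: "c \<in> WC"
  shows "st (jq k) (st (jq l) c) - st (jq l) (st (jq k) c) \<in> ZO"
proof -
  define z where "z = (\<Sum>j<(2*k+2)+(2*l+2). (of_int (int (2*k+2) - 1) gchoose j) *s Y (jq k) (int j) (jq l))"
  have com: "st (jq k) (st (jq l) c) - st (jq l) (st (jq k) c) - st z c \<in> ZO" if "c \<in> WC" for c
    unfolding z_def by (rule st_commutator[OF jq_DD jq_DD that])
  have zW: "z \<in> WC" unfolding z_def by (intro WC_sum WC_scale WC_Y) auto
  have jF: "jq l \<in> F 2 (2 * int l + 2)" using Q_F[OF vac_F, of 0 "2*l"] unfolding jq_xq(1) by (intro F_scale) simp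
  have "Y (jq k) (int j) (jq l) \<in> F 2 (2 * int l + 2 * int k + 3)" for j
  proof -
    have "Y (xq 0 (2*k)) (int j) (jq l) \<in> F 2 (2 * int l + 2 + int 0 + int (2*k) + 1 - int j)"
      using xq_mode_F[OF jF, of "int j" 0 "2*k"] by simp
    moreover have "\<dots> \<subseteq> F 2 (2 * int l + 2 * int k + 3)" by (rule F_mono) auto
    ultimately have "Y (xq 0 (2*k)) (int j) (jq l) \<in> F 2 (2 * int l + 2 * int k + 3)" by blast
    thus ?thesis unfolding jq_xq(1)[of k] by (simp only: Y_linear F_scale)
  qed
  hence "z \<in> F 2 (2 * int l + 2 * int k + 3)" unfolding z_def by (intro F_sum F_scale) auto
  then obtain s where "z \<in> TT s" using F2_TT[OF zW] by blast
  moreover have "ev N z = 0" for N using ev_ZO[OF com[OF WC_vac], of N] by (simp add: ev_linear ev_st zW st_WC)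
  ultimately have "z \<in> nul" by (rule TT_ev_zero[OF n])
  hence "st z c \<in> ZO" using c by (simp add: nul_def)
  from ZO_add[OF com[OF c] this] show ?thesis by simp
qed

subsection \<open>Words in the generators of the Zhu algebra\<close>

definition jact :: "nat list \<Rightarrow> 'v \<Rightarrow> 'v" where
  "jact ms c = foldr (\<lambda>m. st (jq m)) ms c"

abbreviation Jw :: "nat list \<Rightarrow> 'v" where "Jw ms \<equiv> jact ms (vac V)"

lemma jact_simps [simp]: "jact [] c = c" "jact (m # ms) c = st (jq m) (jact ms c)"
  "jact (ms @ ms') c = jact ms (jact ms' c)" by (simp_all add: jact_def)

lemma jact_WC [intro]: "c \<in> WC \<Longrightarrow> jact ms c \<in> WC" by (induction ms) auto

lemma st_jq_ZO: "w \<in> ZO \<Longrightarrow> st (jq m) w \<in> ZO" by (rule st_ZO[OF jq_DD])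

lemma ZO_trans: "a - b \<in> ZO \<Longrightarrow> b - c \<in> ZO \<Longrightarrow> a - c \<in> ZO" using ZO_add[of "a - b" "b - c"] by simp

lemma ZO_sym: "a - b \<in> ZO \<Longrightarrow> b - a \<in> ZO" using ZO_neg[of "a - b"] by simp

lemma ev_cong: "a - b \<in> ZO \<Longrightarrow> ev N a = ev N b" using ev_ZO[of "a - b" N] by (simp add: ev_linear)

lemma jact_move: assumes n: "0 < n" and c: "c \<in> WC" shows "jact (ms @ m # ms') c - jact (m # ms @ ms') c \<in> ZO"
proof (induction ms)
  case (Cons k ms)
  have "st (jq k) (jact (ms @ m # ms') c - jact (m # ms @ ms') c) \<in> ZO" by (rule st_jq_ZO[OF Cons])
  hence 1: "jact (k # ms @ m # ms') c - jact (k # m # ms @ ms') c \<in> ZO" by (simp add: st_linear)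
  have 2: "jact (k # m # ms @ ms') c - jact (m # k # ms @ ms') c \<in> ZO"
    using st_jq_commute[OF n jact_WC[OF c, of "ms @ ms'"], of k m] by simp
  show ?case using ZO_trans[OF 1 2] by simp
qed simp

lemma jact_perm: assumes n: "0 < n" and c: "c \<in> WC" shows "mset ms = mset ms' \<Longrightarrow> jact ms c - jact ms' c \<in> ZO"
proof (induction ms arbitrary: ms')
  case (Cons m ms)
  hence "m \<in> set ms'" by (metis list.set_intros(1) mset_eq_setD)
  then obtain xs ys where ms': "ms' = xs @ m # ys" by (auto simp: in_set_conv_decomp)
  have "jact ms c - jact (xs @ ys) c \<in> ZO" by (rule Cons.IH) (use Cons.prems ms' in simp)
  from st_jq_ZO[OF this, of m] have "jact (m # ms) c - jact (m # xs @ ys) c \<in> ZO" by (simp add: st_linear)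
  from ZO_trans[OF this ZO_sym[OF jact_move[OF n c]]] show ?case by (simp only: ms')
qed simp

definition word_span :: "nat list set \<Rightarrow> 'v set" where
  "word_span S = {w. \<exists>w'\<in>vs.span (Jw ` S). w - w' \<in> ZO}"

lemma word_span_subspace: "vs.subspace (word_span S)" unfolding vs.subspace_def
proof (intro conjI ballI allI)
  show "0 \<in> word_span S" using vs.span_zero by (auto simp: word_span_def intro!: bexI[of _ 0])
next
  fix x y assume "x \<in> word_span S" "y \<in> word_span S"
  then obtain x' y' where "x' \<in> vs.span (Jw ` S)" "y' \<in> vs.span (Jw ` S)" "x - x' \<in> ZO" "y - y' \<in> ZO"
    by (auto simp: word_span_def)
  hence "x' + y' \<in> vs.span (Jw ` S)" "x + y - (x' + y') \<in> ZO"
    using vs.span_add ZO_add[of "x - x'" "y - y'"] by (auto simp: algebra_simps)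
  thus "x + y \<in> word_span S" unfolding word_span_def by blast
next
  fix a x assume "x \<in> word_span S"
  then obtain x' where "x' \<in> vs.span (Jw ` S)" "x - x' \<in> ZO" by (auto simp: word_span_def)
  hence "a *s x' \<in> vs.span (Jw ` S)" "a *s x - a *s x' \<in> ZO"
    using vs.span_scale ZO_scale[of "x - x'" a] by (auto simp: vs.scale_right_diff_distrib)
  thus "a *s x \<in> word_span S" unfolding word_span_def by blast
qed

lemmas ws_0 = vs.subspace_0[OF word_span_subspace] and ws_add = vs.subspace_add[OF word_span_subspace]
  and ws_diff = vs.subspace_diff[OF word_span_subspace]
  and ws_scale = vs.subspace_scale[OF word_span_subspace] and ws_sum = vs.subspace_sum[OF word_span_subspace]

lemma ws_ZO: "w \<in> ZO \<Longrightarrow> w \<in> word_span S" using vs.span_zero by (auto simp: word_span_def intro!: bexI[of _ 0])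

lemma ws_Jw: "ms \<in> S \<Longrightarrow> Jw ms \<in> word_span S"
  using vs.span_base by (auto simp: word_span_def intro!: bexI[of _ "Jw ms"])

lemma ws_cong: "w - w' \<in> ZO \<Longrightarrow> w' \<in> word_span S \<Longrightarrow> w \<in> word_span S" using ws_add[OF ws_ZO] by force

lemma word_span_induct [consumes 1, case_names zero word null add scale]:
  assumes "w \<in> word_span S" "R 0" "\<And>ms. ms \<in> S \<Longrightarrow> R (Jw ms)" "\<And>w. w \<in> ZO \<Longrightarrow> R w"
    "\<And>x y. R x \<Longrightarrow> R y \<Longrightarrow> R (x + y)" "\<And>a x. R x \<Longrightarrow> R (a *s x)" shows "R w"
proof -
  obtain w' where w': "w' \<in> vs.span (Jw ` S)" "w - w' \<in> ZO" using assms(1) by (auto simp: word_span_def)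
  have "R w'" using w'(1) by (induction rule: vs.span_induct_alt) (use assms in auto)
  moreover have "R (w - w')" using assms(4) w'(2) by blast
  ultimately have "R (w' + (w - w'))" by (rule assms(5))
  thus ?thesis by simp
qed

lemma word_span_closed: assumes "w \<in> word_span S" "\<And>ms. ms \<in> S \<Longrightarrow> Jw ms \<in> word_span S'" shows "w \<in> word_span S'"
  using assms(1) by (induction rule: word_span_induct) (auto simp: assms(2) ws_ZO ws_0 ws_add ws_scale)

lemma word_span_st_jq: assumes "w \<in> word_span S" "\<And>ms. ms \<in> S \<Longrightarrow> Jw (m # ms) \<in> word_span S'"
  shows "st (jq m) w \<in> word_span S'" using assms(1)
  by (induction rule: word_span_induct) (use assms(2) in \<open>auto simp: st_linear ws_ZO st_jq_ZO ws_0 ws_add ws_scale\<close>)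

text \<open>The counterpart of the filtration \<open>F\<close>: the letter \<open>m\<close> counts
  with the length \<open>2\<close> and the weight \<open>2m + 2\<close> of
  \<open>jq m\<close>.\<close>

definition WS :: "int \<Rightarrow> int \<Rightarrow> nat list set" where
  "WS d h = {ms. 2 * int (length ms) \<le> d \<and> (\<Sum>m\<leftarrow>ms. 2 * int m + 2) \<le> h}"

lemma word_span_mono: "S \<subseteq> S' \<Longrightarrow> w \<in> word_span S \<Longrightarrow> w \<in> word_span S'" by (rule word_span_closed) (auto intro: ws_Jw)

lemma WS_mono: "d \<le> d' \<Longrightarrow> h \<le> h' \<Longrightarrow> WS d h \<subseteq> WS d' h'" by (auto simp: WS_def)

lemma st_vac_left: "st (vac V) b = b" if "b \<in> C"
proof -
  have "st (vac V) b = Res (vac V) (opX ^ 0) 1 b" by (rule st_DD) (use vac_DD in simp)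
  thus ?thesis using that by (simp add: Res_bound[of _ 0] Y_vac)
qed

lemma st_xq_ws: assumes "b \<in> WC" "b \<in> word_span (WS d h)"
  shows "st (xq k l) b \<in> word_span (WS (d + 2) (h + int k + int l + 2))"
proof -
  let ?S = "WS (d + 2) (h + int k + int l + 2)"
  obtain c \<alpha> where y: "xq k l - (c *s vac V + (\<Sum>i\<le>(k + l) div 2. \<alpha> i *s jq i)) \<in> nul" (is "?y \<in> nul")
    using xq_TT[OF refl, of k l] unfolding TT_def by blast
  have "st ?y b \<in> word_span ?S" using y assms(1) by (intro ws_ZO) (simp add: nul_def)
  moreover have "b \<in> word_span ?S" by (rule word_span_mono[OF WS_mono assms(2)]) auto
  moreover have "st (jq i) b \<in> word_span ?S" if "i \<le> (k + l) div 2" for i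
  proof (rule word_span_st_jq[OF assms(2)])
    fix ms assume "ms \<in> WS d h"
    moreover have "2*i \<le> k + l" using that by linarith
    ultimately show "Jw (i # ms) \<in> word_span ?S" by (intro ws_Jw) (auto simp: WS_def)
  qed
  ultimately have "st ?y b + (c *s b + (\<Sum>i\<le>(k + l) div 2. \<alpha> i *s st (jq i) b)) \<in> word_span ?S"
    by (intro ws_add ws_scale ws_sum) auto
  also have "st ?y b + (c *s b + (\<Sum>i\<le>(k + l) div 2. \<alpha> i *s st (jq i) b)) = st (xq k l) b"
    using assms(1) by (simp add: st_linear st_vac_left WC_C)
  finally show ?thesis .
qed

text \<open>The mode \<open>-1\<close> in the product contains the normally ordered
  \<open>Q k l b\<close>. All other terms involve an annihilation operator and so do not raise the
  length.\<close>

lemma Q_st: assumes "b \<in> WC" "b \<in> F d h" shows "Q k l b - st (xq k l) b \<in> WC \<inter> F d (h + int k + int l + 2)"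
proof
  show "Q k l b - st (xq k l) b \<in> WC" using assms(1) by auto
  define p where "p = k + l + 2"
  let ?h = "h + int k + int l + 2"
  have "st (xq k l) b = (\<Sum>i\<le>p. of_nat (p choose i) *s Y (xq k l) (int i - 1) b)"
    unfolding st_DD[OF xq_DD] Res_opX_power p_def ..
  moreover have "{..p} = insert 0 {1..p}" by auto
  ultimately have "st (xq k l) b = Y (xq k l) (-1) b + (\<Sum>i\<in>{1..p}. of_nat (p choose i) *s Y (xq k l) (int i - 1) b)"
    by simp
  hence "Q k l b - st (xq k l) b = - (Y (xq k l) (-1) b - Q k l b) - (\<Sum>i\<in>{1..p}. of_nat (p choose i) *s Y (xq k l) (int i - 1) b)"
    by simp
  moreover have "Y (xq k l) (-1) b - Q k l b \<in> F d ?h"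
    using xq_mode_F[OF assms(2), of "-1" k l] by (simp add: add.assoc)
  moreover have "Y (xq k l) (int i - 1) b \<in> F d ?h" if "i \<in> {1..p}" for i
    using xq_mode_F[OF assms(2), of "int i - 1" k l] F_mono[of d d "h + int k + int l + 1 - (int i - 1)" ?h] that by (auto split: if_splits)
  ultimately show "Q k l b - st (xq k l) b \<in> F d ?h" by (simp only:) (rule F_diff[OF F_neg F_sum[OF F_scale]])
qed

text \<open>Induction on the length: replacing \<open>Q k l\<close> by the product with
  \<open>xq k l\<close> costs an invariant of smaller length within the same weight bound.\<close>

lemma WC_F_word_span: "w \<in> WC \<Longrightarrow> w \<in> F d h \<Longrightarrow> w \<in> word_span (WS d h)"
proof (induction "nat d" arbitrary: w d h rule: less_induct)
  case less
  show ?case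
  proof (cases "d < 0 \<or> h < 0")
    case True
    hence "w = 0" using F_negative less.prems by auto
    thus ?thesis using ws_0 by simp
  next
    case False
    obtain c b where w: "w = c *s vac V + (\<Sum>k<nat h. \<Sum>l<nat h. Q k l (b k l))"
      and b: "\<And>k l. k < nat h \<Longrightarrow> l < nat h \<Longrightarrow> b k l \<in> WC \<and> b k l \<in> F (d - 2) (h - int k - int l - 2)"
      using WC_decompose[OF less.prems] by blast
    have "Q k l (b k l) \<in> word_span (WS d h)" if kl: "k < nat h" "l < nat h" for k l
    proof (cases "d < 2")
      case True
      hence "b k l = 0" using b[OF kl] F_negative[of "d - 2"] by auto
      thus ?thesis using ws_0 by (simp add: Q_linear)
    next
      case d: False
      have lt: "nat (d - 2) < nat d" using d by auto
      have h: "h - int k - int l - 2 + int k + int l + 2 = h" "d - 2 + 2 = d" by auto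
      note bb = b[OF kl, THEN conjunct1] b[OF kl, THEN conjunct2]
      have "st (xq k l) (b k l) \<in> word_span (WS (d - 2 + 2) (h - int k - int l - 2 + int k + int l + 2))"
        by (rule st_xq_ws[OF bb(1) less.hyps[OF lt bb]])
      moreover have "Q k l (b k l) - st (xq k l) (b k l) \<in> word_span (WS (d - 2) h)"
        using Q_st[OF bb, of k l] unfolding h by (intro less.hyps[OF lt]) auto
      hence "Q k l (b k l) - st (xq k l) (b k l) \<in> word_span (WS d h)"
        by (rule word_span_mono[OF WS_mono, rotated 2]) auto
      ultimately have "(Q k l (b k l) - st (xq k l) (b k l)) + st (xq k l) (b k l) \<in> word_span (WS d h)"
        unfolding h by (intro ws_add)
      thus ?thesis by simp
    qed
    moreover have "vac V \<in> word_span (WS d h)" using ws_Jw[of "[]" "WS d h"] False by (simp add: WS_def)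
    ultimately show ?thesis unfolding w by (intro ws_add ws_scale ws_sum) auto
  qed
qed

subsection \<open>Elimination of the generators \<open>jq m\<close> with \<open>m \<ge> n\<close>\<close>

lemma mon_repeated: assumes "set xs \<subseteq> P" "\<not> distinct xs" shows "mon xs = 0"
  using mon_sort[OF assms(1)] sort_word_repeated[OF assms(2)] by simp

text \<open>There are only \<open>2 n\<close> letters with second entry zero.\<close>

definition low_letters :: "nat \<Rightarrow> 'v set" where
  "low_letters j = vs.span (mon ` {xs. set xs \<subseteq> P \<and> j \<le> length (filter (\<lambda>p. snd p = 0) xs)})"

lemma low_letters_cr: assumes "p \<in> P" "b \<in> low_letters j"
  shows "cr p b \<in> low_letters (if snd p = 0 then Suc j else j)" using assms(2) unfolding low_letters_def
proof (induction rule: vs.span_induct_alt)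
  case base
  thus ?case using vs.span_zero by (simp add: cr_linear)
next
  case (step c x y)
  then obtain xs where xs: "x = mon xs" "set xs \<subseteq> P" "j \<le> length (filter (\<lambda>p. snd p = 0) xs)" by auto
  have "mon (p # xs) \<in> vs.span (mon ` {xs. set xs \<subseteq> P \<and> (if snd p = 0 then Suc j else j) \<le> length (filter (\<lambda>p. snd p = 0) xs)})"
    by (intro vs.span_base imageI) (use xs assms(1) in auto)
  thus ?case using step.IH xs(1) by (simp add: cr_linear vs.span_add vs.span_scale del: set_simps)
qed

lemma low_letters_Q0:
  assumes "b \<in> low_letters j" shows "Q 0 0 b \<in> low_letters (Suc (Suc j))" "Q 0 l b \<in> low_letters (Suc j)"
proof -
  have sub: "vs.subspace (low_letters j)" for j unfolding low_letters_def by (rule vs.subspace_span)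
  have *: "cr (I, 0) c \<in> low_letters (Suc i)" if "I < 2*n" "c \<in> low_letters i" for I c i
    using low_letters_cr[of "(I, 0)" c i] that by simp
  have "cr (dual I, l) b \<in> low_letters j" if "I < 2*n" for I
  proof -
    have "low_letters (Suc j) \<subseteq> low_letters j" unfolding low_letters_def by (intro vs.span_mono) auto
    thus ?thesis using low_letters_cr[of "(dual I, l)" b j] assms that by (auto split: if_splits)
  qed
  thus "Q 0 l b \<in> low_letters (Suc j)"
    unfolding Q_def by (intro vs.subspace_sum[OF sub] vs.subspace_scale[OF sub] *) auto
  show "Q 0 0 b \<in> low_letters (Suc (Suc j))"
    unfolding Q_def by (intro vs.subspace_sum[OF sub] vs.subspace_scale[OF sub] *) (auto simp: assms)
qed

lemma low_letters_zero: "b \<in> low_letters (Suc (2*n)) \<Longrightarrow> b = 0" unfolding low_letters_def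
proof (induction rule: vs.span_induct_alt)
  case (step c x y)
  then obtain xs where xs: "x = mon xs" "set xs \<subseteq> P" "Suc (2*n) \<le> length (filter (\<lambda>p. snd p = 0) xs)" by auto
  have "\<not> distinct xs"
  proof
    assume "distinct xs"
    hence "length (filter (\<lambda>p. snd p = 0) xs) = card (set (filter (\<lambda>p. snd p = 0) xs))"
      by (metis distinct_card distinct_filter)
    also have "\<dots> \<le> card ((\<lambda>I. (I, 0::nat)) ` {..<2*n})" using xs(2) by (intro card_mono) auto
    also have "\<dots> \<le> 2*n" using card_image_le[of "{..<2*n}" "\<lambda>I. (I, 0::nat)"] by simp
    finally show False using xs(3) by simp
  qed
  thus ?case using mon_repeated[OF xs(2)] xs(1) step.IH by simp
qed simp

text \<open>Every \<open>Q 0 0\<close> contributes two letters with second entry zero, and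
  \<open>xq 0 l\<close> at least one: in all \<open>2n + 1\<close>.\<close>

lemma Q00_relation: "(Q 0 0 ^^ n) (xq 0 l) = 0"
proof -
  have "vac V \<in> low_letters 0"
    unfolding low_letters_def using vs.span_base[of "mon []"] by (auto simp: image_iff intro!: vs.span_base exI[of _ "[]"])
  hence "xq 0 l \<in> low_letters (Suc 0)" by (rule low_letters_Q0(2))
  hence "(Q 0 0 ^^ i) (xq 0 l) \<in> low_letters (Suc (2*i))" for i by (induction i) (auto intro: low_letters_Q0(1))
  thus ?thesis using low_letters_zero by blast
qed

text \<open>Replacing each \<open>Q 0 0\<close> by the product with \<open>xq 0 0\<close> produces
  errors shorter by two. So the vanishing product expresses a word with \<open>n + 1\<close> letters
  by words with at most \<open>n\<close> letters and no larger weight.\<close>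

lemma relation_word_span:
  "Jw (replicate n 0 @ [r]) \<in> word_span (WS (2 * int n) (2 * int (n + r) + 2))"
proof -
  define w where "w i = (Q 0 0 ^^ i) (xq 0 (2*r))" for i
  define y where "y i = (st (xq 0 0) ^^ i) (xq 0 (2*r))" for i
  have w: "w i \<in> WC \<and> w i \<in> F (2 * int i + 2) (2 * int r + 2 * int i + 2)" for i
  proof (induction i)
    case 0
    thus ?case using Q_F[OF vac_F, of 0 "2*r"] by (simp add: w_def)
  next
    case (Suc i)
    thus ?case using Q_F[of "w i" "2 * int i + 2" "2 * int r + 2 * int i + 2" 0 0] by (auto simp: w_def algebra_simps)
  qed
  have yW: "y i \<in> WC" for i by (induction i) (auto simp: y_def)
  have "w i - y i \<in> word_span (WS (2 * int i) (2 * int r + 2 * int i + 2))" for i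
  proof (induction i)
    case 0
    thus ?case using ws_0 by (simp add: w_def y_def)
  next
    case (Suc i)
    let ?S = "WS (2 * int (Suc i)) (2 * int r + 2 * int (Suc i) + 2)"
    have "Q 0 0 (w i) - st (xq 0 0) (w i) \<in> word_span (WS (2 * int i + 2) (2 * int r + 2 * int i + 2 + int 0 + int 0 + 2))"
      using Q_st[of "w i", of _ _ 0 0] w[of i] by (intro WC_F_word_span) blast+
    hence 1: "w (Suc i) - st (xq 0 0) (w i) \<in> word_span ?S" by (simp add: w_def algebra_simps)
    have "st (xq 0 0) (w i - y i) \<in> word_span (WS (2 * int i + 2) (2 * int r + 2 * int i + 2 + int 0 + int 0 + 2))"
      by (rule st_xq_ws[OF _ Suc.IH]) (use w yW in blast)
    hence 2: "st (xq 0 0) (w i) - y (Suc i) \<in> word_span ?S" by (simp add: y_def st_linear algebra_simps)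
    show ?case using ws_add[OF 1 2] by simp
  qed
  from this[of n] have "- y n \<in> word_span (WS (2 * int n) (2 * int (n + r) + 2))"
    using Q00_relation[of "2*r"] by (simp add: w_def algebra_simps)
  from ws_scale[OF this, of "-1"] have yn: "y n \<in> word_span (WS (2 * int n) (2 * int (n + r) + 2))" by simp
  have "y i = ((1 / jc 0) ^ i * (1 / jc r)) *s Jw (replicate i 0 @ [r])" for i
  proof (induction i)
    case 0
    thus ?case using jq_xq(2)[of r] by (simp add: y_def st_vac)
  next
    case (Suc i)
    have "y (Suc i) = st ((1 / jc 0) *s jq 0) (y i)" using jq_xq(2)[of 0] by (simp add: y_def)
    thus ?case unfolding Suc by (simp only: st_linear replicate_Suc append_Cons jact_simps vs.scale_scale power_Suc mult.assoc)
        (simp add: mult_ac)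
  qed
  moreover define \<kappa> where "\<kappa> = (1 / jc 0) ^ n * (1 / jc r)"
  ultimately have y: "y n = \<kappa> *s Jw (replicate n 0 @ [r])" by (simp only:)
  have "\<kappa> \<noteq> 0" by (simp add: \<kappa>_def)
  hence "Jw (replicate n 0 @ [r]) = (1 / \<kappa>) *s y n" unfolding y vs.scale_scale by (simp del: jact_simps)
  thus ?thesis using ws_scale[OF yn, of "1 / \<kappa>"] by (simp only:)
qed

definition gp :: "nat list \<Rightarrow> complex poly" where "gp ms = (\<Prod>m\<leftarrow>ms. jpoly m)"

lemma gp_simps [simp]: "gp [] = 1" "gp (m # ms) = jpoly m * gp ms" by (simp_all add: gp_def)

lemma jpoly_nonzero [simp]: "jpoly m \<noteq> 0" using jpoly(1)[of m] by auto

lemma gp_degree: "gp ms \<noteq> 0 \<and> degree (gp ms) = (\<Sum>m\<leftarrow>ms. Suc m)"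
  by (induction ms) (auto simp: degree_mult_eq jpoly(1))

lemma ev_Jw_block: assumes "c \<le> n"
  shows "ev (\<lambda>i. if i < c then \<nu> else 0) (Jw ms) = of_nat c ^ length ms * poly (gp ms) (of_nat \<nu> * (of_nat \<nu> + 1))"
proof (induction ms)
  case (Cons m ms)
  have "ev N (Jw (m # ms)) = ev N (jq m) * ev N (Jw ms)" for N by (simp add: ev_st jact_WC)
  thus ?case by (simp only: Cons ev_jq_block[OF assms]) (simp add: mult_ac)
qed simp

text \<open>Every letter weighs at least \<open>2\<close>, so next to a letter
  \<open>k \<ge> m\<close> there is no room for another one.\<close>

lemma WS_letters: assumes "ms \<in> WS d (2 * int m + 2)" "ms \<noteq> [m]" shows "set ms \<subseteq> {..<m}"
proof
  fix k assume "k \<in> set ms"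
  then obtain xs ys where ms: "ms = xs @ k # ys" by (auto simp: in_set_conv_decomp)
  have pos: "2 * int (length xs) \<le> (\<Sum>k\<leftarrow>xs. 2 * int k + 2)" for xs by (induction xs) auto
  have le: "(\<Sum>k\<leftarrow>xs. 2 * int k + 2) + (2 * int k + 2) + (\<Sum>k\<leftarrow>ys. 2 * int k + 2) \<le> 2 * int m + 2"
    using assms(1) by (simp add: WS_def ms)
  show "k \<in> {..<m}"
  proof (rule ccontr)
    assume "k \<notin> {..<m}"
    hence "2 * int (length xs) + 2 * int (length ys) + 2 * int k \<le> 2 * int m" "m \<le> k"
      using le pos[of xs] pos[of ys] by auto
    hence "length xs = 0" "length ys = 0" "k = m" by linarith+
    thus False using assms(2) ms by simp
  qed
qed

text \<open>Evaluated at the weights with \<open>c\<close> equal blocks, the relation becomes polynomial in \<open>c\<close> of degree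
  \<open>n + 1\<close> with the roots \<open>0, \<dots>, n\<close>; so its linear coefficient is a nonzero multiple of the leading
  one, which forces the word \<open>[m]\<close> to occur.\<close>

lemma jq_eliminate: assumes n: "0 < n" and m: "n \<le> m" shows "jq m \<in> word_span {ms. set ms \<subseteq> {..<m}}"
proof -
  define r where "r = m - n"
  define ms0 where "ms0 = replicate n 0 @ [r]"
  have r: "2 * int (n + r) + 2 = 2 * int m + 2" using m by (simp add: r_def)
  obtain s where s: "s \<in> vs.span (Jw ` WS (2 * int n) (2 * int m + 2))" "Jw ms0 - s \<in> ZO"
    using relation_word_span[of r] unfolding r ms0_def word_span_def by blast
  obtain A c where A: "finite A" "A \<subseteq> WS (2 * int n) (2 * int m + 2)" "s = (\<Sum>ms\<in>A. c ms *s Jw ms)"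
    using vs.span_image_sum[OF s(1)] by blast
  have len: "length ms \<le> n" if "ms \<in> A" for ms using A(2) that by (auto simp: WS_def)
  obtain \<rho> :: complex where \<rho>: "\<rho> \<noteq> 0" "\<And>p. degree p \<le> Suc n \<Longrightarrow> (\<And>c. c \<le> n \<Longrightarrow> poly p (of_nat c) = 0) \<Longrightarrow> coeff p 1 = \<rho> * coeff p (Suc n)"
    using coeff_one_vanishing[of n] by blast
  \<comment> \<open>The relation between the linear and the leading coefficient in the number of
    blocks, as a polynomial in \<open>\<nu>(\<nu>+1)\<close>.\<close>
  define U where "U = (\<Sum>ms\<in>A. smult (if length ms = 1 then c ms else 0) (gp ms)) + smult \<rho> (gp ms0)"
  have "poly U (of_nat \<nu> * (of_nat \<nu> + 1)) = 0" for \<nu> :: nat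
  proof -
    let ?t = "of_nat \<nu> * (of_nat \<nu> + 1) :: complex"
    define p where "p = monom (poly (gp ms0) ?t) (Suc n) - (\<Sum>ms\<in>A. monom (c ms * poly (gp ms) ?t) (length ms))"
    have "degree p \<le> Suc n"
      unfolding p_def using len by (intro degree_diff_le degree_sum_le degree_monom_le A(1)) (metis degree_monom_le le_SucI order_trans)
    moreover have "poly p (of_nat a) = 0" if "a \<le> n" for a
    proof -
      have "ev (\<lambda>i. if i < a then \<nu> else 0) (Jw ms0) = ev (\<lambda>i. if i < a then \<nu> else 0) s" by (rule ev_cong[OF s(2)])
      thus ?thesis
        unfolding A(3) ev_linear ev_Jw_block[OF that] by (simp add: p_def poly_sum poly_monom ms0_def mult_ac)
    qed
    ultimately have "coeff p 1 = \<rho> * coeff p (Suc n)" by (rule \<rho>(2))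
    moreover have "coeff p (Suc n) = poly (gp ms0) ?t"
    proof -
      have "(\<Sum>ms\<in>A. coeff (monom (c ms * poly (gp ms) ?t) (length ms)) (Suc n)) = 0"
        by (rule sum.neutral) (use len in force)
      thus ?thesis by (simp add: p_def coeff_sum)
    qed
    moreover have "coeff p 1 = - (\<Sum>ms\<in>A. (if length ms = 1 then c ms else 0) * poly (gp ms) ?t)"
      using n by (auto simp: p_def coeff_sum intro!: sum.cong)
    ultimately show ?thesis by (simp add: U_def poly_sum)
  qed
  hence "U = 0" by (intro poly_zero_on_infinite[OF infinite_grid]) auto
  \<comment> \<open>Since \<open>gp ms0\<close> has degree \<open>m + 1\<close>, it must be
    cancelled by a word \<open>[k]\<close> with \<open>k \<ge> m\<close>; the weight bound gives
    \<open>k = m\<close>.\<close>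
  hence "coeff U (Suc m) = 0" by simp
  moreover have "coeff (gp ms0) (Suc m) \<noteq> 0"
  proof -
    have "(\<Sum>k\<leftarrow>ms0. Suc k) = Suc m" using m by (simp add: ms0_def r_def sum_list_replicate)
    thus ?thesis using gp_degree[of ms0] by (metis leading_coeff_0_iff)
  qed
  ultimately have "(\<Sum>ms\<in>A. (if length ms = 1 then c ms else 0) * coeff (gp ms) (Suc m)) \<noteq> 0"
    using \<rho>(1) by (auto simp: U_def coeff_sum)
  then obtain ms where "ms \<in> A" "(if length ms = 1 then c ms else 0) * coeff (gp ms) (Suc m) \<noteq> 0"
    by (rule sum.not_neutral_contains_not_neutral)
  hence ms: "ms \<in> A" "length ms = 1" "c ms \<noteq> 0" "coeff (gp ms) (Suc m) \<noteq> 0" by (auto split: if_splits)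
  then obtain k where k: "ms = [k]" by (auto simp: length_Suc_conv)
  have "Suc m \<le> Suc k" using le_degree[OF ms(4)] gp_degree[of ms] by (simp add: k)
  moreover have "k \<le> m" using A(2) ms(1) by (auto simp: WS_def k)
  ultimately have ms: "[m] \<in> A" "c [m] \<noteq> 0" using ms k by auto
  let ?S = "{ms. set ms \<subseteq> {..<m}}"
  have "Jw ms0 \<in> word_span ?S" by (rule ws_Jw) (use n m in \<open>auto simp: ms0_def r_def\<close>)
  moreover have "(\<Sum>ms\<in>A - {[m]}. c ms *s Jw ms) \<in> word_span ?S"
  proof (intro ws_sum ws_scale ws_Jw CollectI)
    fix ms assume "ms \<in> A - {[m]}"
    thus "set ms \<subseteq> {..<m}" using A(2) WS_letters by blast
  qed
  ultimately have "(1 / c [m]) *s (Jw ms0 - (Jw ms0 - s) - (\<Sum>ms\<in>A - {[m]}. c ms *s Jw ms)) \<in> word_span ?S"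
    using ws_ZO[OF s(2)] by - (rule ws_scale, rule ws_diff, rule ws_diff)
  also have "Jw ms0 - (Jw ms0 - s) - (\<Sum>ms\<in>A - {[m]}. c ms *s Jw ms) = c [m] *s jq m"
    unfolding A(3) by (simp add: sum.remove[OF A(1) ms(1)] st_vac)
  finally show ?thesis using ms(2) by simp
qed

abbreviation "top_words \<equiv> {ms. set ms \<subseteq> {..<n}}"

text \<open>For \<open>m \<ge> n\<close> the letter is moved to the end of the word and rewritten
  there by smaller letters. Multiplication by letters below \<open>m\<close> preserves the span by
  the induction hypothesis.\<close>

lemma st_jq_top: assumes n: "0 < n" shows "w \<in> word_span top_words \<Longrightarrow> st (jq m) w \<in> word_span top_words"
proof (induction m arbitrary: w rule: less_induct)
  case (less m)
  have low: "jact ks w \<in> word_span top_words" if "set ks \<subseteq> {..<m}" "w \<in> word_span top_words" for ks w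
    using that by (induction ks) (auto intro: less.IH)
  show ?case
  proof (cases "m < n")
    case True
    thus ?thesis by (intro word_span_st_jq[OF less.prems] ws_Jw) auto
  next
    case False
    have vac: "vac V \<in> word_span top_words" using ws_Jw[of "[]" top_words] by simp
    have jm: "jq m \<in> word_span top_words"
    proof (rule word_span_closed)
      show "jq m \<in> word_span {ms. set ms \<subseteq> {..<m}}" by (rule jq_eliminate[OF n]) (use False in simp)
      show "Jw ms \<in> word_span top_words" if "ms \<in> {ms. set ms \<subseteq> {..<m}}" for ms
        by (rule low[OF _ vac]) (use that in simp)
    qed
    have tops: "jact ks (jq m) \<in> word_span top_words" if "set ks \<subseteq> {..<n}" for ks
    proof (rule low[OF _ jm])
      show "set ks \<subseteq> {..<m}" using that False by (auto dest!: subsetD)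
    qed
    show ?thesis
    proof (rule word_span_st_jq[OF less.prems])
      fix ks assume "ks \<in> top_words"
      hence "jact ks (jq m) \<in> word_span top_words" by (intro tops) simp
      thus "Jw (m # ks) \<in> word_span top_words"
        using ws_cong[OF ZO_sym[OF jact_move[OF n WC_vac, of ks m "[]"]]] by (simp add: st_vac)
    qed
  qed
qed

lemma WC_word_span: assumes n: "0 < n" and w: "w \<in> WC" shows "w \<in> word_span top_words"
proof -
  obtain d h where "w \<in> F d h" using F_exhaust[OF WC_C[OF w]] by blast
  hence "w \<in> word_span (WS d h)" by (rule WC_F_word_span[OF w])
  moreover have "Jw ms \<in> word_span top_words" for ms
  proof (induction ms)
    case Nil
    thus ?case by (rule ws_Jw) simp
  next
    case (Cons m ms)
    thus ?case unfolding jact_simps(2) by (rule st_jq_top[OF n])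
  qed
  ultimately show ?thesis by (rule word_span_closed)
qed

definition mono_of :: "nat list \<Rightarrow> nat \<Rightarrow>\<^sub>0 nat" where
  "mono_of ms = (\<Sum>m\<leftarrow>ms. single m 1)"

lemma mono_of_simps [simp]: "mono_of [] = 0" "mono_of (m # ms) = single m 1 + mono_of ms"
  by (simp_all add: mono_of_def)

lemma lookup_mono_of: "lookup (mono_of ms) m = count (mset ms) m"
  by (induction ms) (auto simp: lookup_add lookup_single)

lemma keys_mono_of: "keys (mono_of ms) = set ms" by (auto simp: in_keys_iff lookup_mono_of)

lemma mono_of_mset: "mono_of ms = mono_of ms' \<longleftrightarrow> mset ms = mset ms'"
  by (metis lookup_mono_of multiset_eq_iff poly_mapping_eqI)

lemma mono_of_exists: "\<exists>ms. mono_of ms = m"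
proof -
  have "finite {k. lookup m k \<noteq> 0}" by (rule finite_lookup)
  hence "finite {k. 0 < lookup m k}" by simp
  hence "count (Abs_multiset (lookup m)) = lookup m" by simp
  moreover obtain ms where "mset ms = Abs_multiset (lookup m)" using ex_mset by blast
  ultimately show ?thesis by (intro exI[of _ ms] poly_mapping_eqI) (simp add: lookup_mono_of)
qed

text \<open>The order of the letters is arbitrary; by \<open>jact_perm\<close> it affects
  \<open>Jw\<close> only modulo \<open>ZO\<close>.\<close>

definition word_of :: "(nat \<Rightarrow>\<^sub>0 nat) \<Rightarrow> nat list" where "word_of m = (SOME ms. mono_of ms = m)"

lemma mono_of_word_of: "mono_of (word_of m) = m" unfolding word_of_def by (rule someI_ex[OF mono_of_exists])

definition Theta :: "((nat \<Rightarrow>\<^sub>0 nat) \<Rightarrow>\<^sub>0 complex) \<Rightarrow> 'v" where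
  "Theta p = (\<Sum>m\<in>keys p. lookup p m *s Jw (word_of m))"

lemma Theta_add: "Theta (p + q) = Theta p + Theta q"
  unfolding Theta_def by (rule setsum_keys_plus_distrib) (auto simp: vs.scale_left_distrib)

lemma Theta_single: "Theta (single m c) = c *s Jw (word_of m)" by (auto simp: Theta_def)

lemma Theta_sum: "Theta (\<Sum>i\<in>A. p i) = (\<Sum>i\<in>A. Theta (p i))"
  by (induction A rule: infinite_finite_induct) (auto simp: Theta_add, auto simp: Theta_def)

lemma Theta_WC [intro]: "Theta p \<in> WC" unfolding Theta_def by (intro WC_sum WC_scale jact_WC WC_vac)

lemma ev_Theta: "ev N (Theta p) = mpoly_eval (\<lambda>m. ev N (jq m)) p"
proof -
  have "ev N (Jw ms) = monomial_eval (\<lambda>m. ev N (jq m)) (mono_of ms)" for ms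
    by (induction ms) (auto simp: ev_st jact_WC monomial_eval_add)
  thus ?thesis by (simp add: Theta_def ev_linear mpoly_eval_def mono_of_word_of)
qed

lemma Theta_word_of: assumes "0 < n" shows "Jw ms - Theta (single (mono_of ms) 1) \<in> ZO"
  using jact_perm[OF assms WC_vac, of ms "word_of (mono_of ms)"] mono_of_word_of[of "mono_of ms"]
  by (simp add: Theta_single mono_of_mset)

abbreviation "mpolys \<equiv> carrier (mpoly_ring n)"

lemma mpolys_iff: "p \<in> mpolys \<longleftrightarrow> (\<forall>m\<in>keys p. keys m \<subseteq> {..<n})" by (simp add: mpoly_ring_def)

lemma mpolys_add: assumes "p \<in> mpolys" "q \<in> mpolys" shows "p + q \<in> mpolys"
  using assms Poly_Mapping.keys_add[of p q] unfolding mpolys_iff by blast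

lemma mpolys_single: "keys m \<subseteq> {..<n} \<Longrightarrow> single m c \<in> mpolys" by (simp add: mpolys_iff)

lemma mpolys_mult: assumes "p \<in> mpolys" "q \<in> mpolys" shows "p * q \<in> mpolys" unfolding mpolys_iff
proof
  fix m assume "m \<in> keys (p * q)"
  then obtain a b where "m = a + b" "a \<in> keys p" "b \<in> keys q" using Poly_Mapping.keys_mult[of p q] by blast
  thus "keys m \<subseteq> {..<n}" using assms Poly_Mapping.keys_add[of a b] unfolding mpolys_iff by blast
qed

lemma mpolys_sum: "(\<And>i. i \<in> A \<Longrightarrow> p i \<in> mpolys) \<Longrightarrow> (\<Sum>i\<in>A. p i) \<in> mpolys"
  by (induction A rule: infinite_finite_induct) (auto intro: mpolys_add, auto simp: mpolys_iff)

lemma WC_Theta: assumes n: "0 < n" and w: "w \<in> WC" shows "\<exists>p\<in>mpolys. w - Theta p \<in> ZO"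
proof -
  obtain w' where w': "w' \<in> vs.span (Jw ` top_words)" "w - w' \<in> ZO"
    using WC_word_span[OF n w] by (auto simp: word_span_def)
  obtain A c where A: "finite A" "A \<subseteq> top_words" "w' = (\<Sum>ms\<in>A. c ms *s Jw ms)"
    using vs.span_image_sum[OF w'(1)] by blast
  define p where "p = (\<Sum>ms\<in>A. single (mono_of ms) (c ms))"
  have "p \<in> mpolys" unfolding p_def using A(2) by (intro mpolys_sum mpolys_single) (auto simp: keys_mono_of)
  have t: "Theta p = (\<Sum>ms\<in>A. c ms *s Theta (single (mono_of ms) 1))" by (simp add: p_def Theta_sum Theta_single)
  have "(\<Sum>ms\<in>A. c ms *s (Jw ms - Theta (single (mono_of ms) 1))) \<in> ZO" by (intro ZO_sum ZO_scale Theta_word_of n)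
  hence "w' - Theta p \<in> ZO" unfolding t A(3) by (simp add: vs.scale_right_diff_distrib sum_subtractf)
  from ZO_trans[OF w'(2) this] show ?thesis using \<open>p \<in> mpolys\<close> by blast
qed

lemma mpolys_eval_zero: assumes "p \<in> mpolys" "\<And>N. mpoly_eval (\<lambda>m. ev N (jq m)) p = 0" shows "p = 0"
  using mpoly_zero_dense[of jpoly p n, OF jpoly(1,2)] assms unfolding mpolys_iff jpoly(3) by blast

text \<open>The characters \<open>ev N\<close> separate the Zhu algebra: modulo \<open>ZO\<close>
  the element is a polynomial in the \<open>jq m\<close>, which is zero by density. From here on,
  congruences modulo \<open>ZO\<close> can be checked on values.\<close>

lemma ev_zero_ZO: assumes n: "0 < n" and w: "w \<in> WC" and zero: "\<And>N. ev N w = 0" shows "w \<in> ZO"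
proof -
  obtain p where p: "p \<in> mpolys" "w - Theta p \<in> ZO" using WC_Theta[OF n w] by blast
  have "p = 0" by (rule mpolys_eval_zero[OF p(1)]) (use ev_cong[OF p(2)] zero ev_Theta in metis)
  thus ?thesis using p(2) by (simp add: Theta_def)
qed

definition poly_of :: "'v \<Rightarrow> (nat \<Rightarrow>\<^sub>0 nat) \<Rightarrow>\<^sub>0 complex" where
  "poly_of w = (SOME p. p \<in> mpolys \<and> (\<forall>N. mpoly_eval (\<lambda>m. ev N (jq m)) p = ev N w))"

lemma poly_of: assumes "0 < n" "w \<in> WC"
  shows "poly_of w \<in> mpolys" "mpoly_eval (\<lambda>m. ev N (jq m)) (poly_of w) = ev N w"
proof -
  obtain p where "p \<in> mpolys" "w - Theta p \<in> ZO" using WC_Theta[OF assms] by blast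
  hence "\<exists>p. p \<in> mpolys \<and> (\<forall>N. mpoly_eval (\<lambda>m. ev N (jq m)) p = ev N w)" using ev_cong ev_Theta by metis
  from someI_ex[OF this] show "poly_of w \<in> mpolys" "mpoly_eval (\<lambda>m. ev N (jq m)) (poly_of w) = ev N w"
    unfolding poly_of_def by auto
qed

lemma poly_of_unique: assumes "0 < n" "w \<in> WC" "p \<in> mpolys" "\<And>N. mpoly_eval (\<lambda>m. ev N (jq m)) p = ev N w"
  shows "poly_of w = p"
proof -
  have "p - poly_of w = p + single 0 (-1) * poly_of w" by (simp add: single_uminus)
  also have "\<dots> \<in> mpolys" using assms poly_of by (intro mpolys_add mpolys_mult mpolys_single) auto
  finally have "p - poly_of w = 0"
    by (rule mpolys_eval_zero) (simp add: mpoly_eval_diff assms(4) poly_of[OF assms(1,2)])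
  thus ?thesis by simp
qed

lemma poly_of_eq_iff: assumes "0 < n" "a \<in> WC" "b \<in> WC" shows "poly_of a = poly_of b \<longleftrightarrow> a - b \<in> ZO"
proof
  assume "poly_of a = poly_of b"
  hence "ev N a = ev N b" for N using poly_of(2)[OF assms(1)] assms by metis
  thus "a - b \<in> ZO" using assms by (intro ev_zero_ZO) (auto simp: ev_linear)
next
  assume "a - b \<in> ZO"
  thus "poly_of a = poly_of b" using assms poly_of[OF assms(1,3)] ev_cong by (intro poly_of_unique) metis+
qed

abbreviation zc :: "'v \<Rightarrow> 'v set" where "zc \<equiv> zhu_class W DD"

lemma zc_iff: "b \<in> zc a \<longleftrightarrow> b - a \<in> ZO" unfolding zhu_class_def by (auto intro: exI[of _ "b - a"])

lemma zc_eq: "b - a \<in> ZO \<Longrightarrow> zc b = zc a"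
proof -
  assume "b - a \<in> ZO"
  hence "x \<in> zc b \<longleftrightarrow> x \<in> zc a" for x
    unfolding zc_iff using ZO_trans[of x b a] ZO_trans[of x a b] ZO_sym[of b a] by blast
  thus ?thesis by blast
qed

lemma zc_self: "a \<in> zc a" by (simp add: zc_iff)

lemma zc_WC: "a \<in> WC \<Longrightarrow> b \<in> zc a \<Longrightarrow> b \<in> WC" using ZO_WC WC_add[of "b - a" a] by (simp add: zc_iff)

definition zhu_iso :: "'v set \<Rightarrow> (nat \<Rightarrow>\<^sub>0 nat) \<Rightarrow>\<^sub>0 complex" where
  "zhu_iso X = poly_of (SOME w. w \<in> X)"

lemma zhu_iso_zc: assumes "0 < n" "a \<in> WC" shows "zhu_iso (zc a) = poly_of a"
proof -
  have "(SOME w. w \<in> zc a) \<in> zc a" by (rule someI[of "\<lambda>w. w \<in> zc a", OF zc_self])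
  thus ?thesis unfolding zhu_iso_def using assms zc_WC[OF assms(2)] by (subst poly_of_eq_iff) (auto simp: zc_iff)
qed

theorem zhu_iso: assumes n: "0 < n" shows "zhu_iso \<in> ring_iso (zhu_algebra W DD) (mpoly_ring n)"
    and "a \<in> WC \<Longrightarrow> zhu_iso (zc (x *s a)) = mpoly_const x * zhu_iso (zc a)"
    and "m < n \<Longrightarrow> zhu_iso (zc (jq m)) = mpoly_var m"
proof -
  note iso = zhu_iso_zc[OF n] and uniq = poly_of_unique[OF n] and po = poly_of[OF n]
  have add: "poly_of (a + b) = poly_of a + poly_of b" if "a \<in> WC" "b \<in> WC" for a b
    using that by (intro uniq mpolys_add po) (auto simp: mpoly_eval_add po ev_linear)
  have mult: "poly_of (st a b) = poly_of a * poly_of b" if "a \<in> WC" "b \<in> WC" for a b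
    using that by (intro uniq mpolys_mult po) (auto simp: mpoly_eval_mult po ev_st)
  have one: "poly_of (vac V) = 1" using mpolys_single[of 0 1] by (intro uniq) (auto simp flip: single_one)
  have scale: "poly_of (x *s a) = mpoly_const x * poly_of a" if "a \<in> WC" for a x
    using that mpolys_single[of 0 x] by (intro uniq mpolys_mult po) (auto simp: mpoly_eval_mult po ev_linear mpoly_const_def)
  have var: "poly_of (jq m) = mpoly_var m" if "m < n" for m
    unfolding mpoly_var_def using that by (intro uniq mpolys_single) auto
  have car: "carrier (zhu_algebra W DD) = zc ` WC" and "\<one>\<^bsub>zhu_algebra W DD\<^esub> = zc (vac V)"
    by (simp_all add: zhu_algebra_def W_simps)
  have zadd: "zc a \<oplus>\<^bsub>zhu_algebra W DD\<^esub> zc b = zc (a + b)" if "a \<in> WC" "b \<in> WC" for a b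
  proof -
    have "zc (a' + b') = zc (a + b)" if "a' \<in> zc a" "b' \<in> zc b" for a' b'
      using that ZO_add[of "a' - a" "b' - b"] by (intro zc_eq) (simp add: zc_iff algebra_simps)
    hence "(\<Union>a'\<in>zc a. \<Union>b'\<in>zc b. zc (a' + b')) = (\<Union>a'\<in>zc a. \<Union>b'\<in>zc b. zc (a + b))" by simp
    also have "\<dots> = zc (a + b)" using zc_self by blast
    finally show ?thesis by (simp add: zhu_algebra_def)
  qed
  have zmult: "zc a \<otimes>\<^bsub>zhu_algebra W DD\<^esub> zc b = zc (st a b)" if ab: "a \<in> WC" "b \<in> WC" for a b
  proof -
    have "zc (zhu_star W DD a' b') = zc (st a b)" if "a' \<in> zc a" "b' \<in> zc b" for a' b'
    proof -
      have "a' \<in> WC" "b' \<in> WC" using zc_WC ab that by auto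
      moreover have "ev N a' = ev N a" "ev N b' = ev N b" for N using that ev_cong by (auto simp: zc_iff)
      ultimately have "st a' b' - st a b \<in> ZO" using ab by (intro ev_zero_ZO[OF n]) (auto simp: ev_linear ev_st)
      thus ?thesis using \<open>a' \<in> WC\<close> \<open>b' \<in> WC\<close> by (simp add: zhu_star_eq zc_eq)
    qed
    hence "(\<Union>a'\<in>zc a. \<Union>b'\<in>zc b. zc (zhu_star W DD a' b')) = (\<Union>a'\<in>zc a. \<Union>b'\<in>zc b. zc (st a b))" by simp
    also have "\<dots> = zc (st a b)" using zc_self by blast
    finally show ?thesis by (simp add: zhu_algebra_def)
  qed
  have ring: "\<one>\<^bsub>mpoly_ring n\<^esub> = 1" "p \<oplus>\<^bsub>mpoly_ring n\<^esub> q = p + q" "p \<otimes>\<^bsub>mpoly_ring n\<^esub> q = p * q" for p q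
    by (simp_all add: mpoly_ring_def)
  show "zhu_iso \<in> ring_iso (zhu_algebra W DD) (mpoly_ring n)" unfolding ring_iso_def mem_Collect_eq
  proof
    show "zhu_iso \<in> Ring.ring_hom (zhu_algebra W DD) (mpoly_ring n)"
    proof (rule ring_hom_memI)
      show "zhu_iso \<one>\<^bsub>zhu_algebra W DD\<^esub> = \<one>\<^bsub>mpoly_ring n\<^esub>"
        using \<open>\<one>\<^bsub>zhu_algebra W DD\<^esub> = zc (vac V)\<close> by (simp add: iso one ring)
    qed (auto simp: car iso zadd zmult add mult ring po st_WC WC_add)
    have "inj_on zhu_iso (zc ` WC)"
    proof (rule inj_onI)
      fix X Y assume "X \<in> zc ` WC" "Y \<in> zc ` WC" "zhu_iso X = zhu_iso Y"
      then obtain a b where "X = zc a" "Y = zc b" "a - b \<in> ZO" by (auto simp: iso poly_of_eq_iff[OF n])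
      thus "X = Y" using zc_eq by blast
    qed
    moreover have "zhu_iso ` zc ` WC = mpolys"
    proof
      show "zhu_iso ` zc ` WC \<subseteq> mpolys" using po by (auto simp: iso)
      show "mpolys \<subseteq> zhu_iso ` zc ` WC"
      proof
        fix p assume "p \<in> mpolys"
        hence "poly_of (Theta p) = p" by (intro uniq) (auto simp: ev_Theta)
        hence "p = zhu_iso (zc (Theta p))" by (simp add: iso Theta_WC)
        thus "p \<in> zhu_iso ` zc ` WC" using Theta_WC by blast
      qed
    qed
    ultimately show "bij_betw zhu_iso (carrier (zhu_algebra W DD)) mpolys" unfolding car bij_betw_def by blast
  qed
  show "a \<in> WC \<Longrightarrow> zhu_iso (zc (x *s a)) = mpoly_const x * zhu_iso (zc a)" by (simp add: iso scale WC_scale)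
  show "m < n \<Longrightarrow> zhu_iso (zc (jq m)) = mpoly_var m" by (simp add: iso var)
qed

end

section \<open>Modules\<close>

subsection \<open>Operators on spaces of countable dimension\<close>

definition poly_op :: "('a::zero \<Rightarrow> 'b \<Rightarrow> 'b) \<Rightarrow> ('b \<Rightarrow> 'b) \<Rightarrow> 'a poly \<Rightarrow> 'b \<Rightarrow> 'b::ab_group_add" where
  "poly_op s T p v = fold_coeffs (\<lambda>a w. s a v + T w) p 0"

context vector_space
begin

text \<open>The span of \<open>B\<close> is exhausted by spans of finitely many vectors, each of
  which contains only finitely many members of \<open>S\<close>.\<close>

lemma independent_countable: assumes S: "independent S" "S \<subseteq> span B" and B: "countable B" shows "countable S"
proof -
  define b where "b = from_nat_into (insert 0 B)"
  have rb: "range b = insert 0 B" unfolding b_def using B by (intro range_from_nat_into) auto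
  have "S \<subseteq> (\<Union>k. S \<inter> span (b ` {..<k}))"
  proof
    fix x assume x: "x \<in> S"
    then obtain t r where t: "finite t" "t \<subseteq> B" "x = (\<Sum>a\<in>t. scale (r a) a)"
      using S(2) unfolding span_explicit by blast
    hence "t \<subseteq> range b" using rb by auto
    then obtain K where K: "finite K" "t = b ` K" using finite_subset_image[OF t(1)] by metis
    then obtain k where "K \<subseteq> {..<k}" using finite_nat_iff_bounded by blast
    hence "x \<in> span (b ` {..<k})" unfolding t(3) K(2) by (intro span_sum span_scale span_base) auto
    thus "x \<in> (\<Union>k. S \<inter> span (b ` {..<k}))" using x by blast
  qed
  moreover have "countable (S \<inter> span (b ` {..<k}))" for k
    using independent_span_bound[of "b ` {..<k}" "S \<inter> span (b ` {..<k})"] independent_mono[OF S(1)]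
    by (intro countable_finite) auto
  ultimately show ?thesis by (meson countable_UN countableI_type countable_subset)
qed

lemma poly_op_0 [simp]: "poly_op scale T 0 v = 0" by (simp add: poly_op_def)

lemma poly_op_pCons: assumes "module_hom scale scale T"
  shows "poly_op scale T (pCons a p) v = scale a v + T (poly_op scale T p v)"
  by (cases "p = 0 \<and> a = 0") (auto simp: poly_op_def module_hom.zero[OF assms])

lemma poly_op_add: assumes "module_hom scale scale T"
  shows "poly_op scale T (p + q) v = poly_op scale T p v + poly_op scale T q v"
  by (induction p q rule: poly_induct2)
    (simp_all add: poly_op_pCons[OF assms] module_hom.add[OF assms] scale_left_distrib)

lemma poly_op_smult: assumes "module_hom scale scale T"
  shows "poly_op scale T (smult c p) v = scale c (poly_op scale T p v)"
  by (induction p) (simp_all add: poly_op_pCons[OF assms] module_hom.scale[OF assms] scale_right_distrib)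

lemma poly_op_sum: assumes "module_hom scale scale T"
  shows "poly_op scale T (sum p A) v = (\<Sum>i\<in>A. poly_op scale T (p i) v)"
  by (induction A rule: infinite_finite_induct) (simp_all add: poly_op_add[OF assms])

lemma poly_op_right: assumes "module_hom scale scale T"
  shows "poly_op scale T p (v + w) = poly_op scale T p v + poly_op scale T p w" "poly_op scale T p (scale c v) = scale c (poly_op scale T p v)"
    "poly_op scale T p (T v) = T (poly_op scale T p v)"
  by (induction p) (simp_all add: poly_op_pCons[OF assms] module_hom.add[OF assms] module_hom.scale[OF assms]
      module_hom.zero[OF assms] scale_right_distrib mult.commute)

lemma poly_op_factor: assumes "module_hom scale scale T"
  shows "poly_op scale T ([:- c, 1:] * p) v = T (poly_op scale T p v) - scale c (poly_op scale T p v)"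
proof -
  have "[:- c, 1:] * p = smult (- c) p + pCons 0 p" by simp
  thus ?thesis by (simp only: poly_op_add[OF assms] poly_op_smult[OF assms] poly_op_pCons[OF assms]) simp
qed

lemma poly_op_closed: assumes "module_hom scale scale T" "subspace S" "\<And>x. x \<in> S \<Longrightarrow> T x \<in> S" "v \<in> S"
  shows "poly_op scale T p v \<in> S" by (induction p) (simp_all add: poly_op_pCons[OF assms(1)] subspace_0[OF assms(2)]
      subspace_add[OF assms(2)] subspace_scale[OF assms(2)] assms(3,4))

end

text \<open>Dixmier's argument: otherwise the vectors \<open>(T - c)\<^sup>-\<^sup>1 u\<close> with \<open>c \<in> \<complex>\<close> would be uncountably many
  linearly independent ones.\<close>

lemma countable_dimension_spectrum:
  fixes s :: "complex \<Rightarrow> 'x \<Rightarrow> 'x::ab_group_add"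
  assumes "vector_space s" and T: "module_hom s s T" and S: "module.subspace s S" "\<And>x. x \<in> S \<Longrightarrow> T x \<in> S"
    and u: "u \<in> S" "u \<noteq> 0" and B: "countable B" "S \<subseteq> module.span s B"
  shows "\<exists>c. \<not> (inj_on (\<lambda>v. T v - s c v) S \<and> (\<lambda>v. T v - s c v) ` S = S)"
proof (rule ccontr)
  assume "\<not> ?thesis"
  hence inj: "\<And>c. inj_on (\<lambda>v. T v - s c v) S" and surj: "\<And>c. (\<lambda>v. T v - s c v) ` S = S" by auto
  interpret vector_space s by fact
  have inj0: "v = 0" if "v \<in> S" "T v - s c v = 0" for v c
    using inj_onD[OF inj[of c], of v 0] that subspace_0[OF S(1)] by (simp add: module_hom.zero[OF T])
  \<comment> \<open>A nonzero polynomial in \<open>T\<close> is a scalar times a product of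
    injective factors \<open>T - c\<close>.\<close>
  have inj_poly: "v = 0" if "p \<noteq> 0" "v \<in> S" "poly_op s T p v = 0" for p v using that
  proof (induction "degree p" arbitrary: p)
    case 0
    then obtain a where "p = [:a:]" "a \<noteq> 0" by (metis degree_eq_zeroE pCons_0_0)
    thus ?case using 0 by (simp add: poly_op_pCons[OF T] module_hom.zero[OF T])
  next
    case (Suc d)
    hence "\<not> constant (poly p)" by (simp add: constant_degree)
    then obtain c where "poly p c = 0" using fundamental_theorem_of_algebra by blast
    then obtain r where r: "p = [:- c, 1:] * r" by (auto simp: poly_eq_0_iff_dvd dvd_def)
    have rn: "r \<noteq> 0" using Suc.prems(1) r by auto
    hence "degree p = Suc (degree r)" unfolding r by (subst degree_mult_eq) auto
    moreover have "poly_op s T r v = 0"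
      by (rule inj0[of _ c]) (use Suc.prems r poly_op_factor[OF T, of c r v] poly_op_closed[OF T S] in auto)
    ultimately show ?case using Suc.hyps rn Suc.prems(2) by simp
  qed
  have "\<forall>c. \<exists>v\<in>S. T v - s c v = u"
  proof
    fix c
    have "u \<in> (\<lambda>v. T v - s c v) ` S" unfolding surj by (rule u(1))
    thus "\<exists>v\<in>S. T v - s c v = u" by blast
  qed
  then obtain v where v: "\<And>c. v c \<in> S" "\<And>c. T (v c) - s c (v c) = u" by metis
  have coeff0: "\<alpha> i = 0" if fin: "finite I" and i: "i \<in> I" and z: "(\<Sum>c\<in>I. s (\<alpha> c) (v c)) = 0" for I \<alpha> and i :: complex
  proof -
    \<comment> \<open>Applying the product of all \<open>T - d\<close> clears the inverses:
      \<open>v c\<close> becomes \<open>q c\<close>, taken at \<open>T\<close>, applied to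
      \<open>u\<close>. Evaluated at the number \<open>i\<close>, only the summand of
      \<open>i\<close> survives.\<close>
    define q where "q c = (\<Prod>d\<in>I - {c}. [:- d, 1:])" for c
    define p where "p = (\<Sum>c\<in>I. smult (\<alpha> c) (q c))"
    have pv: "poly_op s T (\<Prod>d\<in>I. [:- d, 1:]) (v c) = poly_op s T (q c) u" if "c \<in> I" for c
    proof -
      have "(\<Prod>d\<in>I. [:- d, 1:]) = [:- c, 1:] * q c" unfolding q_def by (rule prod.remove[OF fin that])
      hence "poly_op s T (\<Prod>d\<in>I. [:- d, 1:]) (v c) = T (poly_op s T (q c) (v c)) - s c (poly_op s T (q c) (v c))"
        by (simp only: poly_op_factor[OF T])
      also have "\<dots> = poly_op s T (q c) (T (v c) + s (- c) (v c))" by (simp add: poly_op_right[OF T] del: scale_minus_left) (simp add: poly_op_right[OF T])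
      finally show ?thesis using v(2)[of c] by simp
    qed
    have "poly_op s T (\<Prod>d\<in>I. [:- d, 1:]) (\<Sum>c\<in>J. s (\<alpha> c) (v c)) = (\<Sum>c\<in>J. s (\<alpha> c) (poly_op s T (\<Prod>d\<in>I. [:- d, 1:]) (v c)))" for J
      using poly_op_right(2)[OF T, of _ 0 0]
      by (induction J rule: infinite_finite_induct) (simp_all add: poly_op_right[OF T])
    from this[of I] have "(\<Sum>c\<in>I. s (\<alpha> c) (poly_op s T (q c) u)) = 0"
      using poly_op_right(2)[OF T, of "\<Prod>d\<in>I. [:- d, 1:]" 0 0] by (simp add: z pv)
    hence "poly_op s T p u = 0" by (simp add: p_def poly_op_sum[OF T] poly_op_smult[OF T])
    hence "p = 0" using inj_poly u by blast
    hence "0 = poly p i" by simp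
    also have "\<dots> = (\<Sum>c\<in>I. if c = i then \<alpha> i * poly (q i) i else 0)" unfolding p_def poly_sum
    proof (rule sum.cong[OF refl])
      fix c assume "c \<in> I"
      thus "poly (smult (\<alpha> c) (q c)) i = (if c = i then \<alpha> i * poly (q i) i else 0)"
        using fin i by (auto simp: q_def poly_prod intro!: prod_zero bexI[of _ i])
    qed
    also have "\<dots> = \<alpha> i * poly (q i) i" using fin i by simp
    finally show "\<alpha> i = 0" using fin by (auto simp: q_def poly_prod)
  qed
  have "inj v"
  proof (rule injI, rule ccontr)
    fix c d assume *: "v c = v d" "c \<noteq> d"
    have "(\<Sum>x\<in>{c, d}. s (if x = c then 1 else -1) (v x)) = 0" using * by simp
    from coeff0[OF _ _ this, of c] show False by simp
  qed
  moreover have "independent (range v)" unfolding independent_explicit_module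
  proof (intro allI impI)
    fix t x y assume t: "finite t" "t \<subseteq> range v" "(\<Sum>y\<in>t. s (x y) y) = 0" "y \<in> t"
    obtain I where I: "finite I" "t = v ` I" using finite_subset_image[OF t(1,2)] by metis
    have "(\<Sum>c\<in>I. s (x (v c)) (v c)) = 0"
      using t(3) unfolding I(2) by (subst (asm) sum.reindex) (use \<open>inj v\<close> in \<open>auto intro: inj_on_subset\<close>)
    moreover obtain c where "c \<in> I" "y = v c" using t(4) I(2) by blast
    ultimately show "x y = 0" using coeff0[OF I(1), of c "\<lambda>c. x (v c)"] by simp
  qed
  ultimately have "countable (range v)" using independent_countable[of "range v" B] v(1) B by auto
  hence "countable (UNIV :: complex set)" using \<open>inj v\<close> countable_image_inj_on by blast
  hence "countable (range complex_of_real)" by (rule countable_subset[rotated]) simp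
  hence "countable (UNIV :: real set)" by (rule countable_image_inj_on) (simp add: inj_on_def)
  thus False using uncountable_UNIV_real by blast
qed

subsection \<open>Graded actions\<close>

context orbifold_action
begin

text \<open>The submodule generated by \<open>u\<close>; for \<open>u\<close> in \<open>low\<close>
  it consists of sums of single modes applied to \<open>u\<close>.\<close>

definition gen :: "'m \<Rightarrow> 'm set" where "gen u = {\<phi> u | \<phi>. reducible \<phi>}"

lemma gen_I: "reducible \<phi> \<Longrightarrow> \<phi> u \<in> gen u" by (auto simp: gen_def)

lemma gen_subspace: "M.subspace (gen u)"
  unfolding M.subspace_def gen_def using reducible_zero reducible_add reducible_scale by fast

lemma gen_self: "A (vac V) (-1) u = u \<Longrightarrow> u \<in> gen u" using gen_I[OF reducible_A[OF vac_DD, of "-1"], of u] by simp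

lemma A_wc: "a \<in> WC \<Longrightarrow> A a k u = (\<Sum>p\<in>wts a. A (wc p a) k u)"
  unfolding A_linear(5)[symmetric] using wc_sum[OF WC_C finite_wts order_refl] by simp

lemma gen_A: assumes "a \<in> WC" "v \<in> gen u" shows "A a k v \<in> gen u"
proof -
  obtain \<phi> where \<phi>: "reducible \<phi>" "v = \<phi> u" using assms(2) by (auto simp: gen_def)
  have "A (wc p a) k v \<in> gen u" for p
    unfolding \<phi>(2) using gen_I[OF reducible_A_comp[OF \<phi>(1) wc_in_DD[OF assms(1)], of p k], of u] by simp
  thus ?thesis unfolding A_wc[OF assms(1)] by (intro M.subspace_sum[OF gen_subspace])
qed

lemma genE: assumes "v \<in> gen u" "u \<in> low"
  shows "\<exists>c B. finite B \<and> (\<forall>q\<in>B. c q \<in> DD (fst q)) \<and> v = (\<Sum>q\<in>B. A (c q) (snd q) u)"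
proof -
  obtain c B where "finite B" "\<forall>(p, k)\<in>B. c (p, k) \<in> DD p" "v = (\<Sum>(p, k)\<in>B. A (c (p, k)) k u)"
    using assms unfolding gen_def reducible_def by blast
  thus ?thesis by (intro exI[of _ c] exI[of _ B]) (auto simp: case_prod_beta)
qed

end

lemma (in vector_space) decomposition_sum: assumes "\<And>k. subspace (L k)" "finite I" "\<And>i. i \<in> I \<Longrightarrow> y i \<in> L (d i)"
  shows "decomposition L (\<Sum>i\<in>I. y i) (\<lambda>k. \<Sum>i\<in>{i \<in> I. d i = k}. y i)"
proof -
  have sub: "{k. (\<Sum>i\<in>{i \<in> I. d i = k}. y i) \<noteq> 0} \<subseteq> d ` I" by (auto elim!: sum.not_neutral_contains_not_neutral)
  have "Sum_any (\<lambda>k. \<Sum>i\<in>{i \<in> I. d i = k}. y i) = (\<Sum>k\<in>d ` I. \<Sum>i\<in>{i \<in> I. d i = k}. y i)"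
    by (rule Sum_any.expand_superset) (use assms sub in auto)
  also have "\<dots> = (\<Sum>i\<in>I. y i)" using assms(2) by (intro sum.group) auto
  finally show ?thesis unfolding decomposition_def using assms finite_subset[OF sub]
    by (auto intro: subspace_sum[OF assms(1)])
qed

locale graded_action = orbifold_action n V e f s A
  for n :: nat and V :: "'v::ab_group_add vertex_structure" and e f :: "nat \<Rightarrow> 'v"
    and s :: "complex \<Rightarrow> 'm \<Rightarrow> 'm::ab_group_add" and A :: "'v \<Rightarrow> int \<Rightarrow> 'm \<Rightarrow> 'm" +
  fixes U :: "'m set" and L :: "int \<Rightarrow> 'm set" assumes U_subspace: "M.subspace U"
    and A_U: "\<lbrakk>a \<in> WC; u \<in> U\<rbrakk> \<Longrightarrow> A a k u \<in> U" and A_vac: "u \<in> U \<Longrightarrow> A (vac V) k u = (if k = -1 then u else 0)"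
    and direct: "is_direct_sum s U L" and L_neg: "k < 0 \<Longrightarrow> L k = {0}"
    and A_L: "\<lbrakk>a \<in> DD p; u \<in> L k\<rbrakk> \<Longrightarrow> A a l u \<in> L (p + k - l - 1)"
begin

lemma L_subspace: "M.subspace (L k)" and L_U: "u \<in> L k \<Longrightarrow> u \<in> U" using direct by (auto simp: is_direct_sum_def)

lemma decomposition_unique: "u \<in> U \<Longrightarrow> decomposition L u c \<Longrightarrow> decomposition L u c' \<Longrightarrow> c = c'"
  using direct unfolding is_direct_sum_def by blast

lemma level_part: assumes "finite I" "\<And>i. i \<in> I \<Longrightarrow> y i \<in> L (d i)" "(\<Sum>i\<in>I. y i) \<in> L k"
  shows "(\<Sum>i\<in>I. y i) = (\<Sum>i\<in>{i \<in> I. d i = k}. y i)"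
proof -
  have "Sum_any (\<lambda>k'. if k' = k then \<Sum>i\<in>I. y i else 0) = (\<Sum>k'\<in>{k}. if k' = k then \<Sum>i\<in>I. y i else 0)"
    by (rule Sum_any.expand_superset) auto
  hence "decomposition L (\<Sum>i\<in>I. y i) (\<lambda>k'. if k' = k then \<Sum>i\<in>I. y i else 0)"
    using assms(3) M.subspace_0[OF L_subspace] by (auto simp: decomposition_def)
  from decomposition_unique[OF L_U[OF assms(3)] this M.decomposition_sum[of L I y d, OF L_subspace assms(1,2)], THEN fun_cong, of k]
  show ?thesis by simp
qed

lemma level_independent: assumes "finite I" "\<And>i. i \<in> I \<Longrightarrow> y i \<in> L (d i)" "inj_on d I" "(\<Sum>i\<in>I. y i) = 0" "i \<in> I"
  shows "y i = 0"
proof -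
  have "{j \<in> I. d j = d i} = {i}" using assms(3,5) by (auto simp: inj_on_def)
  thus ?thesis
    using level_part[where d = d and y = y and k = "d i", OF assms(1,2)] assms(4) M.subspace_0[OF L_subspace] by simp
qed

lemma low_L0: "u \<in> L 0 \<Longrightarrow> u \<in> low"
proof -
  assume u: "u \<in> L 0"
  have "A a l u = 0" if "a \<in> DD p" "l \<ge> p" for p a l
    using A_L[OF that(1) u, of l] L_neg[of "p + 0 - l - 1"] that(2) by simp
  thus ?thesis by (auto simp: low_def)
qed

lemma combination_L0:
  assumes "finite B" and c: "\<And>q. q \<in> B \<Longrightarrow> c q \<in> DD (fst q)" and u: "u \<in> L 0" and L: "(\<Sum>q\<in>B. A (c q) (snd q) u) \<in> L 0"
  shows "(\<Sum>q\<in>B. A (c q) (snd q) u) = zm (\<Sum>q\<in>{q \<in> B. fst q - snd q - 1 = 0}. c q) u"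
proof -
  have "A (c q) (snd q) u \<in> L (fst q - snd q - 1)" if "q \<in> B" for q using A_L[OF c[OF that] u, of "snd q"] by simp
  from level_part[OF assms(1) this L]
  have "(\<Sum>q\<in>B. A (c q) (snd q) u) = (\<Sum>q\<in>{q \<in> B. fst q - snd q - 1 = 0}. A (c q) (snd q) u)" by simp
  also have "\<dots> = (\<Sum>q\<in>{q \<in> B. fst q - snd q - 1 = 0}. zm (c q) u)"
  proof (rule sum.cong[OF refl])
    fix q assume q: "q \<in> {q \<in> B. fst q - snd q - 1 = 0}"
    hence "snd q = fst q - 1" by simp
    thus "A (c q) (snd q) u = zm (c q) u" using zm_DD[OF c, of q u] q by simp
  qed
  finally show ?thesis by (simp only: zm_linear)
qed

lemma gen_L0: assumes "u \<in> L 0" "v \<in> L 0" "v \<in> gen u"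
  obtains w where "w \<in> WC" "v = zm w u"
proof -
  obtain c B where cB: "finite B" "\<forall>q\<in>B. c q \<in> DD (fst q)" "v = (\<Sum>q\<in>B. A (c q) (snd q) u)"
    using genE[OF assms(3) low_L0[OF assms(1)]] by blast
  show ?thesis
  proof (rule that)
    show "v = zm (\<Sum>q\<in>{q \<in> B. fst q - snd q - 1 = 0}. c q) u" using combination_L0[of B c u] cB assms by simp
    show "(\<Sum>q\<in>{q \<in> B. fst q - snd q - 1 = 0}. c q) \<in> WC" using cB(2) DD_WC by (intro WC_sum) blast
  qed
qed

lemma zm_L0: assumes "a \<in> WC" "u \<in> L 0" shows "zm a u \<in> L 0" unfolding zm_def
proof (rule M.subspace_sum[OF L_subspace])
  fix p
  show "A (wc p a) (p - 1) u \<in> L 0" using A_L[OF wc_in_DD[OF assms(1)] assms(2), of p "p - 1"] by simp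
qed

lemma zm_vac: "u \<in> U \<Longrightarrow> zm (vac V) u = u" using zm_DD[OF vac_DD, of u] A_vac[of u "-1"] by simp

lemma zm_commute: assumes "0 < n" "a \<in> WC" "b \<in> WC" "u \<in> low" shows "zm a (zm b u) = zm b (zm a u)"
proof -
  have "st a b - st b a \<in> ZO" using assms by (intro ev_zero_ZO) (auto simp: ev_linear ev_st)
  from zm_ZO[OF assms(4) this] show ?thesis using assms by (simp add: zm_linear zm_st)
qed

lemma zm_Theta: assumes "0 < n" "w \<in> WC" "u \<in> low" shows "\<exists>p\<in>mpolys. poly_of w = p \<and> zm w u = zm (Theta p) u"
proof -
  obtain p where p: "p \<in> mpolys" "w - Theta p \<in> ZO" using WC_Theta[OF assms(1,2)] by blast
  have "poly_of w = p" by (rule poly_of_unique[OF assms(1,2) p(1)]) (use ev_cong[OF p(2)] ev_Theta in simp)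
  thus ?thesis using zm_ZO[OF assms(3) p(2)] p(1) by (simp add: zm_linear)
qed

lemma zm_eigen: assumes "0 < n" "w \<in> WC" "u \<in> L 0" and x: "\<And>m. m < n \<Longrightarrow> zm (jq m) u = s (x m) u"
  shows "zm w u = s (mpoly_eval x (poly_of w)) u"
proof -
  note u = low_L0[OF assms(3)]
  obtain p where p: "p \<in> mpolys" "poly_of w = p" "zm w u = zm (Theta p) u" using zm_Theta[OF assms(1,2) u] by blast
  have word: "zm (Jw ms) u = s (monomial_eval x (mono_of ms)) u" if "set ms \<subseteq> {..<n}" for ms using that
  proof (induction ms)
    case Nil
    thus ?case by (simp add: zm_vac L_U[OF assms(3)])
  next
    case (Cons m ms)
    thus ?case by (simp add: zm_st[OF u] jact_WC zm_linear x monomial_eval_add mult.commute)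
  qed
  have "zm (Theta p) u = (\<Sum>m\<in>keys p. s (lookup p m * monomial_eval x m) u)" unfolding Theta_def zm_linear
  proof (rule sum.cong[OF refl])
    fix m assume "m \<in> keys p"
    hence "set (word_of m) \<subseteq> {..<n}" using p(1) keys_mono_of[of "word_of m"] by (auto simp: mpolys_iff mono_of_word_of)
    thus "s (lookup p m) (zm (Jw (word_of m)) u) = s (lookup p m * monomial_eval x m) u"
      by (simp add: word mono_of_word_of)
  qed
  thus ?thesis using p by (simp add: mpoly_eval_def M.scale_sum_left)
qed

end

locale irreducible_action = graded_action + assumes n: "0 < n" and L0: "L 0 \<noteq> {0}"
    and irreducible: "\<lbrakk>M.subspace S; S \<subseteq> U; \<And>a k u. a \<in> WC \<Longrightarrow> u \<in> S \<Longrightarrow> A a k u \<in> S\<rbrakk> \<Longrightarrow> S = {0} \<or> S = U"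
begin

lemma gen_U: assumes "u \<in> U" "u \<in> low" "u \<noteq> 0" shows "gen u = U"
proof -
  have "gen u \<subseteq> U"
  proof
    fix v assume "v \<in> gen u"
    then obtain c B where cB: "finite B" "\<forall>q\<in>B. c q \<in> DD (fst q)" "v = (\<Sum>q\<in>B. A (c q) (snd q) u)"
      using genE[OF _ assms(2)] by blast
    show "v \<in> U" unfolding cB(3) by (rule M.subspace_sum[OF U_subspace A_U[OF DD_WC[OF cB(2)[rule_format]] assms(1)]])
  qed
  hence "gen u = {0} \<or> gen u = U" by (rule irreducible[OF gen_subspace]) (rule gen_A)
  thus ?thesis using gen_self[of u] A_vac[OF assms(1)] assms(3) by auto
qed

lemma L0_generated: assumes "u \<in> L 0" "u \<noteq> 0" "v \<in> L 0" obtains w where "w \<in> WC" "v = zm w u"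
  using gen_L0[OF assms(1,3)] gen_U[OF L_U low_L0] assms L_U by metis

text \<open>Such a vector generates nothing below its own degree, but by irreducibility it generates
  the nonzero space of degree zero.\<close>

lemma low_positive: assumes "u \<in> L k" "u \<in> low" "k > 0" shows "u = 0"
proof (rule ccontr)
  assume u: "u \<noteq> 0"
  obtain v where v: "v \<in> L 0" "v \<noteq> 0" using L0 M.subspace_0[OF L_subspace] by blast
  have "v \<in> gen u" using gen_U[OF L_U[OF assms(1)] assms(2) u] L_U[OF v(1)] by simp
  then obtain c B where cB: "finite B" "\<forall>q\<in>B. c q \<in> DD (fst q)" "v = (\<Sum>q\<in>B. A (c q) (snd q) u)"
    using genE[OF _ assms(2)] by blast
  have "A (c q) (snd q) u \<in> L (fst q + k - snd q - 1)" if "q \<in> B" for q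
    using A_L[OF cB(2)[rule_format, OF that] assms(1)] .
  from level_part[where k = 0, of B "\<lambda>q. A (c q) (snd q) u", OF cB(1) this]
  have "v = (\<Sum>q\<in>{q \<in> B. fst q + k - snd q - 1 = 0}. A (c q) (snd q) u)" using v(1) unfolding cB(3) by blast
  also have "\<dots> = 0"
  proof (rule sum.neutral, rule ballI)
    fix q assume q: "q \<in> {q \<in> B. fst q + k - snd q - 1 = 0}"
    hence "c q \<in> DD (fst q)" using cB(2) by simp
    moreover have "snd q \<ge> fst q" using q assms(3) by simp
    ultimately show "A (c q) (snd q) u = 0" using lowD[OF assms(2)] by blast
  qed
  finally show False using v(2) by simp
qed

text \<open>The homogeneous components of \<open>u\<close> are again in \<open>low\<close>, because
  a homogeneous mode sends them to different degrees.\<close>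

lemma low_U_L0: assumes "u \<in> U" "u \<in> low" shows "u \<in> L 0"
proof -
  obtain c where c: "decomposition L u c" using direct assms(1) unfolding is_direct_sum_def by blast
  define K where "K = {k. c k \<noteq> 0}"
  have K: "finite K" "\<And>k. c k \<in> L k" "u = (\<Sum>k\<in>K. c k)"
    using c by (auto simp: decomposition_def K_def Sum_any.expand_set)
  have "c k \<in> low" for k unfolding low_def
  proof (intro CollectI allI ballI impI)
    fix p a l assume a: "a \<in> DD p" "(l::int) \<ge> p"
    show "A a l (c k) = 0"
    proof (cases "k \<in> K")
      case True
      have "(\<Sum>k\<in>K. A a l (c k)) = 0" using lowD[OF assms(2) a] by (simp add: K(3) A_linear)
      thus ?thesis by (intro level_independent[OF K(1), of "\<lambda>k. A a l (c k)" "\<lambda>k. p + k - l - 1"])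
          (auto simp: inj_on_def True intro!: A_L[OF a(1)] K(2))
    qed (simp add: K_def A_linear)
  qed
  hence "c k = 0" if "k \<noteq> 0" for k
    using low_positive[OF K(2), of k] L_neg[of k] K(2)[of k] that by (cases "k > 0") auto
  hence "u = (\<Sum>k\<in>K. if k = 0 then c 0 else 0)" unfolding K(3) by (intro sum.cong) auto
  thus ?thesis using K(1,2) M.subspace_0[OF L_subspace] by (simp split: if_splits)
qed

text \<open>Schur's lemma: \<open>L 0\<close> has countable dimension, as words in the
  \<open>jq m\<close> applied to one vector span it, so some \<open>zm a - c\<close> is not
  bijective there. This operator commutes with all zero modes, and they generate \<open>L 0\<close>
  from any nonzero vector; hence it is zero.\<close>

lemma zm_scalar: assumes a: "a \<in> WC" shows "\<exists>c. \<forall>v\<in>L 0. zm a v = s c v"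
proof -
  obtain u where u: "u \<in> L 0" "u \<noteq> 0" using L0 M.subspace_0[OF L_subspace] by blast
  have "L 0 \<subseteq> M.span (range (\<lambda>ms. zm (Jw ms) u))"
  proof
    fix v assume "v \<in> L 0"
    then obtain w where w: "w \<in> WC" "v = zm w u" using L0_generated[OF u] by blast
    then obtain p where "v = zm (Theta p) u" using zm_Theta[OF n w(1) low_L0[OF u(1)]] by auto
    thus "v \<in> M.span (range (\<lambda>ms. zm (Jw ms) u))"
      unfolding Theta_def zm_linear by (auto intro!: M.span_sum M.span_scale[OF M.span_base])
  qed
  moreover have "countable (range (\<lambda>ms. zm (Jw ms) u))" by simp
  ultimately obtain c where c: "\<not> (inj_on (\<lambda>v. zm a v - s c v) (L 0) \<and> (\<lambda>v. zm a v - s c v) ` L 0 = L 0)"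
    using countable_dimension_spectrum[OF M.vector_space_axioms zm_right L_subspace zm_L0[OF a] u] by blast
  let ?T = "\<lambda>v. zm a v - s c v"
  have TL: "?T v \<in> L 0" if "v \<in> L 0" for v
    using that zm_L0[OF a] by (intro M.subspace_diff[OF L_subspace] M.subspace_scale[OF L_subspace])
  have Tc: "?T (zm w v) = zm w (?T v)" if "w \<in> WC" "v \<in> L 0" for w v
    using zm_commute[OF n a that(1) low_L0[OF that(2)]] by (simp add: zm_linear)
  have "?T v = 0" if v: "v \<in> L 0" for v
  proof (cases "inj_on ?T (L 0)")
    case False
    then obtain x y where xy: "x \<in> L 0" "y \<in> L 0" "x \<noteq> y" "?T x = ?T y" by (auto simp: inj_on_def)
    have "x - y \<in> L 0" "x - y \<noteq> 0" using xy M.subspace_diff[OF L_subspace] by auto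
    then obtain w where w: "w \<in> WC" "v = zm w (x - y)" using L0_generated v by blast
    have "?T (x - y) = 0" using xy(4) by (simp add: zm_linear M.scale_right_diff_distrib algebra_simps)
    thus ?thesis unfolding w(2) Tc[OF w(1) \<open>x - y \<in> L 0\<close>] by (simp only: zm_linear)
  next
    case True
    show ?thesis
    proof (rule ccontr)
      assume "?T v \<noteq> 0"
      hence "y \<in> ?T ` L 0" if "y \<in> L 0" for y
        using L0_generated[OF TL[OF v] _ that] Tc[OF _ v] zm_L0[OF _ v] by (metis (no_types, lifting) image_eqI)
      hence "?T ` L 0 = L 0" using TL by blast
      thus False using c True by blast
    qed
  qed
  thus ?thesis by (intro exI[of _ c]) simp
qed

lemma L0_span: assumes "u \<in> L 0" "u \<noteq> 0" shows "L 0 = M.span {u}"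
proof
  show "M.span {u} \<subseteq> L 0" using assms(1) by (intro M.span_minimal L_subspace) auto
  show "L 0 \<subseteq> M.span {u}"
  proof
    fix v assume "v \<in> L 0"
    then obtain w where w: "w \<in> WC" "v = zm w u" using L0_generated[OF assms] by blast
    obtain c where "zm w u = s c u" using zm_scalar[OF w(1)] assms(1) by blast
    thus "v \<in> M.span {u}" using w(2) by (simp add: M.span_base M.span_scale)
  qed
qed

end

subsection \<open>Irreducible admissible modules\<close>

lemma subspace_projection: assumes "vector_space s" "module.subspace s S"
  shows "\<exists>p. range p \<subseteq> S \<and> module_hom s s p \<and> (\<forall>a\<in>S. p a = a)"
proof -
  interpret vector_space_pair s s using assms(1) by (simp add: vector_space_pair_def)
  have "module_hom s s id"
    using assms(1) by (simp add: module_hom_def module_hom_axioms_def module_iff_vector_space)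
  from linear_exists_left_inverse_on[unfolded linear_iff_module_hom, OF this assms(2)] show ?thesis by simp
qed

context symplectic_fermion_algebra
begin

text \<open>Projections onto the invariants and onto the carrier extend the action linearly to the
  whole types.\<close>

lemma module_graded_action: assumes adm: "admissible_module W DD M"
  shows "\<exists>A. graded_action n V e f (mscl M) A (carrier M) (level M) \<and>
    (\<forall>a\<in>WC. \<forall>u\<in>carrier M. \<forall>k. A a k u = act M a k u)"
proof -
  interpret M: is_vertex_module W M using adm by (simp add: admissible_module_def)
  interpret vM: vector_space "mscl M" by (rule M.vector_space_M)
  obtain pM where pM: "range pM \<subseteq> carrier M" "module_hom (mscl M) (mscl M) pM" "\<And>u. u \<in> carrier M \<Longrightarrow> pM u = u"
    using subspace_projection[OF M.vector_space_M M.subspace_M] by blast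
  obtain pW where pW: "range pW \<subseteq> WC" "lin pW" "\<And>a. a \<in> WC \<Longrightarrow> pW a = a"
    using subspace_projection[OF vector_space WC_subspace] by blast
  have pin: "pM u \<in> carrier M" "pW a \<in> WC" for u a using pM(1) pW(1) by auto
  note hM = module_hom.add[OF pM(2)] module_hom.scale[OF pM(2)]
  note hW = module_hom.add[OF pW(2)] module_hom.scale[OF pW(2)]
  define A where "A a k u = act M (pW a) k (pM u)" for a k u
  have car: "carrier W = WC" by (simp add: W_simps)
  have left: "module_hom (scl V) (mscl M) (\<lambda>a. A a k u)" for k u
    using M.act_add_left[unfolded W_simps] M.act_scl_left[unfolded W_simps] pin
    by (auto simp: module_hom_def module_hom_axioms_def A_def hW vs.module_axioms vM.module_axioms W_simps)
  have right: "module_hom (mscl M) (mscl M) (A a k)" for a k using M.act_add_right M.act_scl_right pin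
    by (auto simp: module_hom_def module_hom_axioms_def A_def hM vM.module_axioms car)
  have A0: "A 0 k u = 0" "A a k 0 = 0" for a k u using module_hom.zero[OF left] module_hom.zero[OF right] by auto
  have orb: "orbifold_action n V e f (mscl M) A"
  proof (intro orbifold_action.intro symplectic_fermion_algebra_axioms vM.vector_space_axioms orbifold_action_axioms.intro left right)
    fix a b J r k u m
    assume ab: "a \<in> WC" "b \<in> WC" and z: "\<And>j. j \<ge> J \<Longrightarrow> Y a (r + int j) b = 0"
      "\<And>j. j \<ge> J \<Longrightarrow> A b (k + int j) u = 0" "\<And>j. j \<ge> J \<Longrightarrow> A a (m + int j) u = 0"
    have Y: "mode V a i b = Y a i b" for i using ab by (simp add: Y_mode WC_C)
    have act: "act M c i x = A c i x" if "c \<in> WC" "x \<in> carrier M" for c i x using that by (simp add: A_def pM pW)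
    have Ap: "A c i (pM x) = A c i x" for c i x by (simp add: A_def pM(3) pin)
    have AU: "A c i x \<in> carrier M" for c i x using M.act_closed pin by (auto simp: A_def car)
    have "borcherds_identity W (mscl M) (act M) 1 a b (pM u)" by (rule M.act_borcherds) (use ab pin car in auto)
    from borcherds_finite[OF this vM.vector_space_axioms, of J r m k]
    show "(\<Sum>j<J. mscl M (of_int m gchoose j) (A (Y a (r + int j) b) (m + k - int j) u)) =
      (\<Sum>j<J. mscl M (sbinom r j) (A a (m + r - int j) (A b (k + int j) u)))
      - (\<Sum>j<J. mscl M (sbinom r j * (-1) powi r) (A b (r + k - int j) (A a (m + int j) u)))"
      using act[OF _ vM.subspace_0[OF M.subspace_M]] by (simp add: Y act ab pin WC_Y z A0 Ap AU)
  qed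
  interpret A: orbifold_action n V e f "mscl M" A by (rule orb)
  have AM: "A a k u = act M a k u" if "a \<in> WC" "u \<in> carrier M" for a k u using that by (simp add: A_def pM pW)
  have lev: "level M k \<subseteq> carrier M" for k using adm by (auto simp: admissible_module_def is_direct_sum_def)
  have "graded_action n V e f (mscl M) A (carrier M) (level M)"
  proof (intro graded_action.intro orb graded_action_axioms.intro)
    show "module.subspace (mscl M) (carrier M)" by (rule M.subspace_M)
    show "A a k u \<in> carrier M" if "a \<in> WC" "u \<in> carrier M" for a k u using M.act_closed that by (simp add: AM car)
    show "A (vac V) k u = (if k = -1 then u else 0)" if "u \<in> carrier M" for k u
      using M.act_vac[OF that, of k] that by (simp add: AM W_simps)
    show "is_direct_sum (mscl M) (carrier M) (level M)" using adm by (simp add: admissible_module_def)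
    show "level M k = {0}" if "k < 0" for k using adm that by (simp add: admissible_module_def)
    show "A a l u \<in> level M (p + k - l - 1)" if "a \<in> DD p" "u \<in> level M k" for a p u k l
      using adm that lev[of k] DD_WC[OF that(1)] by (auto simp: admissible_module_def AM)
  qed
  thus ?thesis using AM by blast
qed

lemma irreducible_graded_action: assumes n: "0 < n" and irr: "irreducible_admissible W DD M"
  shows "\<exists>A. irreducible_action n V e f (mscl M) A (carrier M) (level M) \<and>
    (\<forall>a\<in>WC. \<forall>u\<in>carrier M. \<forall>k. A a k u = act M a k u)"
proof -
  have adm: "admissible_module W DD M" using irr by (simp add: irreducible_admissible_def)
  obtain A where A: "graded_action n V e f (mscl M) A (carrier M) (level M)"
    "\<And>a u k. a \<in> WC \<Longrightarrow> u \<in> carrier M \<Longrightarrow> A a k u = act M a k u" using module_graded_action[OF adm] by blast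
  have "irreducible_action n V e f (mscl M) A (carrier M) (level M)"
  proof (intro irreducible_action.intro A(1) irreducible_action_axioms.intro n)
    show "level M 0 \<noteq> {0}" using irr by (simp add: irreducible_admissible_def)
    fix S assume S: "module.subspace (mscl M) S" "S \<subseteq> carrier M" "\<And>a k u. a \<in> WC \<Longrightarrow> u \<in> S \<Longrightarrow> A a k u \<in> S"
    have "submodule W M S" unfolding submodule_def
    proof (intro conjI S(1,2) ballI allI)
      fix a k u assume "a \<in> carrier W" "u \<in> S"
      thus "act M a k u \<in> S" using S(2) S(3)[of a u k] A(2)[of a u k] by (auto simp: W_simps)
    qed
    thus "S = {0} \<or> S = carrier M" using irr by (simp add: irreducible_admissible_def)
  qed
  thus ?thesis using A(2) by blast
qed

lemma jq_zero_mode: assumes "graded_action n V e f (mscl M) A (carrier M) (level M)"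
    "\<And>a u k. a \<in> WC \<Longrightarrow> u \<in> carrier M \<Longrightarrow> A a k u = act M a k u" "u \<in> carrier M"
  shows "orbifold_action.zm n V e f A (jq m) u = act M (jq m) (int (2*m + 2) - 1) u"
proof -
  interpret graded_action n V e f "mscl M" A "carrier M" "level M" by fact
  show ?thesis using zm_DD[OF jq_DD, of m u] assms(2)[OF jq_WC assms(3)] by simp
qed

theorem irreducible_highest_weight: assumes n: "0 < n" and irr: "irreducible_admissible W DD M"
  shows "highest_weight_module W DD M" "\<exists>!lam. top_point n jq M lam"
proof -
  obtain A where A: "irreducible_action n V e f (mscl M) A (carrier M) (level M)"
    "\<And>a u k. a \<in> WC \<Longrightarrow> u \<in> carrier M \<Longrightarrow> A a k u = act M a k u" using irreducible_graded_action[OF assms] by blast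
  interpret A: irreducible_action n V e f "mscl M" A "carrier M" "level M" by (rule A(1))
  obtain u where u: "u \<in> level M 0" "u \<noteq> 0" using A.L0 A.M.subspace_0[OF A.L_subspace] by blast
  note span = A.L0_span[OF u]
  show "highest_weight_module W DD M" unfolding highest_weight_module_def
  proof (intro conjI exI[of _ u] allI impI)
    show "admissible_module W DD M" using irr by (simp add: irreducible_admissible_def)
    fix S assume "submodule W M S \<and> u \<in> S"
    thus "S = carrier M" using irr u(2) by (auto simp: irreducible_admissible_def)
  qed (use u span in auto)
  have zm: "A.zm (jq m) v = act M (jq m) (int (2*m + 2) - 1) v" if "v \<in> level M 0" for m v
    by (rule jq_zero_mode[OF A.graded_action_axioms A(2) A.L_U[OF that]])
  obtain x where x: "\<And>m v. v \<in> level M 0 \<Longrightarrow> A.zm (jq m) v = mscl M (x m) v" using A.zm_scalar[OF jq_WC] by metis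
  show "\<exists>!lam. top_point n jq M lam"
  proof (rule ex1I[of _ "vec n x"])
    show "top_point n jq M (vec n x)" using x zm by (simp add: top_point_def)
    fix lam assume lam: "top_point n jq M lam"
    show "lam = vec n x"
    proof (rule eq_vecI)
      fix m assume "m < dim_vec (vec n x)"
      hence m: "m < n" by simp
      hence "mscl M (lam $ m) u = mscl M (x m) u"
        using lam u(1) x[OF u(1), of m] zm[OF u(1), of m] by (simp add: top_point_def)
      thus "lam $ m = vec n x $ m" using u(2) m by simp
    qed (use lam in \<open>auto simp: top_point_def\<close>)
  qed
qed

subsection \<open>Isomorphic modules\<close>

text \<open>The submodule of the product generated by \<open>(u, v)\<close>. For equal weights it
  will be the graph of an isomorphism.\<close>

definition joint :: "('v \<Rightarrow> int \<Rightarrow> 'x \<Rightarrow> 'x) \<Rightarrow> ('v \<Rightarrow> int \<Rightarrow> 'y \<Rightarrow> 'y) \<Rightarrow> 'x \<Rightarrow> 'y \<Rightarrow> ('x::ab_group_add \<times> 'y::ab_group_add) set" where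
  "joint A A' u v = {(\<Sum>q\<in>B. A (c q) (snd q) u, \<Sum>q\<in>B. A' (c q) (snd q) v) | (c :: int \<times> int \<Rightarrow> 'v) B.
     finite B \<and> (\<forall>q\<in>B. c q \<in> DD (fst q))}"

lemma joint_swap: "(x, y) \<in> joint A A' u v \<longleftrightarrow> (y, x) \<in> joint A' A v u" by (auto simp: joint_def)

lemma pair_action: assumes "orbifold_action n V e f s A" "orbifold_action n V e f s' A'"
  shows "orbifold_action n V e f (\<lambda>x w. (s x (fst w), s' x (snd w))) (\<lambda>a k w. (A a k (fst w), A' a k (snd w)))"
proof -
  interpret A: orbifold_action n V e f s A by fact
  interpret A': orbifold_action n V e f s' A' by fact
  have vec: "vector_space (\<lambda>x w. (s x (fst w), s' x (snd w)))"
    by (simp add: vector_space_def A.M.scale_right_distrib A'.M.scale_right_distrib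
        A.M.scale_left_distrib A'.M.scale_left_distrib plus_prod_def)
  hence mod: "Modules.module (\<lambda>x w. (s x (fst w), s' x (snd w)))" by (simp add: module_iff_vector_space)
  show ?thesis
  proof (intro orbifold_action.intro symplectic_fermion_algebra_axioms vec orbifold_action_axioms.intro, goal_cases)
    case (3 a b J r k u m)
    thus ?case using A.A_borcherds[OF 3(1-3), of J k "fst u" m] A'.A_borcherds[OF 3(1-3), of J k "snd u" m]
      by (simp add: prod_eq_iff fst_sum snd_sum zero_prod_def)
  qed (use vs.module_axioms mod in \<open>simp_all add: module_hom_def module_hom_axioms_def A.A_linear A'.A_linear plus_prod_def\<close>)
qed

lemma joint_closed: assumes "orbifold_action n V e f s A" "orbifold_action n V e f s' A'"
    and u: "u \<in> orbifold_action.low n V e f A" "A (vac V) (-1) u = u"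
    and v: "v \<in> orbifold_action.low n V e f A'" "A' (vac V) (-1) v = v" shows "(u, v) \<in> joint A A' u v"
    and "a \<in> WC \<Longrightarrow> (x, y) \<in> joint A A' u v \<Longrightarrow> (A a k x, A' a k y) \<in> joint A A' u v"
    and "(x, y) \<in> joint A A' u v \<Longrightarrow> (x', y') \<in> joint A A' u v \<Longrightarrow> (x + x', y + y') \<in> joint A A' u v"
    and "(x, y) \<in> joint A A' u v \<Longrightarrow> (s z x, s' z y) \<in> joint A A' u v" and "(0, 0) \<in> joint A A' u v"
proof -
  let ?R = "joint A A' u v"
  let ?s = "\<lambda>x w. (s x (fst w), s' x (snd w))" and ?A = "\<lambda>a k w. (A a k (fst w), A' a k (snd w))"
  interpret A: orbifold_action n V e f s A by fact
  interpret A': orbifold_action n V e f s' A' by fact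
  interpret P: orbifold_action n V e f ?s ?A by (rule pair_action) fact+
  have low: "(u, v) \<in> P.low" using A.lowD[OF u(1)] A'.lowD[OF v(1)] by (auto simp: P.low_def zero_prod_def)
  have eq: "?R = P.gen (u, v)"
  proof
    show "?R \<subseteq> P.gen (u, v)"
    proof
      fix w assume "w \<in> ?R"
      then obtain c B where cB: "finite B" "\<And>q. q \<in> B \<Longrightarrow> c q \<in> DD (fst q)"
        "w = (\<Sum>q\<in>B. A (c q) (snd q) u, \<Sum>q\<in>B. A' (c q) (snd q) v)" by (auto simp: joint_def)
      have "w = (\<Sum>q\<in>B. ?A (c q) (snd q) (u, v))" by (simp add: cB(3) prod_eq_iff fst_sum snd_sum)
      moreover have "P.reducible (\<lambda>w. \<Sum>q\<in>B. ?A (c q) (snd q) w)" by (intro P.reducible_sum P.reducible_A[OF cB(2)])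
      ultimately show "w \<in> P.gen (u, v)" using P.gen_I[of "\<lambda>w. \<Sum>q\<in>B. ?A (c q) (snd q) w" "(u, v)"] by simp
    qed
    show "P.gen (u, v) \<subseteq> ?R"
    proof
      fix w assume "w \<in> P.gen (u, v)"
      then obtain c B where cB: "finite B" "\<forall>q\<in>B. c q \<in> DD (fst q)" "w = (\<Sum>q\<in>B. ?A (c q) (snd q) (u, v))"
        using P.genE[OF _ low] by blast
      have "w = (\<Sum>q\<in>B. A (c q) (snd q) u, \<Sum>q\<in>B. A' (c q) (snd q) v)" by (simp add: cB(3) prod_eq_iff fst_sum snd_sum)
      thus "w \<in> ?R" unfolding joint_def using cB(1,2) by blast
    qed
  qed
  show "(u, v) \<in> ?R" unfolding eq by (rule P.gen_self) (simp add: u v)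
  show "a \<in> WC \<Longrightarrow> (x, y) \<in> ?R \<Longrightarrow> (A a k x, A' a k y) \<in> ?R" unfolding eq using P.gen_A[of a "(x, y)"] by simp
  show "(x, y) \<in> ?R \<Longrightarrow> (x', y') \<in> ?R \<Longrightarrow> (x + x', y + y') \<in> ?R"
    unfolding eq using P.M.subspace_add[OF P.gen_subspace, of "(x, y)" "(u, v)" "(x', y')"] by simp
  show "(x, y) \<in> ?R \<Longrightarrow> (s z x, s' z y) \<in> ?R"
    unfolding eq using P.M.subspace_scale[OF P.gen_subspace, of "(x, y)" "(u, v)" z] by simp
  show "(0, 0) \<in> ?R" unfolding eq using P.M.subspace_0[OF P.gen_subspace, of "(u, v)"] by (simp add: zero_prod_def)
qed

text \<open>The \<open>y\<close> paired with \<open>0\<close> form a submodule. If it were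
  everything, then \<open>(0, v)\<close> would arise from \<open>(u, v)\<close>; its part of degree
  zero is the zero mode of one \<open>w\<close>, acting by \<open>0\<close> on \<open>u\<close> and
  by \<open>1\<close> on \<open>v\<close>. But both scalars are the value at \<open>x\<close> of the
  polynomial of \<open>w\<close>.\<close>

lemma joint_functional: assumes "irreducible_action n V e f s A U L" "irreducible_action n V e f s' A' U' L'"
    and u: "u \<in> L 0" "u \<noteq> 0" and v: "v \<in> L' 0" "v \<noteq> 0"
    and x: "\<And>m. m < n \<Longrightarrow> orbifold_action.zm n V e f A (jq m) u = s (x m) u"
      "\<And>m. m < n \<Longrightarrow> orbifold_action.zm n V e f A' (jq m) v = s' (x m) v" and y: "(0, y) \<in> joint A A' u v"
  shows "y = 0"
proof -
  interpret A: irreducible_action n V e f s A U L by fact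
  interpret A': irreducible_action n V e f s' A' U' L' by fact
  have "A (vac V) (-1) u = u" "A' (vac V) (-1) v = v"
    using A.A_vac[OF A.L_U[OF u(1)]] A'.A_vac[OF A'.L_U[OF v(1)]] by auto
  note closed = joint_closed[OF A.orbifold_action_axioms A'.orbifold_action_axioms A.low_L0[OF u(1)] this(1) A'.low_L0[OF v(1)] this(2)]
  define K where "K = {y. (0, y) \<in> joint A A' u v}"
  have "K \<subseteq> U'"
  proof
    fix y assume "y \<in> K"
    then obtain c B where cB: "\<forall>q\<in>B. c q \<in> DD (fst q)" "y = (\<Sum>q\<in>B. A' (c q) (snd q) v)"
      by (auto simp: K_def joint_def)
    thus "y \<in> U'" unfolding cB(2)
      by (intro A'.M.subspace_sum[OF A'.U_subspace] A'.A_U[OF DD_WC A'.L_U[OF v(1)]]) blast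
  qed
  moreover have "A'.M.subspace K"
    unfolding A'.M.subspace_def K_def using closed(3)[of 0 _ 0] closed(4)[of 0] closed(5) by auto
  ultimately have "K = {0} \<or> K = U'"
    by (intro A'.irreducible) (use closed(2)[of _ 0] in \<open>auto simp: K_def A.A_linear\<close>)
  moreover have "K \<noteq> U'"
  proof
    assume "K = U'"
    hence "(0, v) \<in> joint A A' u v" using A'.L_U[OF v(1)] by (auto simp: K_def)
    then obtain c B where cB: "finite B" "\<And>q. q \<in> B \<Longrightarrow> c q \<in> DD (fst q)"
      "(\<Sum>q\<in>B. A (c q) (snd q) u) = 0" "v = (\<Sum>q\<in>B. A' (c q) (snd q) v)" unfolding joint_def by auto
    define w where "w = (\<Sum>q\<in>{q \<in> B. fst q - snd q - 1 = 0}. c q)"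
    have w: "w \<in> WC" unfolding w_def using cB(2) DD_WC by (intro WC_sum) blast
    have "0 = A.zm w u"
      using A.combination_L0[of B c u] cB(1-3) u(1) A.M.subspace_0[OF A.L_subspace] by (simp add: w_def)
    moreover have "(\<Sum>q\<in>B. A' (c q) (snd q) v) = A'.zm w v"
      unfolding w_def by (rule A'.combination_L0[OF cB(1,2) v(1)]) (use cB(4) v(1) in auto)
    ultimately have "s (mpoly_eval x (poly_of w)) u = 0" "v = s' (mpoly_eval x (poly_of w)) v"
      using A.zm_eigen[OF A.n w u(1) x(1)] A'.zm_eigen[OF A.n w v(1) x(2)] cB(4) by auto
    thus False using u(2) v(2) by auto
  qed
  ultimately show ?thesis using y by (auto simp: K_def)
qed

lemma joint_total: assumes "irreducible_action n V e f s A U L" "irreducible_action n V e f s' A' U' L'"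
    and u: "u \<in> L 0" "u \<noteq> 0" and v: "v \<in> L' 0" and x: "x \<in> U" shows "\<exists>y\<in>U'. (x, y) \<in> joint A A' u v"
proof -
  interpret A: irreducible_action n V e f s A U L by fact
  interpret A': irreducible_action n V e f s' A' U' L' by fact
  have "x \<in> A.gen u" using A.gen_U[OF A.L_U[OF u(1)] A.low_L0[OF u(1)] u(2)] x by simp
  then obtain c B where cB: "finite B" "\<forall>q\<in>B. c q \<in> DD (fst q)" "x = (\<Sum>q\<in>B. A (c q) (snd q) u)"
    using A.genE[OF _ A.low_L0[OF u(1)]] by blast
  have "(\<Sum>q\<in>B. A' (c q) (snd q) v) \<in> U'"
    using cB(2) by (intro A'.M.subspace_sum[OF A'.U_subspace] A'.A_U[OF DD_WC A'.L_U[OF v]]) blast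
  thus ?thesis using cB unfolding joint_def by blast
qed

theorem isomorphic_iff:
  fixes M :: "('v, 'm::ab_group_add) vertex_module" and N :: "('v, 'k::ab_group_add) vertex_module"
  assumes n: "0 < n" and M: "irreducible_admissible W DD M" and N: "irreducible_admissible W DD N"
    and lam: "top_point n jq M lam" and mu: "top_point n jq N mu" shows "modules_isomorphic W M N \<longleftrightarrow> lam = mu"
proof -
  obtain A where A: "irreducible_action n V e f (mscl M) A (carrier M) (level M)"
    "\<And>a u k. a \<in> WC \<Longrightarrow> u \<in> carrier M \<Longrightarrow> A a k u = act M a k u" using irreducible_graded_action[OF n M] by blast
  obtain A' where A': "irreducible_action n V e f (mscl N) A' (carrier N) (level N)"
    "\<And>a u k. a \<in> WC \<Longrightarrow> u \<in> carrier N \<Longrightarrow> A' a k u = act N a k u" using irreducible_graded_action[OF n N] by blast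
  interpret A: irreducible_action n V e f "mscl M" A "carrier M" "level M" by (rule A(1))
  interpret A': irreducible_action n V e f "mscl N" A' "carrier N" "level N" by (rule A'(1))
  obtain u where u: "u \<in> level M 0" "u \<noteq> 0" using A.L0 A.M.subspace_0[OF A.L_subspace] by blast
  obtain v where v: "v \<in> level N 0" "v \<noteq> 0" using A'.L0 A'.M.subspace_0[OF A'.L_subspace] by blast
  have zm: "A.zm (jq m) w = mscl M (lam $ m) w" if "w \<in> level M 0" "m < n" for m w
    using jq_zero_mode[OF A.graded_action_axioms A(2) A.L_U[OF that(1)]] lam that by (simp add: top_point_def)
  have zm': "A'.zm (jq m) w = mscl N (mu $ m) w" if "w \<in> level N 0" "m < n" for m w
    using jq_zero_mode[OF A'.graded_action_axioms A'(2) A'.L_U[OF that(1)]] mu that by (simp add: top_point_def)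
  have dim: "dim_vec lam = n" "dim_vec mu = n" using lam mu by (auto simp: top_point_def)
  show ?thesis
  proof
    assume "modules_isomorphic W M N"
    then obtain h where h: "bij_betw h (carrier M) (carrier N)"
      "\<And>u v. u \<in> carrier M \<Longrightarrow> v \<in> carrier M \<Longrightarrow> h (u + v) = h u + h v"
      "\<And>x u. u \<in> carrier M \<Longrightarrow> h (mscl M x u) = mscl N x (h u)"
      "\<And>a k u. a \<in> WC \<Longrightarrow> u \<in> carrier M \<Longrightarrow> h (act M a k u) = act N a k (h u)"
      unfolding modules_isomorphic_def W_simps by blast
    have uM: "u \<in> carrier M" by (rule A.L_U[OF u(1)])
    have hu: "h u \<in> carrier N" using h(1) uM by (auto simp: bij_betw_def)
    have h0: "h 0 = 0" using h(2)[of 0 0] A.M.subspace_0[OF A.U_subspace] by simp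
    have hA: "h (A a k u) = A' a k (h u)" if "a \<in> WC" for a k
      using h(4)[OF that uM] A(2)[OF that uM] A'(2)[OF that hu] by simp
    have "h u \<noteq> 0" using h(1) u(2) uM A.M.subspace_0[OF A.U_subspace] h0 by (auto simp: bij_betw_def inj_on_def)
    have "h u \<in> A'.low" unfolding A'.low_def using A.lowD[OF A.low_L0[OF u(1)]] hA[symmetric] h0 DD_WC by auto
    hence hL: "h u \<in> level N 0" by (rule A'.low_U_L0[OF hu])
    show "lam = mu"
    proof (rule eq_vecI)
      fix m assume "m < dim_vec mu"
      hence m: "m < n" using dim by simp
      have "A'.zm (jq m) (h u) = h (A.zm (jq m) u)"
        using A.zm_DD[OF jq_DD, of m u] A'.zm_DD[OF jq_DD, of m "h u"] hA[OF jq_WC] by simp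
      hence "mscl N (mu $ m) (h u) = mscl N (lam $ m) (h u)" using zm[OF u(1) m] zm'[OF hL m] h(3)[OF uM] by simp
      thus "lam $ m = mu $ m" using \<open>h u \<noteq> 0\<close> by simp
    qed (simp add: dim)
  next
    assume eq: "lam = mu"
    let ?R = "joint A A' u v"
    have "A (vac V) (-1) u = u" "A' (vac V) (-1) v = v"
      using A.A_vac[OF A.L_U[OF u(1)]] A'.A_vac[OF A'.L_U[OF v(1)]] by auto
    note closed = joint_closed[OF A.orbifold_action_axioms A'.orbifold_action_axioms A.low_L0[OF u(1)] this(1) A'.low_L0[OF v(1)] this(2)]
    have fun0: "y = 0" if "(0, y) \<in> ?R" for y
      by (rule joint_functional[OF A(1) A'(1) u v _ _ that, of "\<lambda>m. lam $ m"]) (use zm zm' u v eq in auto)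
    have inj0: "x = 0" if "(x, 0) \<in> ?R" for x
      by (rule joint_functional[OF A'(1) A(1) v u _ _ that[unfolded joint_swap[of x]], of "\<lambda>m. lam $ m"]) (use zm zm' u v eq in auto)
    have sub: "(x - x', y - y') \<in> ?R" if "(x, y) \<in> ?R" "(x', y') \<in> ?R" for x y x' y'
      using closed(3)[OF that(1) closed(4)[OF that(2), of "-1"]] by simp
    have "\<forall>x\<in>carrier M. \<exists>y\<in>carrier N. (x, y) \<in> ?R" using joint_total[OF A(1) A'(1) u v(1)] by blast
    then obtain h where h: "\<And>x. x \<in> carrier M \<Longrightarrow> h x \<in> carrier N" "\<And>x. x \<in> carrier M \<Longrightarrow> (x, h x) \<in> ?R" by metis
    have uniq: "h x = y" if "x \<in> carrier M" "(x, y) \<in> ?R" for x y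
      using fun0[of "h x - y"] sub[OF h(2)[OF that(1)] that(2)] by simp
    have "bij_betw h (carrier M) (carrier N)" unfolding bij_betw_def
    proof
      show "inj_on h (carrier M)"
      proof (rule inj_onI)
        fix x x' assume *: "x \<in> carrier M" "x' \<in> carrier M" "h x = h x'"
        thus "x = x'" using inj0[of "x - x'"] sub[OF h(2)[OF *(1)] h(2)[OF *(2)]] by simp
      qed
      show "h ` carrier M = carrier N"
      proof
        show "carrier N \<subseteq> h ` carrier M"
        proof
          fix y assume "y \<in> carrier N"
          then obtain x where "x \<in> carrier M" "(y, x) \<in> joint A' A v u"
            using joint_total[OF A'(1) A(1) v u(1)] by blast
          thus "y \<in> h ` carrier M" using uniq joint_swap[of x y] by blast
        qed
      qed (use h in auto)
    qed
    moreover have "h (x + x') = h x + h x'" if "x \<in> carrier M" "x' \<in> carrier M" for x x'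
      using that by (intro uniq A.M.subspace_add[OF A.U_subspace] closed(3) h)
    moreover have "h (mscl M z x) = mscl N z (h x)" if "x \<in> carrier M" for z x
      using that by (intro uniq A.M.subspace_scale[OF A.U_subspace] closed(4) h)
    moreover have "h (act M a k x) = act N a k (h x)" if "a \<in> WC" "x \<in> carrier M" for a k x
      unfolding A(2)[OF that, symmetric] A'(2)[OF that(1) h(1)[OF that(2)], symmetric]
      using that by (intro uniq A.A_U closed(2) h)
    ultimately show "modules_isomorphic W M N" unfolding modules_isomorphic_def W_simps by blast
  qed
qed

end

subsection \<open>Transport of modules\<close>

definition fin_scale :: "complex \<Rightarrow> (nat \<Rightarrow>\<^sub>0 complex) \<Rightarrow> nat \<Rightarrow>\<^sub>0 complex" where
  "fin_scale c = Poly_Mapping.map ((*) c)"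

lemma lookup_fin_scale: "lookup (fin_scale c y) k = c * lookup y k"
  by (simp add: fin_scale_def Poly_Mapping.map.rep_eq when_def)

lemma fin_scale: "vector_space fin_scale"
  by (auto simp: vector_space_def lookup_fin_scale lookup_add algebra_simps intro!: poly_mapping_eqI)

lemma single_one_eq_iff: "single i (1::complex) = single j 1 \<longleftrightarrow> i = j"
  by (metis lookup_single_eq lookup_single_not_eq zero_neq_one)

text \<open>Through this, modules of countable dimension are realized in one fixed type that does
  not depend on \<open>V\<close>.\<close>

lemma countable_embedding:
  fixes s :: "complex \<Rightarrow> 'x \<Rightarrow> 'x::ab_group_add" assumes "vector_space s" and B: "countable B" "U \<subseteq> module.span s B"
  shows "\<exists>\<iota>. module_hom s fin_scale \<iota> \<and> inj_on \<iota> U"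
proof -
  interpret vector_space_pair s fin_scale using assms(1) fin_scale by (simp add: vector_space_pair_def)
  obtain b where b: "b \<subseteq> U" "vs1.independent b" "U \<subseteq> vs1.span b" "card b = vs1.dim U"
    by (rule vs1.basis_exists[of U])
  have cb: "countable b" by (rule vs1.independent_countable[OF b(2) _ B(1)]) (use b(1) B(2) in blast)
  define \<iota> where "\<iota> = construct b (\<lambda>v. single (to_nat_on b v) 1)"
  have \<iota>: "Vector_Spaces.linear s fin_scale \<iota>" unfolding \<iota>_def by (rule linear_construct[OF b(2)])
  have \<iota>b: "\<iota> v = single (to_nat_on b v) 1" if "v \<in> b" for v unfolding \<iota>_def by (rule construct_basis[OF b(2) that])
  have "vs2.independent (\<iota> ` b)" unfolding vs2.independent_explicit_module
  proof (intro allI impI)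
    fix t u v assume t: "finite t" "t \<subseteq> \<iota> ` b" "(\<Sum>v\<in>t. fin_scale (u v) v) = 0" "v \<in> t"
    obtain w where w: "w \<in> b" "v = \<iota> w" using t by blast
    have "0 = lookup (\<Sum>v\<in>t. fin_scale (u v) v) (to_nat_on b w)" using t(3) by simp
    also have "\<dots> = (\<Sum>y\<in>t. u y * lookup y (to_nat_on b w))" by (simp add: lookup_sum lookup_fin_scale)
    also have "\<dots> = (\<Sum>y\<in>t. if y = v then u v else 0)"
    proof (rule sum.cong[OF refl])
      fix y assume "y \<in> t"
      then obtain w' where w': "w' \<in> b" "y = \<iota> w'" using t by blast
      thus "u y * lookup y (to_nat_on b w) = (if y = v then u v else 0)"
        using w inj_onD[OF inj_on_to_nat_on[OF cb], of w w'] by (auto simp: \<iota>b lookup_single when_def single_one_eq_iff)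
    qed
    also have "\<dots> = u v" using t by simp
    finally show "u v = 0" by simp
  qed
  moreover have "inj_on \<iota> b" using inj_on_to_nat_on[OF cb] by (auto simp: inj_on_def \<iota>b single_one_eq_iff)
  ultimately have "inj_on \<iota> (vs1.span b)" by (rule linear_inj_on_span_independent_image[OF \<iota>])
  hence "inj_on \<iota> U" using b(3) inj_on_subset by blast
  thus ?thesis using \<iota> by (auto simp: module_hom_iff_linear)
qed

definition transport :: "('m \<Rightarrow> 'y) \<Rightarrow> (complex \<Rightarrow> 'y \<Rightarrow> 'y) \<Rightarrow> ('v, 'm) vertex_module \<Rightarrow> ('v, 'y) vertex_module" where
  "transport \<iota> s M = \<lparr>carrier = \<iota> ` carrier M, mscl = s,
     act = (\<lambda>a k y. \<iota> (act M a k (inv_into (carrier M) \<iota> y))), level = (\<lambda>k. \<iota> ` level M k)\<rparr>"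

lemma transport_sel [simp]: "carrier (transport \<iota> s M) = \<iota> ` carrier M" "mscl (transport \<iota> s M) = s"
  "level (transport \<iota> s M) k = \<iota> ` level M k" by (simp_all add: transport_def)

context
  fixes M :: "('v::ab_group_add, 'm::ab_group_add) vertex_module" and V :: "'v vertex_structure"
    and D :: "int \<Rightarrow> 'v set" and \<iota> :: "'m \<Rightarrow> 'y::ab_group_add" and s
  assumes mode: "\<And>a b k. a \<in> carrier V \<Longrightarrow> b \<in> carrier V \<Longrightarrow> mode V a k b \<in> carrier V"
    and irr: "irreducible_admissible V D M" and s: "vector_space s"
    and hom: "module_hom (mscl M) s \<iota>" and inj: "inj_on \<iota> (carrier M)"
begin

interpretation M: is_vertex_module V M using irr by (simp add: irreducible_admissible_def admissible_module_def)

interpretation M: vector_space "mscl M" by (rule M.vector_space_M)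

interpretation s: vector_space s by (rule s)

private lemmas hom_simps = hom_rules[OF hom]

private abbreviation "T \<equiv> transport \<iota> s M"

private lemma act_transport: "u \<in> carrier M \<Longrightarrow> act T a k (\<iota> u) = \<iota> (act M a k u)"
  by (simp add: transport_def inv_into_f_f[OF inj])

private lemma zero_carrier: "0 \<in> carrier M" by (rule M.subspace_0[OF M.subspace_M])

private lemma hom_eq_0: "u \<in> carrier M \<Longrightarrow> \<iota> u = 0 \<longleftrightarrow> u = 0"
  using inj zero_carrier by (auto simp: hom_simps dest: inj_onD[of \<iota> _ u 0])

private lemma level_carrier: "level M k \<subseteq> carrier M"
  using irr by (auto simp: irreducible_admissible_def admissible_module_def is_direct_sum_def)

text \<open>\<open>Sum_any\<close> depends on the support, which is preserved because
  \<open>\<iota>\<close> is injective on the carrier.\<close>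

private lemma hom_Sum_any: assumes "\<And>i. g i \<in> carrier M" shows "Sum_any (\<lambda>i. \<iota> (g i)) = \<iota> (Sum_any g)"
  unfolding Sum_any.expand_set hom_simps by (simp add: hom_eq_0 assms)

private lemma module_transport: "is_vertex_module V T"
proof (rule is_vertex_module.intro)
  show "module.subspace (mscl T) (carrier T)" using module_hom.subspace_image[OF hom M.subspace_M] by simp
  fix a assume a: "a \<in> carrier V"
  fix y assume "y \<in> carrier T"
  then obtain u where u: "u \<in> carrier M" "y = \<iota> u" by auto
  note closed = M.act_closed[OF a]
  show "act T a k y \<in> carrier T" for k using M.act_closed[OF a u(1)] by (simp add: u act_transport)
  show "act T (scl V x a) k y = mscl T x (act T a k y)" for x k
    using M.act_scl_left[OF a u(1)] by (simp add: u act_transport hom_simps)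
  show "act T a k (mscl T x y) = mscl T x (act T a k y)" for x k
  proof -
    have "act T a k (\<iota> (mscl M x u)) = \<iota> (act M a k (mscl M x u))"
      by (rule act_transport[OF M.subspace_scale[OF M.subspace_M u(1)]])
    thus ?thesis using M.act_scl_right[OF a u(1)] by (simp add: u act_transport hom_simps)
  qed
  show "\<exists>N. \<forall>k\<ge>N. act T a k y = 0"
    using M.act_truncation[OF a u(1)] by (metis (no_types) act_transport hom_simps(6) u)
  fix b assume b: "b \<in> carrier V"
  show "act T (a + b) k y = act T a k y + act T b k y" for k
    using M.act_add_left[OF a b u(1)] by (simp add: u act_transport hom_simps)
  show "borcherds_identity V (mscl T) (act T) 1 a b y"
    using M.act_borcherds[OF a b u(1)] unfolding borcherds_identity_def
    by (simp add: u act_transport M.act_closed a b mode M.subspace_scale[OF M.subspace_M] hom_Sum_any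
        flip: module_hom.scale[OF hom] module_hom.diff[OF hom])
next
  fix y k assume "y \<in> carrier T"
  then obtain u where u: "u \<in> carrier M" "y = \<iota> u" by auto
  show "act T (vac V) k y = (if k = -1 then y else 0)"
    using M.act_vac[OF u(1), of k] by (simp add: u act_transport hom_simps)
  fix a y' assume a: "a \<in> carrier V" and "y' \<in> carrier T"
  then obtain u' where u': "u' \<in> carrier M" "y' = \<iota> u'" by auto
  have "act T a k (\<iota> (u + u')) = \<iota> (act M a k (u + u'))"
    by (rule act_transport[OF M.subspace_add[OF M.subspace_M u(1) u'(1)]])
  thus "act T a k (y + y') = act T a k y + act T a k y'"
    using M.act_add_right[OF a u(1) u'(1)] by (simp add: u u' act_transport hom_simps)
qed (simp add: s)

private lemma decomposition_transport: assumes "\<And>k. c k \<in> level M k" and u: "u \<in> carrier M"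
  shows "decomposition (\<lambda>k. \<iota> ` level M k) (\<iota> u) (\<lambda>k. \<iota> (c k)) \<longleftrightarrow> decomposition (level M) u c"
proof -
  have c: "c k \<in> carrier M" for k using assms level_carrier by blast
  have "Sum_any c \<in> carrier M" unfolding Sum_any.expand_set by (rule M.subspace_sum[OF M.subspace_M c])
  hence "\<iota> u = \<iota> (Sum_any c) \<longleftrightarrow> u = Sum_any c" using inj_onD[OF inj] u by blast
  thus ?thesis using assms by (simp add: decomposition_def hom_Sum_any[OF c] hom_eq_0[OF c])
qed

private lemma direct_transport: "is_direct_sum s (carrier T) (level T)" unfolding is_direct_sum_def
proof (intro conjI allI ballI)
  have dir: "is_direct_sum (mscl M) (carrier M) (level M)"
    using irr by (simp add: irreducible_admissible_def admissible_module_def)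
  show "s.subspace (level T k)" for k
    using dir module_hom.subspace_image[OF hom, of "level M k"] by (simp add: is_direct_sum_def)
  show "level T k \<subseteq> carrier T" for k using level_carrier by auto
  fix y assume "y \<in> carrier T"
  then obtain u where u: "u \<in> carrier M" "y = \<iota> u" by auto
  have lev: "level T = (\<lambda>k. \<iota> ` level M k)" by (rule ext) simp
  obtain c where c: "decomposition (level M) u c" and uniq: "\<And>c'. decomposition (level M) u c' \<Longrightarrow> c' = c"
    using dir u(1) unfolding is_direct_sum_def by metis
  show "\<exists>!c. decomposition (level T) y c" unfolding lev u(2)
  proof (rule ex1I)
    show "decomposition (\<lambda>k. \<iota> ` level M k) (\<iota> u) (\<lambda>k. \<iota> (c k))"
      using c by (subst decomposition_transport[OF _ u(1)]) (auto simp: decomposition_def)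
    fix d assume d: "decomposition (\<lambda>k. \<iota> ` level M k) (\<iota> u) d"
    hence "\<forall>k. \<exists>x. x \<in> level M k \<and> d k = \<iota> x" by (auto simp: decomposition_def)
    then obtain c' where c': "\<And>k. c' k \<in> level M k" "d = (\<lambda>k. \<iota> (c' k))" by metis
    have "decomposition (level M) u c'" using d unfolding c'(2) decomposition_transport[OF c'(1) u(1)] .
    thus "d = (\<lambda>k. \<iota> (c k))" using uniq c'(2) by blast
  qed
qed

lemma transport_irreducible: "irreducible_admissible V D (transport \<iota> s M)"
  unfolding irreducible_admissible_def admissible_module_def
proof (intro conjI allI impI ballI module_transport)
  show "is_direct_sum (mscl T) (carrier T) (level T)" using direct_transport by simp
  show "level T k = {0}" if "k < 0" for k
    using irr that by (simp add: irreducible_admissible_def admissible_module_def hom_simps)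
  show "act T a l y \<in> level T (p + k - l - 1)" if a: "a \<in> D p" and y: "y \<in> level T k" for p k l a y
  proof -
    obtain u where u: "u \<in> level M k" "y = \<iota> u" using y by auto
    hence "act M a l u \<in> level M (p + k - l - 1)"
      using irr a by (simp add: irreducible_admissible_def admissible_module_def)
    thus ?thesis using act_transport[OF level_carrier[THEN subsetD, OF u(1)]] by (simp add: u(2))
  qed
  show "level T 0 \<noteq> {0}"
  proof -
    have "level M 0 \<noteq> {0}" "0 \<in> level M 0"
      using irr by (auto simp: irreducible_admissible_def admissible_module_def is_direct_sum_def M.subspace_0)
    then obtain u where "u \<in> level M 0" "u \<noteq> 0" by blast
    hence "\<iota> u \<in> level T 0" "\<iota> u \<noteq> 0" using hom_eq_0 level_carrier by auto
    thus ?thesis by blast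
  qed
  fix S assume S: "submodule V T S"
  define S' where "S' = {u \<in> carrier M. \<iota> u \<in> S}"
  have sub: "s.subspace S" using S by (simp add: submodule_def)
  have "submodule V M S'" unfolding submodule_def
  proof (intro conjI ballI allI)
    show "M.subspace S'"
      using s.subspace_0[OF sub] s.subspace_add[OF sub] s.subspace_scale[OF sub] M.subspace_add[OF M.subspace_M]
        M.subspace_scale[OF M.subspace_M] zero_carrier by (auto simp: M.subspace_def S'_def hom_simps)
    show "act M a k u \<in> S'" if "a \<in> carrier V" "u \<in> S'" for a k u
      using S that M.act_closed[OF that(1)] by (auto simp: submodule_def S'_def simp flip: act_transport)
  qed (auto simp: S'_def)
  hence "S' = {0} \<or> S' = carrier M" using irr by (simp add: irreducible_admissible_def)
  moreover have "S = \<iota> ` S'" using S by (auto simp: submodule_def S'_def)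
  ultimately show "S = {0} \<or> S = carrier T" by (auto simp: hom_simps)
qed

lemma transport_top_point: "top_point n j M lam \<Longrightarrow> top_point n j (transport \<iota> s M) lam"
  using level_carrier[THEN subsetD] by (auto simp: top_point_def act_transport hom_simps)

end

context symplectic_fermion_algebra
begin

lemma mons_countable: "countable (mon ` words)" by (rule countable_image) simp

text \<open>The carrier is spanned by the modes of a countable basis of the invariants, applied to a
  single vector of degree zero.\<close>

theorem countable_model:
  fixes M :: "('v, 'm::ab_group_add) vertex_module"
  assumes n: "0 < n" and irr: "irreducible_admissible W DD M" and top: "top_point n j M lam"
  shows "\<exists>M' :: ('v, nat \<Rightarrow>\<^sub>0 complex) vertex_module. irreducible_admissible W DD M' \<and> top_point n j M' lam"
proof -
  obtain A where A: "irreducible_action n V e f (mscl M) A (carrier M) (level M)"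
    using irreducible_graded_action[OF n irr] by blast
  interpret A: irreducible_action n V e f "mscl M" A "carrier M" "level M" by (rule A)
  obtain u where u: "u \<in> level M 0" "u \<noteq> 0" using A.L0 A.M.subspace_0[OF A.L_subspace] by blast
  obtain B where B: "B \<subseteq> WC" "vs.independent B" "WC \<subseteq> vs.span B" "card B = vs.dim WC"
    by (rule vs.basis_exists[of WC])
  have "B \<subseteq> vs.span (mon ` words)"
  proof
    fix a assume "a \<in> B"
    hence "a \<in> C" using B(1) WC_C by blast
    hence "a = (\<Sum>S\<in>supp a. coef S a *s mon S)" by (rule expand)
    moreover have "(\<Sum>S\<in>supp a. coef S a *s mon S) \<in> vs.span (mon ` words)"
      by (intro vs.span_sum vs.span_scale vs.span_base) (auto simp: supp_iff)
    ultimately show "a \<in> vs.span (mon ` words)" by simp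
  qed
  hence cB: "countable B" using vs.independent_countable[OF B(2) _ mons_countable] by blast
  define X where "X = (\<lambda>(b, k). A b k u) ` (B \<times> (UNIV :: int set))"
  have span: "A a k u \<in> A.M.span X" if "a \<in> WC" for a k
  proof -
    have "a \<in> vs.span B" using B(3) that by blast
    thus ?thesis
    proof (induction rule: vs.span_induct_alt)
      case base
      thus ?case using A.M.span_zero by (simp add: A.A_linear)
    next
      case (step c x y)
      have "A x k u \<in> A.M.span X" using step by (intro A.M.span_base) (auto simp: X_def)
      thus ?case using step by (simp add: A.A_linear A.M.span_add A.M.span_scale)
    qed
  qed
  have "carrier M \<subseteq> A.M.span X"
  proof
    fix x assume "x \<in> carrier M"
    hence "x \<in> A.gen u" using A.gen_U[OF A.L_U[OF u(1)] A.low_L0[OF u(1)] u(2)] by simp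
    then obtain c I where cI: "finite I" "\<forall>q\<in>I. c q \<in> DD (fst q)" "x = (\<Sum>q\<in>I. A (c q) (snd q) u)"
      using A.genE[OF _ A.low_L0[OF u(1)]] by blast
    show "x \<in> A.M.span X" unfolding cI(3) using cI(2) by (intro A.M.span_sum span DD_WC) blast
  qed
  moreover have "countable X" unfolding X_def using cB by (intro countable_image countable_SIGMA) auto
  ultimately obtain \<iota> where \<iota>: "module_hom (mscl M) fin_scale \<iota>" "inj_on \<iota> (carrier M)"
    using countable_embedding[OF A.M.vector_space_axioms] by blast
  have "mode W a k b \<in> carrier W" if "a \<in> carrier W" "b \<in> carrier W" for a b k
    using that WC_Y[of a b k] by (simp add: W_simps Y_mode WC_C)
  note tr = this irr fin_scale \<iota>
  show ?thesis using transport_irreducible[OF tr] transport_top_point[OF tr top] by blast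
qed

end

subsection \<open>Existence of irreducible modules\<close>

text \<open>A letter \<open>(p, a, k)\<close> stands for the mode \<open>a\<^sub>(\<^sub>k\<^sub>)\<close> of an element \<open>a\<close> of weight \<open>p\<close>.\<close>

lemma eq_diffI: "x - y + z = 0 \<Longrightarrow> x = y - (z :: 'a::ab_group_add)"
  using eq_iff_diff_eq_0[of x "y - z"] by (simp add: algebra_simps)

type_synonym 'a mode_word = "(int \<times> 'a \<times> int) list"

context symplectic_fermion_algebra
begin

definition valid :: "'v mode_word \<Rightarrow> bool" where
  "valid t \<longleftrightarrow> (\<forall>(p, a, k)\<in>set t. a \<in> DD p)"

definition wdeg :: "'v mode_word \<Rightarrow> int" where
  "wdeg t = (\<Sum>(p, a, k)\<leftarrow>t. p - k - 1)"

definition wop :: "'v mode_word \<Rightarrow> 'v \<Rightarrow> 'v" where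
  "wop t u = foldr (\<lambda>(p, a, k). Y a k) t u"

lemma word_simps [simp]:
  "valid []" "valid ((p, a, k) # t) \<longleftrightarrow> a \<in> DD p \<and> valid t" "valid (s @ t) \<longleftrightarrow> valid s \<and> valid t"
  "wdeg [] = 0" "wdeg ((p, a, k) # t) = p - k - 1 + wdeg t" "wdeg (s @ t) = wdeg s + wdeg t"
  "wop [] u = u" "wop ((p, a, k) # t) u = Y a k (wop t u)" "wop (s @ t) u = wop s (wop t u)"
  by (simp_all add: valid_def wdeg_def wop_def ball_Un)

lemma wop_linear:
  "wop t (u + v) = wop t u + wop t v" "wop t (z *s u) = z *s wop t u" "wop t 0 = 0" "wop t (u - v) = wop t u - wop t v"
proof -
  show 1: "wop t (u + v) = wop t u + wop t v" "wop t (z *s u) = z *s wop t u" for u v z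
    by (induction t) (auto simp: Y_linear)
  show "wop t 0 = 0" using 1(2)[of 0 0] by simp
  show "wop t (u - v) = wop t u - wop t v" using 1(1)[of u "(-1) *s v"] 1(2)[of "-1" v] by simp
qed

lemma wop_sum: "wop t (\<Sum>i\<in>I. u i) = (\<Sum>i\<in>I. wop t (u i))"
  by (induction I rule: infinite_finite_induct) (auto simp: wop_linear)

lemma wop_level: "valid t \<Longrightarrow> at_level N d u \<Longrightarrow> at_level N (d + wdeg t) (wop t u)"
proof (induction t)
  case (Cons l t)
  obtain p a k where l: "l = (p, a, k)" by (cases l)
  have "at_level N (d + wdeg t + p - k - 1) (Y a k (wop t u))" using Cons l by (intro at_level_Y) auto
  thus ?case by (simp add: l algebra_simps)
qed simp

definition bracket :: "'v mode_word \<Rightarrow> (nat \<Rightarrow> nat) \<Rightarrow> complex" where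
  "bracket t N = coef (hw N) (wop t (hv N))"

lemma coef_at_level: "at_level N d b \<Longrightarrow> d \<noteq> 0 \<Longrightarrow> coef (hw N) b = 0"
  using at_level_supp(3)[of N d b "hw N"] by (auto simp: supp_iff)

text \<open>On \<open>hv N\<close> the composite reduces, uniformly in \<open>N\<close>, to single
  modes. Those of nonzero degree have no coefficient at \<open>hv N\<close>, and the others add up
  to a value \<open>ev N w\<close>, which is polynomial in the values of the
  \<open>jq m\<close>.\<close>

lemma bracket_ev: assumes "valid t" shows "\<exists>w\<in>WC. \<forall>N. bracket t N = ev N w"
proof -
  have "VA.reducible (\<lambda>u. wop t (Y (vac V) (-1) u))" using assms
  proof (induction t)
    case Nil
    thus ?case using VA.reducible_A[OF vac_DD, of "-1"] by simp
  next
    case (Cons l t)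
    thus ?case by (cases l) (auto intro: VA.reducible_A_comp)
  qed
  then obtain c B where B: "finite B" "\<forall>(p, k)\<in>B. c (p, k) \<in> DD p"
    "\<forall>u\<in>VA.low. wop t (Y (vac V) (-1) u) = (\<Sum>(p, k)\<in>B. Y (c (p, k)) k u)" unfolding VA.reducible_def by blast
  have c: "c q \<in> DD (fst q)" if "q \<in> B" for q using B(2) that by (auto simp: case_prod_beta)
  define w where "w = (\<Sum>q\<in>B. if fst q - snd q - 1 = 0 then c q else 0)"
  have "w \<in> WC" unfolding w_def using c DD_WC by (intro WC_sum) auto
  moreover have "bracket t N = ev N w" for N
  proof -
    have "wop t (hv N) = (\<Sum>q\<in>B. Y (c q) (snd q) (hv N))"
      using B(3) hv_low[of N] by (auto simp: Y_vac case_prod_beta)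
    hence "bracket t N = (\<Sum>q\<in>B. coef (hw N) (Y (c q) (snd q) (hv N)))" by (simp add: bracket_def)
    also have "\<dots> = (\<Sum>q\<in>B. ev N (if fst q - snd q - 1 = 0 then c q else 0))"
    proof (rule sum.cong[OF refl])
      fix q assume q: "q \<in> B"
      have lev: "at_level N (0 + fst q - snd q - 1) (Y (c q) (snd q) (hv N))"
        by (rule at_level_Y[OF at_level_hv c[OF q]])
      show "coef (hw N) (Y (c q) (snd q) (hv N)) = ev N (if fst q - snd q - 1 = 0 then c q else 0)"
      proof (cases "fst q - snd q - 1 = 0")
        case True
        hence sq: "snd q = fst q - 1" by simp
        have "ev N (c q) = coef (hw N) (Y (c q) (snd q) (hv N))" unfolding ev_def VA.zm_DD[OF c[OF q]] sq ..
        thus ?thesis using True by simp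
      next
        case False
        thus ?thesis using coef_at_level[OF lev] by (simp add: ev_linear)
      qed
    qed
    finally show ?thesis by (simp add: w_def ev_linear)
  qed
  ultimately show ?thesis by blast
qed

definition brk :: "'v mode_word \<Rightarrow> (nat \<Rightarrow>\<^sub>0 nat) \<Rightarrow>\<^sub>0 complex" where
  "brk t = (SOME R. R \<in> mpolys \<and> (\<forall>N. mpoly_eval (\<lambda>m. ev N (jq m)) R = bracket t N))"

text \<open>The matrix coefficient interpolated at \<open>x\<close>. The value zero at words that
  are not valid confines the functions \<open>xi t\<close> to valid words.\<close>

definition phi :: "(nat \<Rightarrow> complex) \<Rightarrow> 'v mode_word \<Rightarrow> complex" where
  "phi x t = (if valid t then mpoly_eval x (brk t) else 0)"

lemma mpolys_eq: assumes "R \<in> mpolys" "R' \<in> mpolys"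
    "\<And>N. mpoly_eval (\<lambda>m. ev N (jq m)) R = mpoly_eval (\<lambda>m. ev N (jq m)) R'" shows "R = R'"
proof -
  have "R - R' = R + single 0 (-1) * R'" by (simp add: single_uminus)
  also have "\<dots> \<in> mpolys" using assms by (intro mpolys_add mpolys_mult mpolys_single) auto
  finally have "R - R' = 0" by (rule mpolys_eval_zero) (simp add: mpoly_eval_diff assms(3))
  thus ?thesis by simp
qed

context
  fixes x :: "nat \<Rightarrow> complex" assumes n: "0 < n"
begin

lemma brk: assumes "valid t" shows "brk t \<in> mpolys" "mpoly_eval (\<lambda>m. ev N (jq m)) (brk t) = bracket t N"
proof -
  obtain w where w: "w \<in> WC" "\<And>N. bracket t N = ev N w" using bracket_ev[OF assms] by blast
  hence "\<exists>R. R \<in> mpolys \<and> (\<forall>N. mpoly_eval (\<lambda>m. ev N (jq m)) R = bracket t N)" using poly_of[OF n w(1)] by auto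
  from someI_ex[OF this]
  show "brk t \<in> mpolys" "mpoly_eval (\<lambda>m. ev N (jq m)) (brk t) = bracket t N" unfolding brk_def by auto
qed

text \<open>A relation which holds at all the points \<open>N\<close> holds at \<open>x\<close>, since the former are Zariski dense.\<close>

lemma transfer:
  fixes t t' t'' :: "nat \<Rightarrow> 'v mode_word"
  assumes v: "\<And>i. i \<in> I \<Longrightarrow> valid (t i)" "\<And>i. i \<in> I' \<Longrightarrow> valid (t' i)" "\<And>i. i \<in> I'' \<Longrightarrow> valid (t'' i)"
    and eq: "\<And>N. (\<Sum>i\<in>I. \<alpha> i * bracket (t i) N) = (\<Sum>i\<in>I'. \<beta> i * bracket (t' i) N) - (\<Sum>i\<in>I''. g i * bracket (t'' i) N)"
  shows "(\<Sum>i\<in>I. \<alpha> i * phi x (t i)) = (\<Sum>i\<in>I'. \<beta> i * phi x (t' i)) - (\<Sum>i\<in>I''. g i * phi x (t'' i))"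
proof -
  define R where "R I \<alpha> t = (\<Sum>i\<in>I. single 0 (\<alpha> i) * brk (t i))" for I :: "nat set" and \<alpha> :: "nat \<Rightarrow> complex" and t
  have R: "R I \<alpha> t \<in> mpolys" "mpoly_eval y (R I \<alpha> t) = (\<Sum>i\<in>I. \<alpha> i * mpoly_eval y (brk (t i)))"
    if "\<And>i. i \<in> I \<Longrightarrow> valid (t i)" for I \<alpha> t y unfolding R_def using brk(1)[OF that]
    by (auto simp: mpoly_eval_sum mpoly_eval_mult intro!: mpolys_sum mpolys_mult mpolys_single)
  have "R I \<alpha> t + R I'' g t'' = R I' \<beta> t'"
  proof (rule mpolys_eq)
    show "R I \<alpha> t + R I'' g t'' \<in> mpolys" by (intro mpolys_add R v)
    show "R I' \<beta> t' \<in> mpolys" by (intro R v)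
    show "mpoly_eval (\<lambda>m. ev N (jq m)) (R I \<alpha> t + R I'' g t'') = mpoly_eval (\<lambda>m. ev N (jq m)) (R I' \<beta> t')" for N
      using eq[of N] by (simp add: mpoly_eval_add R v brk cong: sum.cong)
  qed
  hence "mpoly_eval x (R I \<alpha> t) + mpoly_eval x (R I'' g t'') = mpoly_eval x (R I' \<beta> t')"
    by (simp flip: mpoly_eval_add)
  thus ?thesis by (simp add: R v phi_def eq_diff_eq cong: sum.cong)
qed

lemma phi_invalid: "\<not> valid t \<Longrightarrow> phi x t = 0" by (simp add: phi_def)

lemma phi_zero: assumes "\<And>N. bracket t N = 0" shows "phi x t = 0"
proof (cases "valid t")
  case True
  thus ?thesis using transfer[of "{0}" "\<lambda>_. t" "{}" "\<lambda>_. t" "{}" "\<lambda>_. t" "\<lambda>_. 1"] assms by simp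
qed (rule phi_invalid)

lemma phi_wdeg: assumes "wdeg t \<noteq> 0" shows "phi x t = 0"
proof (cases "valid t")
  case True
  thus ?thesis
    using coef_at_level[OF wop_level[OF True at_level_hv]] assms by (intro phi_zero) (simp add: bracket_def)
qed (rule phi_invalid)

lemma phi_neg: assumes "wdeg t < 0" shows "phi x (s @ t) = 0"
proof (cases "valid (s @ t)")
  case True
  hence "wop t (hv N) = 0" for N using at_level_neg[OF wop_level[OF _ at_level_hv]] assms by simp
  thus ?thesis by (intro phi_zero) (simp add: bracket_def wop_linear)
qed (rule phi_invalid)

lemma phi_Nil: "phi x [] = 1"
proof -
  have "brk [] = 1" using brk[of "[]"] mpolys_single[of 0 1]
    by (intro mpolys_eq) (auto simp: bracket_def simp flip: single_one)
  thus ?thesis by (simp add: phi_def flip: single_one)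
qed

text \<open>A word of degree zero acts on \<open>hv N\<close> by a scalar, which splits off.\<close>

lemma phi_mult: assumes "wdeg t = 0" shows "phi x (s @ t) = phi x s * phi x t"
proof (cases "valid (s @ t)")
  case True
  have "bracket (s @ t) N = bracket s N * bracket t N" for N
  proof -
    have e: "wop t (hv N) = bracket t N *s hv N"
      using at_level_0[of N "wop t (hv N)"] wop_level[of t N 0 "hv N"] at_level_hv[of N] assms True by (simp add: bracket_def)
    have "bracket (s @ t) N = coef (hw N) (wop s (wop t (hv N)))" by (simp add: bracket_def)
    also have "\<dots> = bracket s N * bracket t N" by (subst e) (simp add: wop_linear bracket_def)
    finally show ?thesis .
  qed
  hence "brk (s @ t) = brk s * brk t"
    using True brk[of s] brk[of t] brk[of "s @ t"] by (intro mpolys_eq mpolys_mult) (auto simp: mpoly_eval_mult)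
  thus ?thesis using True by (simp add: phi_def mpoly_eval_mult)
qed (auto simp: phi_def)

lemma phi_letter: assumes "a \<in> DD p" "b \<in> DD p"
  shows "phi x (s @ (p, a + b, k) # t) = phi x (s @ (p, a, k) # t) + phi x (s @ (p, b, k) # t)" (is ?add)
    and "phi x (s @ (p, z *s a, k) # t) = z * phi x (s @ (p, a, k) # t)" (is ?scale)
proof -
  have ab: "a + b \<in> DD p" "z *s a \<in> DD p"
    using assms vs.subspace_add[OF DD_subspace] vs.subspace_scale[OF DD_subspace] by auto
  show ?add
  proof (cases "valid (s @ t)")
    case True
    thus ?thesis
      using transfer[of "{0}" "\<lambda>_. s @ (p, a + b, k) # t" "{0, 1}" "\<lambda>i. if i = 0 then s @ (p, a, k) # t else s @ (p, b, k) # t" "{}" "\<lambda>_. []" "\<lambda>_. 1" "\<lambda>_. 1"]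
        assms ab by (simp add: bracket_def Y_linear wop_linear)
  qed (auto simp: phi_def)
  show ?scale
  proof (cases "valid (s @ t)")
    case True
    thus ?thesis
      using transfer[of "{0}" "\<lambda>_. s @ (p, z *s a, k) # t" "{0}" "\<lambda>_. s @ (p, a, k) # t" "{}" "\<lambda>_. []" "\<lambda>_. 1" "\<lambda>_. z"]
        assms ab by (simp add: bracket_def Y_linear wop_linear)
  qed (auto simp: phi_def)
qed

lemma phi_vac: "phi x (s @ (0, vac V, k) # t) = (if k = -1 then phi x (s @ t) else 0)"
proof (cases "valid (s @ t)")
  case True
  have "wop t (hv N) \<in> C" for N
    using wop_level[of t N 0 "hv N"] at_level_hv[of N] True by (simp add: at_level_def charged_def)
  hence "bracket (s @ (0, vac V, k) # t) N = (if k = -1 then 1 else 0) * bracket (s @ t) N" for N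
    by (simp add: bracket_def Y_vac wop_linear)
  thus ?thesis
    using transfer[of "{0}" "\<lambda>_. s @ (0, vac V, k) # t" "{0}" "\<lambda>_. s @ t" "{}" "\<lambda>_. []" "\<lambda>_. 1" "\<lambda>_. if k = -1 then 1 else 0"]
      True vac_DD by simp
qed (auto simp: phi_def)

text \<open>At \<open>N\<close> the weight operator acts by the weight of \<open>hv N\<close> plus
  the degree; the first summand interpolates to \<open>phi x [(2, Lc, 1)]\<close>.\<close>

lemma phi_Lc: assumes "valid t"
  shows "phi x (s @ (2, Lc, 1) # t) = (phi x [(2, Lc, 1)] + of_int (wdeg t)) * phi x (s @ t)"
proof -
  have "phi x (s @ (2, Lc, 1) # t) = phi x ((s @ t) @ [(2, Lc, 1)]) + of_int (wdeg t) * phi x (s @ t)"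
  proof (cases "valid s")
    case True
    have "Y Lc 1 (wop t (hv N)) = wop t (Y Lc 1 (hv N)) + of_int (wdeg t) *s wop t (hv N)" for N
    proof -
      have "Y Lc 1 (hv N) = of_int (wt_word (hw N)) *s hv N" using at_level_hv[of N] by (simp add: at_level_def)
      moreover have "Y Lc 1 (wop t (hv N)) = of_int (wt_word (hw N) + wdeg t) *s wop t (hv N)"
        using wop_level[OF assms at_level_hv[of N]] by (simp add: at_level_def)
      ultimately show ?thesis by (simp add: wop_linear vs.scale_left_distrib)
    qed
    hence "bracket (s @ (2, Lc, 1) # t) N = bracket ((s @ t) @ [(2, Lc, 1)]) N + of_int (wdeg t) * bracket (s @ t) N" for N
      by (simp add: bracket_def wop_linear)
    thus ?thesis
      using transfer[of "{0}" "\<lambda>_. s @ (2, Lc, 1) # t" "{0, 1}" "\<lambda>i. if i = 0 then (s @ t) @ [(2, Lc, 1)] else s @ t" "{}" "\<lambda>_. []"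
          "\<lambda>_. 1" "\<lambda>i. if i = 0 then 1 else of_int (wdeg t)"]
        True assms Lc_DD by simp
  qed (auto simp: phi_def)
  thus ?thesis using phi_mult[of "[(2, Lc, 1)]" "s @ t"] by (simp add: algebra_simps)
qed

definition sF :: "complex \<Rightarrow> ('v mode_word \<Rightarrow> complex) \<Rightarrow> 'v mode_word \<Rightarrow> complex" where
  "sF z \<xi> = (\<lambda>s. z * \<xi> s)"

lemma vector_space_sF: "vector_space sF" by (auto simp: vector_space_def sF_def fun_eq_iff algebra_simps)

interpretation vF: vector_space sF by (rule vector_space_sF)

lemma sF_apply [simp]: "sF z \<xi> s = z * \<xi> s" by (simp add: sF_def)

lemma sum_fun_apply: "(\<Sum>i\<in>I. g i) s = (\<Sum>i\<in>I. g i s :: complex)" for g :: "'i \<Rightarrow> 'v mode_word \<Rightarrow> complex"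
  by (induction I rule: infinite_finite_induct) auto

text \<open>The word \<open>t\<close> applied to the lowest weight vector, represented by its matrix
  coefficients against all words.\<close>

definition xi :: "'v mode_word \<Rightarrow> 'v mode_word \<Rightarrow> complex" where
  "xi t = (\<lambda>s. phi x (s @ t))"

definition UF :: "('v mode_word \<Rightarrow> complex) set" where
  "UF = vF.span (xi ` {t. valid t})"

definition LF :: "int \<Rightarrow> ('v mode_word \<Rightarrow> complex) set" where
  "LF k = vF.span (xi ` {t. valid t \<and> wdeg t = k})"

lemma UF_subspace: "vF.subspace UF" and LF_subspace: "vF.subspace (LF k)"
  unfolding UF_def LF_def by (rule vF.subspace_span)+

lemma LF_UF: "LF k \<subseteq> UF" unfolding UF_def LF_def by (rule vF.span_mono) blast

lemma xi_UF: "valid t \<Longrightarrow> xi t \<in> UF" and xi_LF: "valid t \<Longrightarrow> xi t \<in> LF (wdeg t)"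
  unfolding UF_def LF_def by (auto intro: vF.span_base)

text \<open>A mode applied to \<open>xi t\<close> puts a letter in front of \<open>t\<close>; in
  \<open>s @ t\<close> this is the same as appending the letter to \<open>s\<close>. Letters are
  homogeneous, whence the sum over the weights.\<close>

definition aF :: "'v \<Rightarrow> int \<Rightarrow> ('v mode_word \<Rightarrow> complex) \<Rightarrow> 'v mode_word \<Rightarrow> complex" where
  "aF a k \<xi> = (\<lambda>s. \<Sum>p\<in>wts a. \<xi> (s @ [(p, wc p a, k)]))"

lemma UF_letter: assumes "\<xi> \<in> UF" "a \<in> DD p" "b \<in> DD p"
  shows "\<xi> (s @ [(p, a + b, k)]) = \<xi> (s @ [(p, a, k)]) + \<xi> (s @ [(p, b, k)])"
    and "\<xi> (s @ [(p, z *s a, k)]) = z * \<xi> (s @ [(p, a, k)])" using assms(1) unfolding UF_def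
  by (induction rule: vF.span_induct_alt)
    (auto simp: xi_def phi_letter[OF assms(2,3)] algebra_simps)

lemma aF_superset: assumes "\<xi> \<in> UF" "finite I" "wts a \<subseteq> I" shows "aF a k \<xi> s = (\<Sum>p\<in>I. \<xi> (s @ [(p, wc p a, k)]))"
proof -
  have "\<xi> (s @ [(p, 0, k)]) = 0" for p
    using UF_letter(2)[OF assms(1), of 0 p 0 s 0 k] vs.subspace_0[OF DD_subspace] by simp
  thus ?thesis unfolding aF_def using assms by (intro sum.mono_neutral_left) (auto simp: wc_eq_0)
qed

lemma aF_DD: assumes "\<xi> \<in> UF" "a \<in> DD p" shows "aF a k \<xi> s = \<xi> (s @ [(p, a, k)])"
proof -
  have z: "\<xi> (s @ [(q, 0, k)]) = 0" for q
    using UF_letter(2)[OF assms(1), of 0 q 0 s 0 k] vs.subspace_0[OF DD_subspace] by simp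
  have "aF a k \<xi> s = (\<Sum>q\<in>insert p (wts a). \<xi> (s @ [(q, wc q a, k)]))" by (rule aF_superset[OF assms(1)]) auto
  also have "\<dots> = (\<Sum>q\<in>insert p (wts a). if q = p then \<xi> (s @ [(p, a, k)]) else 0)"
    by (rule sum.cong) (auto simp: wc_DD[OF assms(2)] z)
  finally show ?thesis by simp
qed

lemma aF_xi: assumes "valid t" "a \<in> DD p" shows "aF a k (xi t) = xi ((p, a, k) # t)"
  by (rule ext) (simp add: aF_DD[OF xi_UF[OF assms(1)] assms(2)], simp add: xi_def)

lemma aF_right: "aF a k (\<xi> + \<eta>) = aF a k \<xi> + aF a k \<eta>" "aF a k (sF z \<xi>) = sF z (aF a k \<xi>)"
  by (auto simp: aF_def fun_eq_iff sum.distrib sum_distrib_left)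

lemma aF_0: "aF a k 0 = 0" using aF_right(2)[of a k 0 0] by simp

lemma aF_left: assumes "a \<in> WC" "b \<in> WC" "\<xi> \<in> UF"
  shows "aF (a + b) k \<xi> = aF a k \<xi> + aF b k \<xi>" "aF (z *s a) k \<xi> = sF z (aF a k \<xi>)"
proof -
  have "aF (a + b) k \<xi> s = (aF a k \<xi> + aF b k \<xi>) s" for s
  proof -
    let ?I = "wts a \<union> wts b \<union> wts (a + b)"
    have I: "finite ?I" "wts a \<subseteq> ?I" "wts b \<subseteq> ?I" "wts (a + b) \<subseteq> ?I" by auto
    show ?thesis using UF_letter(1)[OF assms(3) wc_in_DD[OF assms(1)] wc_in_DD[OF assms(2)]]
      by (simp add: aF_superset[OF assms(3) I(1,2)] aF_superset[OF assms(3) I(1,3)] aF_superset[OF assms(3) I(1,4)]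
          wc_linear sum.distrib)
  qed
  thus "aF (a + b) k \<xi> = aF a k \<xi> + aF b k \<xi>" by (rule ext)
  have "aF (z *s a) k \<xi> s = sF z (aF a k \<xi>) s" for s
  proof -
    let ?I = "wts a \<union> wts (z *s a)"
    have I: "finite ?I" "wts a \<subseteq> ?I" "wts (z *s a) \<subseteq> ?I" by auto
    show ?thesis using UF_letter(2)[OF assms(3) wc_in_DD[OF assms(1)] wc_in_DD[OF assms(1)]]
      by (simp add: aF_superset[OF assms(3) I(1,2)] aF_superset[OF assms(3) I(1,3)] wc_linear sum_distrib_left)
  qed
  thus "aF (z *s a) k \<xi> = sF z (aF a k \<xi>)" by (rule ext)
qed

lemma aF_wc: assumes "a \<in> WC" "\<xi> \<in> UF" shows "aF a k \<xi> = (\<Sum>p\<in>wts a. aF (wc p a) k \<xi>)"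
  by (rule ext) (simp add: sum_fun_apply aF_DD[OF assms(2) wc_in_DD[OF assms(1)]], simp add: aF_def)

lemma aF_LF: assumes "a \<in> DD p" "\<xi> \<in> LF k" shows "aF a l \<xi> \<in> LF (p + k - l - 1)"
  using assms(2) unfolding LF_def[of k]
proof (induction rule: vF.span_induct_alt)
  case base
  show ?case unfolding aF_0 by (rule vF.subspace_0[OF LF_subspace])
next
  case (step z \<xi> \<eta>)
  then obtain t where t: "\<xi> = xi t" "valid t" "wdeg t = k" by auto
  have "aF a l \<xi> \<in> LF (p + k - l - 1)"
    using xi_LF[of "(p, a, l) # t"] t assms(1) by (simp add: aF_xi[OF t(2) assms(1)] algebra_simps)
  from vF.subspace_add[OF LF_subspace vF.subspace_scale[OF LF_subspace this] step.IH]
  show ?case unfolding aF_right .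
qed

lemma aF_UF: assumes "a \<in> WC" "\<xi> \<in> UF" shows "aF a k \<xi> \<in> UF"
proof -
  have "aF (wc p a) k \<xi> \<in> UF" for p using assms(2) unfolding UF_def
  proof (induction rule: vF.span_induct_alt)
    case base
    show ?case unfolding aF_0 by (rule vF.span_zero)
  next
    case (step z \<xi> \<eta>)
    then obtain t where t: "\<xi> = xi t" "valid t" by auto
    have "aF (wc p a) k \<xi> \<in> vF.span (xi ` {t. valid t})"
      using xi_UF[of "(p, wc p a, k) # t"] t wc_in_DD[OF assms(1)]
      by (simp add: aF_xi[OF t(2) wc_in_DD[OF assms(1)]] UF_def)
    from vF.span_add[OF vF.span_scale[OF this] step.IH]
    show ?case unfolding aF_right .
  qed
  thus ?thesis unfolding aF_wc[OF assms] by (intro vF.subspace_sum[OF UF_subspace])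
qed

lemma LF_support: assumes "\<xi> \<in> LF k" "\<xi> s \<noteq> 0" shows "valid s" "wdeg s = - k"
proof -
  have "(valid s \<and> wdeg s = - k) \<or> \<xi> s = 0" using assms(1) unfolding LF_def
  proof (induction rule: vF.span_induct_alt)
    case (step z \<xi> \<eta>)
    then obtain t where t: "\<xi> = xi t" "valid t" "wdeg t = k" by auto
    have "phi x (s @ t) \<noteq> 0 \<Longrightarrow> valid (s @ t) \<and> wdeg (s @ t) = 0" using phi_wdeg phi_invalid by blast
    hence "(valid s \<and> wdeg s = - k) \<or> \<xi> s = 0" using t by (auto simp: xi_def)
    thus ?case using step.IH by auto
  qed simp
  thus "valid s" "wdeg s = - k" using assms(2) by auto
qed

lemma LF_neg: assumes "k < 0" shows "LF k = {0}"
proof -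
  have "xi ` {t. valid t \<and> wdeg t = k} \<subseteq> {0}" using phi_neg assms by (auto simp: xi_def fun_eq_iff)
  hence "LF k \<subseteq> vF.span {0}" unfolding LF_def by (rule vF.span_mono)
  thus ?thesis using vF.subspace_0[OF LF_subspace] by auto
qed

lemma xi_0: assumes "wdeg t = 0" shows "xi t = sF (phi x t) (xi [])"
  by (rule ext) (simp add: xi_def phi_mult[OF assms])

lemma LF_0: assumes "\<xi> \<in> LF 0" shows "\<xi> = sF (\<xi> []) (xi [])" using assms unfolding LF_def
proof (induction rule: vF.span_induct_alt)
  case base
  show ?case by (simp add: fun_eq_iff)
next
  case (step z \<xi> \<eta>)
  then obtain t where t: "\<xi> = xi t" "valid t" "wdeg t = 0" by auto
  have "xi t [] = phi x t" by (simp add: xi_def)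
  hence "\<xi> = sF (\<xi> []) (xi [])" using xi_0[OF t(3)] by (simp only: t(1))
  hence 1: "\<xi> s = \<xi> [] * xi [] s" for s by (metis sF_apply)
  have 2: "\<eta> s = \<eta> [] * xi [] s" for s using step.IH by (metis sF_apply)
  show ?case
  proof (rule ext)
    fix s
    show "(sF z \<xi> + \<eta>) s = sF ((sF z \<xi> + \<eta>) []) (xi []) s"
      unfolding plus_fun_apply sF_apply 1[of s] 2[of s] by (simp only: distrib_right mult.assoc)
  qed
qed

text \<open>By \<open>LF_support\<close>, the component of degree \<open>k\<close> is the
  restriction of the function to the words of degree \<open>-k\<close>.\<close>

lemma LF_direct: "is_direct_sum sF UF LF" unfolding is_direct_sum_def
proof (intro conjI allI ballI LF_subspace LF_UF)
  fix \<xi> assume "\<xi> \<in> UF"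
  then obtain I \<alpha> where I: "finite I" "I \<subseteq> {t. valid t}" "\<xi> = (\<Sum>t\<in>I. sF (\<alpha> t) (xi t))"
    using vF.span_image_sum[of \<xi> xi "{t. valid t}"] unfolding UF_def by blast
  have "sF (\<alpha> t) (xi t) \<in> LF (wdeg t)" if "t \<in> I" for t
    using I(2) that by (intro vF.subspace_scale[OF LF_subspace] xi_LF) auto
  from vF.decomposition_sum[of LF I _ wdeg, OF LF_subspace I(1) this]
  have ex: "\<exists>c. decomposition LF \<xi> c" using I(3) by blast
  have val: "c k s = (if wdeg s = - k then \<xi> s else 0)" if c: "decomposition LF \<xi> c" for c k s
  proof -
    have "\<xi> s = (\<Sum>k\<in>{k. c k \<noteq> 0}. c k s)" using c by (simp add: decomposition_def Sum_any.expand_set sum_fun_apply)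
    also have "\<dots> = (\<Sum>k\<in>{k. c k \<noteq> 0}. if k = - wdeg s then c (- wdeg s) s else 0)"
      by (rule sum.cong) (use c LF_support(2) in \<open>auto simp: decomposition_def\<close>, force)
    also have "\<dots> = c (- wdeg s) s" using c by (simp add: decomposition_def)
    finally have 1: "\<xi> s = c (- wdeg s) s" .
    have "wdeg s = - k" if "c k s \<noteq> 0" using c LF_support(2)[of "c k" k s] that by (auto simp: decomposition_def)
    thus ?thesis using 1 by auto
  qed
  show "\<exists>!c. decomposition LF \<xi> c" using ex
  proof (rule ex_ex1I)
    fix c c' assume "decomposition LF \<xi> c" "decomposition LF \<xi> c'"
    note d = val[OF this(1)] val[OF this(2)]
    show "c = c'" by (intro ext) (simp only: d)
  qed
qed

lemma aF_hom: "module_hom sF sF (aF a k)" unfolding module_hom_def module_hom_axioms_def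
  using vF.module_axioms aF_right by blast

lemmas aF_linear = hom_rules[OF aF_hom]

lemma aF_zero_left: "aF 0 k \<xi> = 0" by (simp add: aF_def wts_def supp_def fun_eq_iff)

lemma UF_expand: assumes "\<xi> \<in> UF"
  obtains I \<alpha> where "finite I" "\<forall>t\<in>I. valid t" "\<xi> = (\<Sum>t\<in>I. sF (\<alpha> t) (xi t))"
  using vF.span_image_sum[of \<xi> xi "{t. valid t}"] assms unfolding UF_def by blast

lemma aF_truncation: assumes a: "a \<in> WC" and \<xi>: "\<xi> \<in> UF" shows "\<forall>\<^sub>F k in at_top. aF a k \<xi> = 0"
proof -
  obtain I \<alpha> where I: "finite I" "\<forall>t\<in>I. valid t" "\<xi> = (\<Sum>t\<in>I. sF (\<alpha> t) (xi t))" using UF_expand[OF \<xi>] .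
  have "\<forall>\<^sub>F k in at_top. aF (wc p a) k (xi t) = 0" if "valid t" for p t
  proof (rule eventually_at_top_linorderI)
    fix k assume "p + wdeg t \<le> k"
    hence "xi ((p, wc p a, k) # t) = 0" by (auto simp: xi_def fun_eq_iff intro: phi_neg)
    thus "aF (wc p a) k (xi t) = 0" using aF_xi[OF that wc_in_DD[OF a]] by simp
  qed
  hence "\<forall>\<^sub>F k in at_top. \<forall>p\<in>wts a. \<forall>t\<in>I. aF (wc p a) k (xi t) = 0"
    using I(1,2) by (intro eventually_ball_finite ballI) auto
  thus ?thesis
  proof eventually_elim
    case (elim k)
    thus ?case unfolding aF_wc[OF a \<xi>] by (simp add: I(3) aF_linear)
  qed
qed

text \<open>The difference of the two sides of the Borcherds identity, cut off at \<open>J\<close>.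
  It is additive in \<open>a\<close> and \<open>b\<close> and linear in the vector, so its vanishing
  for large \<open>J\<close> need only be shown for homogeneous \<open>a\<close>, \<open>b\<close>
  and the vectors \<open>xi t\<close>.\<close>

definition defect :: "nat \<Rightarrow> int \<Rightarrow> int \<Rightarrow> int \<Rightarrow> 'v \<Rightarrow> 'v \<Rightarrow> ('v mode_word \<Rightarrow> complex) \<Rightarrow> 'v mode_word \<Rightarrow> complex" where
  "defect J m r k a b \<xi> =
     (\<Sum>j<J. sF (of_int m gchoose j) (aF (Y a (r + int j) b) (m + k - int j) \<xi>))
   - (\<Sum>j<J. sF (sbinom r j) (aF a (m + r - int j) (aF b (k + int j) \<xi>)))
   + (\<Sum>j<J. sF (sbinom r j * (-1) powi r) (aF b (r + k - int j) (aF a (m + int j) \<xi>)))"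

lemma defect_hom: "module_hom sF sF (defect J m r k a b)"
  unfolding module_hom_def module_hom_axioms_def defect_def using vF.module_axioms
  by (simp add: aF_linear sum.distrib vF.scale_right_distrib vF.scale_right_diff_distrib vF.scale_sum_right algebra_simps)

lemma defect_add: assumes "a \<in> WC" "a' \<in> WC" "b \<in> WC" "\<xi> \<in> UF"
  shows "defect J m r k (a + a') b \<xi> = defect J m r k a b \<xi> + defect J m r k a' b \<xi>"
    and "defect J m r k b (a + a') \<xi> = defect J m r k b a \<xi> + defect J m r k b a' \<xi>"
  using assms by (simp_all add: defect_def aF_left aF_UF aF_linear WC_Y Y_linear sum.distrib vF.scale_right_distrib)

lemma defect_sum: assumes "b \<in> WC" "\<xi> \<in> UF" and c: "\<And>i. i \<in> I \<Longrightarrow> c i \<in> WC"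
  shows "defect J m r k (\<Sum>i\<in>I. c i) b \<xi> = (\<Sum>i\<in>I. defect J m r k (c i) b \<xi>)"
    and "defect J m r k b (\<Sum>i\<in>I. c i) \<xi> = (\<Sum>i\<in>I. defect J m r k b (c i) \<xi>)"
  using c by (induction I rule: infinite_finite_induct)
    (simp_all add: defect_add[OF _ _ assms(1,2)] WC_sum, simp_all add: defect_def aF_zero_left aF_linear)

text \<open>At every point \<open>N\<close> the identity holds in \<open>V\<close>, with a bound
  \<open>J\<close> that depends on the degrees but not on \<open>N\<close>. Hence
  \<open>transfer\<close> carries it over to \<open>x\<close>.\<close>

lemma defect_homogeneous: assumes a: "a \<in> DD p" and b: "b \<in> DD q" and t: "valid t"
  shows "\<forall>\<^sub>F J in sequentially. defect J m r k a b (xi t) = 0"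
proof (rule eventually_sequentiallyI)
  fix J assume J: "nat (p + q - r) + nat (q + wdeg t - k) + nat (p + wdeg t - m) \<le> J"
  have ab: "a \<in> WC" "b \<in> WC" using a b DD_WC by auto
  have Yab: "Y a (r + int j) b \<in> DD (p + q - (r + int j) - 1)" for j by (rule DD_Y[OF a b])
  note word = aF_xi[OF _ a] aF_xi[OF _ b] aF_xi[OF _ Yab]
  have "defect J m r k a b (xi t) s = 0" for s
  proof (cases "valid s")
    case False
    thus ?thesis by (simp add: defect_def word t a b sum_fun_apply) (simp add: xi_def phi_invalid)
  next
    case True
    have "(\<Sum>j<J. (of_int m gchoose j) * phi x (s @ (p + q - (r + int j) - 1, Y a (r + int j) b, m + k - int j) # t))
      = (\<Sum>j<J. (sbinom r j) * phi x (s @ (p, a, m + r - int j) # (q, b, k + int j) # t))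
      - (\<Sum>j<J. (sbinom r j * (-1) powi r) * phi x (s @ (q, b, r + k - int j) # (p, a, m + int j) # t))"
    proof (rule transfer)
      fix N
      define c where "c = wop t (hv N)"
      have c: "at_level N (wdeg t) c" using wop_level[OF t at_level_hv[of N]] by (simp add: c_def)
      have "(\<Sum>j<J. (of_int m gchoose j) *s Y (Y a (r + int j) b) (m + k - int j) c) =
          (\<Sum>j<J. sbinom r j *s Y a (m + r - int j) (Y b (k + int j) c))
        - (\<Sum>j<J. (sbinom r j * (-1) powi r) *s Y b (r + k - int j) (Y a (m + int j) c))"
      proof (rule VA.A_borcherds[OF ab])
        fix j assume j: "J \<le> j"
        show "Y a (r + int j) b = 0" by (rule DD_neg[OF _ Yab]) (use J j in linarith)
        show "Y b (k + int j) c = 0" by (rule at_level_neg[OF at_level_Y[OF c b]]) (use J j in linarith)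
        show "Y a (m + int j) c = 0" by (rule at_level_neg[OF at_level_Y[OF c a]]) (use J j in linarith)
      qed
      from arg_cong[OF this, of "\<lambda>v. coef (hw N) (wop s v)"]
      show "(\<Sum>j<J. (of_int m gchoose j) * bracket (s @ (p + q - (r + int j) - 1, Y a (r + int j) b, m + k - int j) # t) N)
        = (\<Sum>j<J. (sbinom r j) * bracket (s @ (p, a, m + r - int j) # (q, b, k + int j) # t) N)
        - (\<Sum>j<J. (sbinom r j * (-1) powi r) * bracket (s @ (q, b, r + k - int j) # (p, a, m + int j) # t) N)"
        by (simp add: wop_linear wop_sum bracket_def c_def)
    qed (use True t a b Yab in auto)
    thus ?thesis by (simp add: defect_def word t a b sum_fun_apply) (simp add: xi_def)
  qed
  thus "defect J m r k a b (xi t) = 0" by (simp add: fun_eq_iff)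
qed

lemma defect_zero: assumes a: "a \<in> WC" and b: "b \<in> WC" and \<xi>: "\<xi> \<in> UF"
  shows "\<forall>\<^sub>F J in sequentially. defect J m r k a b \<xi> = 0"
proof -
  obtain I \<alpha> where I: "finite I" "\<forall>t\<in>I. valid t" "\<xi> = (\<Sum>t\<in>I. sF (\<alpha> t) (xi t))" using UF_expand[OF \<xi>] .
  have "\<forall>\<^sub>F J in sequentially. \<forall>p\<in>wts a. \<forall>q\<in>wts b. \<forall>t\<in>I. defect J m r k (wc p a) (wc q b) (xi t) = 0"
    using I(1,2) defect_homogeneous[OF wc_in_DD[OF a] wc_in_DD[OF b]] by (intro eventually_ball_finite ballI) auto
  thus ?thesis
  proof eventually_elim
    case (elim J)
    have "defect J m r k (\<Sum>p\<in>wts a. wc p a) (\<Sum>q\<in>wts b. wc q b) \<xi> = 0"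
      using elim by (simp add: defect_sum wc_WC a b \<xi> WC_sum) (simp add: I(3) hom_rules[OF defect_hom])
    thus ?case by (simp add: wc_sum WC_C a b)
  qed
qed

definition MF :: "('v, 'v mode_word \<Rightarrow> complex) vertex_module" where
  "MF = \<lparr>carrier = UF, mscl = sF, act = aF, level = LF\<rparr>"

lemma MF_sel [simp]: "carrier MF = UF" "mscl MF = sF" "act MF = aF" "level MF = LF" by (simp_all add: MF_def)

lemma aF_large: assumes "a \<in> WC" "\<xi> \<in> UF" shows "\<forall>\<^sub>F j in sequentially. aF a (m + int j) \<xi> = 0"
proof -
  obtain l where "\<And>k. k \<ge> l \<Longrightarrow> aF a k \<xi> = 0"
    using aF_truncation[OF assms] unfolding eventually_at_top_linorder by blast
  thus ?thesis by (intro eventually_sequentiallyI[of "nat (l - m)"]) simp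
qed

lemma MF_borcherds: assumes a: "a \<in> WC" and b: "b \<in> WC" and \<xi>: "\<xi> \<in> UF"
  shows "borcherds_identity W sF aF 1 a b \<xi>" unfolding borcherds_identity_def
proof (intro allI)
  fix m r k :: int
  have Y: "mode W a i b = Y a i b" for i using a b by (simp add: Y_mode WC_C)
  have "\<forall>\<^sub>F j in sequentially. Y a (r + int j) b = 0"
    using Y_truncation[of a r b] by (simp add: eventually_sequentially)
  note ev = eventually_conj[OF this eventually_conj[OF aF_large[OF a \<xi>, of m]
    eventually_conj[OF aF_large[OF b \<xi>, of k] defect_zero[OF a b \<xi>, of m r k]]]]
  obtain J where J: "\<And>j. j \<ge> J \<Longrightarrow> Y a (r + int j) b = 0" "\<And>j. j \<ge> J \<Longrightarrow> aF a (m + int j) \<xi> = 0"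
    "\<And>j. j \<ge> J \<Longrightarrow> aF b (k + int j) \<xi> = 0" "defect J m r k a b \<xi> = 0"
    using ev[unfolded eventually_sequentially] by auto
  have "Sum_any (\<lambda>j. sF (of_int m gchoose j) (aF (Y a (r + int j) b) (m + k - int j) \<xi>))
      = (\<Sum>j<J. sF (of_int m gchoose j) (aF (Y a (r + int j) b) (m + k - int j) \<xi>))"
    "Sum_any (\<lambda>j. sF (sbinom r j) (aF a (m + r - int j) (aF b (k + int j) \<xi>)))
      = (\<Sum>j<J. sF (sbinom r j) (aF a (m + r - int j) (aF b (k + int j) \<xi>)))"
    "Sum_any (\<lambda>j. sF (sbinom r j * (-1) powi r) (aF b (r + k - int j) (aF a (m + int j) \<xi>)))
      = (\<Sum>j<J. sF (sbinom r j * (-1) powi r) (aF b (r + k - int j) (aF a (m + int j) \<xi>)))"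
    by (rule Sum_any_eq_sum_lessThan; simp only: J aF_linear aF_zero_left vF.scale_zero_right)+
  thus "Sum_any (\<lambda>j. sF (of_int m gchoose j) (aF (mode W a (r + int j) b) (m + k - int j) \<xi>)) =
      Sum_any (\<lambda>j. sF (sbinom r j) (aF a (m + r - int j) (aF b (k + int j) \<xi>)))
    - Sum_any (\<lambda>j. sF (sbinom r j * (-1) powi r * 1) (aF b (r + k - int j) (aF a (m + int j) \<xi>)))"
    unfolding Y mult_1_right using eq_diffI[OF J(4)[unfolded defect_def]] by (simp only:)
qed

lemma MF_vac: assumes "\<xi> \<in> UF" shows "aF (vac V) k \<xi> = (if k = -1 then \<xi> else 0)"
proof -
  have "\<xi> (s @ [(0, vac V, k)]) = (if k = -1 then \<xi> s else 0)" for s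
    using assms unfolding UF_def by (induction rule: vF.span_induct_alt) (auto simp: xi_def phi_vac)
  thus ?thesis by (simp add: fun_eq_iff aF_DD[OF assms vac_DD])
qed

lemma MF_admissible: "admissible_module W DD MF" unfolding admissible_module_def
proof (intro conjI allI ballI impI)
  show "is_vertex_module W MF"
  proof
    show "\<exists>N. \<forall>k\<ge>N. act MF a k \<xi> = 0" if "a \<in> carrier W" "\<xi> \<in> carrier MF" for a \<xi>
      using aF_truncation that by (simp add: eventually_at_top_linorder)
  qed (use vector_space_sF UF_subspace MF_vac MF_borcherds aF_UF in \<open>auto simp: aF_linear aF_left vF.scale_right_distrib vF.scale_left_distrib\<close>)
qed (use LF_direct LF_neg aF_LF in auto)

text \<open>The value of \<open>\<eta>\<close> at \<open>s\<close> becomes a value at the empty word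
  when the letters of \<open>s\<close> are applied, the last one first.\<close>

lemma MF_shift: assumes S: "S \<subseteq> UF" "\<And>a k \<eta>. a \<in> WC \<Longrightarrow> \<eta> \<in> S \<Longrightarrow> aF a k \<eta> \<in> S"
  shows "valid s \<Longrightarrow> \<eta> \<in> S \<Longrightarrow> \<eta> \<in> LF k \<Longrightarrow> \<exists>\<zeta>\<in>S. \<zeta> \<in> LF (k + wdeg s) \<and> \<zeta> [] = \<eta> s"
proof (induction s arbitrary: \<eta> k rule: rev_induct)
  case (snoc l s)
  obtain p a i where l: "l = (p, a, i)" by (cases l)
  have a: "a \<in> DD p" "valid s" using snoc.prems by (auto simp: l)
  have "\<exists>\<zeta>\<in>S. \<zeta> \<in> LF (p + k - i - 1 + wdeg s) \<and> \<zeta> [] = aF a i \<eta> s"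
    using snoc.prems a DD_WC by (intro snoc.IH aF_LF S) auto
  thus ?case using aF_DD[OF subsetD[OF S(1) snoc.prems(2)] a(1), of i s] by (auto simp: l algebra_simps)
qed auto

lemma MF_Lc: assumes "\<xi> \<in> LF k" shows "aF Lc 1 \<xi> = sF (phi x [(2, Lc, 1)] + of_int k) \<xi>"
  using assms unfolding LF_def
proof (induction rule: vF.span_induct_alt)
  case (step z \<xi> \<eta>)
  then obtain t where t: "\<xi> = xi t" "valid t" "wdeg t = k" by auto
  have "aF Lc 1 \<xi> = sF (phi x [(2, Lc, 1)] + of_int k) \<xi>"
    unfolding t(1) aF_xi[OF t(2) Lc_DD] by (rule ext) (simp add: xi_def phi_Lc[OF t(2)] t(3))
  thus ?case by (simp only: aF_linear step.IH vF.scale_right_distrib vF.scale_scale mult.commute)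
qed (simp only: aF_linear vF.scale_zero_right)

text \<open>As \<open>Lc\<close> has distinct eigenvalues on the levels, a nonzero submodule
  contains a nonzero homogeneous vector. One of its matrix coefficients is nonzero, and
  \<open>MF_shift\<close> turns it into a vector of degree zero, a nonzero multiple of the generator
  \<open>xi []\<close>.\<close>

lemma MF_irreducible: "irreducible_admissible W DD MF" unfolding irreducible_admissible_def
proof (intro conjI MF_admissible allI impI)
  have "xi [] \<in> LF 0" using xi_LF[of "[]"] by simp
  moreover have "xi [] [] \<noteq> 0" using phi_Nil by (simp add: xi_def)
  hence "xi [] \<noteq> 0" by (metis zero_fun_apply)
  ultimately show "level MF 0 \<noteq> {0}" by auto
  fix S assume S: "submodule W MF S"
  hence sub: "vF.subspace S" "S \<subseteq> UF" and AS: "\<And>a k \<eta>. a \<in> WC \<Longrightarrow> \<eta> \<in> S \<Longrightarrow> aF a k \<eta> \<in> S" by (auto simp: submodule_def)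
  have "UF \<subseteq> S" if "S \<noteq> {0}"
  proof -
    from that obtain \<xi> where \<xi>: "\<xi> \<in> S" "\<xi> \<noteq> 0" using vF.subspace_0[OF sub(1)] by auto
    obtain c where "decomposition LF \<xi> c" using LF_direct \<xi>(1) sub(2) unfolding is_direct_sum_def by blast
    hence c: "\<And>k. c k \<in> LF k" "finite {k. c k \<noteq> 0}" "\<xi> = (\<Sum>k\<in>{k. c k \<noteq> 0}. c k)"
      by (auto simp: decomposition_def Sum_any.expand_set)
    obtain k where k: "c k \<noteq> 0" using c(3) \<xi>(2) by (metis (mono_tags, lifting) mem_Collect_eq sum.neutral)
    have "c k \<in> S"
    proof (rule eigen_components[OF vector_space_sF aF_hom[of Lc 1] sub(1) AS c(2)])
      show "inj_on (\<lambda>k. phi x [(2, Lc, 1)] + complex_of_int k) {k. c k \<noteq> 0}" by (simp add: inj_on_def)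
      show "(\<Sum>k\<in>{k. c k \<noteq> 0}. c k) \<in> S" using \<xi>(1) c(3) by simp
    qed (use k MF_Lc[OF c(1)] in auto)
    obtain s where s: "c k s \<noteq> 0" using k by (auto simp: fun_eq_iff)
    then obtain \<zeta> where \<zeta>: "\<zeta> \<in> S" "\<zeta> \<in> LF 0" "\<zeta> [] \<noteq> 0"
      using MF_shift[OF sub(2) AS LF_support(1)[OF c(1) s] \<open>c k \<in> S\<close> c(1)] LF_support(2)[OF c(1) s] by auto
    have "xi [] = sF (1 / \<zeta> []) \<zeta>" by (subst LF_0[OF \<zeta>(2)]) (use \<zeta>(3) in \<open>simp add: fun_eq_iff\<close>)
    hence 0: "xi [] \<in> S" using vF.subspace_scale[OF sub(1) \<zeta>(1)] by simp
    have "xi t \<in> S" if "valid t" for t using that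
    proof (induction t)
      case (Cons l t)
      obtain p a i where "l = (p, a, i)" by (cases l)
      thus ?case using Cons AS[of a "xi t" i] aF_xi[of t a p i] DD_WC by auto
    qed (rule 0)
    thus ?thesis unfolding UF_def by (intro vF.span_minimal sub) auto
  qed
  thus "S = {0} \<or> S = carrier MF" using sub(2) by auto
qed

lemma MF_top_point: "top_point n jq MF (vec n x)"
proof -
  have "aF (jq m) (int (2*m + 2) - 1) \<xi> = sF (x m) \<xi>" if m: "m < n" and \<xi>: "\<xi> \<in> LF 0" for m \<xi>
  proof -
    let ?t = "[(int (2*m + 2), jq m, int (2*m + 2) - 1)]"
    have v: "valid ?t" using jq_DD by simp
    have "bracket ?t N = ev N (jq m)" for N using VA.zm_DD[OF jq_DD, of m "hv N"] by (simp add: bracket_def ev_def)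
    hence "brk ?t = mpoly_var m" using brk[OF v] m unfolding mpoly_var_def by (intro mpolys_eq mpolys_single) auto
    hence "phi x ?t = x m" using v by (simp add: phi_def mpoly_var_def)
    hence "aF (jq m) (int (2*m + 2) - 1) (xi []) = sF (x m) (xi [])"
      using aF_xi[OF _ jq_DD, of "[]" m "int (2*m + 2) - 1"] xi_0[of ?t] by simp
    thus ?thesis by (subst (1 2) LF_0[OF \<xi>]) (simp only: aF_linear vF.scale_scale mult.commute)
  qed
  thus ?thesis by (simp add: top_point_def)
qed

end

theorem exists_irreducible: assumes "0 < n" "lam \<in> carrier_vec n" shows "\<exists>M :: ('v, nat \<Rightarrow>\<^sub>0 complex) vertex_module.
    irreducible_admissible W DD M \<and> top_point n jq M lam"
proof -
  have "vec n (($) lam) = lam" using assms(2) by auto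
  thus ?thesis
    using countable_model[OF assms(1) MF_irreducible[OF assms(1)] MF_top_point[OF assms(1), of "($) lam"]] by simp
qed

end

theorem corollary6p2:
  fixes n :: nat
    and V W :: "'v::ab_group_add vertex_structure"
    and e f :: "nat \<Rightarrow> 'v"
    and D :: "int \<Rightarrow> 'v set"
    and j :: "nat \<Rightarrow> 'v"
  assumes n: "n \<ge> 1"
    and V: "symplectic_fermion_algebra n V e f"
    and W: "W = sp_orbifold n V e f"
    and D: "D = weight_space W (sf_conformal n V e f)"
    and j: "j = sf_j n V e f"
  shows "(\<exists>h. h \<in> ring_iso (zhu_algebra W D) (mpoly_ring n) \<and>
            (\<forall>x. \<forall>a\<in>carrier W. h (zhu_class W D (scl W x a)) = mpoly_const x * h (zhu_class W D a)) \<and>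
            (\<forall>m<n. h (zhu_class W D (j m)) = mpoly_var m))
      \<and> (\<forall>M :: ('v, 'm::ab_group_add) vertex_module.
            irreducible_admissible W D M \<longrightarrow>
            highest_weight_module W D M \<and> (\<exists>!lam. top_point n j M lam))
      \<and> (\<forall>(M :: ('v, 'm) vertex_module) (N :: ('v, 'k::ab_group_add) vertex_module) lam mu.
            irreducible_admissible W D M \<and> irreducible_admissible W D N \<and>
            top_point n j M lam \<and> top_point n j N mu \<longrightarrow>
            (modules_isomorphic W M N \<longleftrightarrow> lam = mu))
      \<and> (\<forall>lam \<in> carrier_vec n. \<exists>M :: ('v, nat \<Rightarrow>\<^sub>0 complex) vertex_module.
            irreducible_admissible W D M \<and> top_point n j M lam)"
proof -
  interpret symplectic_fermion_algebra n V e f by (rule V)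
  have n0: "0 < n" using n by simp
  note eqs = D[unfolded W] W j
  let ?W = "sp_orbifold n V e f"
  show ?thesis
    unfolding eqs
  proof (intro conjI exI[of _ zhu_iso] allI ballI impI)
    show "zhu_iso (zhu_class ?W DD (scl ?W x a)) = mpoly_const x * zhu_iso (zhu_class ?W DD a)"
      if "a \<in> carrier ?W" for x a
      using zhu_iso(2)[OF n0] that by simp
    fix M N :: "('v, 'm) vertex_module" and N' :: "('v, 'k) vertex_module" and lam mu
    show "irreducible_admissible ?W DD M \<and> irreducible_admissible ?W DD N' \<and>
        top_point n (sf_j n V e f) M lam \<and> top_point n (sf_j n V e f) N' mu \<Longrightarrow>
        modules_isomorphic ?W M N' = (lam = mu)"
      using isomorphic_iff[OF n0] by blast
  qed (use zhu_iso[OF n0] irreducible_highest_weight[OF n0] exists_irreducible[OF n0] in simp_all)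
qed

end
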